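(* Let $T_w$ ($w\in S_n$) be the tableaux defined below (with respect to any diagonal $\lambda_+/\lambda_-$ of $R$, with boxes $b_1,\dots,b_n$), and let $\mathcal{O}_n=\{T\in\mathrm{SYT}(R):\partial^nT=T\}$. Then the map $w\mapsto T_w$ is a bijection $S_n\to\mathcal{O}_n$. Specifically: (i) for all $w\in S_n$, $\partial T_w=T_{wc}$, where $c=(1\ n\ n{-}1\ \dots\ 2)$; in particular $T_w\in\mathcal{O}_n$; (ii) if $w,w'\in S_n$ and $w(i)\neq w'(i)$, then $T_w[b_i]\neq T_{w'}[b_i]$; in particular $w\mapsto T_w$ is injective; (iii) for each $T\in\mathcal{O}_n$, let $w:\{1,\dots,n\}\to\{1,\dots,n\}$ be the function with $w(i)\equiv T[b_i]\pmod n$ for $i=1,\dots,n$; then $w\in S_n$ and $T_w=T$; in particular $w\mapsto T_w$ is surjective.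
   Context: Fix integers $m\ge n\ge 1$. English convention for Young diagrams (row $1$ on top); "above" = smaller row index, "to the right" = larger column index. $R$ is a rectangular Young diagram with either $n$ rows and $m$ columns or $m$ rows and $n$ columns. A diagonal of $R$ is a skew shape $\lambda_+/\lambda_-$ ($\lambda_-\subseteq\lambda_+\subseteq R$ Young diagrams) consisting of exactly $n$ boxes $b_1,\dots,b_n$ with $b_{i+1}$ strictly above and strictly right of $b_i$. $T[x]$ denotes the entry of $T$ in box $x$. Jeu de taquin: for a filling $T$ strictly increasing along rows and columns and an empty box $x$, sliding $x$ through $T$: while the empty box has a filled neighbour immediately right or immediately below, move the smaller such entry into it; reverse-sliding: while it has a filled neighbour immediately left or immediately above, move the larger such entry into it. The box where the empty box ends is the final position of the sliding path. $T^{\lambda_+}_w$: start with $T[b_i]=w(i)$, boxes of $\lambda_-$ unfilled; while not all of $\lambda_+$ is filled, choose a corner box $x$ of the Young diagram $\mu$ of unfilled boxes, slide $x$ through $T$, and if the path ends at $b_i$ put $T[b_i]+n$ there ($T[b_i]$ the entry of $b_i$ before the slide). $T^{R/\lambda_-}_w$: start with $T[b_i]=w(i)+(m-1)n$, boxes of $R/\lambda_+$ unfilled; while not all of $R/\lambda_-$ is filled, with unfilled part $R/\nu$, choose $x\in R/\nu$ with $\nu\cup\{x\}$ a Young diagram, reverse-slide $x$ through $T$, and if the path ends at $b_i$ put $T[b_i]-n$ there. Both outputs are independent of choices, $T_w$ (defined by $T_w[x]=T^{\lambda_+}_w[x]$ for $x\in\lambda_+$, $T_w[x]=T^{R/\lambda_-}_w[x]$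 otherwise) is a standard Young tableau of shape $R$, and $T_w$ is independent of the diagonal. Promotion: for $T\in\mathrm{SYT}(R)$, $\partial T$ is obtained by deleting the entry $1$ (in the top-left box), decreasing every other entry by $1$, sliding the empty top-left box through the tableau, and placing the entry $mn$ in the (now empty) bottom-right box. The product $wc$ is the permutation $i\mapsto c(w(i))$, i.e. $(wc)(i)\equiv w(i)-1\pmod n$. *)

theory Defs
  imports Main "HOL-Library.While_Combinator" "HOL-Number_Theory.Cong" "HOL-Combinatorics.Cycles"
begin

text \<open>
  A box is a pair (row, column), both counted from 1, with row 1 on top and column 1 on the left.
  A filling is a partial function from boxes to entries, undefined on the empty boxes.  Since
  entries are integers, subtracting from an entry never truncates.
\<close>

type_synonym box = "nat \<times> nat"
type_synonym filling = "box \<rightharpoonup> int"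

definition young_diagram :: "box set \<Rightarrow> bool" where
  "young_diagram L \<longleftrightarrow> finite L \<and> (\<forall>(i, j) \<in> L. 1 \<le> i \<and> 1 \<le> j) \<and>
     (\<forall>i j i' j'. (i, j) \<in> L \<and> 1 \<le> i' \<and> i' \<le> i \<and> 1 \<le> j' \<and> j' \<le> j \<longrightarrow> (i', j') \<in> L)"

definition rect :: "nat \<Rightarrow> nat \<Rightarrow> box set" where
  "rect r s = {1..r} \<times> {1..s}"

definition syt :: "box set \<Rightarrow> filling set" where
  "syt L = {T. dom T = L \<and> bij_betw (\<lambda>x. the (T x)) L {1..int (card L)} \<and>
     (\<forall>i j j'. (i, j) \<in> L \<and> (i, j') \<in> L \<and> j < j' \<longrightarrow> the (T (i, j)) < the (T (i, j'))) \<and>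
     (\<forall>i i' j. (i, j) \<in> L \<and> (i', j) \<in> L \<and> i < i' \<longrightarrow> the (T (i, j)) < the (T (i', j)))}"

definition is_diagonal ::
    "box set \<Rightarrow> nat \<Rightarrow> box set \<Rightarrow> box set \<Rightarrow> (nat \<Rightarrow> box) \<Rightarrow> bool" where
  "is_diagonal R n Lplus Lminus b \<longleftrightarrow>
     young_diagram Lplus \<and> young_diagram Lminus \<and> Lminus \<subseteq> Lplus \<and> Lplus \<subseteq> R \<and>
     Lplus - Lminus = b ` {1..n} \<and>
     (\<forall>i. 1 \<le> i \<and> i < n \<longrightarrow> fst (b (i + 1)) < fst (b i) \<and> snd (b i) < snd (b (i + 1)))"


section \<open>Jeu de taquin\<close>

definition slide_next :: "filling \<Rightarrow> box \<Rightarrow> box option" where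
  "slide_next T x =
     (let right = (fst x, snd x + 1); below = (fst x + 1, snd x) in
      case (T right, T below) of
        (None, None) \<Rightarrow> None
      | (Some p, None) \<Rightarrow> Some right
      | (None, Some q) \<Rightarrow> Some below
      | (Some p, Some q) \<Rightarrow> Some (if p < q then right else below))"

text \<open>
  The truncated subtractions below are harmless for fillings supported on boxes with positive
  coordinates: a box in row or column 0 is never filled.
\<close>

definition rev_slide_next :: "filling \<Rightarrow> box \<Rightarrow> box option" where
  "rev_slide_next T x =
     (let left = (fst x, snd x - 1); above = (fst x - 1, snd x) in
      case (T left, T above) of
        (None, None) \<Rightarrow> None
      | (Some p, None) \<Rightarrow> Some left
      | (None, Some q) \<Rightarrow> Some above
      | (Some p, Some q) \<Rightarrow> Some (if q < p then left else above))"

text \<open>The result consists of the filling after the slide and the final position of the empty box.\<close>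

definition slide_by ::
    "(filling \<Rightarrow> box \<Rightarrow> box option) \<Rightarrow> filling \<Rightarrow> box \<Rightarrow> filling \<times> box" where
  "slide_by nxt T x =
     while (\<lambda>(T, x). nxt T x \<noteq> None)
           (\<lambda>(T, x). let y = the (nxt T x) in (T(x := T y, y := None), y))
           (T, x)"

definition slide :: "filling \<Rightarrow> box \<Rightarrow> filling \<times> box" where
  "slide = slide_by slide_next"

definition rev_slide :: "filling \<Rightarrow> box \<Rightarrow> filling \<times> box" where
  "rev_slide = slide_by rev_slide_next"


section \<open>The tableaux attached to a diagonal\<close>

definition diag_filling :: "nat \<Rightarrow> (nat \<Rightarrow> box) \<Rightarrow> (nat \<Rightarrow> int) \<Rightarrow> filling" where
  "diag_filling n b f = map_of (map (\<lambda>i. (b i, f i)) [1..<n + 1])"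

definition lower_step ::
    "nat \<Rightarrow> box set \<Rightarrow> (nat \<Rightarrow> box) \<Rightarrow> filling \<Rightarrow> filling \<Rightarrow> bool" where
  "lower_step n Lplus b T T' \<longleftrightarrow>
     (let M = Lplus - dom T in
      \<exists>x \<in> M. young_diagram (M - {x}) \<and>
        (\<exists>S. \<exists>i \<in> {1..n}. slide T x = (S, b i) \<and> T' = S(b i \<mapsto> the (T (b i)) + int n)))"

text \<open>
  The box to be filled is chosen nondeterministically, and the definite description picks the
  common outcome of all runs.
\<close>

definition T_lower ::
    "nat \<Rightarrow> box set \<Rightarrow> (nat \<Rightarrow> box) \<Rightarrow> (nat \<Rightarrow> nat) \<Rightarrow> filling" where
  "T_lower n Lplus b w =
     (THE T. (lower_step n Lplus b)\<^sup>*\<^sup>* (diag_filling n b (\<lambda>i. int (w i))) T \<and> dom T = Lplus)"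

definition upper_step ::
    "nat \<Rightarrow> box set \<Rightarrow> box set \<Rightarrow> (nat \<Rightarrow> box) \<Rightarrow> filling \<Rightarrow> filling \<Rightarrow> bool" where
  "upper_step n R Lminus b T T' \<longleftrightarrow>
     (let N = Lminus \<union> dom T in
      \<exists>x \<in> R - N. young_diagram (N \<union> {x}) \<and>
        (\<exists>S. \<exists>i \<in> {1..n}. rev_slide T x = (S, b i) \<and> T' = S(b i \<mapsto> the (T (b i)) - int n)))"

definition T_upper ::
    "nat \<Rightarrow> nat \<Rightarrow> box set \<Rightarrow> box set \<Rightarrow> (nat \<Rightarrow> box) \<Rightarrow> (nat \<Rightarrow> nat) \<Rightarrow> filling" where
  "T_upper m n R Lminus b w =
     (THE T. (upper_step n R Lminus b)\<^sup>*\<^sup>*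
               (diag_filling n b (\<lambda>i. int (w i) + (int m - 1) * int n)) T \<and>
             dom T = R - Lminus)"

definition T_tab ::
    "nat \<Rightarrow> nat \<Rightarrow> box set \<Rightarrow> box set \<Rightarrow> box set \<Rightarrow> (nat \<Rightarrow> box) \<Rightarrow> (nat \<Rightarrow> nat) \<Rightarrow> filling" where
  "T_tab m n R Lplus Lminus b w =
     (\<lambda>x. if x \<in> Lplus then T_lower n Lplus b w x else T_upper m n R Lminus b w x)"


section \<open>Promotion\<close>

definition promotion :: "nat \<Rightarrow> nat \<Rightarrow> filling \<Rightarrow> filling" where
  "promotion r s T =
     (let T' = (\<lambda>x. if x = (1, 1) then None else map_option (\<lambda>a. a - 1) (T x))
      in (fst (slide T' (1, 1)))((r, s) \<mapsto> int (r * s)))"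

definition promotion_fixed :: "nat \<Rightarrow> nat \<Rightarrow> nat \<Rightarrow> filling set" where
  "promotion_fixed r s n = {T \<in> syt (rect r s). (promotion r s ^^ n) T = T}"

text \<open>This is the cycle (1 n n-1 ... 2): it sends 1 to n and every other k up to n to k - 1.\<close>

definition cyc :: "nat \<Rightarrow> nat \<Rightarrow> nat" where
  "cyc n = cycle_of_list (1 # rev [2..<n + 1])"

end

theory Submission
  imports Defs
begin

text \<open>
  Write \<open>c k\<close> for the row of the diagonal box whose entry is congruent to \<open>k\<close> modulo \<open>n\<close>. By
  Greene's theorem, the word formed by the letters \<open>c k\<close> with \<open>k > t\<close> has a tableau with \<open>n\<close> infinite
  rows: its first \<open>R\<close> rows contain as many entries up to \<open>k\<close> as can be covered by \<open>R\<close> disjoint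
  subsequences along which \<open>c\<close> weakly decreases. Passing from \<open>t\<close> to \<open>t + 1\<close> is a jeu de taquin slide,
  and the tableau at time \<open>t + n\<close> is the one at time \<open>t\<close> with \<open>n\<close> added to every entry. A slide
  increases neither the covering numbers of the rows nor those of the columns, and these two bounds
  determine every entry. Hence each run of the filling procedure, and the north-west part of each
  tableau fixed by the \<open>n\<close>-th power of promotion, is the universal tableau. Rotation by 180 degrees
  gives the south-east part, and the two parts fit together because the covering numbers of full
  periods can be computed exactly from the descents of the word.
\<close>

section \<open>Covers by decreasing subsequences\<close>

text \<open>A slide in an arbitrary run, or in an arbitrary tableau fixed by the power of promotion,
  can be broken into changes of single letters, but only one of the two matchings that make such a
  change neutral is available there. Covering numbers are thus only known not to grow, and the row
  inequalities alone would leave room for other tableaux; hence the second family of inequalities,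
  for columns.

  Ordinary columns cannot supply it. The chains dual to rows are weakly increasing in
  \<open>c\<close>, and since a letter recurs in every period such chains are infinite, while a
  column has at most \<open>n\<close> boxes. Therefore the columns are made to turn right at the
  antidiagonal \<open>i + j = n + 1\<close>. Beyond it each row is an arithmetic progression of step
  \<open>n\<close>, because an entry always lies weakly north-west of the entry that is larger by
  \<open>n\<close>, and residues therefore determine rows.

  The same tails reduce the gluing to numbers: only the offset of each progression is needed, and
  the covering numbers of whole periods determine it.\<close>

definition dec_colouring :: "(int \<Rightarrow> int) \<Rightarrow> int set \<Rightarrow> nat \<Rightarrow> (int \<Rightarrow> nat) \<Rightarrow> bool" where
  "dec_colouring f V R g \<longleftrightarrow> (\<forall>a\<in>V. \<forall>b\<in>V. a < b \<and> g a = g b \<and> g a < R \<longrightarrow> f b \<le> f a)"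

text \<open>The largest union of \<open>R\<close> disjoint subsets of \<open>V\<close> on which \<open>f\<close> weakly decreases; a colour
  that is not below \<open>R\<close> marks an uncovered element.\<close>

definition cover :: "(int \<Rightarrow> int) \<Rightarrow> int set \<Rightarrow> nat \<Rightarrow> nat" where
  "cover f V R = Max ((\<lambda>g. card {a\<in>V. g a < R}) ` {g. dec_colouring f V R g})"

lemma dec_colouringD: "dec_colouring f V R g \<Longrightarrow> a \<in> V \<Longrightarrow> b \<in> V \<Longrightarrow> a < b \<Longrightarrow> g a = g b \<Longrightarrow> g a < R \<Longrightarrow> f b \<le> f a"
  by (auto simp: dec_colouring_def)

lemma dec_colouring_trivial: "dec_colouring f V R (\<lambda>_. R)"
  by (auto simp: dec_colouring_def)

lemma finite_cover_sizes:
  assumes "finite V"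
  shows "finite ((\<lambda>g. card {a\<in>V. g a < R}) ` {g. dec_colouring f V R g})"
proof (rule finite_subset)
  show "(\<lambda>g. card {a\<in>V. g a < R}) ` {g. dec_colouring f V R g} \<subseteq> {..card V}"
    using assms by (auto intro!: card_mono)
qed simp

lemma cover_ge:
  assumes "finite V" "dec_colouring f V R g"
  shows "card {a\<in>V. g a < R} \<le> cover f V R"
  unfolding cover_def using assms finite_cover_sizes[OF assms(1)] by (intro Max_ge) auto

lemma cover_witness:
  assumes "finite V"
  obtains g where "dec_colouring f V R g" "card {a\<in>V. g a < R} = cover f V R"
proof -
  have "cover f V R \<in> (\<lambda>g. card {a\<in>V. g a < R}) ` {g. dec_colouring f V R g}"
    unfolding cover_def using finite_cover_sizes[OF assms] dec_colouring_trivial[of f V R] by (intro Max_in) blast+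
  thus thesis using that by auto
qed

lemma cover_le:
  assumes "finite V" "\<And>g. dec_colouring f V R g \<Longrightarrow> card {a\<in>V. g a < R} \<le> N"
  shows "cover f V R \<le> N"
  using cover_witness[OF assms(1), of f R] assms(2) by metis

lemma cover_le_cover:
  assumes "finite V" "finite V'"
    and "\<And>g. dec_colouring f V R g \<Longrightarrow> \<exists>g'. dec_colouring f' V' R g' \<and> card {a\<in>V. g a < R} \<le> card {a\<in>V'. g' a < R}"
  shows "cover f V R \<le> cover f' V' R"
proof (rule cover_le[OF assms(1)])
  fix g assume "dec_colouring f V R g"
  then obtain g' where "dec_colouring f' V' R g'" "card {a\<in>V. g a < R} \<le> card {a\<in>V'. g' a < R}" using assms(3) by blast
  thus "card {a\<in>V. g a < R} \<le> cover f' V' R" using cover_ge[OF assms(2)] order_trans by blast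
qed

lemma cover_mono:
  assumes "finite V" "\<And>a b. a \<in> V \<Longrightarrow> b \<in> V \<Longrightarrow> a < b \<Longrightarrow> f b \<le> f a \<Longrightarrow> f' b \<le> f' a"
  shows "cover f V R \<le> cover f' V R"
proof (rule cover_le_cover[OF assms(1,1)])
  fix g assume "dec_colouring f V R g"
  hence "dec_colouring f' V R g" using assms(2) unfolding dec_colouring_def by blast
  thus "\<exists>g'. dec_colouring f' V R g' \<and> card {a\<in>V. g a < R} \<le> card {a\<in>V. g' a < R}" by blast
qed

lemma cover_cong:
  assumes "finite V" "\<And>a. a \<in> V \<Longrightarrow> f a = f' a"
  shows "cover f V R = cover f' V R"
  using assms by (intro antisym cover_mono) auto

text \<open>The condition is imposed pair by pair, and \<open>h\<close> may preserve or reverse the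
  order, so that one argument yields invariance under translation as well as under reversal of the
  positions combined with complementing the letters.\<close>

lemma cover_le_transfer:
  assumes fin: "finite V" and inj: "inj_on h V'" and im: "h ` V' = V"
    and ord: "\<And>a b. a \<in> V' \<Longrightarrow> b \<in> V' \<Longrightarrow> a < b \<Longrightarrow>
      (h a < h b \<and> (f (h b) \<le> f (h a) \<longrightarrow> f' b \<le> f' a)) \<or> (h b < h a \<and> (f (h a) \<le> f (h b) \<longrightarrow> f' b \<le> f' a))"
  shows "cover f V R \<le> cover f' V' R"
proof (rule cover_le_cover[OF fin])
  show fin': "finite V'" using fin im inj by (metis finite_imageD)
  fix g assume g: "dec_colouring f V R g"
  have "dec_colouring f' V' R (g \<circ> h)" unfolding dec_colouring_def
  proof (intro ballI impI, elim conjE)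
    fix a b assume a: "a \<in> V'" and b: "b \<in> V'" and ab: "a < b" "(g \<circ> h) a = (g \<circ> h) b" "(g \<circ> h) a < R"
    have V: "h a \<in> V" "h b \<in> V" using a b im by auto
    from ord[OF a b ab(1)] show "f' b \<le> f' a"
    proof
      assume x: "h a < h b \<and> (f (h b) \<le> f (h a) \<longrightarrow> f' b \<le> f' a)"
      have "f (h b) \<le> f (h a)" using dec_colouringD[OF g V] x ab by auto
      thus ?thesis using x by auto
    next
      assume x: "h b < h a \<and> (f (h a) \<le> f (h b) \<longrightarrow> f' b \<le> f' a)"
      have "f (h a) \<le> f (h b)" using dec_colouringD[OF g V(2) V(1)] x ab by auto
      thus ?thesis using x by auto
    qed
  qed
  moreover have "{a\<in>V. g a < R} = h ` {a\<in>V'. (g \<circ> h) a < R}" using im by auto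
  hence "card {a\<in>V. g a < R} \<le> card {a\<in>V'. (g \<circ> h) a < R}"
    by (metis (no_types, lifting) card_image_le fin' finite_subset mem_Collect_eq subsetI)
  ultimately show "\<exists>g'. dec_colouring f' V' R g' \<and> card {a\<in>V. g a < R} \<le> card {a\<in>V'. g' a < R}" by blast
qed

lemma cover_shift:
  assumes "finite V"
  shows "cover (\<lambda>a. f (a + d)) V R = cover f ((\<lambda>a. a + d) ` V) R"
proof (rule antisym)
  show "cover (\<lambda>a. f (a + d)) V R \<le> cover f ((\<lambda>a. a + d) ` V) R"
    by (rule cover_le_transfer[where h = "\<lambda>a. a - d"]) (use assms in \<open>auto simp: inj_on_def image_image\<close>)
  show "cover f ((\<lambda>a. a + d) ` V) R \<le> cover (\<lambda>a. f (a + d)) V R"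
    by (rule cover_le_transfer[where h = "\<lambda>a. a + d"]) (use assms in \<open>auto simp: inj_on_def\<close>)
qed

lemma cover_reflect:
  assumes "finite V"
  shows "cover (\<lambda>a. B - f (N - a)) ((\<lambda>a. N - a) ` V) R = cover f V R"
proof (rule antisym)
  show "cover (\<lambda>a. B - f (N - a)) ((\<lambda>a. N - a) ` V) R \<le> cover f V R"
    by (rule cover_le_transfer[where h = "\<lambda>a. N - a"]) (use assms in \<open>auto simp: inj_on_def image_image\<close>)
  show "cover f V R \<le> cover (\<lambda>a. B - f (N - a)) ((\<lambda>a. N - a) ` V) R"
    by (rule cover_le_transfer[where h = "\<lambda>a. N - a"]) (use assms in \<open>auto simp: inj_on_def image_image\<close>)
qed

text \<open>The positions of one fixed letter form a weakly decreasing chain, so the letters up to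
  \<open>R\<close> supply \<open>R\<close> disjoint chains.\<close>

lemma cover_ge_rows:
  assumes "finite V" "\<And>a. a \<in> V \<Longrightarrow> 1 \<le> f a"
  shows "card {a\<in>V. f a \<le> int R} \<le> cover f V R"
proof -
  have "dec_colouring f V R (\<lambda>a. nat (f a - 1))" unfolding dec_colouring_def using assms(2) by fastforce
  from cover_ge[OF assms(1) this] have "card {a\<in>V. nat (f a - 1) < R} \<le> cover f V R" .
  moreover have "{a\<in>V. nat (f a - 1) < R} = {a\<in>V. f a \<le> int R}" using assms(2) by (auto; fastforce)
  ultimately show ?thesis by simp
qed

section \<open>Lowering a single letter\<close>

text \<open>A chain through \<open>y\<close> that decreases only after the lowering must contain a
  letter \<open>r\<close> before \<open>y\<close>. The partners \<open>m a\<close>, which are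
  letters \<open>r + 1\<close> between \<open>a\<close> and \<open>y\<close>, allow such a colouring
  to be repaired without losing covered positions. The induction is on the number of letters
  \<open>r\<close> before \<open>y\<close> that share the colour of \<open>y\<close>.\<close>

lemma dec_colouring_lower:
  assumes fin: "finite V" and yV: "y \<in> V" and fy: "f y = r + 1"
    and m: "\<And>a. a \<in> V \<Longrightarrow> a < y \<Longrightarrow> f a = r \<Longrightarrow> m a \<in> V \<and> a < m a \<and> m a < y \<and> f (m a) = r + 1"
    and inj: "inj_on m {a\<in>V. a < y \<and> f a = r}"
    and g: "dec_colouring (f(y := r)) V R g"
  shows "\<exists>g'. dec_colouring f V R g' \<and> card {a\<in>V. g' a < R} = card {a\<in>V. g a < R}"
  using g
proof (induction "card {a\<in>V. a < y \<and> f a = r \<and> g a = g y}" arbitrary: g rule: less_induct)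
  case less
  note g = less.prems
  define A where "A = {a\<in>V. a < y \<and> f a = r \<and> g a = g y}"
  have finA: "finite A" using fin by (auto simp: A_def)
  have gD: "f b \<le> f a" if "a \<in> V" "b \<in> V" "a < b" "g a = g b" "g a < R" "a \<noteq> y" "b \<noteq> y" for a b
    using dec_colouringD[OF g that(1-5)] that by simp
  have gl: "r \<le> f a" if "a \<in> V" "a < y" "g a = g y" "g y < R" for a
    using dec_colouringD[OF g that(1) yV that(2,3)] that by simp
  have gr: "f b \<le> r" if "b \<in> V" "y < b" "g b = g y" "g y < R" for b
    using dec_colouringD[OF g yV that(1,2)] that by simp
  show ?case
  proof (cases "g y < R")
    case False
    have "dec_colouring f V R g" unfolding dec_colouring_def using gD False by metis
    thus ?thesis by blast
  next
    case iR: True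
    show ?thesis
    proof (cases "\<exists>a\<in>A. g (m a) < R")
      case False
      \<comment> \<open>No partner is covered: the offending letters hand their colour to their
        partners. Before \<open>y\<close> this colour then contains only letters above
        \<open>r\<close>, and the number of covered positions is unchanged because \<open>m\<close>
        is injective.\<close>
      define g' where "g' = (\<lambda>b. if b \<in> A then R else if b \<in> m ` A then g y else g b)"
      have mA: "m a \<in> V" "a < m a" "m a < y" "f (m a) = r + 1" "\<not> g (m a) < R" if "a \<in> A" for a
        using m[of a] that False by (auto simp: A_def)
      have disj: "m a \<notin> A" if "a \<in> A" for a using mA(4)[OF that] by (auto simp: A_def)
      have class_i: "b \<in> m ` A \<or> (g b = g y \<and> b \<notin> A)" if "g' b = g y" for b
        using that iR by (auto simp: g'_def split: if_splits)
      have "dec_colouring f V R g'" unfolding dec_colouring_def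
      proof (intro ballI impI, elim conjE)
        fix a b assume ab: "a \<in> V" "b \<in> V" "a < b" "g' a = g' b" "g' a < R"
        show "f b \<le> f a"
        proof (cases "g' a = g y")
          case True
          have ge: "r + 1 \<le> f c" if "c \<in> V" "g' c = g y" "c \<le> y" for c
          proof (cases "c \<in> m ` A \<or> c = y")
            case True thus ?thesis using mA(4) fy by auto
          next
            case False
            hence "g c = g y" "c \<notin> A" "c < y" using class_i[OF that(2)] that by auto
            hence "r \<le> f c" "f c \<noteq> r" using gl[of c] iR that by (auto simp: A_def)
            thus ?thesis by simp
          qed
          have le: "f c \<le> r" if "c \<in> V" "g' c = g y" "y < c" for c
            using class_i[OF that(2)] mA(3) gr[of c] iR that by fastforce
          show ?thesis
          proof (cases "b \<le> y")
            case bly: True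
            have fa: "r + 1 \<le> f a" using ge[OF ab(1)] True bly ab by auto
            show ?thesis
            proof (cases "b \<in> m ` A \<or> b = y")
              case True thus ?thesis using mA(4) fy fa by auto
            next
              case bF: False
              hence gb: "g b = g y" "b \<notin> A" using class_i[of b] True ab by auto
              show ?thesis
              proof (cases "a \<in> m ` A")
                case True
                then obtain c where c: "c \<in> A" "a = m c" by auto
                have "f b \<le> f c" using gD[of c b] c mA(2)[OF c(1)] ab gb iR bF by (auto simp: A_def)
                thus ?thesis using fa c by (auto simp: A_def)
              next
                case False
                hence "g a = g y" using class_i[of a] True by auto
                thus ?thesis using gD[of a b] ab gb iR bF bly by auto
              qed
            qed
          next
            case False
            hence "f b \<le> r" using le[OF ab(2)] True ab by auto
            show ?thesis
            proof (cases "a \<le> y")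
              case True
              thus ?thesis using ge[OF ab(1)] \<open>f b \<le> r\<close> \<open>g' a = g y\<close> by auto
            next
              case False
              hence "a \<notin> m ` A" "b \<notin> m ` A" using mA(3) ab by force+
              hence "g a = g y" "g b = g y" using class_i[of a] class_i[of b] True ab by auto
              thus ?thesis using gD[of a b] ab False iR by auto
            qed
          qed
        next
          case False
          hence na: "a \<notin> A" "b \<notin> A" "a \<notin> m ` A" "b \<notin> m ` A" using ab by (auto simp: g'_def split: if_splits)
          hence "g' a = g a" "g' b = g b" by (auto simp: g'_def)
          moreover from this have "a \<noteq> y" "b \<noteq> y" using False ab by auto
          ultimately show ?thesis using gD[of a b] ab by auto
        qed
      qed
      moreover have "card {a\<in>V. g' a < R} = card {a\<in>V. g a < R}"
      proof -
        have e: "{a\<in>V. g' a < R} = ({a\<in>V. g a < R} - A) \<union> m ` A"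
          using mA disj iR by (auto simp: g'_def split: if_splits)
        have AA: "A \<subseteq> {a\<in>V. g a < R}" using iR by (auto simp: A_def)
        have "card (({a\<in>V. g a < R} - A) \<union> m ` A) = card ({a\<in>V. g a < R} - A) + card (m ` A)"
          using fin finA mA by (intro card_Un_disjoint) auto
        also have "card (m ` A) = card A" using inj by (intro card_image inj_on_subset[OF inj]) (auto simp: A_def)
        also have "card ({a\<in>V. g a < R} - A) + card A = card {a\<in>V. g a < R}"
          using AA finA fin card_mono[of "{a\<in>V. g a < R}" A] by (simp add: card_Diff_subset)
        finally show ?thesis using e by simp
      qed
      ultimately show ?thesis by blast
    next
      case True
      then obtain a where a: "a \<in> A" "g (m a) < R" by auto
      have ma: "m a \<in> V" "a < m a" "m a < y" "f (m a) = r + 1" using m[of a] a by (auto simp: A_def)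
      have aV: "a \<in> V" "a < y" "f a = r" "g a = g y" using a by (auto simp: A_def)
      define j where "j = g (m a)"
      have ji: "j \<noteq> g y" using gD[OF aV(1) ma(1,2)] aV ma iR by (auto simp: j_def)
      define D where "D = {c\<in>V. g c = j \<and> f c = r + 1}"
      have D: "finite D" "m a \<in> D" using fin ma by (auto simp: D_def j_def)
      \<comment> \<open>The colour \<open>j\<close> of a covered partner differs from that of
        \<open>y\<close>, since the letter rises from \<open>a\<close> to \<open>m a\<close>. The
        last letter \<open>r + 1\<close> of colour \<open>j\<close> decides how to repair the
        colouring.\<close>
      define c where "c = Max D"
      have c: "c \<in> V" "g c = j" "f c = r + 1" "m a \<le> c"
        using Max_in[of D] Max_ge[of D "m a"] D unfolding c_def by (auto simp: D_def)
      have cmax: "x \<le> c" if "x \<in> V" "g x = j" "f x = r + 1" for x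
        unfolding c_def using that D by (intro Max_ge) (auto simp: D_def)
      have cy: "c \<noteq> y" using c ji by auto
      show ?thesis
      proof (cases "y < c")
        case True
        \<comment> \<open>With letters \<open>r + 1\<close> of colour \<open>j\<close> on both sides
          of \<open>y\<close>, the position \<open>y\<close> fits into that colour with its old
          letter.\<close>
        have "dec_colouring f V R (g(y := j))" unfolding dec_colouring_def
        proof (intro ballI impI, elim conjE)
          fix u v assume uv: "u \<in> V" "v \<in> V" "u < v" "(g(y := j)) u = (g(y := j)) v" "(g(y := j)) u < R"
          consider "u = y" | "v = y" | "u \<noteq> y" "v \<noteq> y" by blast
          thus "f v \<le> f u"
          proof cases
            case 1
            hence "g v = j" "v \<noteq> y" using uv by auto
            hence "f v \<le> f (m a)" using gD[of "m a" v] ma uv 1 a(2) by (auto simp: j_def)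
            thus ?thesis using 1 fy ma by simp
          next
            case 2
            hence "g u = j" "u \<noteq> y" using uv by auto
            hence "f c \<le> f u" using gD[of u c] c uv 2 True a(2) by (auto simp: j_def)
            thus ?thesis using 2 fy c by simp
          next
            case 3
            thus ?thesis using gD[of u v] uv by auto
          qed
        qed
        moreover have "{x\<in>V. (g(y := j)) x < R} = {x\<in>V. g x < R}" using iR a(2) by (auto simp: j_def)
        ultimately show ?thesis by metis
      next
        case False
        hence cy: "c < y" using cy by simp
        \<comment> \<open>The two colours exchange their tails to the right of \<open>c\<close>.
          Both glued chains decrease for the lowered word: up to \<open>c\<close> the letters are at
          least \<open>r\<close> in the colour of \<open>y\<close> and at least \<open>r + 1\<close>
          in colour \<open>j\<close>, beyond \<open>c\<close> they are at most \<open>r\<close>.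
          Afterwards \<open>y\<close> has colour \<open>j\<close>, and the offending letter
          \<open>a\<close> no longer shares its colour.\<close>
        define s where "s = (\<lambda>k. if k = g y then j else if k = j then g y else k)"
        define g' where "g' = (\<lambda>x. if c < x then s (g x) else g x)"
        have sR: "s k < R \<longleftrightarrow> k < R" for k using iR a(2) by (auto simp: s_def j_def)
        have sinj: "s k = s k' \<longleftrightarrow> k = k'" for k k' using ji by (auto simp: s_def)
        have g'y: "g' y = j" using cy by (auto simp: g'_def s_def)
        have lj: "r + 1 \<le> f u" if "u \<in> V" "g u = j" "u \<le> c" for u
          using gD[of u c] c cy that a(2) by (cases "u = c") (auto simp: j_def)
        have rj: "f v \<le> r" if "v \<in> V" "g v = j" "c < v" for v
        proof -
          have "v \<noteq> y" using that ji by auto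
          hence "f v \<le> r + 1" using gD[of c v] c cy that a(2) by (auto simp: j_def)
          thus ?thesis using cmax[of v] that by (cases "f v = r + 1") auto
        qed
        have ri: "(f(y := r)) v \<le> r" if "v \<in> V" "g v = g y" "c < v" for v
          using gD[of a v] aV that c(4) ma(2) iR by (cases "v = y") auto
        have "dec_colouring (f(y := r)) V R g'" unfolding dec_colouring_def
        proof (intro ballI impI, elim conjE)
          fix u v assume uv: "u \<in> V" "v \<in> V" "u < v" "g' u = g' v" "g' u < R"
          show "(f(y := r)) v \<le> (f(y := r)) u"
          proof (cases "u \<le> c \<and> c < v \<and> (g u = g y \<or> g u = j)")
            case False
            hence "g u = g v \<and> g u < R"
              using uv ji by (auto simp: g'_def sR sinj) (auto simp: s_def split: if_splits)
            thus ?thesis using dec_colouringD[OF g uv(1-3)] by auto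
          next
            case True
            hence us: "g u = s (g v)" using uv by (auto simp: g'_def)
            have uy: "u \<noteq> y" using True cy by auto
            from True consider "g u = g y" | "g u = j" by blast
            thus ?thesis
            proof cases
              case 1
              hence glued_val: "g v = j" using us ji by (auto simp: s_def split: if_splits)
              hence "v \<noteq> y" using ji by auto
              have "r \<le> f u" using gl[of u] uv 1 True cy iR by auto
              thus ?thesis using rj[of v] glued_val True uv uy \<open>v \<noteq> y\<close> by auto
            next
              case 2
              hence glued_val: "g v = g y" using us ji by (auto simp: s_def split: if_splits)
              have "r + 1 \<le> f u" using lj[of u] uv 2 True by auto
              thus ?thesis using ri[of v] glued_val True uv uy by auto
            qed
          qed
        qed
        moreover have "card {x\<in>V. x < y \<and> f x = r \<and> g' x = g' y} < card A"
        proof (rule psubset_card_mono[OF finA])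
          have "{x\<in>V. x < y \<and> f x = r \<and> g' x = g' y} \<subseteq> A"
          proof
            fix u assume u: "u \<in> {x\<in>V. x < y \<and> f x = r \<and> g' x = g' y}"
            show "u \<in> A"
            proof (cases "c < u")
              case True thus ?thesis using u g'y ji by (auto simp: A_def g'_def s_def split: if_splits)
            next
              case False thus ?thesis using u g'y lj[of u] by (auto simp: g'_def)
            qed
          qed
          moreover have "a \<notin> {x\<in>V. x < y \<and> f x = r \<and> g' x = g' y}"
            using aV c(4) ma(2) ji g'y by (auto simp: g'_def)
          ultimately show "{x\<in>V. x < y \<and> f x = r \<and> g' x = g' y} \<subset> A" using a by blast
        qed
        ultimately obtain h where "dec_colouring f V R h" "card {x\<in>V. h x < R} = card {x\<in>V. g' x < R}"
          using less.hyps[of g'] unfolding A_def by blast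
        moreover have "{x\<in>V. g' x < R} = {x\<in>V. g x < R}" using sR by (auto simp: g'_def split: if_splits)
        ultimately show ?thesis by auto
      qed
    qed
  qed
qed

lemma cover_lower:
  assumes "finite V" "y \<in> V" "f y = r + 1"
    and "\<And>a. a \<in> V \<Longrightarrow> a < y \<Longrightarrow> f a = r \<Longrightarrow> m a \<in> V \<and> a < m a \<and> m a < y \<and> f (m a) = r + 1"
    and "inj_on m {a\<in>V. a < y \<and> f a = r}"
  shows "cover (f(y := r)) V R \<le> cover f V R"
proof (rule cover_le_cover[OF assms(1,1)])
  fix g assume g: "dec_colouring (f(y := r)) V R g"
  have "\<exists>g'. dec_colouring f V R g' \<and> card {a\<in>V. g' a < R} = card {a\<in>V. g a < R}"
    by (rule dec_colouring_lower[OF assms(1-3) _ assms(5) g]) (rule assms(4))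
  thus "\<exists>g'. dec_colouring f V R g' \<and> card {a\<in>V. g a < R} \<le> card {a\<in>V. g' a < R}" by (metis order_refl)
qed

text \<open>The mirror image of \<open>cover_lower\<close> under reversing positions and negating
  letters; the partners now lie to the right of \<open>y\<close>, in front of the letters
  \<open>r + 1\<close>.\<close>

lemma cover_raise:
  assumes fin: "finite V" and y: "y \<in> V" "f y = r + 1"
    and m: "\<And>d. d \<in> V \<Longrightarrow> y < d \<Longrightarrow> f d = r + 1 \<Longrightarrow> m d \<in> V \<and> y < m d \<and> m d < d \<and> f (m d) = r"
    and inj: "inj_on m {d\<in>V. y < d \<and> f d = r + 1}"
  shows "cover f V R \<le> cover (f(y := r)) V R"
proof -
  define f' where "f' = f(y := r)"
  define h where "h = (\<lambda>a. - f' (- a))"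
  define W where "W = uminus ` V"
  have "cover (h(- y := - r - 1)) W R \<le> cover h W R"
  proof (rule cover_lower[where m = "\<lambda>a. - m (- a)"])
    show "finite W" "- y \<in> W" "h (- y) = (- r - 1) + 1" using fin y by (auto simp: W_def h_def f'_def)
    fix a assume "a \<in> W" "a < - y" "h a = - r - 1"
    then obtain d where d: "a = - d" "d \<in> V" "y < d" "f d = r + 1" by (auto simp: W_def h_def f'_def split: if_splits)
    show "- m (- a) \<in> W \<and> a < - m (- a) \<and> - m (- a) < - y \<and> h (- m (- a)) = - r - 1 + 1"
      using m[OF d(2-4)] d(1) by (auto simp: W_def h_def f'_def)
  next
    show "inj_on (\<lambda>a. - m (- a)) {a \<in> W. a < - y \<and> h a = - r - 1}"
      using inj by (auto simp: inj_on_def W_def h_def f'_def split: if_splits)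
  qed
  moreover have "h(- y := - r - 1) = (\<lambda>a. 0 - f (0 - a))"
    using y by (auto simp: h_def f'_def fun_eq_iff)
  moreover have "h = (\<lambda>a. 0 - f' (0 - a))" by (auto simp: h_def)
  moreover have "W = (\<lambda>a. 0 - a) ` V" by (auto simp: W_def)
  ultimately show ?thesis using cover_reflect[OF fin, of 0 f 0 R] cover_reflect[OF fin, of 0 f' 0 R]
    unfolding f'_def by simp
qed

text \<open>Hall's condition is needed for final segments only. Any partner of the largest element
  of \<open>A\<close> lies above all other elements, so deleting this pair lowers both counts by
  one.\<close>

lemma matching_exists:
  fixes A C :: "int set"
  assumes "finite A" "finite C" "\<And>a. a \<in> A \<Longrightarrow> card {x\<in>A. a \<le> x} \<le> card {c\<in>C. a < c}"
  shows "\<exists>m. inj_on m A \<and> (\<forall>a\<in>A. m a \<in> C \<and> a < m a)"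
  using assms
proof (induction A arbitrary: C rule: finite_linorder_max_induct)
  case empty thus ?case by simp
next
  case (insert b A)
  have "{x \<in> insert b A. b \<le> x} = {b}" using insert.hyps by auto
  with insert.prems(2)[of b] have "card {c\<in>C. b < c} \<noteq> 0" by auto
  hence "{c\<in>C. b < c} \<noteq> {}" by (metis card.empty)
  then obtain c where c: "c \<in> C" "b < c" by auto
  have "\<exists>m. inj_on m A \<and> (\<forall>a\<in>A. m a \<in> C - {c} \<and> a < m a)"
  proof (rule insert.IH)
    show "finite (C - {c})" using insert.prems by simp
    fix a assume a: "a \<in> A"
    have ab: "a < b" using insert.hyps a by auto
    have "{x\<in>insert b A. a \<le> x} = insert b {x\<in>A. a \<le> x}" using ab by auto
    hence "card {x\<in>insert b A. a \<le> x} = Suc (card {x\<in>A. a \<le> x})" using insert.hyps by auto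
    moreover have "{x\<in>C. a < x} = insert c {x\<in>C - {c}. a < x}" using c ab by auto
    hence "card {x\<in>C. a < x} = Suc (card {x\<in>C - {c}. a < x})" using insert.prems(1) by simp
    ultimately show "card {x\<in>A. a \<le> x} \<le> card {x\<in>C - {c}. a < x}" using insert.prems(2)[of a] a by auto
  qed
  then obtain m where m: "inj_on m A" "\<forall>a\<in>A. m a \<in> C - {c} \<and> a < m a" by blast
  have "b \<notin> A" using insert.hyps by auto
  hence "inj_on (m(b := c)) (insert b A)" using m by (auto simp: inj_on_def)
  moreover have "\<forall>a\<in>insert b A. (m(b := c)) a \<in> C \<and> a < (m(b := c)) a" using m c \<open>b \<notin> A\<close> by auto
  ultimately show ?case by blast
qed

lemma finite_int_interval_filter [simp]:
  "finite {a::int. t < a \<and> a \<le> k \<and> P a}" "finite {a::int. t < a \<and> a < k \<and> P a}"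
  "finite {a::int. t \<le> a \<and> a \<le> k \<and> P a}"
  by (rule finite_subset[of _ "{t..k}"]; auto)+

section \<open>Lattice words\<close>

definition cnt :: "(int \<Rightarrow> int) \<Rightarrow> int \<Rightarrow> int \<Rightarrow> int \<Rightarrow> int" where
  "cnt f t k r = int (card {a\<in>{t<..k}. f a = r})"

lemma cnt_step: "t < k \<Longrightarrow> cnt f t k r = cnt f t (k - 1) r + (if f k = r then 1 else 0)"
proof -
  assume "t < k"
  hence "{a\<in>{t<..k}. f a = r} = (if f k = r then insert k {a\<in>{t<..k-1}. f a = r} else {a\<in>{t<..k-1}. f a = r})"
    by (auto simp: less_le)
  thus ?thesis by (simp add: cnt_def)
qed

lemma cnt_empty: "k \<le> t \<Longrightarrow> cnt f t k r = 0"
  by (simp add: cnt_def)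

lemma cnt_nonneg: "0 \<le> cnt f t k r"
  by (simp add: cnt_def)

lemma cnt_mono: "k \<le> k' \<Longrightarrow> cnt f t k r \<le> cnt f t k' r"
  unfolding cnt_def by (auto intro!: card_mono)

lemma cnt_diff:
  assumes "t \<le> q" "q \<le> k"
  shows "cnt f t k r - cnt f t q r = int (card {a\<in>{q<..k}. f a = r})"
proof -
  have e: "{a\<in>{t<..k}. f a = r} = {a\<in>{t<..q}. f a = r} \<union> {a\<in>{q<..k}. f a = r}" using assms by auto
  have "card {a\<in>{t<..k}. f a = r} = card {a\<in>{t<..q}. f a = r} + card {a\<in>{q<..k}. f a = r}"
    unfolding e by (rule card_Un_disjoint) auto
  thus ?thesis by (simp add: cnt_def)
qed

lemma cnt_cong: "(\<And>a. t < a \<Longrightarrow> a \<le> k \<Longrightarrow> f a = f' a) \<Longrightarrow> cnt f t k r = cnt f' t k r"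
  unfolding cnt_def by (intro arg_cong[where f = int] arg_cong[where f = card]) auto

lemma cnt_upd:
  assumes "t < y" "f y = r + 1"
  shows "cnt (f(y := r)) t k R = cnt f t k R + (if y \<le> k then (if R = r then 1 else if R = r + 1 then -1 else 0) else 0)"
proof (cases "y \<le> k")
  case False
  thus ?thesis by (auto intro!: cnt_cong)
next
  case yk: True
  consider "R = r" | "R = r + 1" | "R \<noteq> r" "R \<noteq> r + 1" by blast
  thus ?thesis
  proof cases
    case 1
    have "{a\<in>{t<..k}. (f(y := r)) a = R} = insert y {a\<in>{t<..k}. f a = R}" using assms yk 1 by auto
    thus ?thesis using yk 1 assms by (simp add: cnt_def)
  next
    case 2
    have "{a\<in>{t<..k}. f a = R} = insert y {a\<in>{t<..k}. (f(y := r)) a = R}" using assms yk 2 by auto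
    hence "card {a\<in>{t<..k}. f a = R} = Suc (card {a\<in>{t<..k}. (f(y := r)) a = R})" using 2 by simp
    thus ?thesis using yk 2 by (simp add: cnt_def)
  next
    case 3
    have "{a\<in>{t<..k}. (f(y := r)) a = R} = {a\<in>{t<..k}. f a = R}" using assms 3 by auto
    thus ?thesis using 3 by (simp add: cnt_def)
  qed
qed

lemma cnt_ex:
  assumes "1 \<le> j" "j \<le> cnt f t k r"
  shows "\<exists>a. t < a \<and> a \<le> k \<and> f a = r \<and> cnt f t a r = j"
proof -
  have "t \<le> k" using assms cnt_empty[of k t f r] by linarith
  thus ?thesis using assms
  proof (induction k rule: int_ge_induct)
    case base thus ?case using cnt_empty[of t t f r] by simp
  next
    case (step k)
    show ?case
    proof (cases "j \<le> cnt f t k r")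
      case True thus ?thesis using step.IH[OF step.prems(1)] by force
    next
      case False
      have "cnt f t (k + 1) r = cnt f t k r + (if f (k + 1) = r then 1 else 0)"
        using cnt_step[of t "k + 1" f r] step.hyps by simp
      hence "f (k + 1) = r \<and> cnt f t (k + 1) r = j" using False step.prems by (auto split: if_splits)
      thus ?thesis using step.hyps by (intro exI[of _ "k + 1"]) auto
    qed
  qed
qed

text \<open>Lattice (Yamanouchi) words: when positive letters are read as row numbers, every prefix
  fills a Young diagram, and the word is the row word of a standard tableau.\<close>

definition lattice :: "(int \<Rightarrow> int) \<Rightarrow> int \<Rightarrow> int \<Rightarrow> bool" where
  "lattice f t k \<longleftrightarrow> (\<forall>k'\<le>k. \<forall>r\<ge>1. cnt f t k' (r + 1) \<le> cnt f t k' r)"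

lemma lattice_le:
  assumes "lattice f t k" "k' \<le> k" "1 \<le> r" "r \<le> r'"
  shows "cnt f t k' r' \<le> cnt f t k' r"
  using assms(4)
proof (induction r' rule: int_ge_induct)
  case (step i)
  thus ?case using assms unfolding lattice_def by (meson order_trans)
qed simp

text \<open>The number of earlier occurrences of its own letter, itself included, is the column of
  an entry. If \<open>b\<close> were not lower than \<open>a\<close>, row \<open>f b\<close> would
  be at least as long as that column already at \<open>a\<close>, and \<open>b\<close> would end up
  further to the right.\<close>

lemma lattice_col_less:
  assumes l: "lattice f t k" and a: "t < a" "a < b" "b \<le> k" "1 \<le> f b" and eq: "cnt f t a (f a) = cnt f t b (f b)"
  shows "f a < f b"
proof (rule ccontr)
  assume "\<not> f a < f b"
  hence "cnt f t a (f a) \<le> cnt f t a (f b)" using lattice_le[OF l, of a "f b" "f a"] a by auto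
  moreover have "cnt f t a (f b) \<le> cnt f t (b - 1) (f b)" using a by (intro cnt_mono) auto
  moreover have "cnt f t b (f b) = cnt f t (b - 1) (f b) + 1" using cnt_step[of t b f "f b"] a by simp
  ultimately show False using eq by simp
qed

lemma card_le_fibres:
  assumes "finite A" "finite B" "\<And>j. card {a\<in>A. h a = j} \<le> card {b\<in>B. h b = j}"
  shows "card A \<le> card B"
proof -
  have c: "card X = (\<Sum>j\<in>h ` (A \<union> B). card {a\<in>X. h a = j})" if "X \<subseteq> A \<union> B" for X
  proof -
    have "finite X" using that assms finite_subset by blast
    have "X = (\<Union>j\<in>h ` (A \<union> B). {a\<in>X. h a = j})" using that by auto
    hence "card X = card (\<Union>j\<in>h ` (A \<union> B). {a\<in>X. h a = j})" by simp
    also have "\<dots> = (\<Sum>j\<in>h ` (A \<union> B). card {a\<in>X. h a = j})"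
      using assms \<open>finite X\<close> by (intro card_UN_disjoint) auto
    finally show ?thesis .
  qed
  show ?thesis using c[of A] c[of B] assms(3) by (simp add: sum_mono)
qed

text \<open>Columns strictly increase, so a decreasing chain meets each column at most once. Hence
  \<open>R\<close> chains take from each column no more boxes than the first \<open>R\<close> rows
  do, and the comparison can be made column by column.\<close>

lemma lattice_cover:
  assumes l: "lattice f t k" and pos: "\<And>a. t < a \<Longrightarrow> a \<le> k \<Longrightarrow> 1 \<le> f a"
  shows "cover f {t<..k} R = card {a\<in>{t<..k}. f a \<le> int R}"
proof (rule antisym)
  show "card {a\<in>{t<..k}. f a \<le> int R} \<le> cover f {t<..k} R" using pos by (intro cover_ge_rows) auto
  show "cover f {t<..k} R \<le> card {a\<in>{t<..k}. f a \<le> int R}"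
  proof (rule cover_le)
    fix g assume g: "dec_colouring f {t<..k} R g"
    define h where "h = (\<lambda>a. cnt f t a (f a))"
    show "card {a\<in>{t<..k}. g a < R} \<le> card {a\<in>{t<..k}. f a \<le> int R}"
    proof (rule card_le_fibres[where h = h])
      fix j
      define U where "U = {a \<in> {a\<in>{t<..k}. g a < R}. h a = j}"
      define B where "B = {a \<in> {a\<in>{t<..k}. f a \<le> int R}. h a = j}"
      have fin: "finite U" "finite B" by (auto simp: U_def B_def)
      have injg: "inj_on g U"
      proof (rule linorder_inj_onI')
        fix a b assume ab: "a \<in> U" "b \<in> U" "a < b"
        have "f a < f b" using lattice_col_less[OF l, of a b] ab pos by (auto simp: U_def h_def)
        thus "g a \<noteq> g b" using dec_colouringD[OF g, of a b] ab by (auto simp: U_def)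
      qed
      have "card U \<le> card B"
      proof (cases "\<exists>a\<in>U. int R < f a")
        case False
        hence "U \<subseteq> B" by (auto simp: U_def B_def not_less)
        thus ?thesis using fin by (intro card_mono)
      next
        case True
        then obtain a where a: "t < a" "a \<le> k" "int R < f a" "h a = j" by (auto simp: U_def)
        have j1: "1 \<le> j" using a cnt_step[of t a f "f a"] cnt_nonneg[of f t "a - 1" "f a"] by (auto simp: h_def)
        \<comment> \<open>A letter beyond \<open>R\<close> in column \<open>j\<close> forces the
          first \<open>R\<close> rows to reach that column.\<close>
        have "{1..int R} \<subseteq> f ` B"
        proof
          fix r assume r: "r \<in> {1..int R}"
          have "j \<le> cnt f t a r" using lattice_le[OF l, of a r "f a"] a r by (auto simp: h_def)
          from cnt_ex[OF j1 this] obtain b where b: "t < b" "b \<le> a" "f b = r" "cnt f t b r = j" by blast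
          thus "r \<in> f ` B" using a r by (auto simp: B_def h_def image_iff intro!: bexI[of _ b])
        qed
        hence "card {1..int R} \<le> card B" using fin by (meson card_image_le card_mono finite_imageI order_trans)
        moreover have "card U \<le> card {..<R}"
          using injg by (intro card_inj_on_le[of g]) (auto simp: U_def)
        ultimately show ?thesis by simp
      qed
      thus "card {a \<in> {a\<in>{t<..k}. g a < R}. h a = j} \<le> card {a \<in> {a\<in>{t<..k}. f a \<le> int R}. h a = j}"
        by (simp add: U_def B_def)
    qed auto
  qed simp
qed

text \<open>The excess of letters \<open>r + 1\<close> over letters \<open>r\<close> attains its
  maximum for the first time at \<open>y\<close>, which is where a crystal raising operator acts.
  \<open>before\<close> and \<open>after\<close> are Hall conditions: each \<open>r\<close> before
  \<open>y\<close> is matched with an \<open>r + 1\<close> between it and \<open>y\<close>, and each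
  \<open>r + 1\<close> after \<open>y\<close> with an \<open>r\<close> between \<open>y\<close> and
  it. So \<open>cover_lower\<close> and \<open>cover_raise\<close> both apply, on every subinterval
  containing \<open>y\<close>.\<close>

lemma crystal_move:
  assumes y: "t < y" "f y = r + 1"
    and before: "\<And>a. t \<le> a \<Longrightarrow> a < y \<Longrightarrow> cnt f t a (r + 1) - cnt f t a r < cnt f t y (r + 1) - cnt f t y r"
    and after: "\<And>a. y < a \<Longrightarrow> a \<le> k \<Longrightarrow> cnt f t a (r + 1) - cnt f t a r \<le> cnt f t y (r + 1) - cnt f t y r"
    and q: "t \<le> q" "k' \<le> k"
  shows "cover (f(y := r)) {q<..k'} R = cover f {q<..k'} R"
proof (cases "y \<in> {q<..k'}")
  case False
  thus ?thesis by (intro cover_cong) auto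
next
  case yV: True
  define h where "h = (\<lambda>a. cnt f t a (r + 1) - cnt f t a r)"
  have hy: "h y = h (y - 1) + 1" using y cnt_step[of t y f "r + 1"] cnt_step[of t y f r] by (simp add: h_def)
  define A where "A = {a\<in>{t<..y-1}. f a = r}"
  define C where "C = {a\<in>{t<..y-1}. f a = r + 1}"
  have "\<exists>m. inj_on m A \<and> (\<forall>a\<in>A. m a \<in> C \<and> a < m a)"
  proof (rule matching_exists)
    show "finite A" "finite C" by (auto simp: A_def C_def)
    fix a assume a: "a \<in> A"
    hence ta: "t < a" "a < y" "f a = r" by (auto simp: A_def)
    have "{x\<in>A. a \<le> x} = {x\<in>{a-1<..y-1}. f x = r}" using ta by (auto simp: A_def)
    hence e1: "int (card {x\<in>A. a \<le> x}) = cnt f t (y - 1) r - cnt f t (a - 1) r"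
      using cnt_diff[of t "a - 1" "y - 1" f r] ta by simp
    have "{x\<in>C. a < x} = {x\<in>{a<..y-1}. f x = r + 1}" using ta by (auto simp: C_def)
    hence e2: "int (card {x\<in>C. a < x}) = cnt f t (y - 1) (r + 1) - cnt f t a (r + 1)"
      using cnt_diff[of t a "y - 1" f "r + 1"] ta by simp
    have "h (a - 1) \<le> h (y - 1)" using before[of "a - 1"] ta hy unfolding h_def by simp
    moreover have "cnt f t a (r + 1) = cnt f t (a - 1) (r + 1)" using cnt_step[of t a f "r + 1"] ta by simp
    ultimately show "card {x\<in>A. a \<le> x} \<le> card {c\<in>C. a < c}" using e1 e2 by (simp add: h_def)
  qed
  then obtain m where m: "inj_on m A" "\<forall>a\<in>A. m a \<in> C \<and> a < m a" by blast
  \<comment> \<open>Negation brings the second matching, which runs to the left, into the form of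
    \<open>matching_exists\<close>.\<close>
  define D where "D = uminus ` {a\<in>{y<..k}. f a = r + 1}"
  define E where "E = uminus ` {a\<in>{y<..k}. f a = r}"
  have "\<exists>m. inj_on m D \<and> (\<forall>a\<in>D. m a \<in> E \<and> a < m a)"
  proof (rule matching_exists)
    show "finite D" "finite E" by (auto simp: D_def E_def)
    fix a assume "a \<in> D"
    then obtain d where d: "a = - d" "y < d" "d \<le> k" "f d = r + 1" by (auto simp: D_def)
    have "{x\<in>D. a \<le> x} = uminus ` {x\<in>{y<..d}. f x = r + 1}" using d by (auto simp: D_def)
    hence e1: "int (card {x\<in>D. a \<le> x}) = cnt f t d (r + 1) - cnt f t y (r + 1)"
      using cnt_diff[of t y d f "r + 1"] d y by (simp add: card_image)
    have "{x\<in>E. a < x} = uminus ` {x\<in>{y<..d-1}. f x = r}" using d by (auto simp: E_def)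
    hence e2: "int (card {x\<in>E. a < x}) = cnt f t (d - 1) r - cnt f t y r"
      using cnt_diff[of t y "d - 1" f r] d y by (simp add: card_image)
    have "cnt f t d r = cnt f t (d - 1) r" using cnt_step[of t d f r] d y by simp
    thus "card {x\<in>D. a \<le> x} \<le> card {c\<in>E. a < c}" using e1 e2 after[of d] d by simp
  qed
  then obtain m' where m': "inj_on m' D" "\<forall>a\<in>D. m' a \<in> E \<and> a < m' a" by blast
  show ?thesis
  proof (rule antisym)
    show "cover (f(y := r)) {q<..k'} R \<le> cover f {q<..k'} R"
    proof (rule cover_lower[where m = m])
      fix a assume a: "a \<in> {q<..k'}" "a < y" "f a = r"
      hence "a \<in> A" using q by (auto simp: A_def)
      thus "m a \<in> {q<..k'} \<and> a < m a \<and> m a < y \<and> f (m a) = r + 1" using m a yV by (auto simp: C_def)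
    next
      show "inj_on m {a \<in> {q<..k'}. a < y \<and> f a = r}"
        using q by (intro inj_on_subset[OF m(1)]) (auto simp: A_def)
    qed (use yV y in auto)
    show "cover f {q<..k'} R \<le> cover (f(y := r)) {q<..k'} R"
    proof (rule cover_raise[where m = "\<lambda>d. - m' (- d)"])
      fix d assume d: "d \<in> {q<..k'}" "y < d" "f d = r + 1"
      hence "- d \<in> D" using q by (auto simp: D_def)
      hence "m' (- d) \<in> E" "- d < m' (- d)" using m' by auto
      thus "- m' (- d) \<in> {q<..k'} \<and> y < - m' (- d) \<and> - m' (- d) < d \<and> f (- m' (- d)) = r"
        using d yV by (auto simp: E_def)
    next
      show "inj_on (\<lambda>d. - m' (- d)) {d \<in> {q<..k'}. y < d \<and> f d = r + 1}"
      proof (rule inj_onI)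
        fix d e assume "d \<in> {d \<in> {q<..k'}. y < d \<and> f d = r + 1}" "e \<in> {d \<in> {q<..k'}. y < d \<and> f d = r + 1}" "- m' (- d) = - m' (- e)"
        thus "d = e" using inj_onD[OF m'(1), of "- d" "- e"] q by (auto simp: D_def)
      qed
    qed (use yV y in auto)
  qed
qed

text \<open>The highest weight word of a crystal component, found by minimising the sum of the
  letters: a violated lattice inequality gives a place for a crystal move, which lowers the sum.
  Covering numbers are preserved on all subintervals and not only on prefixes; this permits the
  starting time to be changed later.\<close>

lemma lattice_form_exists:
  assumes pos: "\<And>a. t < a \<Longrightarrow> a \<le> k \<Longrightarrow> 1 \<le> c a"
  shows "\<exists>f. lattice f t k \<and> (\<forall>a. t < a \<and> a \<le> k \<longrightarrow> 1 \<le> f a \<and> f a \<le> c a) \<and>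
     (\<forall>q k' R. t \<le> q \<and> k' \<le> k \<longrightarrow> cover f {q<..k'} R = cover c {q<..k'} R)"
proof -
  define Q where "Q = (\<lambda>f. (\<forall>a. t < a \<and> a \<le> k \<longrightarrow> 1 \<le> f a \<and> f a \<le> c a) \<and>
     (\<forall>q k' R. t \<le> q \<and> k' \<le> k \<longrightarrow> cover f {q<..k'} R = cover c {q<..k'} R))"
  define S where "S = (\<lambda>f :: int \<Rightarrow> int. nat (\<Sum>a\<in>{t<..k}. f a))"
  have "Q c" using pos by (auto simp: Q_def)
  from ex_has_least_nat[of Q, OF this, of S] obtain f where f: "Q f" "\<And>f'. Q f' \<Longrightarrow> S f \<le> S f'" by auto
  have fp: "1 \<le> f a" if "t < a" "a \<le> k" for a using f(1) that by (auto simp: Q_def)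
  have "lattice f t k"
  proof (rule ccontr)
    assume "\<not> lattice f t k"
    then obtain k0 r where k0: "k0 \<le> k" "1 \<le> r" "cnt f t k0 r < cnt f t k0 (r + 1)" by (auto simp: lattice_def not_le)
    define h where "h = (\<lambda>a. cnt f t a (r + 1) - cnt f t a r)"
    have tk0: "t < k0" using k0 cnt_empty[of k0 t f "r"] cnt_empty[of k0 t f "r+1"] by (cases "t < k0") auto
    define M where "M = Max (h ` {t<..k})"
    have ne: "{t<..k} \<noteq> {}" using tk0 k0 by auto
    have M: "h a \<le> M" if "t < a" "a \<le> k" for a using that by (auto simp: M_def)
    have M0: "0 < M" using M[of k0] k0 tk0 by (auto simp: h_def)
    have "M \<in> h ` {t<..k}" unfolding M_def using ne by (intro Max_in) auto
    hence "\<exists>a\<in>{t<..k}. h a = M" by auto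
    \<comment> \<open>The first place where the excess is maximal. Since the maximum is positive,
      the excess at the start \<open>t\<close> is smaller as well, as \<open>crystal_move\<close>
      demands.\<close>
    define Y where "Y = {a\<in>{t<..k}. h a = M}"
    define y where "y = Min Y"
    have Y: "finite Y" "Y \<noteq> {}" using \<open>\<exists>a\<in>{t<..k}. h a = M\<close> by (auto simp: Y_def)
    have y: "t < y" "y \<le> k" "h y = M" using Min_in[OF Y] by (auto simp: y_def Y_def)
    have ymin: "h a \<noteq> M" if "t < a" "a < y" for a
    proof
      assume "h a = M"
      hence "a \<in> Y" using that y by (auto simp: Y_def)
      hence "y \<le> a" unfolding y_def using Y by simp
      thus False using that by simp
    qed
    have before: "h a < h y" if "t \<le> a" "a < y" for a
    proof (cases "a = t")
      case True thus ?thesis using y M0 by (simp add: h_def cnt_empty)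
    next
      case False thus ?thesis using ymin[of a] M[of a] that y by fastforce
    qed
    have fy: "f y = r + 1"
      using before[of "y - 1"] y cnt_step[of t y f "r + 1"] cnt_step[of t y f r]
      by (auto simp: h_def split: if_splits)
    have "Q (f(y := r))" unfolding Q_def
    proof (intro conjI allI impI)
      fix a assume "t < a \<and> a \<le> k"
      hence "1 \<le> f a \<and> f a \<le> c a" using f(1) by (auto simp: Q_def)
      thus "1 \<le> (f(y := r)) a" "(f(y := r)) a \<le> c a" using fy k0 by auto
    next
      fix q k' R assume qk: "t \<le> q \<and> k' \<le> k"
      have "cover (f(y := r)) {q<..k'} R = cover f {q<..k'} R"
        using before M y fy qk by (intro crystal_move[where t = t and k = k]) (auto simp: h_def)
      thus "cover (f(y := r)) {q<..k'} R = cover c {q<..k'} R" using f(1) qk by (auto simp: Q_def)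
    qed
    from f(2)[OF this] have le: "S f \<le> S (f(y := r))" .
    have "(\<Sum>a\<in>{t<..k}. (f(y := r)) a) = (\<Sum>a\<in>{t<..k} - {y}. (f(y := r)) a) + r"
      using y by (subst sum.remove[of _ y]) auto
    also have "(\<Sum>a\<in>{t<..k} - {y}. (f(y := r)) a) = (\<Sum>a\<in>{t<..k} - {y}. f a)" by (intro sum.cong) auto
    finally have e1: "(\<Sum>a\<in>{t<..k}. (f(y := r)) a) = (\<Sum>a\<in>{t<..k} - {y}. f a) + r" .
    have e2: "(\<Sum>a\<in>{t<..k}. f a) = (\<Sum>a\<in>{t<..k} - {y}. f a) + (r + 1)"
      using y fy by (subst sum.remove[of _ y]) auto
    have "0 \<le> (\<Sum>a\<in>{t<..k} - {y}. f a)" using fp by (intro sum_nonneg) force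
    thus False using le e1 e2 k0(2) by (simp add: S_def)
  qed
  thus ?thesis using f(1) unfolding Q_def by blast
qed

section \<open>The universal tableaux\<close>

text \<open>\<open>c k\<close> is the row, counted from the top, of the diagonal box whose entry is congruent to \<open>k\<close>
  modulo \<open>n\<close>.\<close>

locale rods =
  fixes n :: nat and c :: "int \<Rightarrow> int"
  assumes n_pos: "1 \<le> n"
    and per: "\<And>k. c (k + int n) = c k"
    and bij: "bij_betw c {1..int n} {1..int n}"
begin

lemma per_mult: "c (k + int n * e) = c k"
proof -
  have p: "c (k + int n * int j) = c k" for k j
  proof (induction j)
    case (Suc j)
    have "k + int n * int (Suc j) = (k + int n * int j) + int n" by (simp add: algebra_simps)
    thus ?case using Suc per by metis
  qed simp
  show ?thesis
  proof (cases "0 \<le> e")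
    case True thus ?thesis using p[of k "nat e"] by simp
  next
    case False thus ?thesis using p[of "k + int n * e" "nat (- e)"] by simp
  qed
qed

lemma window_rep: "\<exists>k' e. k' \<in> {1..int n} \<and> k = k' + int n * e"
proof -
  have "k = ((k - 1) mod int n + 1) + int n * ((k - 1) div int n)" by (simp add: algebra_simps)
  moreover have "(k - 1) mod int n + 1 \<in> {1..int n}" using n_pos by (auto simp: add1_zle_eq)
  ultimately show ?thesis by blast
qed

lemma c_range: "1 \<le> c k" "c k \<le> int n"
proof -
  obtain k' e where "k' \<in> {1..int n}" "k = k' + int n * e" using window_rep by blast
  hence "c k \<in> {1..int n}" using per_mult[of k' e] bij by (metis bij_betwE)
  thus "1 \<le> c k" "c k \<le> int n" by auto
qed

lemma c_eq_iff: "c k = c k' \<longleftrightarrow> int n dvd k - k'"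
proof -
  obtain u e where u: "u \<in> {1..int n}" "k = u + int n * e" using window_rep by blast
  obtain u' e' where u': "u' \<in> {1..int n}" "k' = u' + int n * e'" using window_rep by blast
  have "c k = c k' \<longleftrightarrow> c u = c u'" using per_mult u u' by simp
  also have "\<dots> \<longleftrightarrow> u = u'" using bij u u' by (meson bij_betw_imp_inj_on inj_on_eq_iff)
  also have "\<dots> \<longleftrightarrow> int n dvd u - u'"
  proof
    assume "int n dvd u - u'"
    moreover have "\<bar>u - u'\<bar> < int n" using u u' by auto
    ultimately show "u = u'" using dvd_imp_le_int[of "u - u'" "int n"] by (cases "u - u' = 0") auto
  qed simp
  also have "\<dots> \<longleftrightarrow> int n dvd (u - u') + int n * (e - e')" by (simp add: dvd_add_left_iff)
  also have "(u - u') + int n * (e - e') = k - k'" using u u' by (simp add: algebra_simps)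
  finally show ?thesis .
qed

definition row_cover :: "int \<Rightarrow> int \<Rightarrow> nat \<Rightarrow> nat" where "row_cover t k R = cover c {t<..k} R"

text \<open>Greene's theorem read as a definition: \<open>k\<close> lies in the first row whose covering number grows
  when \<open>k\<close> is added. The entries of the tableau at time \<open>t\<close> are the integers above \<open>t\<close>.\<close>

definition row_of :: "int \<Rightarrow> int \<Rightarrow> int" where
  "row_of t k = int (LEAST R. row_cover t k R \<noteq> row_cover t (k - 1) R)"

text \<open>For a lattice word the covering number counts the letters up to \<open>R\<close>; it
  jumps at \<open>a\<close> exactly when \<open>f a \<le> R\<close>, and the least such
  \<open>R\<close> is \<open>f a\<close>.\<close>

lemma row_of_eqI:
  assumes l: "lattice f t k" and pos: "\<And>a. t < a \<Longrightarrow> a \<le> k \<Longrightarrow> 1 \<le> f a"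
    and cov: "\<And>k' R. k' \<le> k \<Longrightarrow> cover f {t<..k'} R = row_cover t k' R"
    and a: "t < a" "a \<le> k"
  shows "row_of t a = f a"
proof -
  have cnt: "row_cover t k' R = card {x\<in>{t<..k'}. f x \<le> int R}" if "k' \<le> k" for k' R
    using lattice_cover[of f t k'] cov[OF that] pos that l unfolding lattice_def by fastforce
  have jump: "row_cover t a R \<noteq> row_cover t (a - 1) R \<longleftrightarrow> f a \<le> int R" for R
  proof -
    have "{x\<in>{t<..a}. f x \<le> int R} = (if f a \<le> int R then insert a {x\<in>{t<..a - 1}. f x \<le> int R} else {x\<in>{t<..a - 1}. f x \<le> int R})"
      using a by (auto simp: less_le)
    thus ?thesis using cnt[of a R] cnt[of "a - 1" R] a by simp
  qed
  have "(LEAST R. f a \<le> int R) = nat (f a)" by (rule Least_equality) auto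
  thus ?thesis using pos[OF a] by (simp add: row_of_def jump)
qed

text \<open>The lattice word produced for a window might depend on the end \<open>k\<close>, but
  \<open>row_of t\<close> does not mention \<open>k\<close>, so the words of all windows agree. The
  third part, with a start \<open>q\<close> after \<open>t\<close>, is the link between the tableaux
  at different times.\<close>

lemma row_of_form:
  shows "lattice (row_of t) t k" and "t < a \<Longrightarrow> a \<le> k \<Longrightarrow> 1 \<le> row_of t a \<and> row_of t a \<le> c a"
    and "t \<le> q \<Longrightarrow> cover (row_of t) {q<..k} R = row_cover q k R"
proof -
  obtain f where f: "lattice f t k" "\<And>a. t < a \<Longrightarrow> a \<le> k \<Longrightarrow> 1 \<le> f a \<and> f a \<le> c a"
      "\<And>q k' R. t \<le> q \<Longrightarrow> k' \<le> k \<Longrightarrow> cover f {q<..k'} R = cover c {q<..k'} R"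
    using lattice_form_exists[of t k c] c_range(1) by (metis (no_types, lifting))
  have e: "row_of t a = f a" if "t < a" "a \<le> k" for a
    using f that by (intro row_of_eqI[of f t k]) (auto simp: row_cover_def)
  have "cnt (row_of t) t k' r = cnt f t k' r" if "k' \<le> k" for k' r using e that by (intro cnt_cong) auto
  thus "lattice (row_of t) t k" using f(1) unfolding lattice_def by auto
  show "t < a \<Longrightarrow> a \<le> k \<Longrightarrow> 1 \<le> row_of t a \<and> row_of t a \<le> c a" using e f(2) by auto
  assume q: "t \<le> q"
  have "cover (row_of t) {q<..k} R = cover f {q<..k} R" using e q by (intro cover_cong) auto
  thus "cover (row_of t) {q<..k} R = row_cover q k R" using f(3)[OF q] by (simp add: row_cover_def)
qed

lemma row_of_ge1: "t < a \<Longrightarrow> 1 \<le> row_of t a" and row_of_le_c: "t < a \<Longrightarrow> row_of t a \<le> c a"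
  and row_of_le_n: "t < a \<Longrightarrow> row_of t a \<le> int n"
  using row_of_form(2)[of t a a] c_range(2)[of a] by fastforce+

lemma row_of_rows: "card {a\<in>{t<..k}. row_of t a \<le> int R} = row_cover t k R"
  using lattice_cover[OF row_of_form(1), of t k R] row_of_ge1 row_of_form(3)[of t t k R] by auto

definition col_of :: "int \<Rightarrow> int \<Rightarrow> int" where "col_of t a = cnt (row_of t) t a (row_of t a)"

lemma col_of_ge1: "t < a \<Longrightarrow> 1 \<le> col_of t a"
  using cnt_step[of t a "row_of t" "row_of t a"] cnt_nonneg[of "row_of t" t "a - 1" "row_of t a"] by (simp add: col_of_def)

lemma row_cover_shift: "row_cover (t + int n) (k + int n) R = row_cover t k R"
proof -
  have "(\<lambda>a. a + int n) ` {t<..k} = {t + int n<..k + int n}"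
  proof
    show "{t + int n<..k + int n} \<subseteq> (\<lambda>a. a + int n) ` {t<..k}"
    proof
      fix x assume "x \<in> {t + int n<..k + int n}"
      thus "x \<in> (\<lambda>a. a + int n) ` {t<..k}" by (intro image_eqI[of _ _ "x - int n"]) auto
    qed
  qed auto
  thus ?thesis using cover_shift[of "{t<..k}" c "int n" R] per by (simp add: row_cover_def)
qed

lemma row_of_shift: "row_of (t + int n) (a + int n) = row_of t a"
  using row_cover_shift[of t a] row_cover_shift[of t "a - 1"] by (simp add: row_of_def algebra_simps)

lemma cnt_row_of_shift: "cnt (row_of (t + int n)) (t + int n) (a + int n) r = cnt (row_of t) t a r"
proof -
  have "{x\<in>{t + int n<..a + int n}. row_of (t + int n) x = r} = (\<lambda>x. x + int n) ` {x\<in>{t<..a}. row_of t x = r}"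
  proof
    show "{x\<in>{t + int n<..a + int n}. row_of (t + int n) x = r} \<subseteq> (\<lambda>x. x + int n) ` {x\<in>{t<..a}. row_of t x = r}"
    proof
      fix x assume "x \<in> {x\<in>{t + int n<..a + int n}. row_of (t + int n) x = r}"
      thus "x \<in> (\<lambda>x. x + int n) ` {x\<in>{t<..a}. row_of t x = r}"
        using row_of_shift[of t "x - int n"] by (intro image_eqI[of _ _ "x - int n"]) auto
    qed
  qed (auto simp: row_of_shift)
  thus ?thesis by (simp add: cnt_def card_image)
qed

lemma col_of_shift: "col_of (t + int n) (a + int n) = col_of t a"
  by (simp add: col_of_def row_of_shift cnt_row_of_shift)

text \<open>The entries bumped up by the slide from time \<open>t\<close> to time \<open>t + 1\<close>, cut off at \<open>k\<close>; the value
  \<open>k + 1\<close> means that the slide has left the part up to \<open>k\<close>.\<close>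

primrec bump :: "int \<Rightarrow> int \<Rightarrow> nat \<Rightarrow> int" where
  "bump t k 0 = t + 1"
| "bump t k (Suc i) = Min (insert (k + 1)
     {a\<in>{bump t k i<..k}. cnt (row_of t) t a (int i + 2) = cnt (row_of t) t a (int i + 1)})"

declare bump.simps(2) [simp del]

text \<open>The row word after the first \<open>i\<close> upward moves along the slide path. Each of
  these moves will turn out to be a crystal move in the window starting at
  \<open>t + 1\<close>.\<close>

primrec bumped :: "int \<Rightarrow> int \<Rightarrow> nat \<Rightarrow> int \<Rightarrow> int" where
  "bumped t k 0 = row_of t"
| "bumped t k (Suc i) = (if bump t k (Suc i) \<le> k then (bumped t k i)(bump t k (Suc i) := int i + 1) else bumped t k i)"

declare bumped.simps(2) [simp del]

context
  fixes t k :: int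
  assumes tk: "t < k"
begin

abbreviation "Na r a \<equiv> cnt (row_of t) t a r"
abbreviation "ya \<equiv> bump t k"

lemma Na_decreasing: "1 \<le> r \<Longrightarrow> Na (r + 1) a \<le> Na r a"
  using row_of_form(1)[of t a] by (auto simp: lattice_def)

lemma y_le: "ya i \<le> k + 1"
  using tk by (cases i) (auto intro!: Min_le simp: bump.simps(2))

lemma y_Suc_cases:
  obtains "ya (Suc i) = k + 1" "\<And>a. ya i < a \<Longrightarrow> a \<le> k \<Longrightarrow> Na (int i + 2) a \<noteq> Na (int i + 1) a"
  | "ya i < ya (Suc i)" "ya (Suc i) \<le> k" "Na (int i + 2) (ya (Suc i)) = Na (int i + 1) (ya (Suc i))"
    "\<And>a. ya i < a \<Longrightarrow> a < ya (Suc i) \<Longrightarrow> Na (int i + 2) a \<noteq> Na (int i + 1) a"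
proof -
  define X where "X = {a\<in>{ya i<..k}. Na (int i + 2) a = Na (int i + 1) a}"
  have e: "ya (Suc i) = Min (insert (k + 1) X)" by (simp add: X_def bump.simps(2))
  have fX: "finite X" by (auto simp: X_def)
  show thesis
  proof (cases "X = {}")
    case True
    have "Na (int i + 2) a \<noteq> Na (int i + 1) a" if "ya i < a" "a \<le> k" for a using True that by (auto simp: X_def)
    thus thesis using that(1) e True by simp
  next
    case False
    have m: "Min X \<in> X" using fX False by simp
    hence "Min (insert (k + 1) X) = Min X" using fX False by (subst Min_insert) (auto simp: X_def)
    hence yX: "ya (Suc i) = Min X" using e by simp
    have "Na (int i + 2) a \<noteq> Na (int i + 1) a" if a: "ya i < a" "a < ya (Suc i)" for a
    proof
      assume "Na (int i + 2) a = Na (int i + 1) a"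
      hence "a \<in> X" using a m yX by (auto simp: X_def)
      hence "Min X \<le> a" using fX by simp
      thus False using a yX by simp
    qed
    moreover have "ya i < ya (Suc i)" "ya (Suc i) \<le> k" "Na (int i + 2) (ya (Suc i)) = Na (int i + 1) (ya (Suc i))"
      using m unfolding yX by (auto simp: X_def)
    ultimately show thesis using that(2) by blast
  qed
qed

lemma y_mono_Suc: "ya i \<le> ya (Suc i)"
  using y_le[of i] by (cases i rule: y_Suc_cases) auto

lemma y_mono: "i \<le> j \<Longrightarrow> ya i \<le> ya j"
  using y_mono_Suc by (rule lift_Suc_mono_le)

lemma y_strict: "ya j \<le> k \<Longrightarrow> i < j \<Longrightarrow> ya i < ya j"
proof -
  assume "ya j \<le> k" "i < j"
  then obtain j' where j: "j = Suc j'" "i \<le> j'" by (cases j) auto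
  have "ya j' < ya j" using \<open>ya j \<le> k\<close> j by (cases j' rule: y_Suc_cases) auto
  thus ?thesis using y_mono[OF j(2)] by simp
qed

lemma y_gt: "t < ya i"
  using y_mono[of 0 i] by simp

lemma row_of_first: "row_of t (t + 1) = 1"
proof -
  have "Na (row_of t (t + 1)) (t + 1) = 1" using cnt_step[of t "t + 1" "row_of t" "row_of t (t + 1)"] cnt_empty[of t t] by simp
  moreover have "Na r (t + 1) = (if row_of t (t + 1) = r then 1 else 0)" for r
    using cnt_step[of t "t + 1" "row_of t" r] cnt_empty[of t t] by simp
  moreover have "Na (row_of t (t + 1)) (t + 1) \<le> Na 1 (t + 1)"
    using lattice_le[OF row_of_form(1), of "t + 1" "t + 1" 1 "row_of t (t + 1)"] row_of_ge1[of t "t + 1"] by simp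
  ultimately show ?thesis by (metis zero_neq_one one_neq_zero not_one_le_zero)
qed

text \<open>The two claims are proved together: strictness just before a bumped entry shows that
  this entry belongs to the row that catches up, and this row gives strictness of the next
  comparison from that entry on.\<close>

lemma y_row: "ya i \<le> k \<Longrightarrow> row_of t (ya i) = int i + 1"
  and y_gap: "ya i \<le> a \<Longrightarrow> a < ya (Suc i) \<Longrightarrow> Na (int i + 2) a < Na (int i + 1) a"
proof (induction i arbitrary: a)
  case 0
  { case 1 thus ?case using row_of_first by simp }
  { case (2 a)
    show ?case
    proof (cases "a = t + 1")
      case True
      thus ?thesis using cnt_step[of t "t + 1" "row_of t" 1] cnt_step[of t "t + 1" "row_of t" 2] row_of_first cnt_empty[of t t] by simp
    next
      case False
      hence "Na 2 a \<noteq> Na 1 a" using 2 y_le[of "Suc 0"] by (cases "0::nat" rule: y_Suc_cases) auto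
      thus ?thesis using Na_decreasing[of 1 a] by simp
    qed }
next
  case (Suc i)
  have row: "row_of t (ya (Suc i)) = int i + 2" if yk: "ya (Suc i) \<le> k"
  proof -
    have e: "Na (int i + 2) (ya (Suc i)) = Na (int i + 1) (ya (Suc i))" "ya i < ya (Suc i)"
      using yk by (cases i rule: y_Suc_cases; auto)+
    have "Na (int i + 2) (ya (Suc i) - 1) < Na (int i + 1) (ya (Suc i) - 1)"
      using Suc(2)[of "ya (Suc i) - 1"] e(2) by auto
    thus ?thesis using e(1) cnt_step[of t "ya (Suc i)" "row_of t" "int i + 2"] cnt_step[of t "ya (Suc i)" "row_of t" "int i + 1"]
        y_gt[of "Suc i"] by (auto split: if_splits)
  qed
  { case 1 thus ?case using row by simp }
  { case (2 a)
    have "Na (int i + 3) a < Na (int i + 2) a"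
    proof (cases "a = ya (Suc i)")
      case True
      have yk: "ya (Suc i) \<le> k" using 2 True y_le[of "Suc (Suc i)"] by simp
      have "Na (int i + 3) (a - 1) \<le> Na (int i + 2) (a - 1)" using Na_decreasing[of "int i + 2" "a - 1"] by (simp add: add.assoc)
      thus ?thesis using True row[OF yk] cnt_step[of t a "row_of t" "int i + 2"] cnt_step[of t a "row_of t" "int i + 3"]
          y_gt[of "Suc i"] by (auto split: if_splits)
    next
      case False
      hence "Na (int (Suc i) + 2) a \<noteq> Na (int (Suc i) + 1) a" using 2 y_le[of "Suc (Suc i)"]
        by (cases "Suc i" rule: y_Suc_cases) auto
      thus ?thesis using Na_decreasing[of "int i + 2" a] by (auto simp: algebra_simps)
    qed
    thus ?case by (simp add: algebra_simps) }
qed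

lemma y_eq: "ya (Suc i) \<le> k \<Longrightarrow> Na (int i + 2) (ya (Suc i)) = Na (int i + 1) (ya (Suc i))"
  by (cases i rule: y_Suc_cases) auto

lemma bumped_val: "bumped t k i a = (if \<exists>j\<in>{1..i}. a = ya j \<and> ya j \<le> k then row_of t a - 1 else row_of t a)"
proof (induction i)
  case (Suc i)
  show ?case
  proof (cases "ya (Suc i) \<le> k \<and> a = ya (Suc i)")
    case True
    thus ?thesis using y_row[of "Suc i"] by (auto simp: bumped.simps(2))
  next
    case False
    thus ?thesis using Suc by (auto simp: le_Suc_eq bumped.simps(2))
  qed
qed auto

lemma bumped_at: "ya (Suc i) \<le> k \<Longrightarrow> bumped t k i (ya (Suc i)) = int i + 2"
proof -
  assume yk: "ya (Suc i) \<le> k"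
  have "ya (Suc i) \<noteq> ya j" if "j \<in> {1..i}" for j using y_strict[OF yk, of j] that by auto
  thus ?thesis using bumped_val[of i "ya (Suc i)"] y_row[OF yk] by auto
qed

text \<open>Row \<open>p + 1\<close> gives away \<open>bump t k p\<close> and receives
  \<open>bump t k (Suc p)\<close>. For \<open>p = 0\<close> the lost entry is \<open>t + 1\<close>,
  which disappears because the count starts later.\<close>

lemma bumped_cnt:
  assumes "t + 1 \<le> a" "a \<le> k"
  shows "cnt (bumped t k i) (t + 1) a (int p + 1) = Na (int p + 1) a - (if p \<le> i \<and> ya p \<le> a then 1 else 0)
     + (if Suc p \<le> i \<and> ya (Suc p) \<le> a then 1 else 0)"
proof (induction i)
  case 0
  have "Na (int p + 1) a - Na (int p + 1) (t + 1) = cnt (row_of t) (t + 1) a (int p + 1)"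
    using cnt_diff[of t "t + 1" a "row_of t" "int p + 1"] assms unfolding cnt_def[of _ "t + 1"] by linarith
  moreover have "Na (int p + 1) (t + 1) = (if p = 0 then 1 else 0)"
    using cnt_step[of t "t + 1" "row_of t" "int p + 1"] row_of_first cnt_empty[of t t] by auto
  moreover have "ya p \<le> a" if "p = 0" using assms that by simp
  ultimately show ?case using assms by (cases "p = 0") auto
next
  case (Suc i)
  show ?case
  proof (cases "ya (Suc i) \<le> k")
    case False
    hence "\<not> ya (Suc i) \<le> a" using assms by simp
    hence "(p \<le> Suc i \<and> ya p \<le> a) = (p \<le> i \<and> ya p \<le> a)" "(Suc p \<le> Suc i \<and> ya (Suc p) \<le> a) = (Suc p \<le> i \<and> ya (Suc p) \<le> a)"
      by (metis le_Suc_eq)+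
    moreover have "bumped t k (Suc i) = bumped t k i" using False by (simp add: bumped.simps(2))
    ultimately show ?thesis using Suc by presburger
  next
    case True
    have ty: "t + 1 < ya (Suc i)" using y_strict[OF True, of 0] by simp
    have E: "cnt (bumped t k (Suc i)) (t + 1) a (int p + 1) = cnt (bumped t k i) (t + 1) a (int p + 1)
      + (if ya (Suc i) \<le> a then (if int p + 1 = int i + 1 then 1 else if int p + 1 = int i + 1 + 1 then -1 else 0) else 0)"
      using cnt_upd[OF ty, of "bumped t k i" "int i + 1" a "int p + 1"] bumped_at[OF True] True by (simp add: algebra_simps bumped.simps(2))
    consider "p = i" | "p = Suc i" | "p < i" | "Suc i < p" by linarith
    thus ?thesis
    proof cases
      case 1 thus ?thesis using E Suc by simp
    next
      case 2 thus ?thesis using E Suc by simp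
    next
      case 3 thus ?thesis using E Suc by simp
    next
      case 4 thus ?thesis using E Suc by simp
    qed
  qed
qed

text \<open>In the window starting at \<open>t + 1\<close> the excess of row \<open>i + 2\<close>
  over row \<open>i + 1\<close> is at most 1, and it reaches 1 first at the next bumped entry, so
  every upward move is a crystal move.\<close>

lemma bumped_cover: "t + 1 \<le> q \<Longrightarrow> k' \<le> k \<Longrightarrow> cover (bumped t k i) {q<..k'} R = cover (row_of t) {q<..k'} R"
proof (induction i)
  case (Suc i)
  show ?case
  proof (cases "ya (Suc i) \<le> k")
    case False
    hence "bumped t k (Suc i) = bumped t k i" by (simp add: bumped.simps(2))
    thus ?thesis using Suc by simp
  next
    case yk: True
    have ty: "t + 1 < ya (Suc i)" using y_strict[OF yk, of 0] by simp
    define h where "h = (\<lambda>a. cnt (bumped t k i) (t + 1) a (int i + 1 + 1) - cnt (bumped t k i) (t + 1) a (int i + 1))"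
    have h: "h a = Na (int i + 2) a - Na (int i + 1) a + (if ya i \<le> a then 1 else 0)" if "t + 1 \<le> a" "a \<le> k" for a
      using bumped_cnt[OF that, of i "Suc i"] bumped_cnt[OF that, of i i] by (simp add: h_def algebra_simps)
    have hy: "h (ya (Suc i)) = 1" using h[of "ya (Suc i)"] ty yk y_eq[OF yk] y_mono_Suc[of i] by simp
    have "cover ((bumped t k i)(ya (Suc i) := int i + 1)) {q<..k'} R = cover (bumped t k i) {q<..k'} R"
    proof (rule crystal_move[where t = "t + 1" and k = k])
      show "t + 1 < ya (Suc i)" by (rule ty)
      show "bumped t k i (ya (Suc i)) = int i + 1 + 1" using bumped_at[OF yk] by simp
      fix a assume a: "t + 1 \<le> a" "a < ya (Suc i)"
      have "h a \<le> 0"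
      proof (cases "ya i \<le> a")
        case True thus ?thesis using y_gap[OF True a(2)] h[of a] a yk by simp
      next
        case False thus ?thesis using Na_decreasing[of "int i + 1" a] h[of a] a yk by (simp add: algebra_simps)
      qed
      hence "h a < h (ya (Suc i))" using hy by simp
      thus "cnt (bumped t k i) (t + 1) a (int i + 1 + 1) - cnt (bumped t k i) (t + 1) a (int i + 1)
        < cnt (bumped t k i) (t + 1) (ya (Suc i)) (int i + 1 + 1) - cnt (bumped t k i) (t + 1) (ya (Suc i)) (int i + 1)"
        by (simp only: h_def)
    next
      fix a assume a: "ya (Suc i) < a" "a \<le> k"
      have "h a \<le> 1" using h[of a] Na_decreasing[of "int i + 1" a] a ty by (auto simp: algebra_simps split: if_splits)
      hence "h a \<le> h (ya (Suc i))" using hy by simp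
      thus "cnt (bumped t k i) (t + 1) a (int i + 1 + 1) - cnt (bumped t k i) (t + 1) a (int i + 1)
        \<le> cnt (bumped t k i) (t + 1) (ya (Suc i)) (int i + 1 + 1) - cnt (bumped t k i) (t + 1) (ya (Suc i)) (int i + 1)"
        by (simp only: h_def)
    qed (use Suc.prems in auto)
    moreover have "bumped t k (Suc i) = (bumped t k i)(ya (Suc i) := int i + 1)" using yk by (simp add: bumped.simps(2))
    ultimately show ?thesis using Suc by presburger
  qed
qed simp

lemma Na_big: "int n < r \<Longrightarrow> Na r a = 0"
  using row_of_le_n[of t] by (fastforce simp: cnt_def)

text \<open>Where a row has lost an entry and not yet regained one, the strict gap of
  \<open>y_gap\<close> keeps it long enough. Below row \<open>n\<close> everything is empty, so
  \<open>n\<close> moves suffice.\<close>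

lemma bumped_lattice: "lattice (bumped t k n) (t + 1) k"
  unfolding lattice_def
proof (intro allI impI)
  fix a r assume a: "a \<le> k" and r: "(1::int) \<le> r"
  show "cnt (bumped t k n) (t + 1) a (r + 1) \<le> cnt (bumped t k n) (t + 1) a r"
  proof (cases "t + 1 \<le> a")
    case False
    hence "cnt (bumped t k n) (t + 1) a z = 0" for z by (intro cnt_empty) simp
    thus ?thesis by simp
  next
    case ta: True
    obtain p where p: "r = int p + 1" using r by (metis add.commute zle_iff_zadd)
    have e1: "cnt (bumped t k n) (t + 1) a (r + 1) = Na (r + 1) a - (if Suc p \<le> n \<and> ya (Suc p) \<le> a then 1 else 0)
     + (if Suc (Suc p) \<le> n \<and> ya (Suc (Suc p)) \<le> a then 1 else 0)"
      using bumped_cnt[OF ta a, of n "Suc p"] p by (simp add: algebra_simps)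
    have e2: "cnt (bumped t k n) (t + 1) a r = Na r a - (if p \<le> n \<and> ya p \<le> a then 1 else 0)
     + (if Suc p \<le> n \<and> ya (Suc p) \<le> a then 1 else 0)"
      using bumped_cnt[OF ta a, of n p] p by simp
    have le: "Na (r + 1) a \<le> Na r a" using Na_decreasing r by simp
    show ?thesis
    proof (cases "Suc p \<le> n")
      case False
      hence "cnt (bumped t k n) (t + 1) a (r + 1) = 0" using e1 Na_big[of "r + 1" a] p by simp
      thus ?thesis using cnt_nonneg[of "bumped t k n" "t + 1" a r] by simp
    next
      case pn: True
      show ?thesis
      proof (cases "ya (Suc p) \<le> a")
        case True thus ?thesis using e1 e2 le pn by simp
      next
        case False
        hence F2: "\<not> ya (Suc (Suc p)) \<le> a" using y_mono_Suc[of "Suc p"] by simp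
        show ?thesis
        proof (cases "ya p \<le> a")
          case True
          have "Na (r + 1) a < Na r a" using y_gap[OF True] False p by (simp add: algebra_simps)
          thus ?thesis using e1 e2 False F2 by simp
        next
          case F3: False thus ?thesis using e1 e2 False F2 le by simp
        qed
      qed
    qed
  qed
qed

text \<open>The moved word is a lattice word with the covering numbers of \<open>c\<close> from
  \<open>t + 1\<close> on, and by \<open>row_of_eqI\<close> there is only one such word.\<close>

lemma row_of_next: "t + 1 < a \<Longrightarrow> a \<le> k \<Longrightarrow> row_of (t + 1) a = bumped t k n a"
proof (rule row_of_eqI[OF bumped_lattice])
  fix a assume a: "t + 1 < a" "a \<le> k"
  have "1 \<le> row_of t a - 1" if j: "j \<in> {1..n}" "a = ya j" "ya j \<le> k" for j
    using y_row[OF j(3)] j by simp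
  thus "1 \<le> bumped t k n a" using bumped_val[of n a] row_of_ge1[of t a] a by auto
next
  fix k' R assume "k' \<le> k"
  thus "cover (bumped t k n) {t + 1<..k'} R = row_cover (t + 1) k' R"
    using bumped_cover[of "t + 1" k' n R] row_of_form(3)[of t "t + 1" k' R] by simp
qed

end

text \<open>A bumped entry goes up into a row which at that moment is equally long, so it keeps its
  column. Any other entry loses one column exactly when it comes after the bump that shortens its
  row and before the bump that refills it.\<close>

lemma row_col_next:
  assumes a: "t + 1 < a"
  shows "(row_of (t + 1) a = row_of t a \<and> (col_of (t + 1) a = col_of t a \<or> col_of (t + 1) a = col_of t a - 1)) \<or>
         (row_of (t + 1) a = row_of t a - 1 \<and> col_of (t + 1) a = col_of t a)"
proof -
  have ta: "t < a" using a by simp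
  have R: "row_of (t + 1) x = bumped t a n x" if "t + 1 < x" "x \<le> a" for x using row_of_next[OF ta that] .
  have cc1: "col_of (t + 1) a = cnt (bumped t a n) (t + 1) a (row_of (t + 1) a)"
    unfolding col_of_def using R by (intro cnt_cong) auto
  have F: "cnt (bumped t a n) (t + 1) a (int p + 1) = cnt (row_of t) t a (int p + 1) - (if p \<le> n \<and> bump t a p \<le> a then 1 else 0)
     + (if Suc p \<le> n \<and> bump t a (Suc p) \<le> a then 1 else 0)" for p
    using bumped_cnt[OF ta, of a n p] a by simp
  show ?thesis
  proof (cases "\<exists>j\<in>{1..n}. a = bump t a j")
    case True
    then obtain j where j: "1 \<le> j" "j \<le> n" "a = bump t a j" by auto
    then obtain p where p: "j = Suc p" by (cases j) auto
    have ra: "row_of t a = int p + 2" using y_row[OF ta, of j] j p by simp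
    have r1: "row_of (t + 1) a = int p + 1" using R[of a] a bumped_val[OF ta, of n a] j ra by auto
    have yp: "bump t a p \<le> a" using y_mono[OF ta, of p j] j p by simp
    have "col_of (t + 1) a = cnt (row_of t) t a (int p + 1)" using cc1 r1 F[of p] yp j p by simp
    also have "\<dots> = col_of t a" using y_eq[OF ta, of p] j p ra by (simp add: col_of_def)
    finally show ?thesis using ra r1 by simp
  next
    case False
    hence r1: "row_of (t + 1) a = row_of t a" using R[of a] a bumped_val[OF ta, of n a] by auto
    obtain p where p: "row_of t a = int p + 1" using row_of_ge1[OF ta] by (metis add.commute zle_iff_zadd)
    have "p < n" using row_of_le_n[OF ta] p by simp
    moreover have "col_of (t + 1) a = cnt (row_of t) t a (int p + 1) - (if p \<le> n \<and> bump t a p \<le> a then 1 else 0)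
     + (if Suc p \<le> n \<and> bump t a (Suc p) \<le> a then 1 else 0)" using cc1 r1 F[of p] p by simp
    ultimately have "col_of (t + 1) a = col_of t a - (if bump t a p \<le> a then 1 else 0) + (if bump t a (Suc p) \<le> a then 1 else 0)"
      using p by (simp add: col_of_def)
    thus ?thesis using r1 y_mono_Suc[OF ta, of p] by (auto split: if_splits)
  qed
qed

end

section \<open>Slides seen through positions\<close>

abbreviation le2 :: "int \<times> int \<Rightarrow> int \<times> int \<Rightarrow> bool" where
  "le2 x y \<equiv> fst x \<le> fst y \<and> snd x \<le> snd y"

definition nw_step :: "int \<times> int \<Rightarrow> int \<times> int \<Rightarrow> bool" where
  "nw_step x y \<longleftrightarrow> x = y \<or> x = (fst y - 1, snd y) \<or> x = (fst y, snd y - 1)"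

lemma nw_step_le: "nw_step x y \<Longrightarrow> le2 x y"
  by (auto simp: nw_step_def)

lemma nw_step_level: "nw_step x y \<Longrightarrow> x \<noteq> y \<Longrightarrow> fst x + snd x = fst y + snd y - 1"
  by (auto simp: nw_step_def)

text \<open>Every moved entry takes the place of another moved entry or of the initial hole, so the vacated
  boxes form a single lattice path.\<close>

lemma moved_chain:
  fixes p p' :: "int \<Rightarrow> int \<times> int"
  assumes inj': "inj_on p' A"
    and mv: "\<And>a. a \<in> A \<Longrightarrow> nw_step (p' a) (p a)"
    and pos: "\<And>a. a \<in> A \<Longrightarrow> 1 \<le> fst (p' a) \<and> 1 \<le> snd (p' a)"
    and fill: "\<And>a. a \<in> A \<Longrightarrow> p' a \<noteq> p a \<Longrightarrow> p' a = x \<or> (\<exists>b\<in>A. p b = p' a)"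
    and ab: "a \<in> A" "b \<in> A" "p' a \<noteq> p a" "p' b \<noteq> p b"
  shows "le2 (p a) (p b) \<or> le2 (p b) (p a)"
proof -
  define l where "l = (\<lambda>a. fst (p a) + snd (p a))"
  define M where "M = {a\<in>A. p' a \<noteq> p a}"
  have lev: "fst (p' a) + snd (p' a) = l a - 1" if "a \<in> M" for a
    using nw_step_level[OF mv, of a] that by (auto simp: M_def l_def)
  have prev: "p' a = x \<or> (\<exists>b\<in>M. p b = p' a \<and> l b = l a - 1)" if a: "a \<in> M" for a
  proof (cases "p' a = x")
    case False
    then obtain b where b: "b \<in> A" "p b = p' a" using fill[of a] a by (auto simp: M_def)
    have "p' b \<noteq> p b"
    proof
      assume "p' b = p b"
      hence "b = a" using inj' b a by (auto simp: M_def inj_on_def)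
      thus False using b a by (auto simp: M_def)
    qed
    moreover have "l b = l a - 1" using lev[OF a] b by (simp add: l_def)
    ultimately show ?thesis using b by (auto simp: M_def)
  qed simp
  have l2: "2 \<le> l a" if "a \<in> M" for a
    using pos[of a] nw_step_le[OF mv, of a] that by (auto simp: M_def l_def)
  have below: "le2 x (p a) \<and> fst x + snd x < l a" if "a \<in> M" for a
    using that
  proof (induction "nat (l a)" arbitrary: a rule: less_induct)
    case less
    from prev[OF less.prems] show ?case
    proof
      assume "p' a = x"
      thus ?thesis using lev[OF less.prems] nw_step_le[OF mv, of a] less.prems by (auto simp: M_def)
    next
      assume "\<exists>b\<in>M. p b = p' a \<and> l b = l a - 1"
      then obtain b where b: "b \<in> M" "p b = p' a" "l b = l a - 1" by blast
      have "le2 x (p b) \<and> fst x + snd x < l b" using less.hyps[of b] b l2[OF b(1)] by simp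
      thus ?thesis using b nw_step_le[OF mv, of a] less.prems by (auto simp: M_def)
    qed
  qed
  \<comment> \<open>Induction along antidiagonals: the targets of both entries lie on the previous
    antidiagonal, where at most one box has been vacated, or both are the initial hole. Equal
    targets contradict injectivity of \<open>p'\<close>.\<close>
  have uniq: "a = b" if "a \<in> M" "b \<in> M" "l a = l b" for a b
    using that
  proof (induction "nat (l a)" arbitrary: a b rule: less_induct)
    case less
    have "p' a = p' b"
    proof (cases "p' a = x \<or> p' b = x")
      case True
      have "p' a = x \<longleftrightarrow> p' b = x"
        using prev[OF less.prems(1)] prev[OF less.prems(2)] lev[OF less.prems(1)] lev[OF less.prems(2)] less.prems(3) below
        by (metis less_irrefl)
      thus ?thesis using True by simp
    next
      case False
      then obtain u v where uv: "u \<in> M" "p u = p' a" "l u = l a - 1" "v \<in> M" "p v = p' b" "l v = l b - 1"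
        using prev[OF less.prems(1)] prev[OF less.prems(2)] by blast
      have "u = v" using less.hyps[of u v] uv less.prems(3) l2[OF uv(1)] by simp
      thus ?thesis using uv by simp
    qed
    thus ?case using inj' less.prems by (auto simp: M_def inj_on_def)
  qed
  have "le2 (p a) (p b)" if "a \<in> M" "b \<in> M" "l a \<le> l b" for a b
    using that
  proof (induction "nat (l b)" arbitrary: b rule: less_induct)
    case less
    show ?case
    proof (cases "l a = l b")
      case True thus ?thesis using uniq less.prems by blast
    next
      case False
      have "p' b \<noteq> x" using lev[OF less.prems(2)] below[OF less.prems(1)] less.prems(3) False by auto
      then obtain d where d: "d \<in> M" "p d = p' b" "l d = l b - 1" using prev[OF less.prems(2)] by blast
      have "le2 (p a) (p d)" using less.hyps[of d] d less.prems False l2[OF d(1)] by simp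
      thus ?thesis using d nw_step_le[OF mv, of b] less.prems by (auto simp: M_def)
    qed
  qed
  moreover have "a \<in> M" "b \<in> M" using ab by (auto simp: M_def)
  ultimately show ?thesis by (metis linear)
qed

text \<open>The intermediate words follow \<open>f'\<close> on an initial segment and
  \<open>f\<close> after it. The relation is a parameter because covering numbers of rows go down
  under a step while those of bent columns go up.\<close>

lemma cover_interpolate:
  assumes Q: "transp Q" "reflp Q" and step: "\<And>y. q < y \<Longrightarrow> y \<le> k \<Longrightarrow> f' y \<noteq> f y \<Longrightarrow>
     Q (cover (\<lambda>a. if a \<le> y then f' a else f a) {q<..k} R) (cover (\<lambda>a. if a < y then f' a else f a) {q<..k} R)"
  shows "Q (cover f' {q<..k} R) (cover f {q<..k} R)"
proof -
  define h where "h = (\<lambda>\<theta> a. if a \<le> \<theta> then f' a else f a)"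
  have "Q (cover (h (q + int i)) {q<..k} R) (cover f {q<..k} R)" if "q + int i \<le> k" for i
    using that
  proof (induction i)
    case 0
    have "cover (h q) {q<..k} R = cover f {q<..k} R" by (rule cover_cong) (auto simp: h_def)
    thus ?case using Q(2) by (simp add: reflp_def)
  next
    case (Suc i)
    define y where "y = q + int (Suc i)"
    have "h (q + int i) = (\<lambda>a. if a < y then f' a else f a)" by (auto simp: h_def y_def fun_eq_iff)
    moreover have "h y = (\<lambda>a. if a \<le> y then f' a else f a)" by (simp add: h_def)
    moreover have "h y = h (q + int i)" if "f' y = f y"
    proof
      fix a show "h y a = h (q + int i) a" using that by (cases "a = y") (auto simp: h_def y_def)
    qed
    moreover have "Q (cover (h y) {q<..k} R) (cover (h (q + int i)) {q<..k} R)"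
    proof (cases "f' y = f y")
      case True thus ?thesis using calculation Q(2) by (simp add: reflp_def)
    next
      case False thus ?thesis using calculation step[of y] Suc.prems by (simp add: y_def)
    qed
    moreover have "Q (cover (h (q + int i)) {q<..k} R) (cover f {q<..k} R)" using Suc by simp
    ultimately show ?case using Q(1) unfolding y_def transp_def by blast
  qed
  from this[of "nat (k - q)"] show ?thesis
  proof (cases "q \<le> k")
    case True
    have "cover (h k) {q<..k} R = cover f' {q<..k} R" by (rule cover_cong) (auto simp: h_def)
    thus ?thesis using \<open>q + int (nat (k - q)) \<le> k \<Longrightarrow> _\<close> True by simp
  next
    case False
    hence "cover f' {q<..k} R = cover f {q<..k} R" by (intro cover_cong) auto
    thus ?thesis using Q(2) by (simp add: reflp_def)
  qed
qed

text \<open>Applying the moves in increasing order of the entries changes one letter at a time.\<close>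

lemma step_cover:
  fixes p p' :: "int \<Rightarrow> int \<times> int" and d :: "int \<Rightarrow> int"
  assumes inj': "inj_on p' A"
    and mv: "\<And>a. a \<in> A \<Longrightarrow> nw_step (p' a) (p a)"
    and hop_letter: "\<And>a b. a \<in> A \<Longrightarrow> b \<in> A \<Longrightarrow> p' a \<noteq> p a \<Longrightarrow> p' b \<noteq> p b \<Longrightarrow> le2 (p a) (p b) \<or> le2 (p b) (p a)"
    and mono: "\<And>a b. a \<in> A \<Longrightarrow> b \<in> A \<Longrightarrow> le2 (p a) (p b) \<Longrightarrow> a \<le> b"
    and mono': "\<And>a b. a \<in> A \<Longrightarrow> b \<in> A \<Longrightarrow> le2 (p' a) (p' b) \<Longrightarrow> a \<le> b"
    and inL: "\<And>a. a \<in> A \<Longrightarrow> p a \<in> L \<Longrightarrow> p' a \<in> L"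
    and enter: "\<And>a. a \<in> A \<Longrightarrow> p a \<notin> L \<Longrightarrow> p' a \<in> L \<Longrightarrow> d a = fst (p' a)"
    and part: "\<And>a y r j j'. a \<in> A \<Longrightarrow> y \<in> A \<Longrightarrow> p y = (r + 1, j) \<Longrightarrow> p y \<in> L \<Longrightarrow> p' y = (r, j) \<Longrightarrow>
        p' a = (r, j') \<Longrightarrow> p' a \<in> L \<Longrightarrow> j' < j \<Longrightarrow> (r + 1, j') \<in> L \<and> (\<exists>m\<in>A. p' m = (r + 1, j'))"
    and dflt: "\<And>a y r j. y \<in> A \<Longrightarrow> p y = (r + 1, j) \<Longrightarrow> p y \<in> L \<Longrightarrow> p' y = (r, j) \<Longrightarrow>
        q < a \<Longrightarrow> a \<notin> A \<or> p' a \<notin> L \<Longrightarrow> d a = r \<Longrightarrow> y \<le> a"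
  shows "cover (\<lambda>a. if a \<in> A \<and> p' a \<in> L then fst (p' a) else d a) {q<..k} R
       \<le> cover (\<lambda>a. if a \<in> A \<and> p a \<in> L then fst (p a) else d a) {q<..k} R"
proof (rule cover_interpolate[where Q = "(\<le>)"])
  show "transp ((\<le>) :: nat \<Rightarrow> nat \<Rightarrow> bool)" "reflp ((\<le>) :: nat \<Rightarrow> nat \<Rightarrow> bool)" by (auto simp: transp_def reflp_def)
  define f where "f = (\<lambda>a. if a \<in> A \<and> p a \<in> L then fst (p a) else d a)"
  define f' where "f' = (\<lambda>a. if a \<in> A \<and> p' a \<in> L then fst (p' a) else d a)"
  fix y assume y: "q < y" "y \<le> k"
    and ne: "(if y \<in> A \<and> p' y \<in> L then fst (p' y) else d y) \<noteq> (if y \<in> A \<and> p y \<in> L then fst (p y) else d y)"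
  have yA: "y \<in> A" "p y \<in> L" using ne enter[of y] inL[of y] by (auto split: if_splits)
  have yL': "p' y \<in> L" using inL yA by blast
  have "fst (p' y) \<noteq> fst (p y)" using ne yA yL' by simp
  then obtain r j where r: "p y = (r + 1, j)" "p' y = (r, j)"
    using mv[OF yA(1)] that[of "fst (p y) - 1" "snd (p y)"] by (auto simp: nw_step_def)
  define h where "h = (\<lambda>a. if a < y then f' a else f a)"
  have fy: "h y = r + 1" using yA r by (simp add: h_def f_def)
  have hr: "h(y := r) = (\<lambda>a. if a \<le> y then f' a else f a)" using yA yL' r by (auto simp: h_def f_def f'_def fun_eq_iff)
  \<comment> \<open>The partner of \<open>a\<close> is the entry directly below it after the step;
    \<open>cover_lower\<close> needs this entry to lie between \<open>a\<close> and
    \<open>y\<close>.\<close>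
  define m where "m = (\<lambda>a. SOME m. m \<in> A \<and> p' m = (r + 1, snd (p' a)))"
  have low: "a \<in> A \<and> p' a \<in> L \<and> p' a = (r, snd (p' a)) \<and> (r + 1, snd (p' a)) \<in> L \<and> m a \<in> A \<and> p' (m a) = (r + 1, snd (p' a)) \<and> snd (p' a) < j"
    if a: "a < y" "h a = r" "q < a" for a
  proof -
    have fa: "f' a = r" using a by (simp add: h_def)
    \<comment> \<open>By \<open>dflt\<close> an entry that merely carries the default letter
      \<open>r\<close> does not come before \<open>y\<close>.\<close>
    have aA: "a \<in> A \<and> p' a \<in> L"
    proof (rule ccontr)
      assume no: "\<not> (a \<in> A \<and> p' a \<in> L)"
      hence "d a = r" using fa by (auto simp: f'_def)
      thus False using dflt[of y r j a] yA r no a by auto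
    qed
    hence pa: "p' a = (r, snd (p' a))" using fa by (simp add: f'_def prod_eq_iff)
    have lt: "snd (p' a) < j"
    proof (rule ccontr)
      assume "\<not> snd (p' a) < j"
      hence "y \<le> a" using mono'[of y a] yA aA r pa by (metis fst_conv snd_conv linorder_not_less order_refl)
      thus False using a by simp
    qed
    have ex: "(r + 1, snd (p' a)) \<in> L \<and> (\<exists>m\<in>A. p' m = (r + 1, snd (p' a)))"
      using part[OF _ yA(1) r(1) yA(2) r(2) pa _ lt] aA by blast
    hence "\<exists>m. m \<in> A \<and> p' m = (r + 1, snd (p' a))" by blast
    hence "m a \<in> A \<and> p' (m a) = (r + 1, snd (p' a))" unfolding m_def by (rule someI_ex)
    thus ?thesis using aA pa lt ex by blast
  qed
  have "cover (h(y := r)) {q<..k} R \<le> cover h {q<..k} R"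
  proof (rule cover_lower)
    show "finite {q<..k}" "y \<in> {q<..k}" "h y = r + 1" using y fy by auto
    fix a assume a: "a \<in> {q<..k}" "a < y" "h a = r"
    note l = low[OF a(2,3)]
    have qa: "q < a" using a by simp
    note l = l[OF qa]
    have m1: "a < m a"
    proof -
      have "le2 (p' a) (p' (m a))" using l by (metis fst_conv snd_conv order_refl zle_add1_eq_le less_add_one less_imp_le)
      hence "a \<le> m a" using mono'[of a "m a"] l by blast
      moreover have "a \<noteq> m a" using l by (metis fst_conv less_add_one less_irrefl)
      ultimately show ?thesis by simp
    qed
    have m2: "m a < y"
    proof -
      have "p' (m a) \<noteq> p' y" using l r by auto
      hence "m a \<noteq> y" by auto
      \<comment> \<open>Had the partner come up from row \<open>r + 2\<close>, it would be a moved
        entry, like \<open>y\<close>, and its old box would have to be comparable with that of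
        \<open>y\<close>, which it is not. In the other two cases its old box is weakly north-west
        of that of \<open>y\<close>.\<close>
      moreover have "le2 (p (m a)) (p y)"
      proof (cases "p (m a) = (r + 2, snd (p' a))")
        case True
        hence "p' (m a) \<noteq> p (m a)" using l by auto
        moreover have "p' y \<noteq> p y" using r by auto
        ultimately have "le2 (p (m a)) (p y) \<or> le2 (p y) (p (m a))" using hop_letter l yA by blast
        thus ?thesis using True r l by auto
      next
        case False
        have "p (m a) = (r + 1, snd (p' a)) \<or> p (m a) = (r + 1, snd (p' a) + 1)"
          using mv[of "m a"] l False unfolding nw_step_def by (cases "p (m a)") auto
        thus ?thesis using l r by auto
      qed
      hence "m a \<le> y" using mono[of "m a" y] l yA by blast
      ultimately show ?thesis by simp
    qed
    have "h (m a) = r + 1" using m2 l by (simp add: h_def f'_def)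
    thus "m a \<in> {q<..k} \<and> a < m a \<and> m a < y \<and> h (m a) = r + 1" using m1 m2 a y by auto
  next
    show "inj_on m {a \<in> {q<..k}. a < y \<and> h a = r}"
    proof (rule inj_onI)
      fix a b assume a: "a \<in> {a \<in> {q<..k}. a < y \<and> h a = r}" and b: "b \<in> {a \<in> {q<..k}. a < y \<and> h a = r}" and e: "m a = m b"
      have "snd (p' a) = snd (p' b)" using low[of a] low[of b] a b e by auto
      hence "p' a = p' b" using low[of a] low[of b] a b by auto
      thus "a = b" using low[of a] low[of b] a b inj' by (auto simp: inj_on_def)
    qed
  qed
  thus "cover (\<lambda>a. if a \<le> y then if a \<in> A \<and> p' a \<in> L then fst (p' a) else d a else if a \<in> A \<and> p a \<in> L then fst (p a) else d a) {q<..k} R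
    \<le> cover (\<lambda>a. if a < y then if a \<in> A \<and> p' a \<in> L then fst (p' a) else d a else if a \<in> A \<and> p a \<in> L then fst (p a) else d a) {q<..k} R"
    unfolding hr unfolding h_def f_def f'_def .
qed

text \<open>\<open>P\<close> gives the position of an entry and \<open>V\<close> the entry of a box, at each time; \<open>live\<close> tells which
  entries are present.\<close>

locale flow =
  fixes n :: nat and D :: "(int \<times> int) set" and live :: "int \<Rightarrow> int \<Rightarrow> bool"
    and P :: "int \<Rightarrow> int \<Rightarrow> int \<times> int" and V :: "int \<Rightarrow> int \<times> int \<Rightarrow> int"
  assumes n_ge1: "1 \<le> n"
    and live_gt: "live t k \<Longrightarrow> t < k"
    and live_down: "live t k \<Longrightarrow> t < k' \<Longrightarrow> k' \<le> k \<Longrightarrow> live t k'"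
    and live_next: "live t k \<Longrightarrow> t + 1 < k \<Longrightarrow> live (t + 1) k"
    and P_D: "live t k \<Longrightarrow> P t k \<in> D" and V_P: "live t k \<Longrightarrow> V t (P t k) = k"
    and V_live: "x \<in> D \<Longrightarrow> live t (V t x)" and P_V: "x \<in> D \<Longrightarrow> P t (V t x) = x"
    and D_pos: "x \<in> D \<Longrightarrow> 1 \<le> fst x \<and> 1 \<le> snd x"
    and D_first: "(1, 1) \<in> D"
    and V_mono: "x \<in> D \<Longrightarrow> y \<in> D \<Longrightarrow> le2 x y \<Longrightarrow> V t x \<le> V t y"
    and V_shift: "x \<in> D \<Longrightarrow> V (t + int n) x = V t x + int n"
    and move: "live t k \<Longrightarrow> t + 1 < k \<Longrightarrow> nw_step (P (t + 1) k) (P t k)"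
begin

section \<open>Residues and moves in a periodic family of fillings\<close>

lemma V_gt: "x \<in> D \<Longrightarrow> t < V t x"
  using V_live live_gt by blast

lemma P_mono: "live t k \<Longrightarrow> live t k' \<Longrightarrow> le2 (P t k) (P t k') \<Longrightarrow> k \<le> k'"
  using V_mono[of "P t k" "P t k'" t] V_P P_D by metis

lemma P_inj: "live t k \<Longrightarrow> live t k' \<Longrightarrow> P t k = P t k' \<Longrightarrow> k = k'"
  using V_P by metis

lemma V_inj: "x \<in> D \<Longrightarrow> y \<in> D \<Longrightarrow> V t x = V t y \<Longrightarrow> x = y"
  using P_V by metis

lemma shift_live: "live t k \<Longrightarrow> live (t + int n) (k + int n) \<and> P (t + int n) (k + int n) = P t k"
  using V_shift[of "P t k" t] V_P P_D V_live[of "P t k" "t + int n"] P_V[of "P t k" "t + int n"] by metis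

lemma P_later: "live t k \<Longrightarrow> t + int i < k \<Longrightarrow> live (t + int i) k \<and> le2 (P (t + int i) k) (P t k)"
proof (induction i)
  case (Suc i)
  hence h: "live (t + int i) k" "le2 (P (t + int i) k) (P t k)" by auto
  have e: "t + int (Suc i) = t + int i + 1" by simp
  show ?case unfolding e using live_next[OF h(1)] nw_step_le[OF move[OF h(1)]] h(2) Suc.prems by auto
qed simp

text \<open>By periodicity \<open>k\<close> occupies at time \<open>t\<close> the box that
  \<open>k + n\<close> will occupy at time \<open>t + n\<close>, and until then \<open>k + n\<close>
  only moves north-west.\<close>

lemma P_period:
  assumes "live t (k + int n)" "t < k"
  shows "le2 (P t k) (P t (k + int n))"
proof -
  have k: "live t k" using live_down[OF assms] by simp
  show ?thesis using shift_live[OF k] P_later[OF assms(1), of n] assms(2) by simp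
qed

lemma P_class:
  assumes "live t k'" "t < k" "k \<le> k'" "int n dvd k' - k"
  shows "le2 (P t k) (P t k')"
proof -
  obtain e where e: "k' = k + int n * e" using assms(4) by (metis dvdE diff_add_cancel add.commute)
  have e0: "0 \<le> e" using e assms(3) n_ge1 by (simp add: zero_le_mult_iff)
  have "live t (k + int n * int i) \<Longrightarrow> le2 (P t k) (P t (k + int n * int i))" for i
  proof (induction i)
    case (Suc i)
    have eq: "k + int n * int (Suc i) = (k + int n * int i) + int n" by (simp add: algebra_simps)
    have ge: "0 \<le> int n * int i" by simp
    have "live t (k + int n * int i)"
      by (rule live_down[OF Suc.prems]) (use assms(2) eq ge in \<open>linarith, simp add: eq\<close>)
    moreover have "le2 (P t (k + int n * int i)) (P t (k + int n * int i + int n))"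
    proof (rule P_period)
      show "live t (k + int n * int i + int n)" using Suc.prems unfolding eq .
      show "t < k + int n * int i" using assms(2) ge by linarith
    qed
    ultimately show ?case using Suc.IH unfolding eq by auto
  qed simp
  from this[of "nat e"] show ?thesis using e e0 assms by simp
qed

text \<open>The entries of one residue class occupy a chain of boxes, so incomparable boxes carry
  different residues.\<close>

lemma antichain_class:
  assumes "x \<in> D" "y \<in> D" "\<not> le2 x y" "\<not> le2 y x"
  shows "\<not> int n dvd V t x - V t y"
proof
  assume d: "int n dvd V t x - V t y"
  show False
  proof (cases "V t x \<le> V t y")
    case True
    have "int n dvd V t y - V t x" using d by (metis dvd_minus_iff minus_diff_eq)
    thus False using P_class[of t "V t y" "V t x"] True V_live[OF assms(2)] V_gt[OF assms(1)] P_V assms by auto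
  next
    case False
    thus False using P_class[of t "V t x" "V t y"] d V_live[OF assms(1)] V_gt[OF assms(2)] P_V assms by auto
  qed
qed

lemma V_first: "V t (1, 1) = t + 1"
proof -
  have l: "live t (t + 1)" using live_down[OF V_live[OF D_first, of t], of "t + 1"] V_gt[OF D_first, of t] by simp
  have "V t (1, 1) \<le> t + 1" using V_mono[OF D_first P_D[OF l], of t] D_pos[OF P_D[OF l]] V_P[OF l] by simp
  thus ?thesis using V_gt[OF D_first, of t] by simp
qed

lemma moved_comparable:
  assumes "live t a" "t + 1 < a" "live t b" "t + 1 < b" "P (t + 1) a \<noteq> P t a" "P (t + 1) b \<noteq> P t b"
  shows "le2 (P t a) (P t b) \<or> le2 (P t b) (P t a)"
proof (rule moved_chain[where A = "{a. live t a \<and> t + 1 < a}" and x = "(1, 1)" and p' = "P (t + 1)"])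
  show "inj_on (P (t + 1)) {a. live t a \<and> t + 1 < a}" by (rule inj_onI) (use P_inj live_next in blast)
  fix a assume a: "a \<in> {a. live t a \<and> t + 1 < a}"
  show "nw_step (P (t + 1) a) (P t a)" using move a by simp
  have D: "P (t + 1) a \<in> D" using P_D live_next a by auto
  show "1 \<le> fst (P (t + 1) a) \<and> 1 \<le> snd (P (t + 1) a)" using D_pos[OF D] .
  show "P (t + 1) a = (1, 1) \<or> (\<exists>b\<in>{a. live t a \<and> t + 1 < a}. P t b = P (t + 1) a)"
  proof (cases "V t (P (t + 1) a) = t + 1")
    case True thus ?thesis using V_inj[OF D D_first, of t] V_first by simp
  next
    case False
    thus ?thesis using V_live[OF D, of t] P_V[OF D, of t] V_gt[OF D, of t] by (intro disjI2 bexI[of _ "V t (P (t + 1) a)"]) auto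
  qed
qed (use assms in auto)

lemma V_incr: "x \<in> D \<Longrightarrow> live t (V (t + 1) x) \<Longrightarrow> V t x \<le> V (t + 1) x"
proof -
  assume x: "x \<in> D" and l: "live t (V (t + 1) x)"
  have g: "t + 1 < V (t + 1) x" using V_gt[OF x] by simp
  have "le2 x (P t (V (t + 1) x))" using nw_step_le[OF move[OF l g]] P_V[OF x] by simp
  thus ?thesis using V_mono[OF x P_D[OF l], of t] V_P[OF l] by simp
qed

lemma V_from: "x \<in> D \<Longrightarrow> live t (V (t + 1) x) \<Longrightarrow> V (t + 1) x \<noteq> V t x \<Longrightarrow>
    P t (V (t + 1) x) = (fst x + 1, snd x) \<or> P t (V (t + 1) x) = (fst x, snd x + 1)"
proof -
  assume x: "x \<in> D" and l: "live t (V (t + 1) x)" and ne: "V (t + 1) x \<noteq> V t x"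
  have g: "t + 1 < V (t + 1) x" using V_gt[OF x] by simp
  have "nw_step x (P t (V (t + 1) x))" using move[OF l g] P_V[OF x] by simp
  moreover have "P t (V (t + 1) x) \<noteq> x" using V_P[OF l] ne by auto
  ultimately show ?thesis by (cases "P t (V (t + 1) x)") (auto simp: nw_step_def)
qed

text \<open>Over one period the entry of a box grows by \<open>n\<close>, so it changes somewhere on
  the way; the last change shows where the present entry came from.\<close>

lemma last_change:
  assumes x: "x \<in> D"
  shows "\<exists>s. t - int n \<le> s \<and> s < t \<and> V s x \<noteq> V t x \<and> V (s + 1) x = V t x"
proof -
  define X where "X = {s\<in>{t - int n..<t}. V s x \<noteq> V t x}"
  have "V (t - int n) x \<noteq> V t x" using V_shift[OF x, of "t - int n"] n_ge1 by simp
  hence ne: "t - int n \<in> X" using n_ge1 by (simp add: X_def)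
  have fX: "finite X" by (rule finite_subset[of _ "{t - int n..<t}"]) (auto simp: X_def)
  define s where "s = Max X"
  have s: "s \<in> X" using Max_in[OF fX] ne by (auto simp: s_def)
  have "V (s + 1) x = V t x"
  proof (rule ccontr)
    assume a: "V (s + 1) x \<noteq> V t x"
    hence "s + 1 \<noteq> t" by auto
    hence "s + 1 \<in> X" using a s by (auto simp: X_def)
    thus False using Max_ge[OF fX, of "s + 1"] by (simp add: s_def)
  qed
  thus ?thesis using s by (auto simp: X_def)
qed

text \<open>The boxes vacated in one step form a chain, so a box incomparable to one of them keeps
  its entry.\<close>

lemma not_vacated:
  assumes x: "x \<in> D" "x \<noteq> (1, 1)" and k: "live t k" "t + 1 < k" "P (t + 1) k \<noteq> P t k"
    and inc: "\<not> le2 x (P t k)" "\<not> le2 (P t k) x"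
  shows "V (t + 1) x = V t x"
proof -
  have l: "live t (V t x)" using V_live x by blast
  have "V t x \<noteq> t + 1" using V_inj[OF x(1) D_first, of t] V_first x(2) by auto
  hence g: "t + 1 < V t x" using V_gt[OF x(1), of t] by simp
  have "P (t + 1) (V t x) = x" using moved_comparable[OF l g k(1,2)] k(3) inc P_V[OF x(1), of t] by auto
  thus ?thesis using V_P[OF live_next[OF l g]] by simp
qed

end

context rods begin

section \<open>The universal tableau fills a strip of \<open>n\<close> infinite rows\<close>

text \<open>Along a decreasing chain the index of the period plus \<open>n - c a\<close> strictly
  increases, since a letter occurs only once per period; over \<open>K\<close> periods this quantity
  stays within \<open>K + n\<close> values.\<close>

lemma row_cover_bound: "row_cover t (t + int n * int K) R \<le> R * (K + n)"
  unfolding row_cover_def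
proof (rule cover_le)
  define V where "V = {t<..t + int n * int K}"
  fix g assume g: "dec_colouring c {t<..t + int n * int K} R g"
  have one: "card {a\<in>V. g a = j} \<le> K + n" if "j < R" for j
  proof -
    define \<phi> where "\<phi> = (\<lambda>a. (a - t - 1) div int n + (int n - c a))"
    have less: "\<phi> a < \<phi> b" if ab: "a \<in> V" "b \<in> V" "g a = j" "g b = j" "a < b" for a b
    proof -
      have le: "c b \<le> c a" using dec_colouringD[OF g, of a b] ab \<open>j < R\<close> by (simp add: V_def)
      have d: "(a - t - 1) div int n \<le> (b - t - 1) div int n" using ab(5) n_pos by (intro zdiv_mono1) auto
      have "\<not> (c b = c a \<and> (a - t - 1) div int n = (b - t - 1) div int n)"
      proof
        assume e: "c b = c a \<and> (a - t - 1) div int n = (b - t - 1) div int n"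
        then obtain z where z: "b - a = int n * z" using c_eq_iff[of b a] by (auto simp: dvd_def)
        have "int n * z > 0" using ab(5) z by simp
        hence z1: "1 \<le> z" using n_pos by (simp add: zero_less_mult_iff)
        have bz: "b - t - 1 = a - t - 1 + int n * z" using z by simp
        have "(b - t - 1) div int n = z + (a - t - 1) div int n" unfolding bz by (rule div_mult_self2) (use n_pos in simp)
        thus False using e z1 by simp
      qed
      thus ?thesis using le d by (auto simp: \<phi>_def)
    qed
    have "inj_on \<phi> {a\<in>V. g a = j}"
    proof (rule inj_onI)
      fix a b assume "a \<in> {a\<in>V. g a = j}" "b \<in> {a\<in>V. g a = j}" "\<phi> a = \<phi> b"
      thus "a = b" using less[of a b] less[of b a] by (cases a b rule: linorder_cases) auto
    qed
    moreover have "\<phi> ` {a\<in>V. g a = j} \<subseteq> {0..<int (K + n)}"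
    proof
      fix z assume "z \<in> \<phi> ` {a\<in>V. g a = j}"
      then obtain a where a: "a \<in> V" "z = \<phi> a" by auto
      have "0 \<le> (a - t - 1) div int n" using a n_pos by (auto simp: V_def pos_imp_zdiv_nonneg_iff)
      moreover have "(a - t - 1) div int n < int K"
      proof (rule ccontr)
        assume "\<not> ?thesis"
        hence "int n * int K \<le> int n * ((a - t - 1) div int n)" by (intro mult_left_mono) auto
        moreover have "int n * ((a - t - 1) div int n) \<le> a - t - 1"
          using mult_div_mod_eq[of "int n" "a - t - 1"] n_pos by (smt (verit) pos_mod_sign of_nat_0_less_iff zero_less_one less_le_trans)
        ultimately show False using a by (simp add: V_def)
      qed
      ultimately show "z \<in> {0..<int (K + n)}" using a c_range[of a] by (auto simp: \<phi>_def)
    qed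
    ultimately have "card {a\<in>V. g a = j} \<le> card {0..<int (K + n)}" by (intro card_inj_on_le) auto
    thus ?thesis by simp
  qed
  have "{a\<in>V. g a < R} = (\<Union>j\<in>{..<R}. {a\<in>V. g a = j})" by auto
  hence "card {a\<in>V. g a < R} \<le> (\<Sum>j\<in>{..<R}. card {a\<in>V. g a = j})" using card_UN_le[of "{..<R}"] by simp
  also have "\<dots> \<le> (\<Sum>j\<in>{..<R}. K + n)" using one by (intro sum_mono) auto
  finally show "card {a\<in>{t<..t + int n * int K}. g a < R} \<le> R * (K + n)" by (simp add: V_def)
qed simp

text \<open>Each period brings \<open>n\<close> entries, while the first \<open>n - 1\<close> rows
  can take only \<open>n - 1\<close> of them per period up to a constant. So row \<open>n\<close> is
  unbounded, and with it all rows above.\<close>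

lemma row_unbounded:
  assumes "1 \<le> i" "i \<le> int n"
  shows "\<exists>k. j \<le> cnt (row_of t) t k i"
proof -
  \<comment> \<open>The summand \<open>n * n\<close> absorbs the constant \<open>(n - 1) * n\<close>
    coming from \<open>row_cover_bound\<close>.\<close>
  define K where "K = nat j + n * n"
  define k where "k = t + int n * int K"
  have "card {a\<in>{t<..k}. row_of t a \<le> int n} = card {t<..k}"
    using row_of_le_n[of t] by (intro arg_cong[where f = card]) auto
  hence all: "card {a\<in>{t<..k}. row_of t a \<le> int n} = n * K" by (simp add: k_def flip: of_nat_mult)
  have sp: "{a\<in>{t<..k}. row_of t a \<le> int n} = {a\<in>{t<..k}. row_of t a \<le> int (n - 1)} \<union> {a\<in>{t<..k}. row_of t a = int n}"
    using n_pos by auto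
  have "card {a\<in>{t<..k}. row_of t a \<le> int n} \<le> card {a\<in>{t<..k}. row_of t a \<le> int (n - 1)} + card {a\<in>{t<..k}. row_of t a = int n}"
    unfolding sp by (rule card_Un_le)
  hence "n * K \<le> (n - 1) * (K + n) + card {a\<in>{t<..k}. row_of t a = int n}"
    using all row_of_rows[of t k "n - 1"] row_cover_bound[of t K "n - 1"] by (simp add: k_def)
  moreover have "n * K = (n - 1) * K + K" using n_pos by (cases n) auto
  moreover have "(n - 1) * (K + n) = (n - 1) * K + (n - 1) * n" by (rule distrib_left)
  ultimately have "K \<le> (n - 1) * n + card {a\<in>{t<..k}. row_of t a = int n}" by linarith
  moreover have "(n - 1) * n \<le> n * n" by simp
  ultimately have "nat j \<le> card {a\<in>{t<..k}. row_of t a = int n}" unfolding K_def by linarith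
  hence "j \<le> cnt (row_of t) t k (int n)" by (simp add: cnt_def)
  also have "\<dots> \<le> cnt (row_of t) t k i" using lattice_le[OF row_of_form(1)] assms by blast
  finally show ?thesis by blast
qed

definition pos :: "int \<Rightarrow> int \<Rightarrow> int \<times> int" where "pos t k = (row_of t k, col_of t k)"

definition val :: "int \<Rightarrow> int \<times> int \<Rightarrow> int" where "val t x = (THE k. t < k \<and> pos t k = x)"

definition strip :: "(int \<times> int) set" where "strip = {x. 1 \<le> fst x \<and> fst x \<le> int n \<and> 1 \<le> snd x}"

lemma col_of_mono: "t < a \<Longrightarrow> a < b \<Longrightarrow> row_of t a = row_of t b \<Longrightarrow> col_of t a < col_of t b"
  using cnt_step[of t b "row_of t" "row_of t b"] cnt_mono[of a "b - 1" "row_of t" t "row_of t b"] by (auto simp: col_of_def)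

lemma pos_inj: "t < a \<Longrightarrow> t < b \<Longrightarrow> pos t a = pos t b \<Longrightarrow> a = b"
  using col_of_mono[of t a b] col_of_mono[of t b a] by (cases a b rule: linorder_cases) (auto simp: pos_def)

lemma pos_strip: "t < k \<Longrightarrow> pos t k \<in> strip"
  using row_of_ge1 row_of_le_n col_of_ge1 by (auto simp: pos_def strip_def)

lemma val_pos: "t < k \<Longrightarrow> val t (pos t k) = k"
  unfolding val_def using pos_inj by (intro the_equality) auto

lemma pos_surj: "x \<in> strip \<Longrightarrow> \<exists>k. t < k \<and> pos t k = x"
proof -
  assume x: "x \<in> strip"
  obtain k where "snd x \<le> cnt (row_of t) t k (fst x)" using row_unbounded[of "fst x" "snd x" t] x by (auto simp: strip_def)
  then obtain a where "t < a" "row_of t a = fst x" "cnt (row_of t) t a (fst x) = snd x"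
    using cnt_ex[of "snd x" "row_of t" t k "fst x"] x by (auto simp: strip_def)
  thus ?thesis by (auto simp: pos_def col_of_def intro!: exI[of _ a])
qed

lemma val_gt: "x \<in> strip \<Longrightarrow> t < val t x" and pos_val: "x \<in> strip \<Longrightarrow> pos t (val t x) = x"
  using pos_surj[of x t] val_pos[of t] by auto

lemma row_of_val: "x \<in> strip \<Longrightarrow> row_of t (val t x) = fst x" and col_of_val: "x \<in> strip \<Longrightarrow> col_of t (val t x) = snd x"
  using pos_val[of x t] unfolding pos_def by (metis fst_conv, metis snd_conv)

lemma val_row: "x \<in> strip \<Longrightarrow> y \<in> strip \<Longrightarrow> fst x = fst y \<Longrightarrow> snd x < snd y \<Longrightarrow> val t x < val t y"
proof (rule ccontr)
  assume x: "x \<in> strip" and y: "y \<in> strip" and e: "fst x = fst y" "snd x < snd y" and "\<not> val t x < val t y"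
  hence "val t y < val t x \<or> val t y = val t x" by auto
  thus False using col_of_mono[of t "val t y" "val t x"] e row_of_val[OF x] row_of_val[OF y] col_of_val[OF x] col_of_val[OF y] val_gt[OF x, of t] val_gt[OF y, of t]
    by (metis less_irrefl less_asym)
qed

lemma val_col: "x \<in> strip \<Longrightarrow> y \<in> strip \<Longrightarrow> snd x = snd y \<Longrightarrow> fst x < fst y \<Longrightarrow> val t x < val t y"
proof (rule ccontr)
  assume x: "x \<in> strip" and y: "y \<in> strip" and e: "snd x = snd y" "fst x < fst y" and "\<not> val t x < val t y"
  hence "val t y < val t x \<or> val t y = val t x" by auto
  thus False using lattice_col_less[OF row_of_form(1), of t "val t y" "val t x" "val t x"] e
      row_of_val[OF x] row_of_val[OF y] col_of_val[OF x, of t, unfolded col_of_def] col_of_val[OF y, of t, unfolded col_of_def]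
      val_gt[OF x, of t] val_gt[OF y, of t] row_of_ge1[of t "val t x"]
    by (metis less_irrefl order_refl not_less_iff_gr_or_eq)
qed

lemma val_mono: "x \<in> strip \<Longrightarrow> y \<in> strip \<Longrightarrow> le2 x y \<Longrightarrow> val t x \<le> val t y"
proof -
  assume x: "x \<in> strip" and y: "y \<in> strip" and le: "le2 x y"
  have z: "(fst x, snd y) \<in> strip" using x y by (auto simp: strip_def)
  have "val t x \<le> val t (fst x, snd y)"
    using val_row[OF x z, of t] le by (cases "snd x = snd y") (metis order_refl prod.collapse, simp)
  also have "\<dots> \<le> val t y"
    using val_col[OF z y, of t] le by (cases "fst x = fst y") (simp, simp)
  finally show ?thesis .
qed

lemma val_shift: "x \<in> strip \<Longrightarrow> val (t + int n) x = val t x + int n"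
proof -
  assume x: "x \<in> strip"
  have "pos (t + int n) (val t x + int n) = x"
    using row_of_val[OF x, of t] col_of_val[OF x, of t] row_of_shift[of t "val t x"] col_of_shift[of t "val t x"] by (simp add: pos_def)
  thus ?thesis using val_pos[of "t + int n" "val t x + int n"] val_gt[OF x, of t] by simp
qed

lemma val_shift_mult:
  assumes "x \<in> strip"
  shows "val (s + int n * e) x = val s x + int n * e"
proof -
  have p: "val (s + int n * int i) x = val s x + int n * int i" for s i
  proof (induction i)
    case (Suc i)
    have "s + int n * int (Suc i) = (s + int n * int i) + int n" by (simp add: algebra_simps)
    thus ?case using Suc val_shift[OF assms, of "s + int n * int i"] by (simp add: algebra_simps)
  qed simp
  show ?thesis
  proof (cases "0 \<le> e")
    case True thus ?thesis using p[of s "nat e"] by simp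
  next
    case False thus ?thesis using p[of "s + int n * e" "nat (- e)"] by simp
  qed
qed

lemma pos_next: "t + 1 < k \<Longrightarrow> nw_step (pos (t + 1) k) (pos t k)"
  using row_col_next[of t k] by (auto simp: nw_step_def pos_def)

sublocale F: flow n strip "\<lambda>t k. t < k" pos val
proof
  show "1 \<le> n" by (rule n_pos)
qed (use pos_strip val_pos val_gt pos_val val_mono val_shift pos_next n_pos in \<open>auto simp: strip_def\<close>)

section \<open>Behaviour beyond the antidiagonal\<close>

text \<open>The values and the indices have the same sum, so no value can exceed its index.\<close>

lemma inj_ge_id:
  assumes inj: "inj_on h {1..int n}" and rng: "\<And>i. i \<in> {1..int n} \<Longrightarrow> i \<le> h i \<and> h i \<le> int n" and i: "i \<in> {1..int n}"
  shows "h i = i"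
proof -
  have sub: "h ` {1..int n} \<subseteq> {1..int n}" using rng by force
  have im: "h ` {1..int n} = {1..int n}" by (rule card_subset_eq) (use sub card_image[OF inj] in auto)
  have "(\<Sum>i\<in>{1..int n}. h i) = (\<Sum>i\<in>h ` {1..int n}. i)" using sum.reindex[OF inj, of "\<lambda>i. i"] by simp
  hence "(\<Sum>i\<in>{1..int n}. h i - i) = 0" using im by (simp add: sum_subtractf)
  hence "h i - i = 0" using sum_nonneg_eq_0_iff[of "{1..int n}" "\<lambda>i. h i - i"] rng i by auto
  thus ?thesis by simp
qed

text \<open>The boxes of an antidiagonal have distinct residues, and an entry never lies below the row of
  its residue; \<open>n\<close> boxes leave no choice.\<close>

lemma class_row:
  assumes x: "x \<in> strip" and lev: "int n + 1 \<le> fst x + snd x"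
  shows "c (val t x) = fst x"
proof -
  define d where "d = fst x + snd x"
  have D: "(i, d - i) \<in> strip" if "i \<in> {1..int n}" for i using that lev by (auto simp: strip_def d_def)
  have "c (val t (i, d - i)) = i" if "i \<in> {1..int n}" for i
  proof (rule inj_ge_id[OF _ _ that])
    show "inj_on (\<lambda>i. c (val t (i, d - i))) {1..int n}"
    proof (rule inj_onI)
      fix i i' assume i: "i \<in> {1..int n}" "i' \<in> {1..int n}" and e: "c (val t (i, d - i)) = c (val t (i', d - i'))"
      show "i = i'"
      proof (rule ccontr)
        assume "i \<noteq> i'"
        hence "\<not> int n dvd val t (i, d - i) - val t (i', d - i')"
          by (intro F.antichain_class[OF D[OF i(1)] D[OF i(2)]]) auto
        thus False using e c_eq_iff by blast
      qed
    qed
    fix i assume i: "i \<in> {1..int n}"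
    show "i \<le> c (val t (i, d - i)) \<and> c (val t (i, d - i)) \<le> int n"
      using row_of_le_c[OF val_gt[OF D[OF i], of t]] row_of_val[OF D[OF i], of t] c_range by auto
  qed
  from this[of "fst x"] show ?thesis using x by (auto simp: strip_def d_def)
qed

text \<open>Larger entries of one class lie further to the south-east, and from the antidiagonal on
  the class determines the row.\<close>

lemma class_tail:
  assumes x: "x \<in> strip" and lev: "int n + 1 \<le> fst x + snd x" and k: "val t x \<le> k" "c k = fst x"
  shows "fst (pos t k) = fst x \<and> snd x \<le> snd (pos t k)"
proof -
  have tk: "t < k" using val_gt[OF x, of t] k by simp
  have "int n dvd k - val t x" using c_eq_iff[of k "val t x"] class_row[OF x lev, of t] k by simp
  hence le: "le2 x (pos t k)" using F.P_class[OF tk val_gt[OF x] k(1)] pos_val[OF x, of t] by simp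
  hence "c k = fst (pos t k)" using class_row[OF pos_strip[OF tk], of t] val_pos[OF tk] lev by simp
  thus ?thesis using k le by simp
qed

text \<open>From the antidiagonal on, row \<open>i\<close> holds only members of its own class and
  all the later ones, so neighbours are consecutive members of the class.\<close>

lemma val_right:
  assumes x: "(i, j) \<in> strip" and lev: "int n + 1 \<le> i + j"
  shows "val t (i, j + 1) = val t (i, j) + int n"
proof -
  have x': "(i, j + 1) \<in> strip" using x by (auto simp: strip_def)
  have lt: "val t (i, j) < val t (i, j + 1)" using val_row[OF x x'] by simp
  have "c (val t (i, j)) = i" "c (val t (i, j + 1)) = i" using class_row[OF x] class_row[OF x'] lev by auto
  hence "int n dvd val t (i, j + 1) - val t (i, j)" using c_eq_iff by metis
  hence ge: "val t (i, j) + int n \<le> val t (i, j + 1)" using lt zdvd_imp_le[of "int n" "val t (i, j + 1) - val t (i, j)"] by simp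
  define k where "k = val t (i, j) + int n"
  have tk: "t < k" using val_gt[OF x, of t] by (simp add: k_def)
  have "c k = i" using per[of "val t (i, j)"] class_row[OF x, of t] lev by (simp add: k_def)
  hence ct: "fst (pos t k) = i \<and> j \<le> snd (pos t k)" using class_tail[OF x, of t k] lev by (simp add: k_def)
  moreover have "pos t k \<noteq> (i, j)" using val_pos[OF tk] n_pos by (auto simp: k_def)
  ultimately have "le2 (i, j + 1) (pos t k)" by (cases "pos t k") auto
  hence "val t (i, j + 1) \<le> k" using val_mono[OF x' pos_strip[OF tk], of t] val_pos[OF tk] by simp
  thus ?thesis using ge by (simp add: k_def)
qed

lemma val_right_mult:
  assumes x: "(i, j) \<in> strip" and lev: "int n + 1 \<le> i + j"
  shows "val t (i, j + int e) = val t (i, j) + int n * int e"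
proof (induction e)
  case (Suc e)
  have "(i, j + int e) \<in> strip" using x by (auto simp: strip_def)
  thus ?case using val_right[of i "j + int e" t] lev Suc by (simp add: algebra_simps)
qed simp

lemma val_time_mono: "x \<in> strip \<Longrightarrow> s \<le> t \<Longrightarrow> val s x \<le> val t x"
proof -
  assume x: "x \<in> strip" and observed: "s \<le> t"
  have "val s x \<le> val (s + int i) x" for i
  proof (induction i)
    case (Suc i)
    have "val (s + int i) x \<le> val (s + int i + 1) x" using val_gt[OF x, of "s + int i + 1"] by (intro F.V_incr[OF x]) simp
    thus ?case using Suc by (simp add: algebra_simps)
  qed simp
  from this[of "nat (t - s)"] show ?thesis using observed by simp
qed

text \<open>If that entry went up, box \<open>(i, j)\<close>, being incomparable to the vacated box,
  would keep its smaller entry, and row \<open>i\<close> would decrease.\<close>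

lemma no_rise:
  assumes x: "(i, j) \<in> strip" "(i + 1, j - 1) \<in> strip" and lt: "val t (i, j) < val t (i + 1, j - 1)"
  shows "pos (t + 1) (val t (i + 1, j - 1)) \<noteq> (i, j - 1)"
proof
  define y where "y = val t (i + 1, j - 1)"
  define z where "z = val t (i, j)"
  assume up: "pos (t + 1) (val t (i + 1, j - 1)) = (i, j - 1)"
  have x3: "(i, j - 1) \<in> strip" using x by (auto simp: strip_def)
  have tz: "t < z" "t < y" using val_gt x by (auto simp: z_def y_def)
  have "z \<noteq> t + 1"
    using F.V_first[of t] F.V_inj[OF x(1) F.D_first, of t] x(2) by (auto simp: z_def strip_def)
  hence z1: "t + 1 < z" using tz by simp
  have y1: "t + 1 < y" using z1 lt by (simp add: y_def z_def)
  have py: "pos t y = (i + 1, j - 1)" "pos t z = (i, j)" using pos_val x by (auto simp: y_def z_def)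
  have "pos (t + 1) z = (i, j)"
  proof (rule ccontr)
    assume "pos (t + 1) z \<noteq> (i, j)"
    hence "le2 (pos t z) (pos t y) \<or> le2 (pos t y) (pos t z)"
      using F.moved_comparable[of t z y] tz z1 y1 py up by (auto simp: y_def)
    thus False using py by auto
  qed
  hence "val (t + 1) (i, j) = z" using val_pos[OF z1] by simp
  moreover have "val (t + 1) (i, j - 1) = y" using val_pos[OF y1] up by (simp add: y_def)
  ultimately have "y < z" using val_row[OF x3 x(1), of "t + 1"] by simp
  thus False using lt by (simp add: y_def z_def)
qed

text \<open>Otherwise the entry on the right would be the smaller of the two at all times, row \<open>r + 1\<close> would never
  pass an entry on to row \<open>r\<close>, and the box \<open>(r + 1, 1)\<close> could not lose its entry.\<close>

lemma corner_gap:
  assumes r: "1 \<le> r" "r < int n"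
  shows "val t (r + 1, int n - r) < val t (r, int n + 1 - r) + int n"
proof (rule ccontr)
  assume no: "\<not> ?thesis"
  define u where "u = (\<lambda>t. val t (r, int n + 1 - r))"
  define v where "v = (\<lambda>t. val t (r + 1, int n - r))"
  have D1: "(r, int n + 1 - r) \<in> strip" and D2: "(r + 1, int n - r) \<in> strip" using r by (auto simp: strip_def)
  have "c (u t) = r" "c (v t) = r + 1" using class_row[OF D1, of t] class_row[OF D2, of t] by (auto simp: u_def v_def)
  hence "u t + int n \<noteq> v t" using per[of "u t"] by auto
  hence gap: "u t + int n < v t" using no by (simp add: u_def v_def)
  \<comment> \<open>Both entries only grow with time, and over one period the first grows by exactly
    \<open>n\<close>, which is less than the gap.\<close>
  have uv: "u s < v s" if s: "t \<le> s" "s \<le> t + int n" for s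
  proof -
    have "u s \<le> u (t + int n)" unfolding u_def by (rule val_time_mono[OF D1 s(2)])
    also have "\<dots> = u t + int n" unfolding u_def by (rule val_shift[OF D1])
    also have "\<dots> < v t" by (rule gap)
    also have "\<dots> \<le> v s" unfolding v_def by (rule val_time_mono[OF D2 s(1)])
    finally show ?thesis .
  qed
  have all: "u s < v s" for s
  proof -
    define e where "e = (s - t) div int n"
    have "s = (t + (s - t) mod int n) + int n * e" by (simp add: e_def)
    moreover have "u (t + (s - t) mod int n) < v (t + (s - t) mod int n)" using n_pos by (intro uv) (auto simp: less_imp_le)
    ultimately show ?thesis using val_shift_mult[OF D1] val_shift_mult[OF D2] unfolding u_def v_def by (metis add_less_cancel_right)
  qed
  \<comment> \<open>The comparison is pushed to the left one column at a time, until the lower box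
    is \<open>(r + 1, 1)\<close>. The class of the upper entry has to be carried along.\<close>
  have diagonal_bijection: "\<forall>s. c (val s (r, int n + 1 - r - int i)) = r \<and>
      val s (r, int n + 1 - r - int i) < val s (r + 1, int n - r - int i)" if "int i \<le> int n - r - 1" for i
    using that
  proof (induction i)
    case 0
    show ?case using all class_row[OF D1] by (simp add: u_def v_def)
  next
    case (Suc i)
    define j where "j = int n + 1 - r - int i"
    have j3: "3 \<le> j" using Suc.prems by (simp add: j_def)
    have IH: "c (val s (r, j)) = r" "val s (r, j) < val s (r + 1, j - 1)" for s
      using Suc by (auto simp: j_def algebra_simps)
    have B: "(r, j) \<in> strip" "(r + 1, j - 1) \<in> strip" "(r, j - 1) \<in> strip" "(r + 1, j - 2) \<in> strip" using j3 r by (auto simp: strip_def)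
    have "c (val s (r, j - 1)) = r \<and> val s (r, j - 1) < val s (r + 1, j - 2)" for s
    proof -
      \<comment> \<open>By \<open>no_rise\<close> the entry of \<open>(r, j - 1)\<close> did not
        come from below. So it came from the right, where by hypothesis the entries have class
        \<open>r\<close>.\<close>
      obtain q where q: "q < s" "val q (r, j - 1) \<noteq> val s (r, j - 1)" "val (q + 1) (r, j - 1) = val s (r, j - 1)"
        using F.last_change[OF B(3), of s] by blast
      define w where "w = val s (r, j - 1)"
      have sw: "s < w" using val_gt[OF B(3)] by (simp add: w_def)
      have "pos q w = (r + 1, j - 1) \<or> pos q w = (r, j)"
        using F.V_from[OF B(3), of q] q sw by (auto simp: w_def)
      moreover have "pos q w \<noteq> (r + 1, j - 1)"
      proof
        assume a: "pos q w = (r + 1, j - 1)"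
        hence "val q (r + 1, j - 1) = w" using val_pos[of q w] q sw by simp
        moreover have "pos (q + 1) w = (r, j - 1)" using pos_val[OF B(3), of "q + 1"] q by (simp add: w_def)
        ultimately show False using no_rise[OF B(1,2) IH(2), of q] by simp
      qed
      ultimately have "pos q w = (r, j)" by simp
      hence wq: "w = val q (r, j)" using val_pos[of q w] q sw by simp
      have perm_class: "c w = r" using wq IH(1) by simp
      have "w < val s (r, j)" using val_row[OF B(3) B(1), of s] by (simp add: w_def)
      moreover have "int n dvd val s (r, j) - w" using c_eq_iff[of "val s (r, j)" w] perm_class IH(1) by simp
      ultimately have w1: "w + int n \<le> val s (r, j)" using zdvd_imp_le[of "int n" "val s (r, j) - w"] by simp
      \<comment> \<open>One period earlier in its class, \<open>k - n\<close> lies north-west of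
        \<open>k\<close>. As it exceeds the entry \<open>w\<close> of \<open>(r, j - 1)\<close>, it
        must be in row \<open>r + 1\<close>, strictly to the left of \<open>k\<close>.\<close>
      define k where "k = val s (r + 1, j - 1)"
      have wk: "w < k - int n" using w1 IH(2)[of s] by (simp add: k_def)
      have sk: "s < k - int n" using wk sw by simp
      have le: "le2 (pos s (k - int n)) (r + 1, j - 1)"
        using F.P_period[of s "k - int n"] sk pos_val[OF B(2), of s] by (simp add: k_def)
      have "\<not> le2 (pos s (k - int n)) (r, j - 1)"
        using val_mono[OF pos_strip[OF sk] B(3), of s] val_pos[OF sk] wk by (auto simp: w_def)
      hence f: "fst (pos s (k - int n)) = r + 1" using le by auto
      have "pos s (k - int n) \<noteq> (r + 1, j - 1)" using val_pos[OF sk] n_pos by (auto simp: k_def)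
      hence "le2 (pos s (k - int n)) (r + 1, j - 2)" using le f by (cases "pos s (k - int n)") auto
      hence "k - int n \<le> val s (r + 1, j - 2)" using val_mono[OF pos_strip[OF sk] B(4), of s] val_pos[OF sk] by simp
      thus ?thesis using perm_class wk by (simp add: w_def)
    qed
    thus ?case by (simp add: j_def algebra_simps)
  qed
  have B: "(r, 2) \<in> strip" "(r + 1, 1) \<in> strip" using r by (auto simp: strip_def)
  have fin: "val s (r, 2) < val s (r + 1, 1)" for s
    using diagonal_bijection[of "nat (int n - r - 1)"] r by auto
  \<comment> \<open>At some time the box \<open>(r + 1, 1)\<close> loses its entry. Without a column
    to its left this entry has to go up, which \<open>no_rise\<close> forbids.\<close>
  obtain q where q: "val q (r + 1, 1) \<noteq> val (q + 1) (r + 1, 1)"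
    using F.last_change[OF B(2), of 0] by metis
  define y where "y = val q (r + 1, 1)"
  have "y \<noteq> q + 1" using F.V_first[of q] F.V_inj[OF B(2) F.D_first, of q] r by (auto simp: y_def)
  hence y1: "q + 1 < y" using val_gt[OF B(2), of q] by (simp add: y_def)
  have py: "pos q y = (r + 1, 1)" using pos_val[OF B(2)] by (simp add: y_def)
  have "pos (q + 1) y \<noteq> (r + 1, 1)" using val_pos[OF y1] q by (auto simp: y_def)
  moreover have "1 \<le> snd (pos (q + 1) y)" using pos_strip[OF y1] by (simp add: strip_def)
  ultimately have "pos (q + 1) y = (r, 1)" using pos_next[OF y1] py by (auto simp: nw_step_def)
  thus False using no_rise[of r 2 q] B fin[of q] by (simp add: y_def)
qed

section \<open>Bent columns\<close>

text \<open>Columns that turn right once they reach the antidiagonal \<open>i + j = n + 1\<close>. With respect to them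
  the tableau still has increasing rows, by \<open>corner_gap\<close>.\<close>

definition bent_col :: "int \<Rightarrow> int \<Rightarrow> int" where
  "bent_col t k = (if fst (pos t k) + snd (pos t k) \<le> int n + 1 then snd (pos t k) else int n + 1 - fst (pos t k))"

text \<open>The neighbour in the previous bent column, at the same distance along it. Bent column
  \<open>r\<close> turns one row lower than bent column \<open>r + 1\<close>, so on the horizontal
  parts the neighbour is one row down and two columns to the left.\<close>

definition bent_mate :: "int \<Rightarrow> int \<Rightarrow> int" where
  "bent_mate t d = (if fst (pos t d) + snd (pos t d) \<le> int n + 1 then val t (fst (pos t d), snd (pos t d) - 1)
     else val t (fst (pos t d) + 1, snd (pos t d) - 2))"

lemma bent_col_val: "x \<in> strip \<Longrightarrow> bent_col t (val t x) = (if fst x + snd x \<le> int n + 1 then snd x else int n + 1 - fst x)"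
  by (simp add: bent_col_def pos_val)

lemma bent_col_range: "t < k \<Longrightarrow> 1 \<le> bent_col t k \<and> bent_col t k \<le> int n"
  using pos_strip[of t k] by (auto simp: bent_col_def strip_def)

lemma bent_mate_cases:
  assumes d: "t < d" and b: "bent_col t d = r + 1" and r: "1 \<le> r"
  obtains i where "pos t d = (i, r + 1)" "i + r \<le> int n" "(i, r) \<in> strip" "bent_mate t d = val t (i, r)"
  | e where "pos t d = (int n - r, r + 2 + int e)" "(int n - r + 1, r + int e) \<in> strip" "bent_mate t d = val t (int n - r + 1, r + int e)"
proof (cases "fst (pos t d) + snd (pos t d) \<le> int n + 1")
  case True
  have "snd (pos t d) = r + 1" using True b by (simp add: bent_col_def)
  thus thesis using that(1)[of "fst (pos t d)"] True pos_strip[OF d] r by (auto simp: bent_mate_def strip_def prod_eq_iff)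
next
  case False
  have f: "fst (pos t d) = int n - r" using False b by (simp add: bent_col_def)
  define e where "e = nat (snd (pos t d) - r - 2)"
  have s: "snd (pos t d) = r + 2 + int e" using False f by (simp add: e_def)
  have "1 \<le> int n - r" using pos_strip[OF d] f by (simp add: strip_def)
  thus thesis using that(2)[of e] False f s r by (auto simp: bent_mate_def strip_def prod_eq_iff)
qed

text \<open>Before the turn this is monotonicity of rows. After it both rows advance by
  \<open>n\<close> from box to box, and the comparison reduces to \<open>corner_gap\<close>.\<close>

lemma bent_mate_props:
  assumes d: "t < d" and b: "bent_col t d = r + 1" and r: "1 \<le> r"
  shows "t < bent_mate t d" "bent_mate t d < d" "bent_col t (bent_mate t d) = r"
proof -
  have "t < bent_mate t d \<and> bent_mate t d < d \<and> bent_col t (bent_mate t d) = r"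
  proof (cases rule: bent_mate_cases[OF d b r])
    case (1 i)
    have D': "(i, r + 1) \<in> strip" using 1 pos_strip[OF d] by simp
    have "d = val t (i, r + 1)" using val_pos[OF d] 1 by simp
    thus ?thesis using 1 val_gt[OF 1(3), of t] val_row[OF 1(3) D', of t] bent_col_val[OF 1(3), of t] by simp
  next
    case (2 e)
    define i where "i = int n - r"
    have i: "1 \<le> i" "i < int n" using pos_strip[OF d] 2 r by (auto simp: strip_def i_def)
    have D1: "(i, int n + 1 - i) \<in> strip" and D2: "(i + 1, int n - i) \<in> strip" using i by (auto simp: strip_def)
    have "d = val t (i, int n + 1 - i + int (Suc e))" using val_pos[OF d] 2 by (simp add: i_def algebra_simps)
    also have "\<dots> = val t (i, int n + 1 - i) + int n * int (Suc e)" using val_right_mult[OF D1, of t "Suc e"] by simp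
    finally have dd: "d = val t (i, int n + 1 - i) + int n + int n * int e" by (simp add: algebra_simps)
    have "bent_mate t d = val t (i + 1, int n - i + int e)" using 2 by (simp add: i_def algebra_simps)
    also have "\<dots> = val t (i + 1, int n - i) + int n * int e" using val_right_mult[OF D2, of t e] by simp
    finally have "bent_mate t d < d" using dd corner_gap[OF i, of t] by simp
    thus ?thesis using 2 val_gt[OF 2(2), of t] bent_col_val[OF 2(2), of t] by auto
  qed
  thus "t < bent_mate t d" "bent_mate t d < d" "bent_col t (bent_mate t d) = r" by auto
qed

lemma bent_mate_inj:
  assumes r: "1 \<le> r" and d: "t < d" "bent_col t d = r + 1" and d': "t < d'" "bent_col t d' = r + 1" and e: "bent_mate t d = bent_mate t d'"
  shows "d = d'"
proof -
  have "pos t d = pos t d'"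
  proof (cases rule: bent_mate_cases[OF d r])
    case (1 i)
    note A = this
    show ?thesis
    proof (cases rule: bent_mate_cases[OF d' r])
      case (1 i')
      have "(i, r) = (i', r)" using A 1 e F.V_inj[of "(i, r)" "(i', r)" t] by auto
      thus ?thesis using A 1 by simp
    next
      case (2 e')
      have "(i, r) = (int n - r + 1, r + int e')" using A 2 e F.V_inj[of "(i, r)" "(int n - r + 1, r + int e')" t] by auto
      thus ?thesis using A by simp
    qed
  next
    case (2 e1)
    note A = this
    show ?thesis
    proof (cases rule: bent_mate_cases[OF d' r])
      case (1 i')
      have "(i', r) = (int n - r + 1, r + int e1)" using A 1 e F.V_inj[of "(i', r)" "(int n - r + 1, r + int e1)" t] by auto
      thus ?thesis using 1 by simp
    next
      case (2 e2)
      have "(int n - r + 1, r + int e1) = (int n - r + 1, r + int e2)"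
        using A 2 e F.V_inj[of "(int n - r + 1, r + int e1)" "(int n - r + 1, r + int e2)" t] by auto
      thus ?thesis using A 2 by simp
    qed
  qed
  thus ?thesis using pos_inj d d' by blast
qed

lemma bent_col_lattice: "lattice (bent_col t) t k"
  unfolding lattice_def
proof (intro allI impI)
  fix k' r :: int assume r: "1 \<le> r"
  have "card {a\<in>{t<..k'}. bent_col t a = r + 1} \<le> card {a\<in>{t<..k'}. bent_col t a = r}"
  proof (rule card_inj_on_le)
    show "inj_on (bent_mate t) {a\<in>{t<..k'}. bent_col t a = r + 1}" using bent_mate_inj[OF r] by (intro inj_onI) auto
    show "bent_mate t ` {a\<in>{t<..k'}. bent_col t a = r + 1} \<subseteq> {a\<in>{t<..k'}. bent_col t a = r}" using bent_mate_props[OF _ _ r] by fastforce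
  qed simp
  thus "cnt (bent_col t) t k' (r + 1) \<le> cnt (bent_col t) t k' r" by (simp add: cnt_def)
qed

lemma bent_col_cover: "cover (bent_col t) {t<..k} R = card {a\<in>{t<..k}. bent_col t a \<le> int R}"
  using lattice_cover[OF bent_col_lattice] bent_col_range by blast

text \<open>An upward move keeps the column before the turn and is impossible after it, where the
  class determines the row; a leftward move after the turn stays in the same bent column.\<close>

lemma bent_col_change:
  assumes y: "q + 1 < y" and ne: "bent_col (q + 1) y \<noteq> bent_col q y"
  shows "\<exists>i j. pos q y = (i, j + 1) \<and> pos (q + 1) y = (i, j) \<and> i + j \<le> int n \<and> bent_col q y = j + 1 \<and> bent_col (q + 1) y = j"
proof -
  have y': "q < y" using y by simp
  obtain i j where ij: "pos (q + 1) y = (i, j)" by (cases "pos (q + 1) y")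
  have "pos q y = (i, j) \<or> pos q y = (i + 1, j) \<or> pos q y = (i, j + 1)"
    using pos_next[OF y] ij by (cases "pos q y") (auto simp: nw_step_def)
  moreover have "pos q y \<noteq> (i, j)" using ne ij unfolding bent_col_def by metis
  moreover have "pos q y \<noteq> (i + 1, j)"
  proof
    assume a: "pos q y = (i + 1, j)"
    have "int n < i + j" using ne a ij by (auto simp: bent_col_def split: if_splits)
    hence "c y = i" "c y = i + 1" using class_row[OF pos_strip[OF y], of "q + 1"] class_row[OF pos_strip[OF y'], of q] val_pos[OF y] val_pos[OF y'] a ij by auto
    thus False by simp
  qed
  ultimately have p: "pos q y = (i, j + 1)" by blast
  have "i + j \<le> int n" using ne p ij by (auto simp: bent_col_def split: if_splits)
  thus ?thesis using p ij by (auto simp: bent_col_def)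
qed

text \<open>A relevant move lowers a bent column from \<open>j + 1\<close> to \<open>j\<close>, and
  \<open>cover_raise\<close> applies with \<open>bent_mate\<close> as the matching. The boxes of
  column \<open>j\<close> below the new box of \<open>y\<close> are untouched by the slide, so their
  entries exceed \<open>y\<close>, and with them all mates of larger entries.\<close>

lemma bent_col_step:
  assumes "q + 1 \<le> t"
  shows "cover (bent_col q) {t<..k} R \<le> cover (bent_col (q + 1)) {t<..k} R"
proof -
  have "(\<ge>) (cover (bent_col (q + 1)) {t<..k} R) (cover (bent_col q) {t<..k} R)"
  proof (rule cover_interpolate[where Q = "(\<ge>)"])
    show "transp ((\<ge>) :: nat \<Rightarrow> nat \<Rightarrow> bool)" "reflp ((\<ge>) :: nat \<Rightarrow> nat \<Rightarrow> bool)" by (auto simp: transp_def reflp_def)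
    fix y assume y: "t < y" "y \<le> k" and ne: "bent_col (q + 1) y \<noteq> bent_col q y"
    have qy: "q + 1 < y" "q < y" using y assms by auto
    obtain i j where p: "pos q y = (i, j + 1)" "pos (q + 1) y = (i, j)" "i + j \<le> int n" "bent_col q y = j + 1" "bent_col (q + 1) y = j"
      using bent_col_change[OF qy(1) ne] by blast
    have i1: "1 \<le> i" "1 \<le> j" using pos_strip[OF qy(1)] p by (auto simp: strip_def)
    define h where "h = (\<lambda>a. if a < y then bent_col (q + 1) a else bent_col q a)"
    have above: "y < val q (i', j)" if i': "i < i'" "(i', j) \<in> strip" for i'
    proof -
      have "val (q + 1) (i', j) = val q (i', j)"
        by (rule F.not_vacated[OF i'(2) _ _ qy(1)]) (use qy p i1 i' in auto)
      moreover have "val (q + 1) (i, j) < val (q + 1) (i', j)"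
        using val_col[OF pos_strip[OF qy(1)] i'(2), of "q + 1"] p i' by simp
      ultimately show ?thesis using val_pos[OF qy(1)] p by simp
    qed
    have mt: "y < bent_mate q d" if d: "y < d" "bent_col q d = j + 1" for d
    proof -
      have qd: "q < d" using d qy by simp
      show ?thesis
      proof (cases rule: bent_mate_cases[OF qd d(2) i1(2)])
        case (1 i')
        have "i < i'"
        proof (rule ccontr)
          assume "\<not> i < i'"
          hence "d \<le> y" using val_mono[OF pos_strip[OF qd] pos_strip[OF qy(2)], of q] val_pos[OF qd] val_pos[OF qy(2)] p 1 by simp
          thus False using d by simp
        qed
        thus ?thesis using above[of i'] 1 by simp
      next
        case (2 e)
        have D': "(int n - j + 1, j) \<in> strip" using 2 i1 by (auto simp: strip_def)
        have "y < val q (int n - j + 1, j)" using above[OF _ D'] p by simp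
        also have "\<dots> \<le> bent_mate q d" using val_mono[OF D' 2(2), of q] 2(3) by simp
        finally show ?thesis .
      qed
    qed
    have "cover h {t<..k} R \<le> cover (h(y := j)) {t<..k} R"
    proof (rule cover_raise)
      show "finite {t<..k}" "y \<in> {t<..k}" "h y = j + 1" using y p by (auto simp: h_def)
      fix d assume d: "d \<in> {t<..k}" "y < d" "h d = j + 1"
      have b: "bent_col q d = j + 1" "q < d" using d qy by (auto simp: h_def)
      note m = bent_mate_props[OF b(2,1) i1(2)] mt[OF d(2) b(1)]
      thus "bent_mate q d \<in> {t<..k} \<and> y < bent_mate q d \<and> bent_mate q d < d \<and> h (bent_mate q d) = j" using d y by (auto simp: h_def)
    next
      show "inj_on (bent_mate q) {d \<in> {t<..k}. y < d \<and> h d = j + 1}"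
        using bent_mate_inj[OF i1(2), of q] qy by (intro inj_onI) (auto simp: h_def)
    qed
    moreover have "h(y := j) = (\<lambda>a. if a \<le> y then bent_col (q + 1) a else bent_col q a)" using p by (auto simp: h_def fun_eq_iff)
    ultimately show "cover (\<lambda>a. if a < y then bent_col (q + 1) a else bent_col q a) {t<..k} R \<le> cover (\<lambda>a. if a \<le> y then bent_col (q + 1) a else bent_col q a) {t<..k} R"
      by (simp add: h_def)
  qed
  thus ?thesis by simp
qed

text \<open>Seen from far enough in the past, all entries above \<open>t\<close> lie outside the
  square with corner \<open>(n, n)\<close>. There the class determines the row and hence the bent
  column.\<close>

lemma bent_col_past:
  assumes "val t (int n, int n) - t \<le> int N" "t < a"
  shows "bent_col (t - int n * int N) a = int n + 1 - c a"
proof -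
  define q where "q = t - int n * int N"
  have "0 \<le> int n * int N" by simp
  hence qa: "q < a" using assms unfolding q_def by linarith
  have nn: "(int n, int n) \<in> strip" using n_pos by (auto simp: strip_def)
  have lev: "int n + 1 \<le> fst (pos q a) + snd (pos q a)"
  proof (rule ccontr)
    assume "\<not> ?thesis"
    hence "le2 (pos q a) (int n, int n)" using pos_strip[OF qa] by (auto simp: strip_def)
    hence "a \<le> val q (int n, int n)" using val_mono[OF pos_strip[OF qa] nn, of q] val_pos[OF qa] by simp
    also have "\<dots> = val t (int n, int n) - int n * int N" using val_shift_mult[OF nn, of t "- int N"] by (simp add: q_def)
    also have "\<dots> \<le> val t (int n, int n) - int N" using n_pos by (simp add: mult_le_cancel_right1)
    finally show False using assms by simp
  qed
  hence "c a = fst (pos q a)" using class_row[OF pos_strip[OF qa], of q] val_pos[OF qa] by simp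
  thus ?thesis using lev unfolding q_def[symmetric] by (simp add: bent_col_def)
qed

text \<open>The word \<open>n + 1 - c\<close> is the word of bent columns at a remote past time.
  Advancing the time to \<open>t\<close> can only raise its covering numbers, and at time
  \<open>t\<close> these count the entries of the first \<open>R\<close> bent columns.\<close>

lemma neg_cover: "cover (\<lambda>a. - c a) {t<..k} R \<le> card {a\<in>{t<..k}. bent_col t a \<le> int R}"
proof -
  define N where "N = nat (val t (int n, int n) - t)"
  have "cover (\<lambda>a. - c a) {t<..k} R \<le> cover (\<lambda>a. int n + 1 - c a) {t<..k} R" by (rule cover_mono) auto
  also have "\<dots> = cover (bent_col (t - int n * int N)) {t<..k} R"
    by (rule cover_cong) (use bent_col_past[of t N] in \<open>auto simp: N_def\<close>)
  also have "\<dots> \<le> cover (bent_col t) {t<..k} R"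
  proof -
    have "cover (bent_col (t - int i)) {t<..k} R \<le> cover (bent_col t) {t<..k} R" for i
    proof (induction i)
      case (Suc i)
      have "t - int (Suc i) + 1 = t - int i" by simp
      thus ?case using Suc bent_col_step[of "t - int (Suc i)" t k R] by simp
    qed simp
    from this[of "n * N"] show ?thesis by simp
  qed
  finally show ?thesis by (simp add: bent_col_cover)
qed

text \<open>The first \<open>r\<close> rows and the first \<open>n - r\<close> bent columns share at
  most \<open>r * (n - r)\<close> boxes: after the turn, a box of the first \<open>r\<close> rows
  has a bent column beyond \<open>n - r\<close>.\<close>

lemma row_cover_neg_cover:
  assumes r: "r \<le> n"
  shows "row_cover t k r + cover (\<lambda>a. - c a) {t<..k} (n - r) \<le> nat (k - t) + r * (n - r)"
proof -
  define A where "A = {a\<in>{t<..k}. row_of t a \<le> int r}"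
  define B where "B = {a\<in>{t<..k}. bent_col t a \<le> int (n - r)}"
  have "card (A \<inter> B) \<le> card ({1..int r} \<times> {1..int (n - r)})"
  proof (rule card_inj_on_le)
    show "inj_on (pos t) (A \<inter> B)" using pos_inj by (intro inj_onI) (auto simp: A_def)
    show "pos t ` (A \<inter> B) \<subseteq> {1..int r} \<times> {1..int (n - r)}"
    proof
      fix x assume "x \<in> pos t ` (A \<inter> B)"
      then obtain a where a: "a \<in> A" "a \<in> B" "x = pos t a" by auto
      have "t < a" using a by (simp add: A_def)
      hence D: "x \<in> strip" using pos_strip a by simp
      have f: "fst x \<le> int r" using a by (simp add: A_def pos_def)
      have "snd x \<le> int (n - r)" using a f r by (auto simp: B_def bent_col_def split: if_splits)
      thus "x \<in> {1..int r} \<times> {1..int (n - r)}" using f D by (cases x) (auto simp: strip_def)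
    qed
  qed simp
  hence "card (A \<inter> B) \<le> r * (n - r)" by (simp add: card_cartesian_product)
  moreover have "card (A \<union> B) \<le> card {t<..k}" by (rule card_mono) (auto simp: A_def B_def)
  moreover have "card A + card B = card (A \<union> B) + card (A \<inter> B)" by (rule card_Un_Int) (auto simp: A_def B_def)
  moreover have "row_cover t k r = card A" using row_of_rows[of t k r] by (simp add: A_def)
  moreover have "cover (\<lambda>a. - c a) {t<..k} (n - r) \<le> card B" using neg_cover[of t k "n - r"] by (simp add: B_def)
  ultimately show ?thesis by simp
qed

section \<open>Exact covering numbers\<close>

definition rep :: "int \<Rightarrow> int" where "rep a = inv_into {1..int n} c a"

lemma rep_in: "1 \<le> a \<Longrightarrow> a \<le> int n \<Longrightarrow> 1 \<le> rep a \<and> rep a \<le> int n \<and> c (rep a) = a"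
proof -
  assume "1 \<le> a" "a \<le> int n"
  hence "a \<in> c ` {1..int n}" using bij by (auto simp: bij_betw_def)
  thus ?thesis using inv_into_into[of a c "{1..int n}"] f_inv_into_f[of a c "{1..int n}"] by (auto simp: rep_def)
qed

lemma rep_c: "k \<in> {1..int n} \<Longrightarrow> rep (c k) = k"
  using bij by (simp add: rep_def bij_betw_def)

text \<open>Here \<open>a + 1\<close> occurs before \<open>a\<close> in every period, so a
  decreasing chain can take both letters from the same period.\<close>

definition descents :: "int set" where "descents = {a. 1 \<le> a \<and> a < int n \<and> rep (a + 1) < rep a}"

text \<open>Pairs of a chain \<open>i\<close> and a passage from letter \<open>a + 1\<close> to
  letter \<open>a\<close> which that chain makes on its way from \<open>n - r + i\<close> down to
  \<open>i\<close>.\<close>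

definition hops :: "int set \<Rightarrow> int \<Rightarrow> (int \<times> int) set" where
  "hops A r = {(i, a). 1 \<le> i \<and> i \<le> r \<and> a \<in> A \<and> i \<le> a \<and> a < int n - r + i}"

lemma finite_hops: "finite (hops A r)"
  by (rule finite_subset[of _ "{1..r} \<times> {1..int n + r}"]) (auto simp: hops_def)

text \<open>The \<open>i\<close>-th of \<open>r\<close> chains starts on letter \<open>n - r + i\<close> and, from period \<open>2 * i\<close> on, descends one
  letter per period down to letter \<open>i\<close>; the delays keep the chains disjoint. A descent gains one
  element whenever both letters fit into one period.\<close>

definition hop_letter :: "int \<Rightarrow> int \<Rightarrow> int \<Rightarrow> int" where
  "hop_letter r i p = max i (min (int n - r + i) (int n - r + 3 * i - p))"

definition hop_uses :: "int \<Rightarrow> int \<Rightarrow> int \<Rightarrow> int \<Rightarrow> bool" where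
  "hop_uses r i p a \<longleftrightarrow> a = hop_letter r i p \<or> (a = hop_letter r i (p + 1) \<and> a + 1 = hop_letter r i p \<and> a \<in> descents)"

text \<open>Each chain starts to descend two periods after its predecessor, so whenever a chain is
  about to hop, the chains before it are at least two letters lower and do not use the letter it
  hops to.\<close>

lemma hop_letter_lt: "i < i' \<Longrightarrow> hop_letter r i p < hop_letter r i' p \<and> (hop_letter r i' (p + 1) \<noteq> hop_letter r i' p \<longrightarrow> hop_letter r i p + 1 < hop_letter r i' p)"
  by (auto simp: hop_letter_def)

lemma hop_uses_inj: "hop_uses r i p a \<Longrightarrow> hop_uses r i' p a \<Longrightarrow> i = i'"
  using hop_letter_lt[of i i' r p] hop_letter_lt[of i' i r p] by (cases i i' rule: linorder_cases) (auto simp: hop_uses_def)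

lemma hop_letter_anti: "p \<le> p' \<Longrightarrow> hop_letter r i p' \<le> hop_letter r i p"
  by (auto simp: hop_letter_def)

lemma hop_letter_range: "1 \<le> i \<Longrightarrow> i \<le> r \<Longrightarrow> r \<le> int n \<Longrightarrow> 1 \<le> hop_letter r i p \<and> hop_letter r i p \<le> int n"
  by (auto simp: hop_letter_def)

lemma hop_uses_le: "hop_uses r i p a \<Longrightarrow> hop_letter r i (p + 1) \<le> a \<and> a \<le> hop_letter r i p"
  using hop_letter_anti[of p "p + 1" r i] by (auto simp: hop_uses_def)

text \<open>Each chain takes one letter per period, and a second one in the period in which it
  passes a descent. The bound on \<open>K\<close> leaves time for all hops.\<close>

lemma hop_cover:
  assumes r: "r \<le> n" and K: "3 * n \<le> K"
  shows "r * K + card (hops descents (int r)) \<le> row_cover 0 (int n * int K) r"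
proof -
  define V where "V = {0<..int n * int K}"
  define per where "per = (\<lambda>k. (k - 1) div int n)"
  define ok where "ok = (\<lambda>k i. 1 \<le> i \<and> i \<le> int r \<and> hop_uses (int r) i (per k) (c k))"
  define g where "g = (\<lambda>k. if \<exists>i. ok k i then nat ((THE i. ok k i) - 1) else r)"
  have okI: "g k = nat (i - 1) \<and> g k < r" if "ok k i" for k i
  proof -
    have "(THE i. ok k i) = i" using that hop_uses_inj by (intro the_equality) (auto simp: ok_def)
    thus ?thesis using that by (auto simp: g_def ok_def)
  qed
  have okD: "\<exists>i. ok k i \<and> i = int (g k) + 1" if "g k < r" for k
  proof -
    obtain i where i: "ok k i" using \<open>g k < r\<close> by (auto simp: g_def split: if_splits)
    thus ?thesis using okI[OF i] by (intro exI[of _ i]) (auto simp: ok_def)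
  qed
  have val_eq: "k = int n * per k + rep (c k)" if "0 < k" for k
  proof -
    have e: "k = int n * per k + ((k - 1) mod int n + 1)" using mult_div_mod_eq[of "int n" "k - 1"] by (simp add: per_def)
    have "(k - 1) mod int n + 1 \<in> {1..int n}" using n_pos by (auto simp: add1_zle_eq)
    moreover have "c k = c ((k - 1) mod int n + 1)" using per_mult[of "(k - 1) mod int n + 1" "per k"] e by (metis add.commute)
    ultimately show ?thesis using rep_c e by simp
  qed
  have dc: "dec_colouring c V r g"
    unfolding dec_colouring_def
  proof (intro ballI impI)
    fix a b assume a: "a \<in> V" and b: "b \<in> V" and ab: "a < b \<and> g a = g b \<and> g a < r"
    obtain i where i: "ok a i" "ok b i" using okD[of a] okD[of b] ab by auto
    have le: "per a \<le> per b" using ab n_pos by (auto simp: per_def intro!: zdiv_mono1)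
    show "c b \<le> c a"
    proof (cases "per a = per b")
      case True
      show ?thesis
      proof (rule ccontr)
        assume no: "\<not> c b \<le> c a"
        hence "c a \<in> descents \<and> c b = c a + 1" using i True hop_uses_le[of "int r" i "per a" "c a"] hop_uses_le[of "int r" i "per a" "c b"]
          by (auto simp: ok_def hop_uses_def)
        hence "rep (c b) < rep (c a)" by (auto simp: descents_def)
        thus False using val_eq[of a] val_eq[of b] a b ab True by (simp add: V_def)
      qed
    next
      case False
      hence "hop_letter (int r) i (per b) \<le> hop_letter (int r) i (per a + 1)" using le by (intro hop_letter_anti) simp
      thus ?thesis using i hop_uses_le[of "int r" i "per a" "c a"] hop_uses_le[of "int r" i "per b" "c b"] by (auto simp: ok_def)
    qed
  qed
  \<comment> \<open>The left summand indexes the regular letters, the right one the extra letters.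
    Chain \<open>i\<close> passes from \<open>a + 1\<close> to \<open>a\<close> in period
    \<open>n - r + 3 * i - a - 1\<close>.\<close>
  define X where "X = ({1..int r} \<times> {0..<int K}) <+> hops descents (int r)"
  define \<psi> where "\<psi> = (\<lambda>z. case z of Inl (i, p) \<Rightarrow> (i, p, hop_letter (int r) i p) | Inr (i, a) \<Rightarrow> (i, int n - int r + 3 * i - a - 1, a))"
  define \<phi> where "\<phi> = (\<lambda>z. case \<psi> z of (i, p, a) \<Rightarrow> int n * p + rep a)"
  have psi: "\<exists>i p a. \<psi> z = (i, p, a) \<and> 1 \<le> i \<and> i \<le> int r \<and> 0 \<le> p \<and> p < int K \<and> hop_uses (int r) i p a \<and> 1 \<le> a \<and> a \<le> int n"
    if z: "z \<in> X" for z
  proof (cases z)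
    case (Inl ip)
    obtain i p where ip: "ip = (i, p)" by (cases ip)
    have h: "1 \<le> i" "i \<le> int r" "0 \<le> p" "p < int K" using z Inl ip by (auto simp: X_def)
    thus ?thesis using hop_letter_range[of i "int r" p] r Inl ip by (auto simp: \<psi>_def hop_uses_def)
  next
    case (Inr ia)
    obtain i a where ia: "ia = (i, a)" by (cases ia)
    have h: "1 \<le> i" "i \<le> int r" "a \<in> descents" "i \<le> a" "a < int n - int r + i" using z Inr ia by (auto simp: X_def hops_def)
    define p where "p = int n - int r + 3 * i - a - 1"
    have "hop_letter (int r) i p = a + 1" "hop_letter (int r) i (p + 1) = a" using h by (auto simp: hop_letter_def p_def)
    hence "hop_uses (int r) i p a" using h by (simp add: hop_uses_def)
    moreover have "0 \<le> p" "p < int K" using h r K by (auto simp: p_def)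
    moreover have "1 \<le> a" "a \<le> int n" using h by (auto simp: descents_def)
    moreover have "\<psi> z = (i, p, a)" using Inr ia by (simp add: \<psi>_def p_def)
    ultimately show ?thesis using h by blast
  qed
  have back_val: "per (int n * p + rep a) = p \<and> c (int n * p + rep a) = a \<and> int n * p + rep a \<in> V"
    if h: "0 \<le> p" "p < int K" "1 \<le> a" "a \<le> int n" for p a
  proof -
    note w = rep_in[OF h(3,4)]
    have sw: "int n * p + rep a - 1 = (rep a - 1) + int n * p" by simp
    have "per (int n * p + rep a) = p + (rep a - 1) div int n"
      unfolding per_def sw by (rule div_mult_self2) (use n_pos in simp)
    moreover have "(rep a - 1) div int n = 0" using w by (intro div_pos_pos_trivial) auto
    moreover have "c (int n * p + rep a) = a" using per_mult[of "rep a" p] w by (simp add: add.commute)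
    moreover have "int n * p + rep a \<in> V"
    proof -
      have "int n * (p + 1) \<le> int n * int K" using h by (intro mult_left_mono) auto
      moreover have "0 \<le> int n * p" using h by simp
      ultimately show ?thesis using w by (auto simp: V_def algebra_simps)
    qed
    ultimately show ?thesis by simp
  qed
  have "card X \<le> card {k\<in>V. g k < r}"
  proof (rule card_inj_on_le)
    show "\<phi> ` X \<subseteq> {k\<in>V. g k < r}"
    proof
      fix k assume "k \<in> \<phi> ` X"
      then obtain z where z: "z \<in> X" "k = \<phi> z" by auto
      obtain i p a where q: "\<psi> z = (i, p, a)" "1 \<le> i" "i \<le> int r" "0 \<le> p" "p < int K" "hop_uses (int r) i p a" "1 \<le> a" "a \<le> int n"
        using psi[OF z(1)] by blast
      have k: "k = int n * p + rep a" using z q by (simp add: \<phi>_def)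
      have "ok k i" using back_val[of p a] q k by (simp add: ok_def)
      thus "k \<in> {k\<in>V. g k < r}" using back_val[of p a] q k okI[of k i] by simp
    qed
    show "inj_on \<phi> X"
    proof (rule inj_onI)
      fix z z' assume z: "z \<in> X" "z' \<in> X" "\<phi> z = \<phi> z'"
      obtain i p a where q: "\<psi> z = (i, p, a)" "1 \<le> i" "i \<le> int r" "0 \<le> p" "p < int K" "hop_uses (int r) i p a" "1 \<le> a" "a \<le> int n"
        using psi[OF z(1)] by blast
      obtain i' p' a' where q': "\<psi> z' = (i', p', a')" "1 \<le> i'" "i' \<le> int r" "0 \<le> p'" "p' < int K" "hop_uses (int r) i' p' a'" "1 \<le> a'" "a' \<le> int n"
        using psi[OF z(2)] by blast
      have e: "int n * p + rep a = int n * p' + rep a'" using z(3) q q' by (simp add: \<phi>_def)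
      have b1: "per (int n * p + rep a) = p" "c (int n * p + rep a) = a" using back_val[OF q(4,5,7,8)] by auto
      have b2: "per (int n * p' + rep a') = p'" "c (int n * p' + rep a') = a'" using back_val[OF q'(4,5,7,8)] by auto
      have pa: "p = p'" "a = a'" using b1 b2 unfolding e by auto
      hence ii: "i = i'" using hop_uses_inj q q' by blast
      have "hop_letter (int r) i (int n - int r + 3 * i - a - 1) = a + 1" if "(i, a) \<in> hops descents (int r)" for i a
        using that by (auto simp: hop_letter_def hops_def)
      thus "z = z'" using z(1,2) q(1) q'(1) pa ii
        by (auto simp: \<psi>_def X_def split: sum.splits)
    qed
    show "finite {k\<in>V. g k < r}" by (simp add: V_def)
  qed
  also have "\<dots> \<le> row_cover 0 (int n * int K) r" unfolding row_cover_def V_def[symmetric] by (rule cover_ge[OF _ dc]) (simp add: V_def)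
  finally have "card X \<le> row_cover 0 (int n * int K) r" .
  moreover have "card X = r * K + card (hops descents (int r))"
    unfolding X_def by (subst card_Plus) (auto simp: card_cartesian_product finite_hops)
  ultimately show ?thesis by simp
qed

lemma hops_sym: "0 \<le> r \<Longrightarrow> r \<le> int n \<Longrightarrow> card (hops A r) = card (hops A (int n - r))"
proof -
  assume r: "0 \<le> r" "r \<le> int n"
  have "bij_betw (\<lambda>(i, a). (a - i + 1, a)) (hops A r) (hops A (int n - r))"
    by (rule bij_betw_byWitness[where f' = "\<lambda>(i, a). (a - i + 1, a)"]) (auto simp: hops_def)
  thus ?thesis by (rule bij_betw_same_card)
qed

lemma hops_compl:
  assumes A: "A \<subseteq> {1..<int n}" and r: "r \<le> n"
  shows "card (hops A (int r)) + card (hops ({1..<int n} - A) (int r)) = r * (n - r)"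
proof -
  have "hops A (int r) \<union> hops ({1..<int n} - A) (int r) = hops {1..<int n} (int r)" using A by (auto simp: hops_def)
  moreover have "hops A (int r) \<inter> hops ({1..<int n} - A) (int r) = {}" by (auto simp: hops_def)
  ultimately have "card (hops A (int r)) + card (hops ({1..<int n} - A) (int r)) = card (hops {1..<int n} (int r))"
    using card_Un_disjoint[OF finite_hops finite_hops] by metis
  also have "bij_betw (\<lambda>(i, a). (i, a - i)) (hops {1..<int n} (int r)) ({1..int r} \<times> {0..<int (n - r)})"
    by (rule bij_betw_byWitness[where f' = "\<lambda>(i, a). (i, a + i)"]) (use r in \<open>auto simp: hops_def\<close>)
  hence "card (hops {1..<int n} (int r)) = card ({1..int r} \<times> {0..<int (n - r)})" by (rule bij_betw_same_card)
  finally show ?thesis by (simp add: card_cartesian_product)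
qed

lemma rods_compl: "rods n (\<lambda>k. int n + 1 - c k)"
proof
  have "bij_betw (\<lambda>x. int n + 1 - x) {1..int n} {1..int n}"
    by (rule bij_betw_byWitness[where f' = "\<lambda>x. int n + 1 - x"]) auto
  from bij_betw_trans[OF bij this] show "bij_betw (\<lambda>k. int n + 1 - c k) {1..int n} {1..int n}" by (simp add: o_def)
qed (use n_pos per in auto)

text \<open>The hopping chains for \<open>c\<close> and for the complementary word together attain the upper bound of
  \<open>row_cover_neg_cover\<close>.\<close>

lemma row_cover_value:
  assumes r: "r \<le> n" and K: "3 * n \<le> K"
  shows "row_cover 0 (int n * int K) r = r * K + card (hops descents (int r))"
proof -
  interpret R: rods n "\<lambda>k. int n + 1 - c k" by (rule rods_compl)
  define s where "s = n - r"
  have s: "s \<le> n" using r by (simp add: s_def)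
  have wR: "R.rep a = rep (int n + 1 - a)" if a: "1 \<le> a" "a \<le> int n" for a
  proof -
    have "c (R.rep a) = int n + 1 - a" using R.rep_in[OF a] by linarith
    moreover have "rep (c (R.rep a)) = R.rep a" using R.rep_in[OF a] by (intro rep_c) simp
    ultimately show ?thesis by metis
  qed
  \<comment> \<open>Complementing the letters sends the pair \<open>a\<close>, \<open>a + 1\<close>
    to \<open>n + 1 - a\<close>, \<open>n - a\<close>, and so exchanges descents with
    ascents.\<close>
  have dR: "a \<in> R.descents \<longleftrightarrow> int n - a \<in> {1..<int n} - descents" for a
  proof (cases "1 \<le> a \<and> a < int n")
    case True
    have "rep (int n - a) \<noteq> rep (int n - a + 1)" using rep_in[of "int n - a"] rep_in[of "int n - a + 1"] True by force
    moreover have "R.rep a = rep (int n - a + 1)"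
    proof -
      have e: "int n + 1 - a = int n - a + 1" by simp
      have "a \<le> int n" using True by simp
      thus ?thesis using wR[of a] True unfolding e by blast
    qed
    moreover have "R.rep (a + 1) = rep (int n - a)" using wR[of "a + 1"] True by simp
    moreover have "a \<in> R.descents \<longleftrightarrow> R.rep (a + 1) < R.rep a" using True by (simp add: R.descents_def)
    moreover have "int n - a \<in> descents \<longleftrightarrow> rep (int n - a + 1) < rep (int n - a)" using True by (simp add: descents_def)
    ultimately show ?thesis using True by auto
  next
    case False thus ?thesis by (auto simp: R.descents_def)
  qed
  define X where "X = {1..<int n} - descents"
  define Y where "Y = R.descents"
  have dXY: "a \<in> Y \<longleftrightarrow> int n - a \<in> X" for a unfolding X_def Y_def by (rule dR)
  have s1: "(int s + 1 - i, int n - a) \<in> hops X (int s)" if h: "(i, a) \<in> hops Y (int s)" for i a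
  proof -
    have "int n - a \<in> X" using h dXY[of a] by (simp add: hops_def)
    thus ?thesis using h by (simp add: hops_def)
  qed
  have s2: "(int s + 1 - i, int n - a) \<in> hops Y (int s)" if h: "(i, a) \<in> hops X (int s)" for i a
  proof -
    have "int n - a \<in> Y" using h dXY[of "int n - a"] by (simp add: hops_def)
    thus ?thesis using h by (simp add: hops_def)
  qed
  have "bij_betw (\<lambda>(i, a). (int s + 1 - i, int n - a)) (hops Y (int s)) (hops X (int s))"
    by (rule bij_betw_byWitness[where f' = "\<lambda>(i, a). (int s + 1 - i, int n - a)"]) (use s1 s2 in auto)
  hence "card (hops Y (int s)) = card (hops X (int s))" by (rule bij_betw_same_card)
  hence h: "card (R.hops R.descents (int s)) = card (hops ({1..<int n} - descents) (int s))" unfolding X_def Y_def .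
  have "s * K + card (hops ({1..<int n} - descents) (int s)) \<le> R.row_cover 0 (int n * int K) s"
    using R.hop_cover[OF s K] h by simp
  also have "\<dots> \<le> cover (\<lambda>a. - c a) {0<..int n * int K} s" unfolding R.row_cover_def by (rule cover_mono) auto
  finally have 1: "s * K + card (hops ({1..<int n} - descents) (int s)) \<le> cover (\<lambda>a. - c a) {0<..int n * int K} s" .
  have 2: "card (hops descents (int s)) + card (hops ({1..<int n} - descents) (int s)) = r * (n - r)"
  proof -
    have "descents \<subseteq> {1..<int n}" by (auto simp: descents_def)
    moreover have "s * (n - s) = r * (n - r)" using r by (simp add: s_def mult.commute)
    ultimately show ?thesis using hops_compl[of descents s] s by simp
  qed
  have 3: "card (hops descents (int s)) = card (hops descents (int r))" using hops_sym[of "int r" descents] r by (simp add: s_def of_nat_diff)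
  have 4: "row_cover 0 (int n * int K) r + cover (\<lambda>a. - c a) {0<..int n * int K} s \<le> n * K + r * (n - r)"
    using row_cover_neg_cover[OF r, of 0 "int n * int K"] by (simp add: s_def flip: of_nat_mult)
  have 5: "n * K = r * K + s * K" using r by (simp add: s_def flip: add_mult_distrib)
  show ?thesis using hop_cover[OF r K] 1 2 3 4 5 by linarith
qed

section \<open>Gluing the tableau to its rotation\<close>

lemma rods_shift: "rods n (\<lambda>k. c (k + d))"
proof
  show "bij_betw (\<lambda>k. c (k + d)) {1..int n} {1..int n}"
  proof (rule bij_betw_imageI)
    show inj: "inj_on (\<lambda>k. c (k + d)) {1..int n}"
    proof (rule inj_onI)
      fix x y assume x: "x \<in> {1..int n}" and y: "y \<in> {1..int n}" and "c (x + d) = c (y + d)"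
      hence "int n dvd x - y" using c_eq_iff[of "x + d" "y + d"] by simp
      thus "x = y" using x y dvd_imp_le_int[of "x - y" "int n"] by (cases "x = y") auto
    qed
    show "(\<lambda>k. c (k + d)) ` {1..int n} = {1..int n}"
      by (rule card_subset_eq) (use c_range card_image[OF inj] in auto)
  qed
next
  fix k show "c (k + int n + d) = c (k + d)" using per[of "k + d"] by (simp add: algebra_simps)
qed (use n_pos in auto)

lemma row_cover_shifted: "rods.row_cover (\<lambda>k. c (k + d)) t k R = row_cover (t + d) (k + d) R"
proof -
  interpret S: rods n "\<lambda>k. c (k + d)" by (rule rods_shift)
  have "(\<lambda>a. a + d) ` {t<..k} = {t + d<..k + d}"
  proof
    show "{t + d<..k + d} \<subseteq> (\<lambda>a. a + d) ` {t<..k}"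
    proof
      fix x assume "x \<in> {t + d<..k + d}"
      thus "x \<in> (\<lambda>a. a + d) ` {t<..k}" by (intro image_eqI[of _ _ "x - d"]) auto
    qed
  qed auto
  thus ?thesis using cover_shift[of "{t<..k}" c d R] by (simp add: S.row_cover_def row_cover_def)
qed

lemma row_of_shifted: "rods.row_of (\<lambda>k. c (k + d)) t k = row_of (t + d) (k + d)"
proof -
  interpret S: rods n "\<lambda>k. c (k + d)" by (rule rods_shift)
  show ?thesis unfolding S.row_of_def row_of_def row_cover_shifted by (simp add: algebra_simps)
qed

lemma col_of_shifted: "rods.col_of (\<lambda>k. c (k + d)) t k = col_of (t + d) (k + d)"
proof -
  interpret S: rods n "\<lambda>k. c (k + d)" by (rule rods_shift)
  have "{x\<in>{t + d<..k + d}. row_of (t + d) x = r} = (\<lambda>x. x + d) ` {x\<in>{t<..k}. row_of (t + d) (x + d) = r}" for r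
  proof
    show "{x\<in>{t + d<..k + d}. row_of (t + d) x = r} \<subseteq> (\<lambda>x. x + d) ` {x\<in>{t<..k}. row_of (t + d) (x + d) = r}"
    proof
      fix x assume "x \<in> {x\<in>{t + d<..k + d}. row_of (t + d) x = r}"
      thus "x \<in> (\<lambda>x. x + d) ` {x\<in>{t<..k}. row_of (t + d) (x + d) = r}" by (intro image_eqI[of _ _ "x - d"]) auto
    qed
  qed auto
  thus ?thesis unfolding S.col_of_def col_of_def cnt_def row_of_shifted by (simp add: card_image)
qed

lemma val_shifted: "x \<in> strip \<Longrightarrow> rods.val (\<lambda>k. c (k + d)) t x = val (t + d) x - d"
proof -
  assume x: "x \<in> strip"
  interpret S: rods n "\<lambda>k. c (k + d)" by (rule rods_shift)
  have "S.pos t (val (t + d) x - d) = x"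
    using row_of_val[OF x, of "t + d"] col_of_val[OF x, of "t + d"] by (simp add: S.pos_def row_of_shifted col_of_shifted)
  thus ?thesis using S.val_pos[of t "val (t + d) x - d"] val_gt[OF x, of "t + d"] by simp
qed

text \<open>Rotation by 180 degrees replaces an entry \<open>k\<close> by
  \<open>m * n + 1 - k\<close>, which is \<open>1 - k\<close> modulo \<open>n\<close>, and row
  \<open>i\<close> by row \<open>n + 1 - i\<close>.\<close>

definition rev_class :: "int \<Rightarrow> int" where "rev_class k = int n + 1 - c (1 - k)"

lemma rods_rev_class: "rods n rev_class"
proof
  have c1: "c (1 - k) = c (int n + 1 - k)" for k using per[of "1 - k"] by (simp add: algebra_simps)
  have b: "bij_betw (\<lambda>x. int n + 1 - x) {1..int n} {1..int n}"
    by (rule bij_betw_byWitness[where f' = "\<lambda>x. int n + 1 - x"]) auto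
  have "rev_class = (\<lambda>x. int n + 1 - x) \<circ> (c \<circ> (\<lambda>x. int n + 1 - x))" by (auto simp: rev_class_def c1 fun_eq_iff)
  thus "bij_betw rev_class {1..int n} {1..int n}" using bij_betw_trans[OF bij_betw_trans[OF b bij] b] by simp
  fix k show "rev_class (k + int n) = rev_class k" using per[of "1 - k - int n"] by (simp add: rev_class_def algebra_simps)
qed (use n_pos in auto)

lemma row_cover_shift_mult: "row_cover (t + int n * int e) (k + int n * int e) R = row_cover t k R"
proof (induction e)
  case (Suc e)
  have "t + int n * int (Suc e) = (t + int n * int e) + int n" "k + int n * int (Suc e) = (k + int n * int e) + int n"
    by (auto simp: algebra_simps)
  thus ?case using row_cover_shift Suc by metis
qed simp

text \<open>Reversing positions and complementing letters preserves decreasing chains; because the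
  interval consists of whole periods, it can then be shifted back to its place.\<close>

lemma row_cover_rev: "rods.row_cover rev_class 0 (int n * int K) R = row_cover 0 (int n * int K) R"
proof -
  interpret R: rods n rev_class by (rule rods_rev_class)
  have "(\<lambda>a. 1 - a) ` {- (int n * int K)<..0} = {0<..int n * int K}"
  proof
    show "{0<..int n * int K} \<subseteq> (\<lambda>a. 1 - a) ` {- (int n * int K)<..0}"
    proof
      fix x assume "x \<in> {0<..int n * int K}"
      thus "x \<in> (\<lambda>a. 1 - a) ` {- (int n * int K)<..0}" by (intro image_eqI[of _ _ "1 - x"]) auto
    qed
  qed auto
  hence "cover rev_class {0<..int n * int K} R = cover c {- (int n * int K)<..0} R"
    using cover_reflect[of "{- (int n * int K)<..0}" "int n + 1" c 1 R] by (simp add: rev_class_def[abs_def])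
  also have "\<dots> = row_cover 0 (int n * int K) R" using row_cover_shift_mult[of "- (int n * int K)" K 0 R] by (simp add: row_cover_def)
  finally show ?thesis by (simp add: R.row_cover_def)
qed

text \<open>So many periods that every row has passed the antidiagonal at their end: the hop numbers
  subtracted from a row length are at most \<open>n * n\<close>. The rest also meets the bound
  \<open>3 * n\<close> of \<open>row_cover_value\<close>.\<close>

definition many_periods :: nat where "many_periods = 4 * n + n * n"

lemma row_count:
  assumes "1 \<le> r" "r \<le> n"
  shows "cnt (row_of 0) 0 (int n * int K) (int r) = int (row_cover 0 (int n * int K) r) - int (row_cover 0 (int n * int K) (r - 1))"
proof -
  define V where "V = {0<..int n * int K}"
  have "{a\<in>V. row_of 0 a \<le> int r} = {a\<in>V. row_of 0 a \<le> int (r - 1)} \<union> {a\<in>V. row_of 0 a = int r}" using assms by auto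
  moreover have "{a\<in>V. row_of 0 a \<le> int (r - 1)} \<inter> {a\<in>V. row_of 0 a = int r} = {}" using assms by auto
  moreover have "finite V" by (simp add: V_def)
  ultimately have "card {a\<in>V. row_of 0 a \<le> int r} = card {a\<in>V. row_of 0 a \<le> int (r - 1)} + card {a\<in>V. row_of 0 a = int r}"
    by (simp add: card_Un_disjoint)
  thus ?thesis using row_of_rows[of 0 "int n * int K" r] row_of_rows[of 0 "int n * int K" "r - 1"] by (simp add: cnt_def V_def)
qed

text \<open>The number \<open>N\<close> of entries of row \<open>r\<close> after
  \<open>many_periods\<close> periods is a difference of two exact covering numbers. The last of
  these entries is the member of class \<open>r\<close> in the final period, and from it the
  progression of step \<open>n\<close> extends in both directions as far as the
  antidiagonal.\<close>

lemma row_progression: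
  assumes r: "1 \<le> r" "r \<le> n" and lev: "int n + 1 \<le> int r + j"
  shows "val 0 (int r, j) = int n * (int many_periods - 1) + rep (int r) + int n * (j - int many_periods - int (card (hops descents (int r))) + int (card (hops descents (int r - 1))))"
proof -
  define N where "N = cnt (row_of 0) 0 (int n * int many_periods) (int r)"
  have many_periods: "3 * n \<le> many_periods" by (simp add: many_periods_def)
  have f: "row_cover 0 (int n * int many_periods) (r - 1) = (r - 1) * many_periods + card (hops descents (int r - 1))"
    using row_cover_value[of "r - 1" many_periods] r many_periods by (simp add: of_nat_diff)
  have "r * many_periods = (r - 1) * many_periods + many_periods" using r by (cases r) auto
  hence N: "N = int many_periods + int (card (hops descents (int r))) - int (card (hops descents (int r - 1)))"
    using row_count[OF r, of many_periods] row_cover_value[OF r(2) many_periods] f unfolding N_def by simp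
  have "card (hops descents (int (r - 1))) \<le> (r - 1) * (n - (r - 1))"
  proof -
    have "descents \<subseteq> {1..<int n}" by (auto simp: descents_def)
    moreover have "r - 1 \<le> n" using r by simp
    ultimately show ?thesis using hops_compl[of descents "r - 1"] by linarith
  qed
  also have "\<dots> \<le> n * n" using r by (intro mult_mono) auto
  finally have "card (hops descents (int r - 1)) \<le> n * n" using r by (simp add: of_nat_diff)
  hence "int (card (hops descents (int r - 1))) \<le> int n * int n" by (metis of_nat_le_iff of_nat_mult)
  hence Nn: "int n \<le> N" using N by (simp add: many_periods_def)
  have D: "(int r, N) \<in> strip" "(int r, N + 1) \<in> strip" using r Nn by (auto simp: strip_def)
  \<comment> \<open>The \<open>N\<close>-th entry falls within the given periods and the next one,
    larger by \<open>n\<close>, does not; so the \<open>N\<close>-th entry lies in the last period,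
    where its class identifies it.\<close>
  have lt: "val 0 (int r, N) \<le> int n * int many_periods"
  proof (rule ccontr)
    assume "\<not> ?thesis"
    hence "cnt (row_of 0) 0 (int n * int many_periods) (int r) \<le> cnt (row_of 0) 0 (val 0 (int r, N) - 1) (int r)" by (intro cnt_mono) simp
    also have "\<dots> = N - 1" using cnt_step[of 0 "val 0 (int r, N)" "row_of 0" "int r"] val_gt[OF D(1), of 0] row_of_val[OF D(1), of 0] col_of_val[OF D(1), of 0]
      by (simp add: col_of_def)
    finally show False by (simp add: N_def)
  qed
  have gt: "int n * int many_periods < val 0 (int r, N + 1)"
  proof (rule ccontr)
    assume "\<not> ?thesis"
    hence "cnt (row_of 0) 0 (val 0 (int r, N + 1)) (int r) \<le> cnt (row_of 0) 0 (int n * int many_periods) (int r)" by (intro cnt_mono) simp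
    moreover have "cnt (row_of 0) 0 (val 0 (int r, N + 1)) (int r) = N + 1" using row_of_val[OF D(2), of 0] col_of_val[OF D(2), of 0] by (simp add: col_of_def)
    ultimately show False by (simp add: N_def)
  qed
  have nx: "val 0 (int r, N + 1) = val 0 (int r, N) + int n" using val_right[OF D(1), of 0] r Nn by simp
  have w: "1 \<le> rep (int r)" "rep (int r) \<le> int n" "c (rep (int r)) = int r" using rep_in[of "int r"] r by auto
  have cv: "c (val 0 (int r, N)) = int r" using class_row[OF D(1), of 0] r Nn by simp
  have perm_class: "c (int n * (int many_periods - 1) + rep (int r)) = int r" using per_mult[of "rep (int r)" "int many_periods - 1"] w by (simp add: add.commute)
  have "int n dvd val 0 (int r, N) - (int n * (int many_periods - 1) + rep (int r))" using c_eq_iff cv perm_class by metis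
  moreover have "\<bar>val 0 (int r, N) - (int n * (int many_periods - 1) + rep (int r))\<bar> < int n"
    using lt gt nx w by (simp add: algebra_simps abs_if)
  ultimately have vN: "val 0 (int r, N) = int n * (int many_periods - 1) + rep (int r)"
    using dvd_imp_le_int[of "val 0 (int r, N) - (int n * (int many_periods - 1) + rep (int r))" "int n"] by fastforce
  have "val 0 (int r, j) = val 0 (int r, N) + int n * (j - N)"
  proof (cases "N \<le> j")
    case True thus ?thesis using val_right_mult[OF D(1), of 0 "nat (j - N)"] r Nn by simp
  next
    case False
    have "(int r, j) \<in> strip" using r lev by (auto simp: strip_def)
    thus ?thesis using val_right_mult[of "int r" j 0 "nat (N - j)"] False lev by (simp add: algebra_simps)
  qed
  thus ?thesis using vN N by (simp add: algebra_simps)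
qed

text \<open>Both entries belong to explicit progressions. The hop numbers of \<open>c\<close> and of
  \<open>rev_class\<close> agree because the covering numbers do, and the symmetry of hop numbers
  under exchanging \<open>r\<close> with \<open>n - r\<close> makes the offsets cancel.\<close>

lemma glue_at_0:
  assumes r: "1 \<le> r" "r \<le> int n" and j: "int n + 1 \<le> r + j" "r + j \<le> m + 1"
  shows "val 0 (r, j) + rods.val rev_class 0 (int n + 1 - r, m + 1 - j) = m * int n + 1"
proof -
  interpret R: rods n rev_class by (rule rods_rev_class)
  define s where "s = nat r"
  define s' where "s' = n + 1 - s"
  have s: "1 \<le> s" "s \<le> n" "r = int s" and s': "1 \<le> s'" "s' \<le> n" "int n + 1 - r = int s'" using r by (auto simp: s_def s'_def)
  have hR: "card (R.hops R.descents (int a)) = card (hops descents (int a))" if "a \<le> n" for a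
    using row_cover_value[OF that, of "3 * n"] R.row_cover_value[OF that, of "3 * n"] row_cover_rev[of "3 * n" a] by simp
  have hs: "card (hops descents (int s)) = card (hops descents (int s' - 1))" "card (hops descents (int s - 1)) = card (hops descents (int s'))"
  proof -
    have e1: "int n - int s = int s' - 1" "int n - (int s - 1) = int s'" using s s' by auto
    show "card (hops descents (int s)) = card (hops descents (int s' - 1))" using hops_sym[of "int s" descents] s unfolding e1 by simp
    show "card (hops descents (int s - 1)) = card (hops descents (int s'))" using hops_sym[of "int s - 1" descents] s unfolding e1 by simp
  qed
  have h2: "card (R.hops R.descents (int s')) = card (hops descents (int s'))" "card (R.hops R.descents (int s' - 1)) = card (hops descents (int s' - 1))"
    using hR[of s'] hR[of "s' - 1"] s' by (auto simp: of_nat_diff)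
  have w: "R.rep (int s') = int n + 1 - rep (int s)"
  proof -
    have w1: "1 \<le> rep (int s)" "rep (int s) \<le> int n" "c (rep (int s)) = int s" using rep_in[of "int s"] s by auto
    have "rev_class (int n + 1 - rep (int s)) = int n + 1 - c (rep (int s) - int n)" by (simp add: rev_class_def)
    also have "c (rep (int s) - int n) = int s" using per[of "rep (int s) - int n"] w1 by simp
    finally have "rev_class (int n + 1 - rep (int s)) = int s'" using s s' by simp
    thus ?thesis using R.rep_c[of "int n + 1 - rep (int s)"] w1 by auto
  qed
  have KK: "R.many_periods = many_periods" by (simp add: many_periods_def R.many_periods_def)
  have 1: "val 0 (int s, j) = int n * (int many_periods - 1) + rep (int s) + int n * (j - int many_periods - int (card (hops descents (int s))) + int (card (hops descents (int s - 1))))"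
    by (rule row_progression) (use s j in auto)
  have 2: "R.val 0 (int s', m + 1 - j) = int n * (int many_periods - 1) + (int n + 1 - rep (int s)) + int n * (m + 1 - j - int many_periods - int (card (hops descents (int s'))) + int (card (hops descents (int s' - 1))))"
    using R.row_progression[OF s'(1,2), of "m + 1 - j"] j s s' h2 w KK by simp
  show ?thesis using 1 2 hs s s' by (simp add: algebra_simps)
qed

lemma rev_class_shifted: "rods.rev_class n (\<lambda>k. c (k + d)) = (\<lambda>k. rev_class (k + (- d)))"
proof -
  interpret S: rods n "\<lambda>k. c (k + d)" by (rule rods_shift)
  show ?thesis by (auto simp: S.rev_class_def rev_class_def fun_eq_iff algebra_simps)
qed

text \<open>Translating the word moves the time to 0; the reversed word is then translated in the
  opposite direction.\<close>

lemma glue: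
  assumes r: "1 \<le> r" "r \<le> int n" and j: "int n + 1 \<le> r + j" "r + j \<le> m + 1"
  shows "val t (r, j) + rods.val rev_class (- t) (int n + 1 - r, m + 1 - j) = m * int n + 1"
proof -
  interpret S: rods n "\<lambda>k. c (k + t)" by (rule rods_shift)
  interpret R: rods n rev_class by (rule rods_rev_class)
  have D: "(r, j) \<in> strip" "(int n + 1 - r, m + 1 - j) \<in> R.strip" using r j by (auto simp: strip_def R.strip_def)
  have "S.val 0 (r, j) + rods.val S.rev_class 0 (int n + 1 - r, m + 1 - j) = m * int n + 1" using S.glue_at_0[OF r j] .
  moreover have "S.val 0 (r, j) = val t (r, j) - t" using val_shifted[OF D(1), of t 0] by simp
  moreover have "rods.val S.rev_class 0 (int n + 1 - r, m + 1 - j) = R.val (- t) (int n + 1 - r, m + 1 - j) + t"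
    using R.val_shifted[OF D(2), of "- t" 0] unfolding rev_class_shifted by simp
  ultimately show ?thesis by simp
qed

end

section \<open>The glued tableau on the rectangle\<close>

definition rectz :: "nat \<Rightarrow> nat \<Rightarrow> (int \<times> int) set" where "rectz n m = {1..int n} \<times> {1..int m}"

definition rotz :: "nat \<Rightarrow> nat \<Rightarrow> int \<times> int \<Rightarrow> int \<times> int" where
  "rotz n m x = (int n + 1 - fst x, int m + 1 - snd x)"

lemma rotz_rotz [simp]: "rotz n m (rotz n m x) = x"
  by (simp add: rotz_def)

lemma rotz_rectz: "x \<in> rectz n m \<Longrightarrow> rotz n m x \<in> rectz n m"
  by (auto simp: rotz_def rectz_def)

locale glued = rods +
  fixes m :: nat
  assumes n_le_m: "n \<le> m"
begin

sublocale R: rods n rev_class by (rule rods_rev_class)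

abbreviation "RR \<equiv> rectz n m"

abbreviation "rot \<equiv> rotz n m"

definition glued_val :: "int \<Rightarrow> int \<times> int \<Rightarrow> int" where
  "glued_val t x = (if fst x + snd x \<le> int m + 1 then val t x else int m * int n + 1 - R.val (- t) (rot x))"

lemma RR_strip: "x \<in> RR \<Longrightarrow> x \<in> strip" and RR_rev_strip: "x \<in> RR \<Longrightarrow> x \<in> R.strip"
  by (auto simp: rectz_def strip_def R.strip_def)

text \<open>By \<open>glue\<close> both formulas hold on the band
  \<open>n + 1 \<le> i + j \<le> m + 1\<close>. As \<open>n \<le> m\<close>, any two neighbouring
  boxes are therefore described by one and the same formula.\<close>

lemma glued_val_rot: "x \<in> RR \<Longrightarrow> int n + 1 \<le> fst x + snd x \<Longrightarrow> glued_val t x = int m * int n + 1 - R.val (- t) (rot x)"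
proof (cases "fst x + snd x \<le> int m + 1")
  case True
  assume "x \<in> RR" "int n + 1 \<le> fst x + snd x"
  hence "val t x + R.val (- t) (rot x) = int m * int n + 1"
    using glue[of "fst x" "snd x" "int m" t] True by (auto simp: rectz_def rotz_def)
  thus ?thesis using True by (simp add: glued_val_def)
qed (simp add: glued_val_def)

lemma glued_val_row: "(i, j) \<in> RR \<Longrightarrow> (i, j + 1) \<in> RR \<Longrightarrow> glued_val t (i, j) < glued_val t (i, j + 1)"
proof (cases "i + j + 1 \<le> int m + 1")
  case True
  assume "(i, j) \<in> RR" "(i, j + 1) \<in> RR"
  thus ?thesis using True val_row[of "(i, j)" "(i, j + 1)" t] RR_strip by (simp add: glued_val_def)
next
  case False
  assume x: "(i, j) \<in> RR" "(i, j + 1) \<in> RR"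
  have "R.val (- t) (rot (i, j + 1)) < R.val (- t) (rot (i, j))"
    by (rule R.val_row[OF RR_rev_strip[OF rotz_rectz[OF x(2)]] RR_rev_strip[OF rotz_rectz[OF x(1)]]]) (auto simp: rotz_def)
  thus ?thesis using glued_val_rot[OF x(1), of t] glued_val_rot[OF x(2), of t] False n_le_m by simp
qed

lemma glued_val_col: "(i, j) \<in> RR \<Longrightarrow> (i + 1, j) \<in> RR \<Longrightarrow> glued_val t (i, j) < glued_val t (i + 1, j)"
proof (cases "i + j + 1 \<le> int m + 1")
  case True
  assume "(i, j) \<in> RR" "(i + 1, j) \<in> RR"
  thus ?thesis using True val_col[of "(i, j)" "(i + 1, j)" t] RR_strip by (simp add: glued_val_def)
next
  case False
  assume x: "(i, j) \<in> RR" "(i + 1, j) \<in> RR"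
  have "R.val (- t) (rot (i + 1, j)) < R.val (- t) (rot (i, j))"
    by (rule R.val_col[OF RR_rev_strip[OF rotz_rectz[OF x(2)]] RR_rev_strip[OF rotz_rectz[OF x(1)]]]) (auto simp: rotz_def)
  thus ?thesis using glued_val_rot[OF x(1), of t] glued_val_rot[OF x(2), of t] False n_le_m by simp
qed

lemma glued_val_mono: "x \<in> RR \<Longrightarrow> y \<in> RR \<Longrightarrow> le2 x y \<Longrightarrow> glued_val t x \<le> glued_val t y"
proof -
  assume x: "x \<in> RR" and y: "y \<in> RR" and le: "le2 x y"
  have a: "glued_val t (fst x, snd x) \<le> glued_val t (fst x, snd x + int e)" if "snd x + int e \<le> int m" for e
    using that
  proof (induction e)
    case (Suc e)
    have "glued_val t (fst x, snd x + int e) < glued_val t (fst x, snd x + int e + 1)" using Suc.prems x by (intro glued_val_row) (auto simp: rectz_def)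
    thus ?case using Suc by (simp add: algebra_simps)
  qed simp
  have b: "glued_val t (fst x, snd y) \<le> glued_val t (fst x + int e, snd y)" if "fst x + int e \<le> int n" for e
    using that
  proof (induction e)
    case (Suc e)
    have "glued_val t (fst x + int e, snd y) < glued_val t (fst x + int e + 1, snd y)" using Suc.prems x y by (intro glued_val_col) (auto simp: rectz_def)
    thus ?case using Suc by (simp add: algebra_simps)
  qed simp
  have "snd x + int (nat (snd y - snd x)) = snd y" "fst x + int (nat (fst y - fst x)) = fst y" using le by auto
  moreover have "snd y \<le> int m" "fst y \<le> int n" using y by (auto simp: rectz_def)
  ultimately have "glued_val t (fst x, snd x) \<le> glued_val t (fst x, snd y)" "glued_val t (fst x, snd y) \<le> glued_val t (fst y, snd y)"
    using a[of "nat (snd y - snd x)"] b[of "nat (fst y - fst x)"] by auto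
  thus ?thesis by simp
qed

lemma glued_val_range: "x \<in> RR \<Longrightarrow> t < glued_val t x \<and> glued_val t x \<le> t + int m * int n"
proof -
  assume x: "x \<in> RR"
  have o: "(1, 1) \<in> RR" "(int n, int m) \<in> RR" using n_pos n_le_m by (auto simp: rectz_def)
  have "glued_val t (1, 1) = t + 1" using F.V_first[of t] n_pos n_le_m by (simp add: glued_val_def)
  moreover have "glued_val t (int n, int m) = int m * int n + t"
    using glued_val_rot[OF o(2), of t] R.F.V_first[of "- t"] n_pos n_le_m by (simp add: rotz_def)
  ultimately show ?thesis using glued_val_mono[OF o(1) x, of t] glued_val_mono[OF x o(2), of t] x by (auto simp: rectz_def)
qed

text \<open>If the universal position of \<open>k\<close> lies too far to the right, its class is
  that of its row \<open>r\<close>. Comparison with the box \<open>(r, m + 1 - r)\<close> of the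
  band shows that the complementary entry \<open>m * n + 1 - k\<close> lies in the needed part of
  the rotated tableau.\<close>

lemma glued_val_surj:
  assumes k: "t < k" "k \<le> t + int m * int n"
  shows "\<exists>x\<in>RR. glued_val t x = k"
proof (cases "fst (pos t k) + snd (pos t k) \<le> int m + 1")
  case True
  have "pos t k \<in> RR" using pos_strip[OF k(1)] True by (cases "pos t k") (auto simp: strip_def rectz_def)
  thus ?thesis using True val_pos[OF k(1)] by (intro bexI[of _ "pos t k"]) (auto simp: glued_val_def)
next
  case False
  define r where "r = fst (pos t k)"
  define k' where "k' = int m * int n + 1 - k"
  have r: "1 \<le> r" "r \<le> int n" using pos_strip[OF k(1)] by (auto simp: strip_def r_def)
  have ck: "c k = r" using class_row[OF pos_strip[OF k(1)], of t] val_pos[OF k(1)] False n_le_m by (simp add: r_def)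
  have "c (1 - k') = c k" using per_mult[of k "- int m"] by (simp add: k'_def algebra_simps)
  hence rck: "rev_class k' = int n + 1 - r" using ck by (simp add: rev_class_def)
  have x1: "(r, int m + 1 - r) \<in> RR" using r n_le_m by (auto simp: rectz_def)
  have x2: "(int n + 1 - r, r) \<in> R.strip" using r by (auto simp: R.strip_def)
  have "val t (r, int m + 1 - r) \<le> k"
    using val_mono[OF RR_strip[OF x1] pos_strip[OF k(1)], of t] val_pos[OF k(1)] False by (simp add: r_def)
  moreover have "val t (r, int m + 1 - r) + R.val (- t) (int n + 1 - r, r) = int m * int n + 1"
    using glue[OF r, of "int m + 1 - r" "int m" t] n_le_m by simp
  ultimately have le: "k' \<le> R.val (- t) (int n + 1 - r, r)" by (simp add: k'_def)
  have tk': "- t < k'" using k by (simp add: k'_def)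
  have "rev_class (R.val (- t) (int n + 1 - r, r)) = int n + 1 - r" using R.class_row[OF x2, of "- t"] by simp
  hence "int n dvd R.val (- t) (int n + 1 - r, r) - k'" using R.c_eq_iff rck by metis
  hence le2: "le2 (R.pos (- t) k') (int n + 1 - r, r)"
    using R.F.P_class[OF R.val_gt[OF x2] tk' le] R.pos_val[OF x2, of "- t"] by simp
  define x where "x = rot (R.pos (- t) k')"
  have pd: "1 \<le> fst (R.pos (- t) k')" "1 \<le> snd (R.pos (- t) k')" using R.pos_strip[OF tk'] by (auto simp: R.strip_def)
  have xR: "x \<in> RR" using le2 pd r n_le_m by (auto simp: x_def rotz_def rectz_def)
  have "glued_val t x = int m * int n + 1 - R.val (- t) (R.pos (- t) k')"
    using glued_val_rot[OF xR, of t] le2 n_le_m by (simp add: x_def) (simp add: rotz_def)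
  also have "\<dots> = k" using R.val_pos[OF tk'] by (simp add: k'_def)
  finally show ?thesis using xR by blast
qed

lemma glued_val_bij: "bij_betw (glued_val t) RR {t<..t + int m * int n}"
proof -
  have im: "glued_val t ` RR = {t<..t + int m * int n}" using glued_val_surj[of t] glued_val_range[of _ t] by (auto simp: image_iff; blast)
  have "card RR = n * m" by (simp add: rectz_def card_cartesian_product)
  moreover have "card {t<..t + int m * int n} = n * m" by (simp add: mult.commute flip: of_nat_mult)
  ultimately have "inj_on (glued_val t) RR" using im by (intro eq_card_imp_inj_on) (auto simp: rectz_def)
  thus ?thesis using im by (simp add: bij_betw_def)
qed

definition glued_pos :: "int \<Rightarrow> int \<Rightarrow> int \<times> int" where "glued_pos t k = inv_into RR (glued_val t) k"

lemma glued_pos_val: "x \<in> RR \<Longrightarrow> glued_pos t (glued_val t x) = x"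
  using glued_val_bij[of t] by (simp add: glued_pos_def bij_betw_def)

lemma glued_pos_RR: "t < k \<Longrightarrow> k \<le> t + int m * int n \<Longrightarrow> glued_pos t k \<in> RR \<and> glued_val t (glued_pos t k) = k"
  using glued_val_bij[of t] inv_into_into[of k "glued_val t" RR] f_inv_into_f[of k "glued_val t" RR] by (auto simp: glued_pos_def bij_betw_def)

lemma glued_val_shift: "x \<in> RR \<Longrightarrow> glued_val (t + int n) x = glued_val t x + int n"
  using val_shift[OF RR_strip, of x t] R.val_shift[OF RR_rev_strip[OF rotz_rectz], of x "- t - int n"] by (simp add: glued_val_def)

text \<open>Rotation reverses time, so in the south-east part a step is a step of the rotated
  tableau read backwards.\<close>

lemma glued_pos_move:
  assumes k: "t + 1 < k" "k \<le> t + int m * int n"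
  shows "nw_step (glued_pos (t + 1) k) (glued_pos t k)"
proof -
  define x where "x = glued_pos t k"
  have tk: "t < k" using k by simp
  have x: "x \<in> RR" "glued_val t x = k" using glued_pos_RR[OF tk k(2)] by (auto simp: x_def)
  have "\<exists>y\<in>RR. glued_val (t + 1) y = k \<and> nw_step y x"
  proof (cases "fst x + snd x \<le> int m + 1")
    case True
    have px: "pos t k = x" using x True pos_val[OF RR_strip[OF x(1)], of t] by (simp add: glued_val_def)
    define y where "y = pos (t + 1) k"
    have nwy: "nw_step y x" using pos_next[OF k(1)] px by (simp add: y_def)
    have yD: "y \<in> strip" using pos_strip[OF k(1)] by (simp add: y_def)
    have "fst y + snd y \<le> int m + 1" "le2 y x" using nw_step_le[OF nwy] True by auto
    moreover have "y \<in> RR" using yD x(1) \<open>le2 y x\<close> by (cases y) (auto simp: strip_def rectz_def)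
    ultimately show ?thesis using nwy val_pos[OF k(1)] by (intro bexI[of _ y]) (auto simp: glued_val_def y_def)
  next
    case False
    define k' where "k' = int m * int n + 1 - k"
    have k'1: "- (t + 1) + 1 < k'" using k by (simp add: k'_def)
    have v: "R.val (- t) (rot x) = k'" using x False by (simp add: glued_val_def k'_def)
    have px: "R.pos (- t) k' = rot x" using v R.pos_val[OF RR_rev_strip[OF rotz_rectz[OF x(1)]], of "- t"] by simp
    define y where "y = R.pos (- t - 1) k'"
    have nwy: "nw_step (rot x) y" using R.pos_next[OF k'1] px by (simp add: y_def)
    have yD: "y \<in> R.strip" using R.pos_strip[of "- t - 1" k'] k by (simp add: y_def k'_def)
    have lev: "fst y + snd y \<le> fst (rot x) + snd (rot x) + 1" using nwy by (auto simp: nw_step_def)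
    have yR: "y \<in> RR" using yD lev False n_le_m by (cases y) (auto simp: R.strip_def rectz_def rotz_def)
    have "glued_val (t + 1) (rot y) = int m * int n + 1 - R.val (- t - 1) y"
      using glued_val_rot[OF rotz_rectz[OF yR], of "t + 1"] lev False n_le_m by (simp add: rotz_def)
    also have "\<dots> = k" using R.val_pos[of "- t - 1" k'] k by (simp add: y_def k'_def)
    finally have "glued_val (t + 1) (rot y) = k" .
    moreover have "nw_step (rot y) x" using nwy by (cases x; cases y) (auto simp: nw_step_def rotz_def)
    ultimately show ?thesis using rotz_rectz[OF yR] by blast
  qed
  then obtain y where y: "y \<in> RR" "glued_val (t + 1) y = k" "nw_step y x" by blast
  have "glued_pos (t + 1) k = y" using glued_pos_val[OF y(1), of "t + 1"] y(2) by simp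
  thus ?thesis using y(3) by (simp add: x_def)
qed

end

section \<open>Uniqueness of states with small covering numbers\<close>

text \<open>\<open>C i\<close> is the column of the diagonal box in row \<open>i\<close>, and
  \<open>L\<close> is the diagram consisting of the diagonal and everything north-west of
  it.\<close>

locale diag =
  fixes n :: nat and C :: "int \<Rightarrow> int"
  assumes C_dec: "\<And>i. 1 \<le> i \<Longrightarrow> i < int n \<Longrightarrow> C (i + 1) < C i" and C_last: "1 \<le> C (int n)"
begin

definition L :: "(int \<times> int) set" where "L = {x. 1 \<le> fst x \<and> fst x \<le> int n \<and> 1 \<le> snd x \<and> snd x \<le> C (fst x)}"

lemma C_gap: "1 \<le> i \<Longrightarrow> i \<le> i' \<Longrightarrow> i' \<le> int n \<Longrightarrow> C i' + (i' - i) \<le> C i"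
proof -
  assume i: "1 \<le> i" "i \<le> i'" "i' \<le> int n"
  have "C (i + int e) + int e \<le> C i" if "i + int e \<le> int n" for e
    using that
  proof (induction e)
    case (Suc e)
    have "C (i + int e + 1) < C (i + int e)" using Suc.prems i by (intro C_dec) auto
    thus ?case using Suc by (simp add: algebra_simps)
  qed simp
  from this[of "nat (i' - i)"] show ?thesis using i by simp
qed

text \<open>A strictly decreasing sequence that ends with at least 1 keeps every diagonal box on or
  beyond the antidiagonal, where residues determine rows.\<close>

lemma C_lower: "1 \<le> i \<Longrightarrow> i \<le> int n \<Longrightarrow> int n + 1 \<le> i + C i"
  using C_gap[of i "int n"] C_last by simp

lemma C_pos: "1 \<le> i \<Longrightarrow> i \<le> int n \<Longrightarrow> 1 \<le> C i"
  using C_lower[of i] by simp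

lemma L_down: "x \<in> L \<Longrightarrow> le2 y x \<Longrightarrow> 1 \<le> fst y \<Longrightarrow> 1 \<le> snd y \<Longrightarrow> y \<in> L"
  using C_gap[of "fst y" "fst x"] by (auto simp: L_def)

lemma corner_L: "1 \<le> s \<Longrightarrow> s \<le> int n \<Longrightarrow> (s, C s) \<in> L"
  using C_pos by (simp add: L_def)

lemma corner_max: "1 \<le> s \<Longrightarrow> s \<le> int n \<Longrightarrow> x \<in> L \<Longrightarrow> le2 (s, C s) x \<Longrightarrow> x = (s, C s)"
  using C_gap[of s "fst x"] by (cases x) (auto simp: L_def)

end

locale diag_rods = rods n c + diag n C for n c C
begin

lemma L_strip: "x \<in> L \<Longrightarrow> x \<in> strip"
  by (simp add: L_def strip_def)

text \<open>By induction on \<open>k\<close>: the row bound puts \<open>k\<close> no higher than in the universal tableau, and if it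
  were lower, it would lie in a column to the left, against the column bound.\<close>

lemma bounded_state_unique:
  fixes p :: "int \<Rightarrow> int \<times> int" and v :: "int \<Rightarrow> int"
  assumes inj: "inj_on p A" and im: "p ` A = L"
    and mono: "\<And>a b. a \<in> A \<Longrightarrow> b \<in> A \<Longrightarrow> le2 (p a) (p b) \<Longrightarrow> a \<le> b"
    and A: "\<And>k. k \<in> A \<longleftrightarrow> 0 < k \<and> k \<le> v (c k)"
    and v: "\<And>s. 1 \<le> s \<Longrightarrow> s \<le> int n \<Longrightarrow> v s \<in> A \<and> p (v s) = (s, C s) \<and> c (v s) = s"
    and rowc: "\<And>k. k \<in> A \<Longrightarrow> fst (p k) \<le> c k"
    and rows: "\<And>k R. cover (\<lambda>a. if a \<in> A then fst (p a) else c a) {0<..k} R \<le> row_cover 0 k R"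
    and cols: "\<And>k R. cover (\<lambda>a. if a \<in> A then snd (p a) else C (c a)) {0<..k} R \<le> cover (\<lambda>a. - c a) {0<..k} R"
    and k: "k \<in> A"
  shows "pos 0 k = p k"
proof -
  define rw where "rw = (\<lambda>a. if a \<in> A then fst (p a) else c a)"
  define box_class where "box_class = (\<lambda>a. if a \<in> A then snd (p a) else C (c a))"
  have pL: "p a \<in> L" if "a \<in> A" for a using im that by auto
  have rw1: "1 \<le> rw a" for a using pL[of a] c_range[of a] by (auto simp: rw_def L_def)
  have cl1: "1 \<le> box_class a" for a using pL[of a] c_range[of a] C_pos by (auto simp: box_class_def L_def)
  have "0 < k" using k A by simp
  hence "k \<in> A \<longrightarrow> pos 0 k = p k"
  proof (induction "nat k" arbitrary: k rule: less_induct)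
    case less
    have IH: "pos 0 a = p a" if "0 < a" "a < k" "a \<in> A" for a
      using less.hyps[of a] that less.prems by auto
    \<comment> \<open>In the universal tableau an entry later than the corner entry of its class
      lies to the right of the corner in the same row. So its default row letter is its true row,
      and its default column letter is smaller than its true column.\<close>
    have out: "row_of 0 a = c a \<and> C (c a) < col_of 0 a" if a: "0 < a" "a < k" "a \<notin> A" for a
    proof -
      define s where "s = c a"
      have s: "1 \<le> s" "s \<le> int n" using c_range by (auto simp: s_def)
      have va: "v s < a" using a A[of a] by (simp add: s_def)
      have "v s \<in> A" "p (v s) = (s, C s)" using v[OF s] by auto
      hence ps: "pos 0 (v s) = (s, C s)" using IH[of "v s"] A[of "v s"] va a by simp
      have v0: "0 < v s" using \<open>v s \<in> A\<close> A by simp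
      have D: "(s, C s) \<in> strip" using L_strip[OF corner_L[OF s]] .
      have vs: "val 0 (s, C s) = v s" using val_pos[OF v0] ps by simp
      have ct: "fst (pos 0 a) = s \<and> C s \<le> snd (pos 0 a)"
        using class_tail[OF D, of 0 a] C_lower[OF s] vs va s_def by (metis fst_conv less_imp_le snd_conv)
      moreover have "pos 0 a \<noteq> (s, C s)" using vs val_pos[of 0 a] a va by auto
      ultimately have "row_of 0 a = s \<and> C s < col_of 0 a" by (auto simp: pos_def)
      thus ?thesis unfolding s_def .
    qed
    have eq: "rw a = row_of 0 a" if a: "0 < a" "a < k" for a
      using IH[OF a] out[OF a] by (cases "a \<in> A") (auto simp: rw_def pos_def prod_eq_iff)
    show ?case
    proof
      assume kA: "k \<in> A"
      obtain i' j' where p: "p k = (i', j')" by (cases "p k")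
      define i where "i = row_of 0 k"
      define j where "j = col_of 0 k"
      have pk: "pos 0 k = (i, j)" by (simp add: pos_def i_def j_def)
      have ij: "1 \<le> i" "i \<le> int n" "1 \<le> j" using pos_strip[OF less.prems] pk by (auto simp: strip_def)
      have L': "(i', j') \<in> L" using pL[OF kA] p by simp
      hence ij': "1 \<le> i'" "i' \<le> int n" "1 \<le> j'" "j' \<le> C i'" by (auto simp: L_def)
      \<comment> \<open>A higher box for \<open>k\<close> would give the first \<open>i'\<close>
        rows one entry more than the universal tableau has there.\<close>
      have row: "i \<le> i'"
      proof (rule ccontr)
        assume no: "\<not> i \<le> i'"
        define R where "R = nat i'"
        have R: "int R = i'" using ij' by (simp add: R_def)
        have "{a\<in>{0<..k}. rw a \<le> int R} = insert k {a\<in>{0<..k}. row_of 0 a \<le> int R}"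
        proof (intro set_eqI iffI)
          fix a assume "a \<in> {a\<in>{0<..k}. rw a \<le> int R}"
          thus "a \<in> insert k {a\<in>{0<..k}. row_of 0 a \<le> int R}" using eq[of a] by (cases "a = k") auto
        next
          fix a assume a: "a \<in> insert k {a\<in>{0<..k}. row_of 0 a \<le> int R}"
          show "a \<in> {a\<in>{0<..k}. rw a \<le> int R}"
          proof (cases "a = k")
            case True thus ?thesis using less.prems kA p R by (simp add: rw_def)
          next
            case False thus ?thesis using a eq[of a] by auto
          qed
        qed
        moreover have "k \<notin> {a\<in>{0<..k}. row_of 0 a \<le> int R}" using no R by (simp add: i_def)
        moreover have "finite {a\<in>{0<..k}. row_of 0 a \<le> int R}" by simp
        ultimately have "card {a\<in>{0<..k}. rw a \<le> int R} = Suc (card {a\<in>{0<..k}. row_of 0 a \<le> int R})"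
          by (simp only: card_insert_disjoint not_False_eq_True)
        moreover have "card {a\<in>{0<..k}. rw a \<le> int R} \<le> cover rw {0<..k} R" by (rule cover_ge_rows) (use rw1 in auto)
        moreover have "cover rw {0<..k} R \<le> row_cover 0 k R" using rows[of k R] by (simp add: rw_def)
        ultimately show False using row_of_rows[of 0 k R] by simp
      qed
      have "i = i'"
      proof (rule ccontr)
        assume "i \<noteq> i'"
        hence lt: "i < i'" using row by simp
        \<comment> \<open>Beyond the antidiagonal the universal tableau has \<open>k\<close> in the
          row of its class, and \<open>rowc\<close> excludes any lower row.\<close>
        have lev: "i + j \<le> int n"
        proof (rule ccontr)
          assume "\<not> i + j \<le> int n"
          hence "c k = i" using class_row[OF pos_strip[OF less.prems], of 0] val_pos[OF less.prems] pk by simp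
          thus False using rowc[OF kA] p lt by simp
        qed
        have jj: "j' < j"
        proof (rule ccontr)
          assume "\<not> j' < j"
          hence "(i, j) \<in> L" using L_down[OF L', of "(i, j)"] lt ij by simp
          then obtain a where a: "a \<in> A" "p a = (i, j)" using im by (metis imageE)
          have "a \<le> k" using mono[OF a(1) kA] a p lt \<open>\<not> j' < j\<close> by simp
          moreover have "a \<noteq> k" using a p lt by auto
          ultimately have "pos 0 a = (i, j)" using IH[of a] a A[of a] by simp
          hence "a = k" using pos_inj[of 0 a k] pk a(1) A[of a] less.prems by simp
          thus False using \<open>a \<noteq> k\<close> by simp
        qed
        define R where "R = nat (j - 1)"
        have R: "int R = j - 1" using ij by (simp add: R_def)
        \<comment> \<open>All entries of the first \<open>j - 1\<close> bent columns, and
          \<open>k\<close> in addition, have a column letter of at most \<open>j - 1\<close>; this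
          is one entry more than \<open>neg_cover\<close> admits.\<close>
        have "insert k {a\<in>{0<..k}. bent_col 0 a \<le> int R} \<subseteq> {a\<in>{0<..k}. box_class a \<le> int R}"
        proof
          fix a assume a: "a \<in> insert k {a\<in>{0<..k}. bent_col 0 a \<le> int R}"
          have btk: "bent_col 0 k = j" using pk lev by (simp add: bent_col_def)
          show "a \<in> {a\<in>{0<..k}. box_class a \<le> int R}"
          proof (cases "a = k")
            case True thus ?thesis using less.prems kA p jj R by (simp add: box_class_def)
          next
            case False
            hence a': "0 < a" "a < k" "bent_col 0 a \<le> j - 1" using a R by auto
            have far: "snd (pos 0 a) < j" if "i \<le> fst (pos 0 a)"
            proof (rule ccontr)
              assume "\<not> snd (pos 0 a) < j"
              hence "val 0 (i, j) \<le> val 0 (pos 0 a)"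
                using val_mono[of "(i, j)" "pos 0 a" 0] that pos_strip[OF a'(1)] pos_strip[OF less.prems] pk by simp
              thus False using val_pos[OF a'(1)] val_pos[OF less.prems] pk a' by simp
            qed
            have sn: "snd (pos 0 a) < j"
            proof (cases "fst (pos 0 a) + snd (pos 0 a) \<le> int n + 1")
              case True thus ?thesis using a' by (simp add: bent_col_def)
            next
              case False
              hence "i \<le> fst (pos 0 a)" using a' lev by (simp add: bent_col_def)
              thus ?thesis by (rule far)
            qed
            have "box_class a \<le> snd (pos 0 a)"
            proof (cases "a \<in> A")
              case True thus ?thesis using IH[OF a'(1,2)] by (simp add: box_class_def)
            next
              case False thus ?thesis using out[OF a'(1,2)] by (simp add: box_class_def pos_def)
            qed
            thus ?thesis using sn a' R by simp
          qed
        qed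
        hence "card (insert k {a\<in>{0<..k}. bent_col 0 a \<le> int R}) \<le> card {a\<in>{0<..k}. box_class a \<le> int R}" by (intro card_mono) auto
        moreover have "k \<notin> {a\<in>{0<..k}. bent_col 0 a \<le> int R}" using pk lev R by (simp add: bent_col_def)
        moreover have "finite {a\<in>{0<..k}. bent_col 0 a \<le> int R}" by simp
        ultimately have "Suc (card {a\<in>{0<..k}. bent_col 0 a \<le> int R}) \<le> card {a\<in>{0<..k}. box_class a \<le> int R}"
          by (simp only: card_insert_disjoint not_False_eq_True)
        also have "\<dots> \<le> cover box_class {0<..k} R" by (rule cover_ge_rows) (use cl1 in auto)
        also have "\<dots> \<le> cover (\<lambda>a. - c a) {0<..k} R" using cols[of k R] by (simp add: box_class_def)
        also have "\<dots> \<le> card {a\<in>{0<..k}. bent_col 0 a \<le> int R}" by (rule neg_cover)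
        finally show False by simp
      qed
      \<comment> \<open>If \<open>j < j'\<close>, the box \<open>(i, j)\<close> already holds a
        smaller entry, which by induction is also there in the universal tableau. If
        \<open>j' < j\<close>, the universal entry of \<open>(i, j')\<close> is smaller than
        \<open>k\<close> and competes with \<open>k\<close> for that box.\<close>
      have "j = j'"
      proof (cases j j' rule: linorder_cases)
        case less2: less
        have "(i, j) \<in> L" using L_down[OF L', of "(i, j)"] \<open>i = i'\<close> less2 ij by simp
        then obtain a where a: "a \<in> A" "p a = (i, j)" using im by (metis imageE)
        have "a \<le> k" using mono[OF a(1) kA] a p \<open>i = i'\<close> less2 by simp
        moreover have ne: "a \<noteq> k" using a p less2 by auto
        ultimately have "pos 0 a = (i, j)" using IH[of a] a A[of a] by simp
        hence "a = k" using pos_inj[of 0 a k] pk a(1) A[of a] less.prems by simp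
        thus ?thesis using ne by simp
      next
        case greater
        define a where "a = val 0 (i, j')"
        have D: "(i, j') \<in> strip" "(i, j) \<in> strip" using ij ij' by (auto simp: strip_def)
        have a0: "0 < a" using val_gt[OF D(1)] by (simp add: a_def)
        have ak: "a < k" using val_row[OF D, of 0] greater val_pos[OF less.prems] pk by (simp add: a_def)
        show ?thesis
        proof (cases "a \<in> A")
          case True
          hence "p a = (i, j')" using IH[OF a0 ak] pos_val[OF D(1), of 0] by (simp add: a_def)
          hence "a = k" using inj True kA p \<open>i = i'\<close> by (auto simp: inj_on_def)
          thus ?thesis using ak by simp
        next
          case False
          hence "C (c a) < col_of 0 a" "row_of 0 a = c a" using out[OF a0 ak] by auto
          hence "C i < j'" using row_of_val[OF D(1), of 0] col_of_val[OF D(1), of 0] by (simp add: a_def)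
          thus ?thesis using ij' \<open>i = i'\<close> by simp
        qed
      qed simp
      thus "pos 0 k = p k" using pk p \<open>i = i'\<close> by simp
    qed
  qed
  thus ?thesis using k by simp
qed

end

section \<open>Promotion-periodic families\<close>

locale rflow = flow n "rectz n m" "\<lambda>t k. t < k \<and> k \<le> t + int m * int n" P V
  for n m :: nat and P V +
  assumes n_le_m: "n \<le> m"
begin

lemma V_le: "x \<in> rectz n m \<Longrightarrow> V t x \<le> t + int m * int n"
  using V_live[of x t] by simp

lemma live_later:
  assumes "t + 1 < a" "a \<le> t + int m * int n"
  shows "t < a \<and> a \<le> t + int m * int n" "t + 1 < a \<and> a \<le> t + 1 + int m * int n"
  using assms by auto

lemma V_strict: "x \<in> rectz n m \<Longrightarrow> y \<in> rectz n m \<Longrightarrow> le2 x y \<Longrightarrow> x \<noteq> y \<Longrightarrow> V t x < V t y"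
  using V_mono[of x y t] V_inj[of x y t] by fastforce

lemma V_last: "V t (int n, int m) = t + int m * int n"
proof -
  have o: "(int n, int m) \<in> rectz n m" using n_ge1 n_le_m by (auto simp: rectz_def)
  define k where "k = t + int m * int n"
  have "0 < int m * int n" using n_ge1 n_le_m by simp
  hence k: "t < k \<and> k \<le> t + int m * int n" by (simp add: k_def)
  have "V t (P t k) \<le> V t (int n, int m)" using V_mono[OF P_D[OF k] o, of t] P_D[OF k] by (auto simp: rectz_def)
  thus ?thesis using V_P[OF k] V_le[OF o, of t] by (simp add: k_def)
qed

text \<open>After rotation entries move south-east as time advances, hence north-west when time is
  read backwards.\<close>

lemma rflow_rot: "rflow n m (\<lambda>t k. rotz n m (P (- t) (int m * int n + 1 - k))) (\<lambda>t x. int m * int n + 1 - V (- t) (rotz n m x))"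
proof
  show "1 \<le> n" by (rule n_ge1)
  show "n \<le> m" by (rule n_le_m)
  show "(1, 1) \<in> rectz n m" by (rule D_first)
  fix t k
  assume l: "t < k \<and> k \<le> t + int m * int n"
  hence l': "- t < int m * int n + 1 - k \<and> int m * int n + 1 - k \<le> - t + int m * int n" by auto
  show "rotz n m (P (- t) (int m * int n + 1 - k)) \<in> rectz n m" using rotz_rectz[OF P_D[OF l']] .
  show "int m * int n + 1 - V (- t) (rotz n m (rotz n m (P (- t) (int m * int n + 1 - k)))) = k" using V_P[OF l'] by simp
next
  fix t k
  assume l: "t < k \<and> k \<le> t + int m * int n" and k: "t + 1 < k"
  define k' where "k' = int m * int n + 1 - k"
  have l1: "- t - 1 < k' \<and> k' \<le> - t - 1 + int m * int n" using l k by (auto simp: k'_def)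
  have "nw_step (P (- t - 1 + 1) k') (P (- t - 1) k')" by (rule move[OF l1]) (use l in \<open>auto simp: k'_def\<close>)
  hence "nw_step (P (- t) k') (P (- (t + 1)) k')" by simp
  thus "nw_step (rotz n m (P (- (t + 1)) (int m * int n + 1 - k))) (rotz n m (P (- t) (int m * int n + 1 - k)))"
    unfolding k'_def[symmetric] by (cases "P (- t) k'"; cases "P (- (t + 1)) k'") (auto simp: nw_step_def rotz_def)
next
  fix x t assume x: "x \<in> rectz n m"
  note v = V_live[OF rotz_rectz[OF x], of "- t"]
  show "t < int m * int n + 1 - V (- t) (rotz n m x) \<and> int m * int n + 1 - V (- t) (rotz n m x) \<le> t + int m * int n" using v by auto
  show "rotz n m (P (- t) (int m * int n + 1 - (int m * int n + 1 - V (- t) (rotz n m x)))) = x" using P_V[OF rotz_rectz[OF x], of "- t"] by simp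
  show "1 \<le> fst x \<and> 1 \<le> snd x" using D_pos[OF x] .
  show "int m * int n + 1 - V (- (t + int n)) (rotz n m x) = int m * int n + 1 - V (- t) (rotz n m x) + int n"
    using V_shift[OF rotz_rectz[OF x], of "- t - int n"] by simp
next
  fix x y t assume x: "x \<in> rectz n m" "y \<in> rectz n m" "le2 x y"
  thus "int m * int n + 1 - V (- t) (rotz n m x) \<le> int m * int n + 1 - V (- t) (rotz n m y)"
    using V_mono[OF rotz_rectz[OF x(2)] rotz_rectz[OF x(1)], of "- t"] by (simp add: rotz_def)
qed auto

end

lemma (in glued) glued_rflow: "rflow n m glued_pos glued_val"
proof
  show "1 \<le> n" by (rule n_pos)
  show "n \<le> m" by (rule n_le_m)
  show "(1, 1) \<in> rectz n m" using n_pos n_le_m by (auto simp: rectz_def)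
  fix t k assume l: "t < k \<and> k \<le> t + int m * int n"
  show "glued_pos t k \<in> rectz n m" "glued_val t (glued_pos t k) = k" using glued_pos_RR[of t k] l by auto
  show "t + 1 < k \<Longrightarrow> nw_step (glued_pos (t + 1) k) (glued_pos t k)" using glued_pos_move l by blast
next
  fix x t assume x: "x \<in> rectz n m"
  show "t < glued_val t x \<and> glued_val t x \<le> t + int m * int n" by (rule glued_val_range[OF x])
  show "glued_pos t (glued_val t x) = x" by (rule glued_pos_val[OF x])
  show "1 \<le> fst x \<and> 1 \<le> snd x" using x by (auto simp: rectz_def)
  show "glued_val (t + int n) x = glued_val t x + int n" by (rule glued_val_shift[OF x])
next
  fix x y t assume "x \<in> rectz n m" "y \<in> rectz n m" "le2 x y"
  thus "glued_val t x \<le> glued_val t y" by (rule glued_val_mono)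
qed auto

section \<open>Reading a promotion-periodic family off a diagonal\<close>

locale dflow = rflow n m P V + diag n C for n m P V C +
  assumes C_first: "C 1 \<le> int m"
begin

lemma L_rectz: "x \<in> L \<Longrightarrow> x \<in> rectz n m"
  using C_gap[of 1 "fst x"] C_first by (cases x) (auto simp: L_def rectz_def)

lemma corner_rectz: "1 \<le> s \<Longrightarrow> s \<le> int n \<Longrightarrow> (s, C s) \<in> rectz n m"
  using L_rectz corner_L by blast

lemma corner_incomparable: "1 \<le> s \<Longrightarrow> s \<le> int n \<Longrightarrow> 1 \<le> s' \<Longrightarrow> s' \<le> int n \<Longrightarrow> s \<noteq> s' \<Longrightarrow> \<not> le2 (s, C s) (s', C s')"
  using C_gap[of s s'] by auto

text \<open>The corners are \<open>n\<close> pairwise incomparable boxes, so their residues are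
  distinct and exhaust all classes.\<close>

lemma corner_residues: "(\<lambda>s. V t (s, C s) mod int n) ` {1..int n} = {0..<int n}"
  and corner_residues_inj: "inj_on (\<lambda>s. V t (s, C s) mod int n) {1..int n}"
proof -
  show inj: "inj_on (\<lambda>s. V t (s, C s) mod int n) {1..int n}"
  proof (rule inj_onI)
    fix s s' assume s: "s \<in> {1..int n}" "s' \<in> {1..int n}" and e: "V t (s, C s) mod int n = V t (s', C s') mod int n"
    show "s = s'"
    proof (rule ccontr)
      assume ne: "s \<noteq> s'"
      have "\<not> int n dvd V t (s, C s) - V t (s', C s')"
        by (rule antichain_class[OF corner_rectz corner_rectz]) (use s ne corner_incomparable[of s s'] corner_incomparable[of s' s] in auto)
      thus False using e by (simp add: mod_eq_dvd_iff)
    qed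
  qed
  show "(\<lambda>s. V t (s, C s) mod int n) ` {1..int n} = {0..<int n}"
    by (rule card_subset_eq) (use n_ge1 card_image[OF inj] in auto)
qed

text \<open>At most one corner changes its entry, and the residues of the corners are a permutation.\<close>

lemma corner_step:
  assumes s: "1 \<le> s" "s \<le> int n"
  shows "V (t + 1) (s, C s) mod int n = V t (s, C s) mod int n"
proof (cases "V (t + 1) (s, C s) = V t (s, C s)")
  case False
  have other: "V (t + 1) (s', C s') = V t (s', C s')" if s': "1 \<le> s'" "s' \<le> int n" "s' \<noteq> s" for s'
  proof -
    have inc: "\<not> le2 (s', C s') (s, C s)" "\<not> le2 (s, C s) (s', C s')" using corner_incomparable s s' by metis+
    have ne: "(s', C s') \<noteq> (1, 1)" "(s, C s) \<noteq> (1, 1)"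
      using inc C_pos[OF s] C_pos[OF s'(1,2)] s s' by auto
    define k where "k = V t (s, C s)"
    have "k \<noteq> t + 1" using V_inj[OF corner_rectz[OF s] D_first, of t] V_first ne by (auto simp: k_def)
    moreover have l: "t < k \<and> k \<le> t + int m * int n" using V_live[OF corner_rectz[OF s], of t] by (simp add: k_def)
    ultimately have k1: "t + 1 < k" by simp
    have Pk: "P t k = (s, C s)" using P_V[OF corner_rectz[OF s]] by (simp add: k_def)
    have "P (t + 1) k \<noteq> P t k"
    proof
      assume "P (t + 1) k = P t k"
      hence "V (t + 1) (s, C s) = k" using V_P[of "t + 1" k] Pk l k1 by simp
      thus False using False by (simp add: k_def)
    qed
    thus ?thesis using not_vacated[OF corner_rectz[OF s'(1,2)] ne(1) l k1] Pk inc by simp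
  qed
  have "V (t + 1) (s, C s) mod int n \<in> (\<lambda>s. V t (s, C s) mod int n) ` {1..int n}"
    unfolding corner_residues using n_ge1 by simp
  then obtain s' where s': "s' \<in> {1..int n}" "V (t + 1) (s, C s) mod int n = V t (s', C s') mod int n" by blast
  show ?thesis
  proof (cases "s' = s")
    case False
    hence "V (t + 1) (s, C s) mod int n = V (t + 1) (s', C s') mod int n" using other[of s'] s' by simp
    hence "s = s'" using corner_residues_inj[of "t + 1"] s s' by (auto simp: inj_on_def)
    thus ?thesis using False by simp
  qed (use s' in simp)
qed simp

lemma corner_const:
  assumes s: "1 \<le> s" "s \<le> int n"
  shows "V t (s, C s) mod int n = V 0 (s, C s) mod int n"
proof (induction t rule: int_induct[where k = 0])
  case (step1 i)
  thus ?case using corner_step[OF s, of i] by simp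
next
  case (step2 i)
  thus ?case using corner_step[OF s, of "i - 1"] by simp
qed simp

text \<open>The corners keep their residues, so time 0 serves merely as a reference.\<close>

definition box_class :: "int \<Rightarrow> int" where
  "box_class k = (THE s. 1 \<le> s \<and> s \<le> int n \<and> k mod int n = V 0 (s, C s) mod int n)"

lemma box_class_eqI: "1 \<le> s \<Longrightarrow> s \<le> int n \<Longrightarrow> k mod int n = V t (s, C s) mod int n \<Longrightarrow> box_class k = s"
  unfolding box_class_def using corner_const[of s t] corner_residues_inj[of 0]
  by (intro the_equality) (auto simp: inj_on_def)

lemma box_class_props: "1 \<le> box_class k \<and> box_class k \<le> int n \<and> k mod int n = V t (box_class k, C (box_class k)) mod int n"
proof -
  have "k mod int n \<in> (\<lambda>s. V t (s, C s) mod int n) ` {1..int n}"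
    unfolding corner_residues using n_ge1 by simp
  then obtain s where "s \<in> {1..int n}" "k mod int n = V t (s, C s) mod int n" by blast
  thus ?thesis using box_class_eqI[of s k t] by auto
qed

lemma rods_box_class: "rods n box_class"
proof
  show "1 \<le> n" by (rule n_ge1)
  fix k show "box_class (k + int n) = box_class k" by (simp add: box_class_def)
next
  have inj: "inj_on box_class {1..int n}"
  proof (rule inj_onI)
    fix x y assume x: "x \<in> {1..int n}" and y: "y \<in> {1..int n}" and e: "box_class x = box_class y"
    have "x mod int n = y mod int n" using box_class_props[of x 0] box_class_props[of y 0] e by simp
    hence "int n dvd x - y" by (simp add: mod_eq_dvd_iff)
    thus "x = y" using x y dvd_imp_le_int[of "x - y" "int n"] by (cases "x = y") auto
  qed
  have "box_class ` {1..int n} = {1..int n}"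
    by (rule card_subset_eq) (use box_class_props card_image[OF inj] in auto)
  thus "bij_betw box_class {1..int n} {1..int n}" using inj by (simp add: bij_betw_def)
qed

sublocale Q: diag_rods n box_class C
  by (intro diag_rods.intro rods_box_class diag_axioms)

lemma class_before:
  assumes k: "t < k" "k \<le> V t (box_class k, C (box_class k))"
  shows "le2 (P t k) (box_class k, C (box_class k))"
proof -
  note c = box_class_props[of k t]
  have x: "(box_class k, C (box_class k)) \<in> rectz n m" using corner_rectz c by blast
  have "int n dvd V t (box_class k, C (box_class k)) - k" using c by (metis mod_eq_dvd_iff)
  thus ?thesis using P_class[OF V_live[OF x] k(1,2)] P_V[OF x, of t] by simp
qed

lemma class_after:
  assumes k: "k \<le> t + int m * int n" "V t (box_class k, C (box_class k)) \<le> k"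
  shows "le2 (box_class k, C (box_class k)) (P t k)"
proof -
  note c = box_class_props[of k t]
  have x: "(box_class k, C (box_class k)) \<in> rectz n m" using corner_rectz c by blast
  have "int n dvd k - V t (box_class k, C (box_class k))" using c by (metis mod_eq_dvd_iff)
  thus ?thesis using P_class[of t k "V t (box_class k, C (box_class k))"] k V_gt[OF x, of t] P_V[OF x, of t] by auto
qed

text \<open>Up to the corner entry of its class an entry lies north-west of that corner, after it
  south-east; and \<open>L\<close> has no box beyond a corner.\<close>

lemma class_comparable:
  assumes k: "t < k" "k \<le> t + int m * int n"
  shows "P t k \<in> L \<and> le2 (P t k) (box_class k, C (box_class k)) \<or> le2 (box_class k, C (box_class k)) (P t k) \<and> (P t k \<notin> L \<or> P t k = (box_class k, C (box_class k)))"
proof -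
  note c = box_class_props[of k t]
  have cL: "(box_class k, C (box_class k)) \<in> L" using corner_L c by blast
  have pd: "1 \<le> fst (P t k) \<and> 1 \<le> snd (P t k)" using D_pos[OF P_D[of t k]] k by simp
  show ?thesis
  proof (cases "k \<le> V t (box_class k, C (box_class k))")
    case True
    hence "le2 (P t k) (box_class k, C (box_class k))" using class_before k by blast
    thus ?thesis using L_down[OF cL] pd by blast
  next
    case False
    hence "le2 (box_class k, C (box_class k)) (P t k)" using class_after k by simp
    thus ?thesis using corner_max[of "box_class k" "P t k"] c by blast
  qed
qed

text \<open>The entry is south-east of its corner before the step and north-west of it afterwards; a
  single step leaves only the corner itself.\<close>

lemma enter_corner:
  assumes a: "t + 1 < a" "a \<le> t + int m * int n" and out: "P t a \<notin> L" and inn: "P (t + 1) a \<in> L"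
  shows "P (t + 1) a = (box_class a, C (box_class a))"
proof -
  note l = live_later[OF a]
  have 1: "le2 (box_class a, C (box_class a)) (P t a)" using class_comparable[of t a] l out by blast
  have 2: "le2 (P (t + 1) a) (box_class a, C (box_class a))" using class_comparable[of "t + 1" a] l inn by auto
  have "(box_class a, C (box_class a)) \<in> L" using corner_L box_class_props by blast
  hence ne: "P t a \<noteq> (box_class a, C (box_class a))" using out by auto
  have "nw_step (P (t + 1) a) (P t a)" using move[OF l(1) a(1)] .
  thus ?thesis using 1 2 ne by (cases "P t a"; cases "P (t + 1) a") (auto simp: nw_step_def)
qed

text \<open>An entry outside \<open>L\<close> is south-east of its corner and hence not smaller than
  any entry north-west of that corner. Entries that have not yet appeared are larger anyway.\<close>

lemma outside_later:
  assumes y: "t + 1 < y" "y \<le> t + int m * int n" and a: "t + 1 < a"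
    and out: "\<not> (t < a \<and> a \<le> t + int m * int n \<and> t + 1 < a) \<or> P (t + 1) a \<notin> L"
    and le: "le2 (P (t + 1) y) (box_class a, C (box_class a))"
  shows "y \<le> a"
proof (cases "a \<le> t + int m * int n")
  case True
  note la = live_later[OF a True]
  note ly = live_later[OF y]
  have "P (t + 1) a \<notin> L" using out la by auto
  hence "le2 (box_class a, C (box_class a)) (P (t + 1) a)" using class_comparable[of "t + 1" a] la by blast
  hence "le2 (P (t + 1) y) (P (t + 1) a)" using le by auto
  thus ?thesis using P_mono[OF ly(2) la(2)] by blast
qed (use y in simp)

lemma occupied:
  assumes x: "x \<in> rectz n m" "z \<in> rectz n m" "le2 x z" "x \<noteq> z"
  shows "\<exists>b\<in>{a. (t < a \<and> a \<le> t + int m * int n) \<and> t + 1 < a}. P (t + 1) b = x"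
proof (rule bexI[of _ "V (t + 1) x"])
  show "P (t + 1) (V (t + 1) x) = x" by (rule P_V[OF x(1)])
  show "V (t + 1) x \<in> {a. (t < a \<and> a \<le> t + int m * int n) \<and> t + 1 < a}"
    using V_gt[OF x(1), of "t + 1"] V_strict[OF x(1,2,3,4), of "t + 1"] V_le[OF x(2), of "t + 1"] by auto
qed

text \<open>The new largest entry sits in box \<open>(n, m)\<close>, which can belong to
  \<open>L\<close> only as a corner.\<close>

lemma newcomer:
  assumes a: "0 < a" "t + 1 \<le> 0" "\<not> (t < a \<and> a \<le> t + int m * int n)" "t + 1 < a \<and> a \<le> t + 1 + int m * int n" "P (t + 1) a \<in> L"
  shows "P (t + 1) a = (box_class a, C (box_class a))"
proof -
  have "a = V (t + 1) (int n, int m)" using a V_last[of "t + 1"] by auto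
  hence Pa: "P (t + 1) a = (int n, int m)" using P_V[of "(int n, int m)" "t + 1"] n_ge1 n_le_m by (auto simp: rectz_def)
  have "C (int n) \<le> int m" using C_gap[of 1 "int n"] C_first n_ge1 by simp
  hence e: "(int n, int m) = (int n, C (int n))" using a(5) Pa by (auto simp: L_def)
  have "box_class a = int n" by (rule box_class_eqI[of _ _ "t + 1"]) (use n_ge1 e \<open>a = _\<close> in auto)
  thus ?thesis using e Pa by simp
qed

definition observed :: "int \<Rightarrow> int \<Rightarrow> bool" where "observed t a \<longleftrightarrow> (t < a \<and> a \<le> t + int m * int n) \<and> P t a \<in> L"

text \<open>An entry outside \<open>L\<close> counts with the row of its class, which is the row in
  which it enters \<open>L\<close>. Appearing and entering therefore change no letter, and only the
  moves inside \<open>L\<close> have to be examined.\<close>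

lemma rows_step:
  assumes t: "t + 1 \<le> 0"
  shows "cover (\<lambda>a. if observed (t + 1) a then fst (P (t + 1) a) else box_class a) {0<..k} R
    \<le> cover (\<lambda>a. if observed t a then fst (P t a) else box_class a) {0<..k} R"
proof -
  define A where "A = {a. (t < a \<and> a \<le> t + int m * int n) \<and> t + 1 < a}"
  have "cover (\<lambda>a. if observed (t + 1) a then fst (P (t + 1) a) else box_class a) {0<..k} R
    = cover (\<lambda>a. if a \<in> A \<and> P (t + 1) a \<in> L then fst (P (t + 1) a) else box_class a) {0<..k} R"
  proof (rule cover_cong)
    fix a assume "a \<in> {0<..k}"
    thus "(if observed (t + 1) a then fst (P (t + 1) a) else box_class a) = (if a \<in> A \<and> P (t + 1) a \<in> L then fst (P (t + 1) a) else box_class a)"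
      using newcomer[of a t] t by (cases "a \<in> A") (auto simp: A_def observed_def)
  qed simp
  also have "\<dots> \<le> cover (\<lambda>a. if a \<in> A \<and> P t a \<in> L then fst (P t a) else box_class a) {0<..k} R"
  proof (rule step_cover)
    show "inj_on (P (t + 1)) A" by (rule inj_onI) (use P_inj[of "t + 1"] in \<open>auto simp: A_def\<close>)
    fix a assume a: "a \<in> A"
    show "nw_step (P (t + 1) a) (P t a)" using move[of t a] a by (simp add: A_def)
    show "P t a \<in> L \<Longrightarrow> P (t + 1) a \<in> L"
      using L_down nw_step_le[OF move[of t a]] D_pos[OF P_D[of "t + 1" a]] a by (auto simp: A_def)
    show "P t a \<notin> L \<Longrightarrow> P (t + 1) a \<in> L \<Longrightarrow> box_class a = fst (P (t + 1) a)"
      using enter_corner[of t a] a by (auto simp: A_def)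
    fix b assume b: "b \<in> A"
    show "P (t + 1) a \<noteq> P t a \<Longrightarrow> P (t + 1) b \<noteq> P t b \<Longrightarrow> le2 (P t a) (P t b) \<or> le2 (P t b) (P t a)"
      by (rule moved_comparable) (use a b in \<open>auto simp: A_def\<close>)
    show "le2 (P t a) (P t b) \<Longrightarrow> a \<le> b" by (rule P_mono[of t a b]) (use a b in \<open>auto simp: A_def\<close>)
    show "le2 (P (t + 1) a) (P (t + 1) b) \<Longrightarrow> a \<le> b" by (rule P_mono[of "t + 1" a b]) (use a b in \<open>auto simp: A_def\<close>)
  next
    fix a y r j j' assume a: "a \<in> A" "y \<in> A" and y: "P t y = (r + 1, j)" "P t y \<in> L" "P (t + 1) y = (r, j)"
      and p: "P (t + 1) a = (r, j')" "P (t + 1) a \<in> L" "j' < j"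
    have x: "(r + 1, j') \<in> L" using L_down[of "(r + 1, j)" "(r + 1, j')"] y p by (auto simp: L_def)
    moreover have "\<exists>b\<in>A. P (t + 1) b = (r + 1, j')"
      unfolding A_def by (rule occupied[of _ "(r + 1, j)"]) (use x y p L_rectz in auto)
    ultimately show "(r + 1, j') \<in> L \<and> (\<exists>m\<in>A. P (t + 1) m = (r + 1, j'))" by blast
  next
    fix a y r j assume y: "y \<in> A" "P t y = (r + 1, j)" "P t y \<in> L" "P (t + 1) y = (r, j)"
      and a: "0 < a" "a \<notin> A \<or> P (t + 1) a \<notin> L" "box_class a = r"
    have "(r, j) \<in> L" using L_down[of "P t y" "(r, j)"] y D_pos[OF P_D[of "t + 1" y]] by (auto simp: A_def)
    hence le: "le2 (P (t + 1) y) (box_class a, C (box_class a))" using a y by (auto simp: L_def)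
    show "y \<le> a" by (rule outside_later[of t y a]) (use y a t le in \<open>auto simp: A_def\<close>)
  qed
  also have "\<dots> = cover (\<lambda>a. if observed t a then fst (P t a) else box_class a) {0<..k} R"
    by (rule cover_cong) (use t in \<open>auto simp: A_def observed_def\<close>)
  finally show ?thesis .
qed

text \<open>The argument for rows with all positions transposed; the default letter of an entry
  becomes the column of the corner of its class.\<close>

lemma cols_step:
  assumes t: "t + 1 \<le> 0"
  shows "cover (\<lambda>a. if observed (t + 1) a then snd (P (t + 1) a) else C (box_class a)) {0<..k} R
    \<le> cover (\<lambda>a. if observed t a then snd (P t a) else C (box_class a)) {0<..k} R"
proof -
  define A where "A = {a. (t < a \<and> a \<le> t + int m * int n) \<and> t + 1 < a}"
  define LL where "LL = {x. prod.swap x \<in> L}"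
  define p where "p = (\<lambda>a. prod.swap (P t a))"
  define p' where "p' = (\<lambda>a. prod.swap (P (t + 1) a))"
  have "cover (\<lambda>a. if observed (t + 1) a then snd (P (t + 1) a) else C (box_class a)) {0<..k} R
    = cover (\<lambda>a. if a \<in> A \<and> p' a \<in> LL then fst (p' a) else C (box_class a)) {0<..k} R"
  proof (rule cover_cong)
    fix a assume "a \<in> {0<..k}"
    thus "(if observed (t + 1) a then snd (P (t + 1) a) else C (box_class a)) = (if a \<in> A \<and> p' a \<in> LL then fst (p' a) else C (box_class a))"
      using newcomer[of a t] t by (cases "a \<in> A") (auto simp: A_def observed_def p'_def LL_def)
  qed simp
  also have "\<dots> \<le> cover (\<lambda>a. if a \<in> A \<and> p a \<in> LL then fst (p a) else C (box_class a)) {0<..k} R"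
  proof (rule step_cover)
    show "inj_on p' A"
    proof (rule inj_onI)
      fix x y assume "x \<in> A" "y \<in> A" "p' x = p' y"
      moreover from this have "P (t + 1) x = P (t + 1) y" unfolding p'_def by (metis swap_swap)
      ultimately show "x = y" using P_inj[of "t + 1" x y] by (auto simp: A_def)
    qed
    fix a assume a: "a \<in> A"
    show "nw_step (p' a) (p a)" using move[of t a] a by (auto simp: A_def p_def p'_def nw_step_def prod_eq_iff)
    show "p a \<in> LL \<Longrightarrow> p' a \<in> LL"
      using L_down nw_step_le[OF move[of t a]] D_pos[OF P_D[of "t + 1" a]] a by (auto simp: A_def p_def p'_def LL_def)
    show "p a \<notin> LL \<Longrightarrow> p' a \<in> LL \<Longrightarrow> C (box_class a) = fst (p' a)"
      using enter_corner[of t a] a by (auto simp: A_def p_def p'_def LL_def)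
    fix b assume b: "b \<in> A"
    show "p' a \<noteq> p a \<Longrightarrow> p' b \<noteq> p b \<Longrightarrow> le2 (p a) (p b) \<or> le2 (p b) (p a)"
    proof -
      assume "p' a \<noteq> p a" "p' b \<noteq> p b"
      hence "P (t + 1) a \<noteq> P t a" "P (t + 1) b \<noteq> P t b" by (auto simp: p_def p'_def)
      hence "le2 (P t a) (P t b) \<or> le2 (P t b) (P t a)" using moved_comparable[of t a b] a b by (auto simp: A_def)
      thus ?thesis by (auto simp: p_def)
    qed
    show "le2 (p a) (p b) \<Longrightarrow> a \<le> b" using P_mono[of t a b] a b by (auto simp: A_def p_def)
    show "le2 (p' a) (p' b) \<Longrightarrow> a \<le> b" using P_mono[of "t + 1" a b] a b by (auto simp: A_def p'_def)
  next
    fix a y r j j' assume a: "a \<in> A" "y \<in> A" and y0: "p y = (r + 1, j)" "p y \<in> LL" "p' y = (r, j)"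
      and p0: "p' a = (r, j')" "p' a \<in> LL" "j' < j"
    have y: "P t y = (j, r + 1)" "P t y \<in> L" "P (t + 1) y = (j, r)" and p: "P (t + 1) a = (j', r)" "P (t + 1) a \<in> L" "j' < j"
      using y0 p0 by (auto simp: p_def p'_def LL_def prod_eq_iff)
    have x: "(j', r + 1) \<in> L" using L_down[of "(j, r + 1)" "(j', r + 1)"] y p by (auto simp: L_def)
    have "\<exists>b\<in>A. P (t + 1) b = (j', r + 1)"
      unfolding A_def by (rule occupied[of _ "(j, r + 1)"]) (use x y p L_rectz in auto)
    then obtain b where "b \<in> A" "P (t + 1) b = (j', r + 1)" by blast
    thus "(r + 1, j') \<in> LL \<and> (\<exists>m\<in>A. p' m = (r + 1, j'))" using x by (auto simp: LL_def p'_def intro!: bexI[of _ b])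
  next
    fix a y r j assume y0: "y \<in> A" "p y = (r + 1, j)" "p y \<in> LL" "p' y = (r, j)"
      and a: "0 < a" "a \<notin> A \<or> p' a \<notin> LL" "C (box_class a) = r"
    have y: "P t y = (j, r + 1)" "P t y \<in> L" "P (t + 1) y = (j, r)"
      using y0 by (auto simp: p_def p'_def LL_def prod_eq_iff)
    have "j \<le> box_class a"
    proof (rule ccontr)
      assume "\<not> j \<le> box_class a"
      hence "C j \<le> C (box_class a)" using C_gap[of "box_class a" j] box_class_props[of a 0] y by (auto simp: L_def)
      thus False using y a by (auto simp: L_def)
    qed
    hence le: "le2 (P (t + 1) y) (box_class a, C (box_class a))" using a y by auto
    show "y \<le> a" by (rule outside_later[of t y a]) (use y0 a t le in \<open>auto simp: A_def p'_def LL_def\<close>)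
  qed
  also have "\<dots> = cover (\<lambda>a. if observed t a then snd (P t a) else C (box_class a)) {0<..k} R"
    by (rule cover_cong) (use t in \<open>auto simp: A_def observed_def p_def LL_def\<close>)
  finally show ?thesis .
qed

lemma rows_bound: "cover (\<lambda>a. if observed 0 a then fst (P 0 a) else box_class a) {0<..k} R \<le> Q.row_cover 0 k R"
proof -
  have "cover (\<lambda>a. if observed 0 a then fst (P 0 a) else box_class a) {0<..k} R
     \<le> cover (\<lambda>a. if observed (- int i) a then fst (P (- int i) a) else box_class a) {0<..k} R" for i
  proof (induction i)
    case 0
    show ?case by (simp only: of_nat_0 minus_zero order_refl)
  next
    case (Suc i)
    have e: "- int (Suc i) + 1 = - int i" by simp
    show ?case by (rule order_trans[OF Suc rows_step[of "- int (Suc i)" k R, unfolded e]]) simp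
  qed
  \<comment> \<open>At time \<open>- (m * n)\<close> no positive entry is present, so every letter
    in the window is a default letter.\<close>
  from this[of "m * n"] show ?thesis
    unfolding Q.row_cover_def by (rule order_trans) (rule eq_imp_le, rule cover_cong, auto simp: observed_def)
qed

lemma cols_bound: "cover (\<lambda>a. if observed 0 a then snd (P 0 a) else C (box_class a)) {0<..k} R \<le> cover (\<lambda>a. - box_class a) {0<..k} R"
proof -
  have "cover (\<lambda>a. if observed 0 a then snd (P 0 a) else C (box_class a)) {0<..k} R
     \<le> cover (\<lambda>a. if observed (- int i) a then snd (P (- int i) a) else C (box_class a)) {0<..k} R" for i
  proof (induction i)
    case 0
    show ?case by (simp only: of_nat_0 minus_zero order_refl)
  next
    case (Suc i)
    have e: "- int (Suc i) + 1 = - int i" by simp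
    show ?case by (rule order_trans[OF Suc cols_step[of "- int (Suc i)" k R, unfolded e]]) simp
  qed
  from this[of "m * n"] have "cover (\<lambda>a. if observed 0 a then snd (P 0 a) else C (box_class a)) {0<..k} R
     \<le> cover (\<lambda>a. if observed (- int (m * n)) a then snd (P (- int (m * n)) a) else C (box_class a)) {0<..k} R" .
  also have "\<dots> = cover (\<lambda>a. C (box_class a)) {0<..k} R" by (rule cover_cong) (auto simp: observed_def)
  also have "\<dots> \<le> cover (\<lambda>a. - box_class a) {0<..k} R"
  proof (rule cover_mono)
    fix a b assume le: "C (box_class b) \<le> C (box_class a)"
    show "- box_class b \<le> - box_class a"
    proof (rule ccontr)
      assume "\<not> ?thesis"
      hence "box_class b < box_class a" by simp
      hence "C (box_class a) < C (box_class b)" using C_gap[of "box_class b" "box_class a"] box_class_props[of a 0] box_class_props[of b 0] by simp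
      thus False using le by simp
    qed
  qed simp
  finally show ?thesis .
qed

text \<open>The bounds transported from the remote past are the hypotheses of
  \<open>bounded_state_unique\<close> at time 0.\<close>

theorem lower_val: "x \<in> L \<Longrightarrow> V 0 x = Q.val 0 x"
proof -
  assume x: "x \<in> L"
  define A where "A = {a. observed 0 a}"
  have stI: "observed 0 (V 0 x)" "P 0 (V 0 x) = x" if "x \<in> L" for x
    using V_live[OF L_rectz[OF that], of 0] P_V[OF L_rectz[OF that], of 0] that by (auto simp: observed_def)
  have "Q.pos 0 (V 0 x) = P 0 (V 0 x)"
  proof (rule Q.bounded_state_unique[where A = A and v = "\<lambda>s. V 0 (s, C s)"])
    show "inj_on (P 0) A" by (rule inj_onI) (use P_inj[of 0] in \<open>auto simp: A_def observed_def\<close>)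
    show "P 0 ` A = L" using stI by (force simp: A_def observed_def)
    show "V 0 x \<in> A" using stI[OF x] by (simp add: A_def)
    fix k R
    show "cover (\<lambda>a. if a \<in> A then fst (P 0 a) else box_class a) {0<..k} R \<le> Q.row_cover 0 k R"
      using rows_bound[of k R] by (simp add: A_def)
    show "cover (\<lambda>a. if a \<in> A then snd (P 0 a) else C (box_class a)) {0<..k} R \<le> cover (\<lambda>a. - box_class a) {0<..k} R"
      using cols_bound[of k R] by (simp add: A_def)
  next
    fix a b assume "a \<in> A" "b \<in> A" "le2 (P 0 a) (P 0 b)"
    thus "a \<le> b" using P_mono[of 0 a b] by (auto simp: A_def observed_def)
  next
    fix k
    note c = box_class_props[of k 0]
    have xr: "(box_class k, C (box_class k)) \<in> rectz n m" "(box_class k, C (box_class k)) \<in> L" using corner_rectz corner_L c by blast+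
    show "k \<in> A \<longleftrightarrow> 0 < k \<and> k \<le> V 0 (box_class k, C (box_class k))"
    proof
      assume k: "k \<in> A"
      hence k': "0 < k" "k \<le> 0 + int m * int n" "P 0 k \<in> L" by (auto simp: A_def observed_def)
      have "le2 (P 0 k) (box_class k, C (box_class k))" using class_comparable[OF k'(1,2)] k'(3) by auto
      hence "V 0 (P 0 k) \<le> V 0 (box_class k, C (box_class k))" using V_mono[OF P_D xr(1), of 0 k] k' by simp
      thus "0 < k \<and> k \<le> V 0 (box_class k, C (box_class k))" using V_P[of 0 k] k' by simp
    next
      assume k: "0 < k \<and> k \<le> V 0 (box_class k, C (box_class k))"
      hence k': "k \<le> 0 + int m * int n" using V_le[OF xr(1), of 0] by simp
      have "le2 (P 0 k) (box_class k, C (box_class k))" using class_before k by blast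
      moreover have "1 \<le> fst (P 0 k) \<and> 1 \<le> snd (P 0 k)" using D_pos[OF P_D[of 0 k]] k k' by simp
      ultimately have "P 0 k \<in> L" using L_down[OF xr(2)] by blast
      thus "k \<in> A" using k k' by (simp add: A_def observed_def)
    qed
    assume k: "k \<in> A"
    hence k': "0 < k" "k \<le> 0 + int m * int n" "P 0 k \<in> L" by (auto simp: A_def observed_def)
    show "fst (P 0 k) \<le> box_class k" using class_comparable[OF k'(1,2)] k'(3) by auto
  next
    fix s assume s: "1 \<le> s" "s \<le> int n"
    show "V 0 (s, C s) \<in> A \<and> P 0 (V 0 (s, C s)) = (s, C s) \<and> box_class (V 0 (s, C s)) = s"
      using stI[OF corner_L[OF s]] box_class_eqI[OF s, of "V 0 (s, C s)" 0] by (simp add: A_def)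
  qed
  hence "Q.pos 0 (V 0 x) = x" using stI[OF x] by simp
  thus ?thesis using Q.val_pos[of 0 "V 0 x"] V_gt[OF L_rectz[OF x], of 0] by simp
qed

definition Cr :: "int \<Rightarrow> int" where "Cr s = int m + 1 - C (int n + 1 - s)"

lemma diag_Cr: "diag n Cr"
proof
  fix i assume "1 \<le> i" "i < int n"
  thus "Cr (i + 1) < Cr i" using C_dec[of "int n - i"] by (simp add: Cr_def algebra_simps)
qed (use C_first in \<open>simp add: Cr_def\<close>)

text \<open>This is \<open>lower_val\<close> for the rotated family and the rotated diagonal; its
  class function is \<open>rev_class\<close> because \<open>m * n + 1 - k\<close> is
  \<open>1 - k\<close> modulo \<open>n\<close>.\<close>

theorem upper_val:
  assumes x: "x \<in> rectz n m" "C (fst x) \<le> snd x"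
  shows "V 0 x = int m * int n + 1 - rods.val Q.rev_class 0 (rotz n m x)"
proof -
  define P' where "P' = (\<lambda>t k. rotz n m (P (- t) (int m * int n + 1 - k)))"
  define V' where "V' = (\<lambda>t x. int m * int n + 1 - V (- t) (rotz n m x))"
  have rf: "rflow n m P' V'" unfolding P'_def V'_def by (rule rflow_rot)
  interpret U: dflow n m P' V' Cr
    by (intro dflow.intro rf diag_Cr dflow_axioms.intro) (use C_last in \<open>simp add: Cr_def\<close>)
  have e: "U.box_class = Q.rev_class"
  proof
    fix k
    define s where "s = box_class (1 - k)"
    have s: "1 \<le> s" "s \<le> int n" "(1 - k) mod int n = V 0 (s, C s) mod int n" using box_class_props[of "1 - k" 0] by (auto simp: s_def)
    have d: "int n dvd (1 - k) - V 0 (s, C s)" using s(3) by (simp add: mod_eq_dvd_iff)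
    have v: "V' 0 (int n + 1 - s, Cr (int n + 1 - s)) = int m * int n + 1 - V 0 (s, C s)" by (simp add: V'_def rotz_def Cr_def)
    have "k - (int m * int n + 1 - V 0 (s, C s)) = - ((1 - k) - V 0 (s, C s)) - int n * int m" by (simp add: algebra_simps)
    hence "int n dvd k - (int m * int n + 1 - V 0 (s, C s))" using d by (metis dvd_diff dvd_minus_iff dvd_triv_left)
    hence "U.box_class k = int n + 1 - s" by (intro U.box_class_eqI[of _ _ 0]) (use s v in \<open>auto simp: mod_eq_dvd_iff\<close>)
    thus "U.box_class k = Q.rev_class k" by (simp add: Q.rev_class_def s_def)
  qed
  have "rotz n m x \<in> U.L" using x by (auto simp: U.L_def rotz_def rectz_def Cr_def)
  hence "V' 0 (rotz n m x) = rods.val Q.rev_class 0 (rotz n m x)" using U.lower_val e by simp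
  thus ?thesis by (simp add: V'_def)
qed

end

section \<open>Runs of the filling procedure\<close>

context diag_rods begin

text \<open>A partial filling seen through its entries: \<open>A\<close> are the entries present,
  \<open>p\<close> gives their boxes and \<open>v s\<close> is the entry of the corner in row
  \<open>s\<close>. The last two clauses are the bounds of \<open>bounded_state_unique\<close>,
  where entries still absent carry the default letters of their class.\<close>

definition run_state :: "int set \<Rightarrow> (int \<Rightarrow> int \<times> int) \<Rightarrow> (int \<Rightarrow> int) \<Rightarrow> bool" where
  "run_state A p v \<longleftrightarrow> inj_on p A \<and> p ` A \<subseteq> L \<and> (\<forall>x\<in>p ` A. \<forall>y\<in>L. le2 x y \<longrightarrow> y \<in> p ` A) \<and>
     (\<forall>a\<in>A. \<forall>b\<in>A. le2 (p a) (p b) \<longrightarrow> a \<le> b) \<and>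
     (\<forall>s. 1 \<le> s \<and> s \<le> int n \<longrightarrow> v s \<in> A \<and> p (v s) = (s, C s) \<and> c (v s) = s) \<and>
     (\<forall>k. k \<in> A \<longleftrightarrow> 0 < k \<and> k \<le> v (c k)) \<and>
     (\<forall>a\<in>A. fst (p a) \<le> c a) \<and>
     (\<forall>k R. cover (\<lambda>a. if a \<in> A then fst (p a) else c a) {0<..k} R \<le> row_cover 0 k R) \<and>
     (\<forall>k R. cover (\<lambda>a. if a \<in> A then snd (p a) else C (c a)) {0<..k} R \<le> cover (\<lambda>a. - c a) {0<..k} R)"

lemma run_state_full: "run_state A p v \<Longrightarrow> p ` A = L \<Longrightarrow> k \<in> A \<Longrightarrow> pos 0 k = p k"
  by (rule bounded_state_unique[where v = v]) (auto simp: run_state_def)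

lemma C_anti: "1 \<le> s \<Longrightarrow> s \<le> int n \<Longrightarrow> 1 \<le> s' \<Longrightarrow> s' \<le> int n \<Longrightarrow> C s \<le> C s' \<Longrightarrow> s' \<le> s"
  using C_gap[of s s'] by force

text \<open>The entry placed in the emptied corner has the class of that corner, so its letters
  equal the default letters it had while absent. Only the sliding entries change letters, and
  \<open>step_cover\<close> controls them.\<close>

lemma run_state_step:
  assumes observed: "run_state A p v" and s0: "1 \<le> s0" "s0 \<le> int n"
    and mv: "\<And>a. a \<in> A \<Longrightarrow> nw_step (p' a) (p a)" and inj': "inj_on p' A"
    and mono': "\<And>a b. a \<in> A \<Longrightarrow> b \<in> A \<Longrightarrow> le2 (p' a) (p' b) \<Longrightarrow> a \<le> b"
    and im': "p' ` A = insert x (p ` A) - {(s0, C s0)}" and x: "x \<in> L"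
    and up: "\<And>y z. y \<in> insert x (p ` A) \<Longrightarrow> z \<in> L \<Longrightarrow> le2 y z \<Longrightarrow> z \<in> insert x (p ` A)"
    and xn: "x \<notin> p ` A"
  shows "run_state (insert (v s0 + int n) A) (p'(v s0 + int n := (s0, C s0))) (v(s0 := v s0 + int n))"
proof -
  define k0 where "k0 = v s0 + int n"
  have inj: "inj_on p A" and imL: "p ` A \<subseteq> L" using observed unfolding run_state_def by blast+
  have mono: "le2 (p a) (p b) \<Longrightarrow> a \<le> b" if "a \<in> A" "b \<in> A" for a b using observed that unfolding run_state_def by blast
  have v: "v s \<in> A" "p (v s) = (s, C s)" "c (v s) = s" if "1 \<le> s" "s \<le> int n" for s
    using observed that unfolding run_state_def by blast+
  have A: "k \<in> A \<longleftrightarrow> 0 < k \<and> k \<le> v (c k)" for k using observed unfolding run_state_def by blast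
  have rowc: "fst (p a) \<le> c a" if "a \<in> A" for a using observed that unfolding run_state_def by blast
  have rows: "cover (\<lambda>a. if a \<in> A then fst (p a) else c a) {0<..k} R \<le> row_cover 0 k R" for k R
    using observed unfolding run_state_def by blast
  have cols: "cover (\<lambda>a. if a \<in> A then snd (p a) else C (c a)) {0<..k} R \<le> cover (\<lambda>a. - c a) {0<..k} R" for k R
    using observed unfolding run_state_def by blast
  have pL: "p a \<in> L" if "a \<in> A" for a using imL that by blast
  have p'L: "p' a \<in> L" if "a \<in> A" for a
  proof -
    have "p' a \<in> insert x (p ` A)" using im' that by blast
    thus ?thesis using x imL by blast
  qed
  have pos': "1 \<le> fst (p' a) \<and> 1 \<le> snd (p' a)" if "a \<in> A" for a using p'L[OF that] by (simp add: L_def)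
  have hop_letter: "le2 (p a) (p b) \<or> le2 (p b) (p a)" if "a \<in> A" "b \<in> A" "p' a \<noteq> p a" "p' b \<noteq> p b" for a b
  proof (rule moved_chain[OF inj' mv pos' _ that])
    fix a assume "a \<in> A"
    thus "p' a = x \<or> (\<exists>b\<in>A. p b = p' a)" using im' by force
  qed
  have ck0: "c k0 = s0" using per[of "v s0"] v(3)[OF s0] by (simp add: k0_def)
  have k0A: "k0 \<notin> A" using A[of k0] ck0 n_pos by (simp add: k0_def)
  have s0p: "(s0, C s0) \<in> p ` A" using v[OF s0] by force
  have v0mv: "p' (v s0) \<noteq> p (v s0)"
  proof
    assume "p' (v s0) = p (v s0)"
    hence "(s0, C s0) \<in> p' ` A" using v[OF s0] by force
    thus False using im' by simp
  qed
  \<comment> \<open>No entry that is now north-west of the corner exceeds the old corner entry: a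
    moved one has an old box comparable to the corner, and no box of \<open>L\<close> lies beyond a
    corner. So the larger new corner entry respects monotonicity.\<close>
  have below: "a \<le> v s0" if a: "a \<in> A" "le2 (p' a) (s0, C s0)" for a
  proof (cases "p' a = p a")
    case True thus ?thesis using mono[of a "v s0"] a v[OF s0] by simp
  next
    case False
    have "le2 (p a) (p (v s0)) \<or> le2 (p (v s0)) (p a)" using hop_letter[OF a(1) v(1)[OF s0] False v0mv] .
    hence "le2 (p a) (s0, C s0)" using corner_max[OF s0 pL[OF a(1)]] v(2)[OF s0] by auto
    thus ?thesis using mono[of a "v s0"] a v[OF s0] by simp
  qed
  have v': "p' (v s) = (s, C s)" if s: "1 \<le> s" "s \<le> int n" "s \<noteq> s0" for s
  proof -
    have "(s, C s) \<in> p ` A" using v[OF s(1,2)] by force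
    hence "(s, C s) \<in> p' ` A" using im' s by auto
    then obtain a where a: "a \<in> A" "p' a = (s, C s)" by (metis imageE)
    have "p a = (s, C s)" using corner_max[OF s(1,2) pL[OF a(1)]] nw_step_le[OF mv[OF a(1)]] a by simp
    hence "a = v s" using inj a v[OF s(1,2)] by (auto simp: inj_on_def)
    thus ?thesis using a by simp
  qed
  define p2 where "p2 = p'(k0 := (s0, C s0))"
  define v2 where "v2 = v(s0 := k0)"
  define A2 where "A2 = insert k0 A"
  have p2A: "p2 a = p' a" if "a \<in> A" for a using that k0A by (auto simp: p2_def)
  have p2k: "p2 k0 = (s0, C s0)" by (simp add: p2_def)
  have im2: "p2 ` A2 = insert x (p ` A)"
  proof -
    have "p2 ` A = p' ` A" using p2A by simp
    thus ?thesis using im' s0p p2k xn by (auto simp: A2_def)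
  qed
  have 1: "inj_on p2 A2"
    unfolding A2_def
  proof (rule inj_on_insert[THEN iffD2], intro conjI)
    show "inj_on p2 A" using inj' p2A by (simp add: inj_on_def)
    have "p2 ` (A - {k0}) \<subseteq> p' ` A" using p2A by auto
    thus "p2 k0 \<notin> p2 ` (A - {k0})" using im' p2k by auto
  qed
  have 4: "a \<le> b" if ab: "a \<in> A2" "b \<in> A2" "le2 (p2 a) (p2 b)" for a b
  proof -
    consider "a = k0" "b = k0" | "a \<in> A" "b \<in> A" | "a \<in> A" "b = k0" | "a = k0" "b \<in> A" using ab by (auto simp: A2_def)
    thus ?thesis
    proof cases
      case 2 thus ?thesis using mono' ab p2A by metis
    next
      case 3
      hence "a \<le> v s0" using below ab p2A p2k by metis
      thus ?thesis using 3 by (simp add: k0_def)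
    next
      case 4
      hence "p' b = (s0, C s0)" using corner_max[OF s0 p'L[of b]] ab p2A[of b] p2k by simp
      thus ?thesis using im' 4 by blast
    qed simp
  qed
  have 5: "v2 s \<in> A2 \<and> p2 (v2 s) = (s, C s) \<and> c (v2 s) = s" if "1 \<le> s" "s \<le> int n" for s
    using v[OF that] v'[OF that] p2A p2k ck0 by (cases "s = s0") (auto simp: v2_def A2_def)
  have 6: "k \<in> A2 \<longleftrightarrow> 0 < k \<and> k \<le> v2 (c k)" for k
  proof (cases "c k = s0")
    case True
    have "int n dvd k - v s0" using c_eq_iff[of k "v s0"] v(3)[OF s0] True by simp
    then obtain z where z: "k - v s0 = int n * z" by (auto simp: dvd_def)
    have v0: "0 < v s0" using v(1)[OF s0] A by blast
    have "k \<le> k0 \<longleftrightarrow> k \<le> v s0 \<or> k = k0"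
    proof
      assume "k \<le> k0"
      hence "int n * z \<le> int n * 1" using z by (simp add: k0_def)
      hence "z \<le> 1" using n_pos by (simp add: mult_le_cancel_left)
      moreover have "int n * z \<le> 0" if "z \<le> 0" using that by (simp add: mult_nonneg_nonpos)
      ultimately show "k \<le> v s0 \<or> k = k0" using z by (cases "z = 1") (auto simp: k0_def)
    qed (auto simp: k0_def)
    thus ?thesis using A[of k] True v0 n_pos by (auto simp: A2_def v2_def k0_def)
  next
    case False
    thus ?thesis using A[of k] ck0 by (auto simp: A2_def v2_def)
  qed
  have 7: "fst (p2 a) \<le> c a" if "a \<in> A2" for a
  proof (cases "a = k0")
    case True thus ?thesis using p2k ck0 by simp
  next
    case False
    hence a: "a \<in> A" using that by (simp add: A2_def)
    show ?thesis using nw_step_le[OF mv[OF a]] rowc[OF a] p2A[OF a] by simp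
  qed
  \<comment> \<open>If \<open>y\<close> enters the part north-west of corner \<open>r\<close>, the
    entry of that corner has stayed in place; otherwise the corner and the old box of
    \<open>y\<close> would be comparable.\<close>
  have unm: "y \<le> v r" if y: "y \<in> A" "p' y \<noteq> p y" and r: "1 \<le> r" "r \<le> int n" and le: "le2 (p' y) (r, C r)" "\<not> le2 (p y) (r, C r)" for y r
  proof -
    have "p' (v r) = p (v r)"
    proof (rule ccontr)
      assume "p' (v r) \<noteq> p (v r)"
      hence "le2 (p y) (r, C r) \<or> le2 (r, C r) (p y)" using hop_letter[OF y(1) v(1)[OF r] y(2)] v(2)[OF r] by simp
      thus False using le corner_max[OF r pL[OF y(1)]] by auto
    qed
    thus ?thesis using mono'[OF y(1) v(1)[OF r]] v(2)[OF r] le by simp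
  qed
  have 8: "cover (\<lambda>a. if a \<in> A2 then fst (p2 a) else c a) {0<..k} R \<le> row_cover 0 k R" for k R
  proof -
    have "cover (\<lambda>a. if a \<in> A2 then fst (p2 a) else c a) {0<..k} R = cover (\<lambda>a. if a \<in> A \<and> p' a \<in> L then fst (p' a) else c a) {0<..k} R"
    proof (rule cover_cong)
      fix a show "(if a \<in> A2 then fst (p2 a) else c a) = (if a \<in> A \<and> p' a \<in> L then fst (p' a) else c a)"
        using p2A[of a] p2k ck0 k0A p'L[of a] by (cases "a = k0") (auto simp: A2_def)
    qed simp
    also have "\<dots> \<le> cover (\<lambda>a. if a \<in> A \<and> p a \<in> L then fst (p a) else c a) {0<..k} R"
    proof (rule step_cover[OF inj' mv hop_letter mono mono'])
      fix a assume "a \<in> A" thus "p' a \<in> L" by (rule p'L)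
    next
      fix a assume "a \<in> A" "p a \<notin> L" thus "c a = fst (p' a)" using pL by blast
    next
      fix a y r j j' assume a: "a \<in> A" "y \<in> A" and y: "p y = (r + 1, j)" "p y \<in> L" "p' y = (r, j)"
        and q: "p' a = (r, j')" "p' a \<in> L" "j' < j"
      have z: "(r + 1, j') \<in> L" using L_down[of "(r + 1, j)" "(r + 1, j')"] y q by (auto simp: L_def)
      have "(r, j') \<in> insert x (p ` A)" using im' q a by (metis DiffD1 imageI)
      hence "(r + 1, j') \<in> insert x (p ` A)" using up[of "(r, j')" "(r + 1, j')"] z by simp
      moreover have "(r + 1, j') \<noteq> (s0, C s0)" using y q by (auto simp: L_def)
      ultimately have "(r + 1, j') \<in> p' ` A" using im' by blast
      thus "(r + 1, j') \<in> L \<and> (\<exists>m\<in>A. p' m = (r + 1, j'))" using z by (metis imageE)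
    next
      fix a y r j assume y: "y \<in> A" "p y = (r + 1, j)" "p y \<in> L" "p' y = (r, j)"
        and a: "0 < a" "a \<notin> A \<or> p' a \<notin> L" "c a = r"
      have aA: "a \<notin> A" using a p'L by blast
      have r: "1 \<le> r" "r \<le> int n" using c_range[of a] a by auto
      have "(r, j) \<in> L" using p'L[OF y(1)] y by simp
      hence "y \<le> v r" using unm[OF y(1) _ r] y by (auto simp: L_def)
      thus "y \<le> a" using A[of a] aA a by simp
    qed auto
    also have "\<dots> = cover (\<lambda>a. if a \<in> A then fst (p a) else c a) {0<..k} R" by (rule cover_cong) (use pL in auto)
    also have "\<dots> \<le> row_cover 0 k R" by (rule rows)
    finally show ?thesis .
  qed
  have 9: "cover (\<lambda>a. if a \<in> A2 then snd (p2 a) else C (c a)) {0<..k} R \<le> cover (\<lambda>a. - c a) {0<..k} R" for k R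
  proof -
    define LL where "LL = {x. prod.swap x \<in> L}"
    define q where "q = (\<lambda>a. prod.swap (p a))"
    define q' where "q' = (\<lambda>a. prod.swap (p' a))"
    have qL: "q' a \<in> LL" "q a \<in> LL" if "a \<in> A" for a using p'L[OF that] pL[OF that] by (auto simp: LL_def q_def q'_def)
    have "cover (\<lambda>a. if a \<in> A2 then snd (p2 a) else C (c a)) {0<..k} R = cover (\<lambda>a. if a \<in> A \<and> q' a \<in> LL then fst (q' a) else C (c a)) {0<..k} R"
    proof (rule cover_cong)
      fix a show "(if a \<in> A2 then snd (p2 a) else C (c a)) = (if a \<in> A \<and> q' a \<in> LL then fst (q' a) else C (c a))"
        using p2A[of a] p2k ck0 k0A qL[of a] by (cases "a = k0") (auto simp: A2_def q'_def)
    qed simp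
    also have "\<dots> \<le> cover (\<lambda>a. if a \<in> A \<and> q a \<in> LL then fst (q a) else C (c a)) {0<..k} R"
    proof (rule step_cover)
      show "inj_on q' A"
      proof (rule inj_onI)
        fix a b assume "a \<in> A" "b \<in> A" "q' a = q' b"
        moreover from this have "p' a = p' b" unfolding q'_def by (metis swap_swap)
        ultimately show "a = b" using inj' by (auto simp: inj_on_def)
      qed
      fix a assume a: "a \<in> A"
      show "nw_step (q' a) (q a)" using mv[OF a] by (auto simp: q_def q'_def nw_step_def prod_eq_iff)
      show "q a \<in> LL \<Longrightarrow> q' a \<in> LL" using qL a by blast
      show "q a \<notin> LL \<Longrightarrow> q' a \<in> LL \<Longrightarrow> C (c a) = fst (q' a)" using qL a by blast
      fix b assume b: "b \<in> A"
      show "q' a \<noteq> q a \<Longrightarrow> q' b \<noteq> q b \<Longrightarrow> le2 (q a) (q b) \<or> le2 (q b) (q a)"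
      proof -
        assume "q' a \<noteq> q a" "q' b \<noteq> q b"
        hence "p' a \<noteq> p a" "p' b \<noteq> p b" by (auto simp: q_def q'_def)
        hence "le2 (p a) (p b) \<or> le2 (p b) (p a)" using hop_letter a b by blast
        thus ?thesis by (auto simp: q_def)
      qed
      show "le2 (q a) (q b) \<Longrightarrow> a \<le> b" using mono[OF a b] by (auto simp: q_def)
      show "le2 (q' a) (q' b) \<Longrightarrow> a \<le> b" using mono'[OF a b] by (auto simp: q'_def)
    next
      fix a y r j j' assume a: "a \<in> A" "y \<in> A" and y0: "q y = (r + 1, j)" "q y \<in> LL" "q' y = (r, j)"
        and q0: "q' a = (r, j')" "q' a \<in> LL" "j' < j"
      have y: "p y = (j, r + 1)" "p y \<in> L" "p' y = (j, r)" and q: "p' a = (j', r)" "p' a \<in> L" "j' < j"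
        using y0 q0 by (auto simp: q_def q'_def LL_def prod_eq_iff)
      have z: "(j', r + 1) \<in> L" using L_down[of "(j, r + 1)" "(j', r + 1)"] y q by (auto simp: L_def)
      have "(j', r) \<in> insert x (p ` A)" using im' q a by (metis DiffD1 imageI)
      hence "(j', r + 1) \<in> insert x (p ` A)" using up[of "(j', r)" "(j', r + 1)"] z by simp
      moreover have "(j', r + 1) \<noteq> (s0, C s0)"
      proof
        assume e: "(j', r + 1) = (s0, C s0)"
        hence "C j < C j'" using C_gap[of j' j] y q s0 by (auto simp: L_def)
        thus False using e y by (auto simp: L_def)
      qed
      ultimately have "(j', r + 1) \<in> p' ` A" using im' by blast
      then obtain b where "b \<in> A" "p' b = (j', r + 1)" by (metis imageE)
      thus "(r + 1, j') \<in> LL \<and> (\<exists>m\<in>A. q' m = (r + 1, j'))" using z by (auto simp: LL_def q'_def intro!: bexI[of _ b])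
    next
      fix a y r j assume y0: "y \<in> A" "q y = (r + 1, j)" "q y \<in> LL" "q' y = (r, j)"
        and a: "0 < a" "a \<notin> A \<or> q' a \<notin> LL" "C (c a) = r"
      have y: "p y = (j, r + 1)" "p y \<in> L" "p' y = (j, r)"
        using y0 by (auto simp: q_def q'_def LL_def prod_eq_iff)
      have aA: "a \<notin> A" using a qL by blast
      have r: "1 \<le> c a" "c a \<le> int n" using c_range[of a] by auto
      have "j \<le> c a"
      proof (rule ccontr)
        assume "\<not> j \<le> c a"
        hence "C j \<le> C (c a)" using C_gap[of "c a" j] r y by (auto simp: L_def)
        thus False using y a by (auto simp: L_def)
      qed
      hence "y \<le> v (c a)" using unm[OF y0(1) _ r] y a by auto
      thus "y \<le> a" using A[of a] aA a by simp
    qed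
    also have "\<dots> = cover (\<lambda>a. if a \<in> A then snd (p a) else C (c a)) {0<..k} R"
      by (rule cover_cong) (use qL in \<open>auto simp: q_def\<close>)
    also have "\<dots> \<le> cover (\<lambda>a. - c a) {0<..k} R" by (rule cols)
    finally show ?thesis .
  qed
  have "run_state A2 p2 v2"
    unfolding run_state_def im2
  proof (intro conjI allI ballI impI)
    show "insert x (p ` A) \<subseteq> L" using x imL by blast
    show "\<And>y z. y \<in> insert x (p ` A) \<Longrightarrow> z \<in> L \<Longrightarrow> le2 y z \<Longrightarrow> z \<in> insert x (p ` A)" by (rule up)
  qed (use 1 4 5 6 7 8 9 in blast)+
  thus ?thesis by (simp add: A2_def p2_def v2_def k0_def)
qed

text \<open>With only the corners filled, the letters read from the boxes coincide with the default
  letters. The row bound is then an equality, and the column bound holds because \<open>C\<close>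
  reverses the order of rows.\<close>

lemma run_state_init:
  assumes v: "\<And>s. 1 \<le> s \<Longrightarrow> s \<le> int n \<Longrightarrow> 1 \<le> v s \<and> v s \<le> int n \<and> c (v s) = s"
  shows "run_state {1..int n} (\<lambda>a. (c a, C (c a))) v"
  unfolding run_state_def
proof (intro conjI allI ballI impI)
  have vc: "v (c a) = a" if "a \<in> {1..int n}" for a
    using v[OF c_range] that bij by (metis atLeastAtMost_iff bij_betw_imp_inj_on inj_onD)
  show "inj_on (\<lambda>a. (c a, C (c a))) {1..int n}" by (rule inj_onI) (metis vc prod.inject)
  show "(\<lambda>a. (c a, C (c a))) ` {1..int n} \<subseteq> L" using corner_L c_range by auto
  show "y \<in> (\<lambda>a. (c a, C (c a))) ` {1..int n}"
    if h: "x \<in> (\<lambda>a. (c a, C (c a))) ` {1..int n}" "y \<in> L" "le2 x y" for x y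
  proof -
    obtain a where a: "a \<in> {1..int n}" "x = (c a, C (c a))" using h(1) by blast
    have "y = (c a, C (c a))" using corner_max[OF c_range h(2), of a] h(3) a(2) by simp
    thus ?thesis using a(1) by (rule image_eqI)
  qed
  show "a \<le> b" if ab: "a \<in> {1..int n}" "b \<in> {1..int n}" and le: "le2 (c a, C (c a)) (c b, C (c b))" for a b
  proof -
    have "(c b, C (c b)) = (c a, C (c a))" using corner_max[OF c_range corner_L[OF c_range] le] .
    thus ?thesis using vc[OF ab(1)] vc[OF ab(2)] by simp
  qed
  show "v s \<in> {1..int n}" "(c (v s), C (c (v s))) = (s, C s)" "c (v s) = s" if "1 \<le> s \<and> s \<le> int n" for s
    using v[of s] that by auto
  show "(k \<in> {1..int n}) = (0 < k \<and> k \<le> v (c k))" for k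
  proof
    assume "k \<in> {1..int n}" thus "0 < k \<and> k \<le> v (c k)" using vc[of k] by auto
  next
    assume "0 < k \<and> k \<le> v (c k)" thus "k \<in> {1..int n}" using v[OF c_range, of k] by auto
  qed
  show "fst (c a, C (c a)) \<le> c a" for a by simp
  show "cover (\<lambda>a. if a \<in> {1..int n} then fst (c a, C (c a)) else c a) {0<..k} R \<le> row_cover 0 k R" for k R
    unfolding row_cover_def by (rule eq_imp_le, rule cover_cong) auto
  show "cover (\<lambda>a. if a \<in> {1..int n} then snd (c a, C (c a)) else C (c a)) {0<..k} R \<le> cover (\<lambda>a. - c a) {0<..k} R" for k R
  proof -
    have "cover (\<lambda>a. if a \<in> {1..int n} then snd (c a, C (c a)) else C (c a)) {0<..k} R = cover (\<lambda>a. C (c a)) {0<..k} R"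
      by (rule cover_cong) auto
    also have "\<dots> \<le> cover (\<lambda>a. - c a) {0<..k} R"
      by (rule cover_mono) (use C_anti[OF c_range c_range] in auto)
    finally show ?thesis .
  qed
qed

end

text \<open>The same sliding argument serves forward and backward slides and both orientations of the
  rectangle: \<open>\<phi>\<close> places the boxes and \<open>\<psi>\<close> the entries so that the empty box
  always travels right or down past the smaller neighbour.\<close>

locale frame =
  fixes X :: "box set" and \<phi> :: "box \<Rightarrow> int \<times> int" and \<psi> :: "int \<Rightarrow> int"
    and nxt :: "filling \<Rightarrow> box \<Rightarrow> box option"
  assumes X_fin: "finite X" and phi_inj: "inj_on \<phi> X" and psi_inj: "inj \<psi>"
    and nxt_Some: "dom T \<subseteq> X \<Longrightarrow> h \<in> X \<Longrightarrow> nxt T h = Some v \<Longrightarrow>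
        v \<in> dom T \<and> (\<phi> v = (fst (\<phi> h), snd (\<phi> h) + 1) \<or> \<phi> v = (fst (\<phi> h) + 1, snd (\<phi> h))) \<and>
        (\<forall>u\<in>dom T. \<phi> u = (fst (\<phi> h), snd (\<phi> h) + 1) \<or> \<phi> u = (fst (\<phi> h) + 1, snd (\<phi> h)) \<longrightarrow> \<psi> (the (T v)) \<le> \<psi> (the (T u)))"
    and nxt_None: "dom T \<subseteq> X \<Longrightarrow> h \<in> X \<Longrightarrow> nxt T h = None \<Longrightarrow> u \<in> dom T \<Longrightarrow>
        \<phi> u \<noteq> (fst (\<phi> h), snd (\<phi> h) + 1) \<and> \<phi> u \<noteq> (fst (\<phi> h) + 1, snd (\<phi> h))"
begin

definition inc :: "filling \<Rightarrow> bool" where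
  "inc T \<longleftrightarrow> (\<forall>u\<in>dom T. \<forall>v\<in>dom T. le2 (\<phi> u) (\<phi> v) \<longrightarrow> \<psi> (the (T u)) \<le> \<psi> (the (T v))) \<and> inj_on T (dom T)"

definition convex :: "box set \<Rightarrow> bool" where
  "convex D \<longleftrightarrow> (\<forall>u\<in>D. \<forall>w\<in>D. \<forall>y. le2 (\<phi> u) y \<and> le2 y (\<phi> w) \<longrightarrow> y \<in> \<phi> ` D)"

text \<open>The loop invariant says that boxes not weakly north-west of the hole are untouched. So
  the entry moving into the hole still sits in its original box, and every entry makes at most one
  step. The loop ends because the hole passes to a later antidiagonal each time.\<close>

lemma slide_ex:
  assumes D: "D \<subseteq> X" "x \<in> X" "x \<notin> D" "dom T0 = D" and i0: "inc T0" and cv: "convex (insert x D)"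
  shows "\<exists>S e. slide_by nxt T0 x = (S, e) \<and> e \<in> insert x D \<and> dom S = insert x D - {e} \<and> inc S \<and>
     (\<forall>u\<in>D. \<exists>u'\<in>dom S. S u' = T0 u \<and> nw_step (\<phi> u') (\<phi> u)) \<and>
     (\<forall>u\<in>insert x D. \<phi> u \<noteq> (fst (\<phi> e), snd (\<phi> e) + 1) \<and> \<phi> u \<noteq> (fst (\<phi> e) + 1, snd (\<phi> e)))"
proof -
  define E where "E = insert x D"
  have EX: "E \<subseteq> X" using D by (auto simp: E_def)
  have fE: "finite E" using EX X_fin finite_subset by blast
  define Inv where "Inv = (\<lambda>(T :: filling, h). h \<in> E \<and> dom T = E - {h} \<and> inc T \<and>
     (\<forall>u\<in>E. \<not> le2 (\<phi> u) (\<phi> h) \<longrightarrow> T u = T0 u) \<and> (\<forall>u\<in>D. \<exists>u'\<in>dom T. T u' = T0 u \<and> nw_step (\<phi> u') (\<phi> u)))"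
  define ms where "ms = (\<lambda>(T :: filling, h). card {u\<in>E. fst (\<phi> h) + snd (\<phi> h) < fst (\<phi> u) + snd (\<phi> u)})"
  define Q where "Q = (\<lambda>(S :: filling, e). e \<in> E \<and> dom S = E - {e} \<and> inc S \<and>
     (\<forall>u\<in>D. \<exists>u'\<in>dom S. S u' = T0 u \<and> nw_step (\<phi> u') (\<phi> u)) \<and>
     (\<forall>u\<in>E. \<phi> u \<noteq> (fst (\<phi> e), snd (\<phi> e) + 1) \<and> \<phi> u \<noteq> (fst (\<phi> e) + 1, snd (\<phi> e))))"
  have "Q (slide_by nxt T0 x)"
    unfolding slide_by_def
  proof (rule while_rule[where P = Inv and r = "measure ms"])
    show "Inv (T0, x)"
      using D i0 by (auto simp: Inv_def E_def nw_step_def)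
  next
    fix s assume I: "Inv s" and b: "case s of (T, x) \<Rightarrow> nxt T x \<noteq> None"
    obtain T h where s: "s = (T, h)" by (cases s)
    obtain v where nv: "nxt T h = Some v" using b s by auto
    have hE: "h \<in> E" and dT: "dom T = E - {h}" and iT: "inc T"
      and same: "\<And>u. u \<in> E \<Longrightarrow> \<not> le2 (\<phi> u) (\<phi> h) \<Longrightarrow> T u = T0 u"
      and moved: "\<And>u. u \<in> D \<Longrightarrow> \<exists>u'\<in>dom T. T u' = T0 u \<and> nw_step (\<phi> u') (\<phi> u)" using I s by (auto simp: Inv_def)
    have dX: "dom T \<subseteq> X" and hX: "h \<in> X" using dT hE EX by auto
    note nx = nxt_Some[OF dX hX nv]
    have vT: "v \<in> dom T" and vh: "\<phi> v = (fst (\<phi> h), snd (\<phi> h) + 1) \<or> \<phi> v = (fst (\<phi> h) + 1, snd (\<phi> h))" using nx by auto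
    have vE: "v \<in> E" "v \<noteq> h" using vT dT by auto
    have hv: "le2 (\<phi> h) (\<phi> v)" "\<not> le2 (\<phi> v) (\<phi> h)" using vh by auto
    define T' where "T' = T(h := T v, v := None)"
    have T'h: "T' h = T v" and T'o: "\<And>u. u \<noteq> h \<Longrightarrow> u \<noteq> v \<Longrightarrow> T' u = T u" using vE by (auto simp: T'_def)
    have dT': "dom T' = E - {v}" using dT vT vE hE by (auto simp: T'_def)
    have Tv: "T v = T0 v" using same[OF vE(1) hv(2)] .
    have vD: "v \<in> D" using Tv vT D vE by (auto simp: E_def)
    have mono: "\<psi> (the (T u)) \<le> \<psi> (the (T w))" if "u \<in> dom T" "w \<in> dom T" "le2 (\<phi> u) (\<phi> w)" for u w
      using iT that by (auto simp: inc_def)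
    have "inc T'"
      unfolding inc_def
    proof (intro conjI ballI impI)
      fix u w assume u: "u \<in> dom T'" and w: "w \<in> dom T'" and le: "le2 (\<phi> u) (\<phi> w)"
      have uE: "u \<in> E" "u \<noteq> v" "w \<in> E" "w \<noteq> v" using u w dT' by auto
      show "\<psi> (the (T' u)) \<le> \<psi> (the (T' w))"
      proof (cases "u = h")
        case uh: True
        show ?thesis
        proof (cases "w = h")
          case False
          have wT: "w \<in> dom T" using uE False dT by auto
          have "\<phi> w \<noteq> \<phi> h" using phi_inj False uE hE EX by (meson inj_on_eq_iff subsetD)
          hence cases: "le2 (fst (\<phi> h), snd (\<phi> h) + 1) (\<phi> w) \<or> le2 (fst (\<phi> h) + 1, snd (\<phi> h)) (\<phi> w)"
            using le uh by (cases "\<phi> w"; cases "\<phi> h") auto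
          then obtain y where y: "y = (fst (\<phi> h), snd (\<phi> h) + 1) \<or> y = (fst (\<phi> h) + 1, snd (\<phi> h))" "le2 y (\<phi> w)" by blast
          have "le2 (\<phi> h) y" using y by auto
          \<comment> \<open>Convexity of the domain supplies a filled neighbour of the hole between
            it and \<open>w\<close>, and the entry moved into the hole is not larger than that
            neighbour.\<close>
          hence "y \<in> \<phi> ` E" using cv y(2) hE uE unfolding convex_def E_def[symmetric] by blast
          then obtain z where z: "z \<in> E" "\<phi> z = y" by blast
          have "y \<noteq> \<phi> h" using y(1) by (auto simp: prod_eq_iff)
          hence "z \<noteq> h" using z by auto
          hence zT: "z \<in> dom T" using z dT by auto
          have "\<psi> (the (T v)) \<le> \<psi> (the (T z))" using nx zT z y by blast
          also have "\<dots> \<le> \<psi> (the (T w))" using mono[OF zT wT] z y by simp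
          finally show ?thesis using uh T'h T'o[OF False uE(4)] by simp
        qed (use uh in simp)
      next
        case uh: False
        have uT: "u \<in> dom T" using uE uh dT by auto
        show ?thesis
        proof (cases "w = h")
          case True
          have "le2 (\<phi> u) (\<phi> v)" using le hv True by auto
          thus ?thesis using mono[OF uT vT] True T'h T'o[OF uh uE(2)] by simp
        next
          case False
          have "w \<in> dom T" using uE False dT by auto
          thus ?thesis using mono[OF uT _ le] T'o[OF uh uE(2)] T'o[OF False uE(4)] by simp
        qed
      qed
    next
      have injT: "inj_on T (dom T)" using iT by (simp add: inc_def)
      show "inj_on T' (dom T')"
      proof (rule inj_onI)
        fix u w assume u: "u \<in> dom T'" and w: "w \<in> dom T'" and e: "T' u = T' w"
        define u1 where "u1 = (if u = h then v else u)"
        define w1 where "w1 = (if w = h then v else w)"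
        have "T u1 = T w1" "u1 \<in> dom T" "w1 \<in> dom T"
          using e u w dT dT' T'h T'o[of u] T'o[of w] vT by (auto simp: u1_def w1_def split: if_splits)
        hence "u1 = w1" using injT by (auto simp: inj_on_def)
        thus "u = w" using u w dT' by (auto simp: u1_def w1_def split: if_splits)
      qed
    qed
    moreover have "T' u = T0 u" if u: "u \<in> E" "\<not> le2 (\<phi> u) (\<phi> v)" for u
    proof -
      have "u \<noteq> v" "u \<noteq> h" "\<not> le2 (\<phi> u) (\<phi> h)" using u hv by auto
      thus ?thesis using T'o same[OF u(1)] by simp
    qed
    moreover have "\<exists>u'\<in>dom T'. T' u' = T0 u \<and> nw_step (\<phi> u') (\<phi> u)" if u: "u \<in> D" for u
    proof -
      obtain u' where u': "u' \<in> dom T" "T u' = T0 u" "nw_step (\<phi> u') (\<phi> u)" using moved[OF u] by blast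
      show ?thesis
      proof (cases "u' = v")
        case True
        have "T0 u = T0 v" using u' True Tv by simp
        hence "u = v" using i0 u vD D by (auto simp: inc_def inj_on_def)
        hence "nw_step (\<phi> h) (\<phi> u)" using vh by (cases "\<phi> h") (auto simp: nw_step_def)
        thus ?thesis using T'h u' True dT' hE vE by (intro bexI[of _ h]) auto
      next
        case False
        have "u' \<noteq> h" using u' dT by auto
        thus ?thesis using T'o[OF _ False] u' dT' dT False by (intro bexI[of _ u']) auto
      qed
    qed
    ultimately have "Inv (T', v)" using dT' vE by (auto simp: Inv_def)
    thus "Inv (case s of (T, x) \<Rightarrow> let y = the (nxt T x) in (T(x := T y, y := None), y))"
      using s nv by (simp add: T'_def Let_def)
    have "{u\<in>E. fst (\<phi> v) + snd (\<phi> v) < fst (\<phi> u) + snd (\<phi> u)} \<subset> {u\<in>E. fst (\<phi> h) + snd (\<phi> h) < fst (\<phi> u) + snd (\<phi> u)}"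
    proof -
      have lv: "fst (\<phi> v) + snd (\<phi> v) = fst (\<phi> h) + snd (\<phi> h) + 1" using vh by auto
      hence "v \<in> {u\<in>E. fst (\<phi> h) + snd (\<phi> h) < fst (\<phi> u) + snd (\<phi> u)}" using vE by simp
      moreover have "v \<notin> {u\<in>E. fst (\<phi> v) + snd (\<phi> v) < fst (\<phi> u) + snd (\<phi> u)}" by simp
      moreover have "{u\<in>E. fst (\<phi> v) + snd (\<phi> v) < fst (\<phi> u) + snd (\<phi> u)} \<subseteq> {u\<in>E. fst (\<phi> h) + snd (\<phi> h) < fst (\<phi> u) + snd (\<phi> u)}"
        using lv by fastforce
      ultimately show ?thesis by blast
    qed
    hence "ms (T', v) < ms (T, h)" unfolding ms_def using fE by (auto intro!: psubset_card_mono)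
    thus "(case s of (T, x) \<Rightarrow> let y = the (nxt T x) in (T(x := T y, y := None), y), s) \<in> measure ms"
      using s nv by (simp add: T'_def Let_def)
  next
    fix s assume I: "Inv s" and b: "\<not> (case s of (T, x) \<Rightarrow> nxt T x \<noteq> None)"
    obtain T h where s: "s = (T, h)" by (cases s)
    have nv: "nxt T h = None" using b s by (cases "nxt T h") auto
    have hE: "h \<in> E" and dT: "dom T = E - {h}" using I s by (auto simp: Inv_def)
    have dX: "dom T \<subseteq> X" and hX: "h \<in> X" using dT hE EX by auto
    have "\<phi> u \<noteq> (fst (\<phi> h), snd (\<phi> h) + 1) \<and> \<phi> u \<noteq> (fst (\<phi> h) + 1, snd (\<phi> h))" if "u \<in> E" for u
    proof (cases "u = h")
      case True thus ?thesis by (cases "\<phi> h") auto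
    next
      case False thus ?thesis using nxt_None[OF dX hX nv, of u] that dT by blast
    qed
    thus "Q s" using I s by (auto simp: Q_def Inv_def)
  qed simp
  thus ?thesis by (cases "slide_by nxt T0 x") (auto simp: Q_def E_def)
qed

end

section \<open>Complete runs inside a frame\<close>

locale run_frame = diag_rods n c C + frame X \<phi> \<psi> nxt for n c C X \<phi> \<psi> nxt +
  fixes dl :: int
  assumes phi_bij: "bij_betw \<phi> X L" and psi_dl: "\<And>k. \<psi> (k + dl) = \<psi> k + int n"
begin

definition up_closed :: "box set \<Rightarrow> bool" where
  "up_closed E \<longleftrightarrow> (\<forall>u\<in>E. \<forall>w\<in>X. le2 (\<phi> u) (\<phi> w) \<longrightarrow> w \<in> E)"

definition entry :: "filling \<Rightarrow> box \<Rightarrow> int" where "entry T u = \<psi> (the (T u))"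

definition good :: "filling \<Rightarrow> bool" where
  "good T \<longleftrightarrow> dom T \<subseteq> X \<and> inc T \<and> (\<exists>p v. run_state (entry T ` dom T) p v \<and> (\<forall>u\<in>dom T. p (entry T u) = \<phi> u))"

definition run_step :: "filling \<Rightarrow> filling \<Rightarrow> bool" where
  "run_step T T' \<longleftrightarrow> (\<exists>x\<in>X - dom T. up_closed (insert x (dom T)) \<and>
     (\<exists>S \<beta> s. \<beta> \<in> X \<and> 1 \<le> s \<and> s \<le> int n \<and> \<phi> \<beta> = (s, C s) \<and> slide_by nxt T x = (S, \<beta>) \<and> T' = S(\<beta> \<mapsto> the (T \<beta>) + dl)))"

lemma phi_X: "u \<in> X \<Longrightarrow> \<phi> u \<in> L"
  using phi_bij by (auto simp: bij_betw_def)

lemma phi_ex: "y \<in> L \<Longrightarrow> \<exists>u\<in>X. \<phi> u = y"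
  using phi_bij by (force simp: bij_betw_def)

lemma phi_eq: "u \<in> X \<Longrightarrow> w \<in> X \<Longrightarrow> \<phi> u = \<phi> w \<Longrightarrow> u = w"
  using phi_inj by (auto simp: inj_on_def)

lemma up_closed_convex: "E \<subseteq> X \<Longrightarrow> up_closed E \<Longrightarrow> convex E"
  unfolding convex_def
proof (intro ballI allI impI)
  fix u w y assume E: "E \<subseteq> X" "up_closed E" and u: "u \<in> E" and w: "w \<in> E" and y: "le2 (\<phi> u) y \<and> le2 y (\<phi> w)"
  have X: "u \<in> X" "w \<in> X" using E u w by auto
  have "1 \<le> fst y \<and> 1 \<le> snd y" using phi_X[OF X(1)] y by (auto simp: L_def)
  hence "y \<in> L" using L_down[OF phi_X[OF X(2)], of y] y by blast
  then obtain z where "z \<in> X" "\<phi> z = y" using phi_ex by blast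
  thus "y \<in> \<phi> ` E" using E u y unfolding up_closed_def by blast
qed

lemma entry_inj: "inc T \<Longrightarrow> inj_on (entry T) (dom T)"
proof (rule inj_onI)
  fix u w assume i: "inc T" and u: "u \<in> dom T" and w: "w \<in> dom T" and e: "entry T u = entry T w"
  have "the (T u) = the (T w)" using psi_inj e by (auto simp: entry_def inj_def)
  hence "T u = T w" using u w by force
  thus "u = w" using i u w by (auto simp: inc_def inj_on_def)
qed

text \<open>The slide stops where nothing lies to the right, and in a domain closed towards the
  south-east this happens only at the end of a row of \<open>L\<close>.\<close>

lemma slide_run:
  assumes T: "dom T \<subseteq> X" "inc T" and x: "x \<in> X - dom T" and up: "up_closed (insert x (dom T))"
  shows "\<exists>S e. slide_by nxt T x = (S, e) \<and> e \<in> insert x (dom T) \<and> dom S = insert x (dom T) - {e} \<and> inc S \<and>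
     (\<forall>u\<in>dom T. \<exists>u'\<in>dom S. S u' = T u \<and> nw_step (\<phi> u') (\<phi> u)) \<and> (\<exists>s. 1 \<le> s \<and> s \<le> int n \<and> \<phi> e = (s, C s))"
proof -
  have cv: "convex (insert x (dom T))" by (rule up_closed_convex[OF _ up]) (use T x in auto)
  obtain S e where S: "slide_by nxt T x = (S, e)" "e \<in> insert x (dom T)" "dom S = insert x (dom T) - {e}" "inc S"
     "\<forall>u\<in>dom T. \<exists>u'\<in>dom S. S u' = T u \<and> nw_step (\<phi> u') (\<phi> u)"
     "\<forall>u\<in>insert x (dom T). \<phi> u \<noteq> (fst (\<phi> e), snd (\<phi> e) + 1) \<and> \<phi> u \<noteq> (fst (\<phi> e) + 1, snd (\<phi> e))"
    using slide_ex[OF T(1) _ _ refl T(2) cv] x by blast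
  have eX: "e \<in> X" using S(2) T x by auto
  have eL: "\<phi> e \<in> L" using phi_X[OF eX] .
  have "snd (\<phi> e) = C (fst (\<phi> e))"
  proof (rule ccontr)
    assume "snd (\<phi> e) \<noteq> C (fst (\<phi> e))"
    hence "(fst (\<phi> e), snd (\<phi> e) + 1) \<in> L" using eL by (auto simp: L_def)
    then obtain z where z: "z \<in> X" "\<phi> z = (fst (\<phi> e), snd (\<phi> e) + 1)" using phi_ex by blast
    have "z \<in> insert x (dom T)" using up S(2) z unfolding up_closed_def by force
    thus False using S(6) z by blast
  qed
  hence "\<phi> e = (fst (\<phi> e), C (fst (\<phi> e)))" by (simp add: prod_eq_iff)
  moreover have "1 \<le> fst (\<phi> e)" "fst (\<phi> e) \<le> int n" using eL by (auto simp: L_def)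
  ultimately show ?thesis using S by blast
qed

text \<open>Translates a slide of boxes into moves of entries, so that \<open>run_state_step\<close>
  applies.\<close>

lemma good_step:
  assumes T: "good T" and x: "x \<in> X - dom T" and up: "up_closed (insert x (dom T))"
    and \<beta>: "\<beta> \<in> X" "1 \<le> s" "s \<le> int n" "\<phi> \<beta> = (s, C s)" "slide_by nxt T x = (S, \<beta>)" "T' = S(\<beta> \<mapsto> the (T \<beta>) + dl)"
  shows "good T' \<and> dom T' = insert x (dom T)"
proof -
  define D where "D = dom T"
  define A where "A = entry T ` D"
  have DX: "D \<subseteq> X" and iT: "inc T" using T by (auto simp: good_def D_def)
  obtain p v where cs: "run_state A p v" and p: "\<And>u. u \<in> D \<Longrightarrow> p (entry T u) = \<phi> u"
    using T by (auto simp: good_def A_def D_def)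
  have S: "dom S = insert x D - {\<beta>}" "inc S" "\<beta> \<in> insert x D" "\<And>u. u \<in> D \<Longrightarrow> \<exists>u'\<in>dom S. S u' = T u \<and> nw_step (\<phi> u') (\<phi> u)"
  proof -
    obtain S' e where S': "slide_by nxt T x = (S', e)" "e \<in> insert x D" "dom S' = insert x D - {e}" "inc S'"
       "\<forall>u\<in>D. \<exists>u'\<in>dom S'. S' u' = T u \<and> nw_step (\<phi> u') (\<phi> u)"
      using slide_run[OF DX[unfolded D_def] iT x up] unfolding D_def by blast
    have e: "S' = S" "e = \<beta>" using S'(1) \<beta>(5) by auto
    show "dom S = insert x D - {\<beta>}" "inc S" "\<beta> \<in> insert x D" using S' unfolding e by auto
    show "\<And>u. u \<in> D \<Longrightarrow> \<exists>u'\<in>dom S. S u' = T u \<and> nw_step (\<phi> u') (\<phi> u)" using S'(5) unfolding e by blast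
  qed
  have vs: "v s \<in> A" "p (v s) = (s, C s)" "c (v s) = s" using cs \<beta>(2,3) by (auto simp: run_state_def)
  have injp: "inj_on p A" using cs by (auto simp: run_state_def)
  obtain u0 where u0: "u0 \<in> D" "v s = entry T u0" using vs by (auto simp: A_def)
  have "\<phi> u0 = \<phi> \<beta>" using p[OF u0(1)] u0 vs \<beta> by simp
  hence "u0 = \<beta>" using phi_eq u0 DX \<beta> by blast
  hence bD: "\<beta> \<in> D" and vb: "entry T \<beta> = v s" using u0 by auto
  have xD: "x \<notin> D" "x \<in> X" using x by (auto simp: D_def)
  have fD: "finite D" using DX X_fin finite_subset by blast
  \<comment> \<open>\<open>f u\<close> is the box to which the slide carries the entry of
    \<open>u\<close>. It is injective, and by counting its image is the whole new domain.\<close>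
  define f where "f = (\<lambda>u. SOME u'. u' \<in> dom S \<and> S u' = T u \<and> nw_step (\<phi> u') (\<phi> u))"
  have f: "f u \<in> dom S \<and> S (f u) = T u \<and> nw_step (\<phi> (f u)) (\<phi> u)" if "u \<in> D" for u
    unfolding f_def by (rule someI_ex) (use S(4)[OF that] in blast)
  have f_inj: "inj_on f D"
  proof (rule inj_onI)
    fix u w assume u: "u \<in> D" "w \<in> D" "f u = f w"
    hence "T u = T w" using f by metis
    thus "u = w" using iT u by (auto simp: inc_def inj_on_def D_def)
  qed
  have "card (f ` D) = card (dom S)" using card_image[OF f_inj] S(1,3) fD xD by simp
  moreover have "f ` D \<subseteq> dom S" using f by blast
  moreover have "finite (dom S)" using S(1) fD by simp
  ultimately have f_im: "f ` D = dom S" by (simp add: card_subset_eq)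
  have vlS: "entry S (f u) = entry T u" if "u \<in> D" for u using f[OF that] by (simp add: entry_def)
  define p' where "p' = (\<lambda>a. \<phi> (f (the_inv_into D (entry T) a)))"
  have vi: "inj_on (entry T) D" using entry_inj[OF iT] by (simp add: D_def)
  have p': "p' (entry T u) = \<phi> (f u)" if "u \<in> D" for u using the_inv_into_f_f[OF vi that] by (simp add: p'_def)
  have p'S: "p' (entry S u) = \<phi> u" "entry S u \<in> A" if u: "u \<in> dom S" for u
  proof -
    obtain w where w: "w \<in> D" "u = f w" using u f_im by blast
    show "p' (entry S u) = \<phi> u" using p'[OF w(1)] vlS[OF w(1)] w by simp
    show "entry S u \<in> A" using vlS[OF w(1)] w by (simp add: A_def)
  qed
  have SX: "dom S \<subseteq> X" unfolding S(1) using DX xD(2) by blast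
  have fX: "f u \<in> X" if "u \<in> D" for u using f[OF that] SX by (meson subsetD)
  have pA: "p ` A = \<phi> ` D" using p by (force simp: A_def image_image)
  have p'A: "p' ` A = \<phi> ` dom S" unfolding f_im[symmetric] A_def using p' by (force simp: image_image)
  have c2: "run_state (insert (v s + int n) A) (p'(v s + int n := (s, C s))) (v(s := v s + int n))"
  proof (rule run_state_step[OF cs \<beta>(2,3), where x = "\<phi> x"])
    fix a assume "a \<in> A"
    then obtain u where u: "u \<in> D" "a = entry T u" by (auto simp: A_def)
    thus "nw_step (p' a) (p a)" using p p' f by simp
  next
    show "inj_on p' A"
    proof (rule inj_onI)
      fix a b assume "a \<in> A" "b \<in> A" and e: "p' a = p' b"
      then obtain u w where u: "u \<in> D" "a = entry T u" "w \<in> D" "b = entry T w" by (auto simp: A_def)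
      have "f u = f w" using phi_eq[OF fX[OF u(1)] fX[OF u(3)]] e p' u by simp
      thus "a = b" using f_inj u by (auto simp: inj_on_def)
    qed
  next
    fix a b assume "a \<in> A" "b \<in> A" and e: "le2 (p' a) (p' b)"
    then obtain u w where u: "u \<in> D" "a = entry T u" "w \<in> D" "b = entry T w" by (auto simp: A_def)
    have le: "le2 (\<phi> (f u)) (\<phi> (f w))" using e p'[OF u(1)] p'[OF u(3)] u by simp
    have "\<forall>u\<in>dom S. \<forall>w\<in>dom S. le2 (\<phi> u) (\<phi> w) \<longrightarrow> entry S u \<le> entry S w" using S(2) unfolding inc_def entry_def by blast
    hence "entry S (f u) \<le> entry S (f w)" using f[OF u(1)] f[OF u(3)] le by blast
    thus "a \<le> b" using vlS u by simp
  next
    have "\<phi> ` (insert x D - {\<beta>}) = insert (\<phi> x) (\<phi> ` D) - {(s, C s)}"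
    proof
      show "\<phi> ` (insert x D - {\<beta>}) \<subseteq> insert (\<phi> x) (\<phi> ` D) - {(s, C s)}" using phi_eq[OF _ \<beta>(1)] \<beta>(4) xD DX by force
      show "insert (\<phi> x) (\<phi> ` D) - {(s, C s)} \<subseteq> \<phi> ` (insert x D - {\<beta>})" using \<beta>(4) by auto
    qed
    thus "p' ` A = insert (\<phi> x) (p ` A) - {(s, C s)}" using p'A pA S(1) by simp
    show "\<phi> x \<in> L" using phi_X xD by blast
    show "\<phi> x \<notin> p ` A" unfolding pA using phi_eq[of x] xD DX by blast
    fix y z assume y: "y \<in> insert (\<phi> x) (p ` A)" and z: "z \<in> L" "le2 y z"
    have "y \<in> \<phi> ` insert x D" using y pA by simp
    then obtain u where u: "u \<in> insert x D" "y = \<phi> u" by blast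
    obtain w where w: "w \<in> X" "z = \<phi> w" using phi_ex[OF z(1)] by auto
    have "w \<in> insert x D" using up u w z(2) unfolding up_closed_def D_def by blast
    thus "z \<in> insert (\<phi> x) (p ` A)" using w pA by auto
  qed
  define k0 where "k0 = v s + int n"
  have ck0: "c k0 = s" using per[of "v s"] vs by (simp add: k0_def)
  have k0A: "k0 \<notin> A"
  proof
    assume "k0 \<in> A"
    hence "k0 \<le> v (c k0)" using cs unfolding run_state_def by blast
    thus False using ck0 n_pos by (simp add: k0_def)
  qed
  have dT': "dom T' = insert x D" using S(1,3) \<beta>(6) bD by auto
  have vT'b: "entry T' \<beta> = k0" using \<beta>(6) psi_dl[of "the (T \<beta>)"] vb by (simp add: entry_def k0_def)
  have vT'o: "entry T' u = entry S u" if "u \<in> dom S" for u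
  proof -
    have "u \<noteq> \<beta>" using that S(1) by blast
    thus ?thesis using \<beta>(6) by (simp add: entry_def)
  qed
  define p2 where "p2 = p'(k0 := (s, C s))"
  have p2: "p2 (entry T' u) = \<phi> u" if "u \<in> insert x D" for u
  proof (cases "u = \<beta>")
    case True thus ?thesis using vT'b \<beta>(4) by (simp add: p2_def)
  next
    case False
    hence u: "u \<in> dom S" using that S(1) by blast
    have "entry S u \<noteq> k0" using p'S(2)[OF u] k0A by auto
    thus ?thesis using vT'o[OF u] p'S(1)[OF u] by (simp add: p2_def)
  qed
  have vA: "entry T' ` insert x D = insert k0 A"
  proof -
    have "insert x D = insert \<beta> (dom S)" using S(1,3) by auto
    hence "entry T' ` insert x D = insert k0 (entry S ` dom S)" using vT'b vT'o by auto
    moreover have "entry S ` dom S = A" unfolding f_im[symmetric] A_def using vlS by (force simp: image_image)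
    ultimately show ?thesis by simp
  qed
  have c3: "run_state (entry T' ` insert x D) p2 (v(s := k0))" using c2 unfolding vA p2_def k0_def .
  have "inc T'"
    unfolding inc_def dT'
  proof (intro conjI ballI impI)
    fix u w assume u: "u \<in> insert x D" and w: "w \<in> insert x D" and le: "le2 (\<phi> u) (\<phi> w)"
    have "le2 (p2 (entry T' u)) (p2 (entry T' w))" using p2[OF u] p2[OF w] le by simp
    moreover have "\<forall>a\<in>entry T' ` insert x D. \<forall>b\<in>entry T' ` insert x D. le2 (p2 a) (p2 b) \<longrightarrow> a \<le> b" using c3 unfolding run_state_def by blast
    ultimately show "\<psi> (the (T' u)) \<le> \<psi> (the (T' w))" using u w unfolding entry_def by blast
  next
    show "inj_on T' (insert x D)"
    proof (rule inj_onI)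
      fix u w assume u: "u \<in> insert x D" and w: "w \<in> insert x D" and e: "T' u = T' w"
      have "\<phi> u = \<phi> w" using p2[OF u] p2[OF w] e by (simp add: entry_def)
      thus "u = w" using phi_eq u w xD DX by blast
    qed
  qed
  moreover have "dom T' \<subseteq> X" unfolding dT' using DX xD by simp
  moreover have "\<exists>p v. run_state (entry T' ` dom T') p v \<and> (\<forall>u\<in>dom T'. p (entry T' u) = \<phi> u)" unfolding dT' using c3 p2 by blast
  ultimately have "good T'" unfolding good_def by blast
  thus ?thesis using dT' by (simp add: D_def)
qed

lemma good_run_step: "good T \<Longrightarrow> run_step T T' \<Longrightarrow> good T' \<and> card (dom T') = Suc (card (dom T))"
proof -
  assume T: "good T" and "run_step T T'"
  then obtain x S \<beta> s where a: "x \<in> X - dom T" "up_closed (insert x (dom T))" "\<beta> \<in> X" "1 \<le> s" "s \<le> int n" "\<phi> \<beta> = (s, C s)"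
     "slide_by nxt T x = (S, \<beta>)" "T' = S(\<beta> \<mapsto> the (T \<beta>) + dl)" unfolding run_step_def by blast
  have "finite (dom T)" using T X_fin finite_subset by (auto simp: good_def)
  thus ?thesis using good_step[OF T a] a(1) by auto
qed

lemma run_step_ex:
  assumes T: "good T" and ne: "dom T \<noteq> X"
  shows "\<exists>T'. run_step T T'"
proof -
  have dX: "dom T \<subseteq> X" and iT: "inc T" using T by (auto simp: good_def)
  obtain p v where cs: "run_state (entry T ` dom T) p v" and p: "\<And>u. u \<in> dom T \<Longrightarrow> p (entry T u) = \<phi> u"
    using T by (auto simp: good_def)
  have upT: "w \<in> dom T" if u: "u \<in> dom T" "w \<in> X" "le2 (\<phi> u) (\<phi> w)" for u w
  proof -
    have "p ` entry T ` dom T = \<phi> ` dom T" using p by (force simp: image_image)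
    moreover have "\<forall>x\<in>p ` entry T ` dom T. \<forall>y\<in>L. le2 x y \<longrightarrow> y \<in> p ` entry T ` dom T" using cs unfolding run_state_def by blast
    ultimately have "\<phi> w \<in> \<phi> ` dom T" using u phi_X[OF u(2)] by blast
    thus ?thesis using phi_eq u(2) dX by blast
  qed
  define M where "M = X - dom T"
  have M: "finite M" "M \<noteq> {}" using X_fin ne dX by (auto simp: M_def)
  \<comment> \<open>An empty box on the last antidiagonal that still has one can be filled next, for
    no other empty box lies south-east of it.\<close>
  define l where "l = (\<lambda>y. fst (\<phi> y) + snd (\<phi> y))"
  have "Max (l ` M) \<in> l ` M" using M by simp
  then obtain x where xM0: "x \<in> M" "l x = Max (l ` M)" by force
  have x: "x \<in> M" "\<And>y. y \<in> M \<Longrightarrow> fst (\<phi> y) + snd (\<phi> y) \<le> fst (\<phi> x) + snd (\<phi> x)"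
    using xM0 M(1) Max_ge[of "l ` M"] by (auto simp: l_def)
  have up: "up_closed (insert x (dom T))"
    unfolding up_closed_def
  proof (intro ballI impI)
    fix u w assume u: "u \<in> insert x (dom T)" and w: "w \<in> X" and le: "le2 (\<phi> u) (\<phi> w)"
    show "w \<in> insert x (dom T)"
    proof (cases "u \<in> dom T")
      case True thus ?thesis using upT w le by blast
    next
      case False
      hence ux: "u = x" using u by simp
      show ?thesis
      proof (rule ccontr)
        assume no: "w \<notin> insert x (dom T)"
        hence "fst (\<phi> w) + snd (\<phi> w) \<le> fst (\<phi> x) + snd (\<phi> x)" using x(2)[of w] w by (simp add: M_def)
        hence "\<phi> w = \<phi> x" using le ux by (simp add: prod_eq_iff)
        thus False using phi_eq[OF w, of x] x(1) no by (simp add: M_def)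
      qed
    qed
  qed
  have xM: "x \<in> X - dom T" using x(1) by (simp add: M_def)
  obtain S e s where "slide_by nxt T x = (S, e)" "e \<in> insert x (dom T)" "1 \<le> s" "s \<le> int n" "\<phi> e = (s, C s)"
    using slide_run[OF dX iT xM up] by blast
  moreover have "e \<in> X" using calculation xM dX by blast
  ultimately show ?thesis unfolding run_step_def using xM up by blast
qed

lemma run_ex: "good T \<Longrightarrow> \<exists>T'. run_step\<^sup>*\<^sup>* T T' \<and> dom T' = X"
proof (induction "card X - card (dom T)" arbitrary: T rule: less_induct)
  case less
  show ?case
  proof (cases "dom T = X")
    case False
    then obtain T' where T': "run_step T T'" using run_step_ex[OF less.prems] by blast
    have dX: "dom T \<subset> X" using less.prems False by (auto simp: good_def)
    have "card (dom T) < card X" by (rule psubset_card_mono[OF X_fin dX])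
    hence "card X - card (dom T') < card X - card (dom T)" using good_run_step[OF less.prems T'] by simp
    then obtain T2 where T2: "run_step\<^sup>*\<^sup>* T' T2" "dom T2 = X" using less.hyps[of T'] good_run_step[OF less.prems T'] by blast
    have "run_step\<^sup>*\<^sup>* T T2" by (rule converse_rtranclp_into_rtranclp[OF T' T2(1)])
    thus ?thesis using T2(2) by blast
  qed blast
qed

lemma good_full:
  assumes T: "good T" and d: "dom T = X" and u: "u \<in> X"
  shows "\<psi> (the (T u)) = val 0 (\<phi> u)"
proof -
  obtain p v where cs: "run_state (entry T ` X) p v" and p: "\<And>u. u \<in> X \<Longrightarrow> p (entry T u) = \<phi> u"
    using T d by (auto simp: good_def)
  have "p ` entry T ` X = \<phi> ` X" using p by (force simp: image_image)
  hence im: "p ` entry T ` X = L" using phi_bij by (simp add: bij_betw_def)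
  have "pos 0 (entry T u) = \<phi> u" using run_state_full[OF cs im, of "entry T u"] p[OF u] u by simp
  moreover have "0 < entry T u" using cs u unfolding run_state_def by blast
  ultimately show ?thesis using val_pos[of 0 "entry T u"] by (simp add: entry_def)
qed

text \<open>\<open>step\<close> is a parameter so that the definite descriptions of both filling
  procedures are covered: some run is complete, and every complete run ends with the universal
  values.\<close>

lemma run_result:
  assumes T0: "good T0" and R: "\<And>T T'. good T \<Longrightarrow> step T T' \<longleftrightarrow> run_step T T'"
  shows "dom (THE T. step\<^sup>*\<^sup>* T0 T \<and> dom T = X) = X" (is "dom ?T = X")
    and "u \<in> X \<Longrightarrow> \<psi> (the ((THE T. step\<^sup>*\<^sup>* T0 T \<and> dom T = X) u)) = val 0 (\<phi> u)"
proof -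
  have fwd: "step\<^sup>*\<^sup>* T0 T \<Longrightarrow> run_step\<^sup>*\<^sup>* T0 T \<and> good T" for T
  proof (induction rule: rtranclp_induct)
    case (step T T')
    thus ?case using R good_run_step by (meson rtranclp.rtrancl_into_rtrancl)
  qed (use T0 in simp)
  have bwd: "run_step\<^sup>*\<^sup>* T0 T \<Longrightarrow> step\<^sup>*\<^sup>* T0 T \<and> good T" for T
  proof (induction rule: rtranclp_induct)
    case (step T T')
    thus ?case using R good_run_step by (meson rtranclp.rtrancl_into_rtrancl)
  qed (use T0 in simp)
  obtain T1 where T1: "run_step\<^sup>*\<^sup>* T0 T1" "dom T1 = X" using run_ex[OF T0] by blast
  have uniq: "T = T1" if "step\<^sup>*\<^sup>* T0 T \<and> dom T = X" for T
  proof
    fix u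
    show "T u = T1 u"
    proof (cases "u \<in> X")
      case True
      have "\<psi> (the (T u)) = \<psi> (the (T1 u))" using good_full[of T u] good_full[of T1 u] fwd[of T] bwd[of T1] that T1 True by simp
      hence "the (T u) = the (T1 u)" using psi_inj by (simp add: inj_eq)
      moreover have "u \<in> dom T" "u \<in> dom T1" using True that T1 by auto
      ultimately show ?thesis by force
    next
      case False
      hence "u \<notin> dom T" "u \<notin> dom T1" using that T1 by auto
      thus ?thesis by (simp add: domIff)
    qed
  qed
  have e: "?T = T1" by (rule the_equality) (use bwd[OF T1(1)] T1 uniq in auto)
  show "dom ?T = X" using e T1 by simp
  show "u \<in> X \<Longrightarrow> \<psi> (the (?T u)) = val 0 (\<phi> u)" using e good_full[of T1 u] bwd[OF T1(1)] T1 by simp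
qed

lemma good_init:
  assumes d: "dom T = {u\<in>X. snd (\<phi> u) = C (fst (\<phi> u))}"
    and T: "\<And>u. u \<in> dom T \<Longrightarrow> 1 \<le> \<psi> (the (T u)) \<and> \<psi> (the (T u)) \<le> int n \<and> c (\<psi> (the (T u))) = fst (\<phi> u)"
  shows "good T"
proof -
  define bx where "bx = (\<lambda>s. SOME u. u \<in> X \<and> \<phi> u = (s, C s))"
  have bx: "bx s \<in> dom T \<and> \<phi> (bx s) = (s, C s)" if "1 \<le> s" "s \<le> int n" for s
  proof -
    have "bx s \<in> X \<and> \<phi> (bx s) = (s, C s)" unfolding bx_def by (rule someI_ex) (use phi_ex[OF corner_L[OF that]] in blast)
    thus ?thesis using d by simp
  qed
  define v where "v = (\<lambda>s. entry T (bx s))"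
  have v: "1 \<le> v s \<and> v s \<le> int n \<and> c (v s) = s" if "1 \<le> s" "s \<le> int n" for s
    using bx[OF that] T[of "bx s"] by (simp add: v_def entry_def)
  have im: "entry T ` dom T = {1..int n}"
  proof
    show "entry T ` dom T \<subseteq> {1..int n}"
    proof
      fix a assume "a \<in> entry T ` dom T"
      then obtain u where "u \<in> dom T" "a = entry T u" by blast
      thus "a \<in> {1..int n}" using T[of u] by (simp add: entry_def)
    qed
    show "{1..int n} \<subseteq> entry T ` dom T"
    proof
      fix a assume a: "a \<in> {1..int n}"
      have "v (c a) = a" using v[OF c_range] a bij by (metis atLeastAtMost_iff bij_betw_imp_inj_on inj_onD)
      moreover have "v (c a) \<in> entry T ` dom T" using bx[OF c_range, of a] by (auto simp: v_def)
      ultimately show "a \<in> entry T ` dom T" by simp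
    qed
  qed
  have cs: "run_state {1..int n} (\<lambda>a. (c a, C (c a))) v" by (rule run_state_init[OF v])
  have p: "(c (entry T u), C (c (entry T u))) = \<phi> u" if "u \<in> dom T" for u
    using T[OF that] that d by (simp add: entry_def prod_eq_iff)
  have mono: "\<forall>a\<in>{1..int n}. \<forall>b\<in>{1..int n}. le2 (c a, C (c a)) (c b, C (c b)) \<longrightarrow> a \<le> b" using cs unfolding run_state_def by blast
  have "inc T"
    unfolding inc_def
  proof (intro conjI ballI impI)
    fix u w assume u: "u \<in> dom T" and w: "w \<in> dom T" and le: "le2 (\<phi> u) (\<phi> w)"
    have "entry T u \<in> {1..int n}" "entry T w \<in> {1..int n}" using im u w by blast+
    thus "\<psi> (the (T u)) \<le> \<psi> (the (T w))" using mono p[OF u] p[OF w] le unfolding entry_def by metis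
  next
    show "inj_on T (dom T)"
    proof (rule inj_onI)
      fix u w assume u: "u \<in> dom T" and w: "w \<in> dom T" and e: "T u = T w"
      have "\<phi> u = \<phi> w" using p[OF u] p[OF w] e by (simp add: entry_def)
      thus "u = w" using phi_eq u w d by blast
    qed
  qed
  thus ?thesis using d cs im p unfolding good_def by auto
qed

end

section \<open>Uniqueness of a slide\<close>

text \<open>Consider the smallest entry on which the two moves differ. Its targets are incomparable,
  so one move takes it up and the other to the left. The old occupants of both boxes are smaller,
  hence treated alike by the two moves, and both must leave; but boxes vacated in one step are
  comparable. This identifies a slide from its outcome without following its path.\<close>

lemma unique_moves:
  fixes p p1 p2 :: "int \<Rightarrow> int \<times> int"
  assumes inj1: "inj_on p1 A" and inj2: "inj_on p2 A"
    and mv1: "\<And>a. a \<in> A \<Longrightarrow> nw_step (p1 a) (p a)" and mv2: "\<And>a. a \<in> A \<Longrightarrow> nw_step (p2 a) (p a)"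
    and mono1: "\<And>a b. a \<in> A \<Longrightarrow> b \<in> A \<Longrightarrow> le2 (p1 a) (p1 b) \<Longrightarrow> a \<le> b"
    and mono2: "\<And>a b. a \<in> A \<Longrightarrow> b \<in> A \<Longrightarrow> le2 (p2 a) (p2 b) \<Longrightarrow> a \<le> b"
    and im: "p1 ` A = p2 ` A"
    and pos: "\<And>a. a \<in> A \<Longrightarrow> 1 \<le> fst (p1 a) \<and> 1 \<le> snd (p1 a)"
    and fill: "\<And>a. a \<in> A \<Longrightarrow> p1 a = (1, 1) \<or> (\<exists>b\<in>A. p b = p1 a)"
    and A0: "\<And>a. a \<in> A \<Longrightarrow> 0 < a" and fin: "\<And>a b. a \<in> A \<Longrightarrow> b \<in> A \<Longrightarrow> le2 (p a) (p b) \<Longrightarrow> a \<le> b"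
    and a: "a \<in> A"
  shows "p1 a = p2 a"
  using A0[OF a] a
proof (induction "nat a" arbitrary: a rule: less_induct)
  case less
  have IH: "p1 b = p2 b" if "b \<in> A" "b < a" for b using less.hyps[of b] that A0 less.prems by auto
  have pos2: "1 \<le> fst (p2 a) \<and> 1 \<le> snd (p2 a)"
  proof -
    obtain b where "b \<in> A" "p2 a = p1 b" using im less.prems by (metis imageE imageI)
    thus ?thesis using pos by simp
  qed
  \<comment> \<open>Comparable targets cannot differ: one of the two boxes would be held in the
    other move by a smaller entry, which by induction holds it in both moves.\<close>
  have occ1: "p1 b \<noteq> y \<Longrightarrow> False" if y: "y = p2 a" "le2 y (p1 a)" and b: "b = a" for y b
  proof -
    assume ne: "p1 b \<noteq> y"
    obtain d where d: "d \<in> A" "p1 d = y" using im y less.prems by (metis imageE imageI)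
    have "d \<le> a" using mono1[OF d(1) less.prems(2)] d y by simp
    moreover have "d \<noteq> a" using d ne b by auto
    ultimately have "p2 d = p2 a" using IH[of d] d y by simp
    thus False using inj2 d less.prems \<open>d \<noteq> a\<close> by (auto simp: inj_on_def)
  qed
  have occ2: "p2 b \<noteq> y \<Longrightarrow> False" if y: "y = p1 a" "le2 y (p2 a)" and b: "b = a" for y b
  proof -
    assume ne: "p2 b \<noteq> y"
    obtain d where d: "d \<in> A" "p2 d = y" using im y less.prems by (metis imageE imageI)
    have "d \<le> a" using mono2[OF d(1) less.prems(2)] d y by simp
    moreover have "d \<noteq> a" using d ne b by auto
    ultimately have "p1 d = p1 a" using IH[of d] d y by simp
    thus False using inj1 d less.prems \<open>d \<noteq> a\<close> by (auto simp: inj_on_def)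
  qed
  show ?case
  proof (rule ccontr)
    assume ne: "p1 a \<noteq> p2 a"
    have n1: "\<not> le2 (p2 a) (p1 a)" using occ1[OF refl] ne by blast
    have n2: "\<not> le2 (p1 a) (p2 a)" using occ2[OF refl] ne by metis
    obtain i j where ij: "p a = (i, j)" by (cases "p a")
    have "p1 a = (i - 1, j) \<and> p2 a = (i, j - 1) \<or> p1 a = (i, j - 1) \<and> p2 a = (i - 1, j)"
      using mv1[OF less.prems(2)] mv2[OF less.prems(2)] n1 n2 ij by (auto simp: nw_step_def)
    then obtain y1 y2 where y: "p1 a = y1" "p2 a = y2" "\<not> le2 y1 y2" "\<not> le2 y2 y1" "le2 y1 (p a)" "le2 y2 (p a)" "y1 \<noteq> p a" "y2 \<noteq> p a"
      using ij by auto
    have "y1 \<noteq> (1, 1)" "y2 \<noteq> (1, 1)" using y pos[OF less.prems(2)] pos2 by auto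
    then obtain z1 where z1: "z1 \<in> A" "p z1 = y1" using fill[OF less.prems(2)] y by metis
    obtain d where d: "d \<in> A" "p1 d = y2" using im y less.prems by (metis imageE imageI)
    obtain z2 where z2: "z2 \<in> A" "p z2 = y2" using fill[OF d(1)] d \<open>y2 \<noteq> (1, 1)\<close> by metis
    have "z1 \<noteq> a" "z2 \<noteq> a" using z1 z2 y by auto
    hence lt: "z1 < a" "z2 < a" using fin[OF z1(1) less.prems(2)] fin[OF z2(1) less.prems(2)] z1 z2 y by auto
    have m1: "p1 z1 \<noteq> p z1"
    proof
      assume "p1 z1 = p z1"
      hence "z1 = a" using inj1 z1 y less.prems by (auto simp: inj_on_def)
      thus False using lt by simp
    qed
    have m2: "p1 z2 \<noteq> p z2"
    proof
      assume "p1 z2 = p z2"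
      hence "p2 z2 = p2 a" using IH[OF z2(1) lt(2)] z2 y by simp
      hence "z2 = a" using inj2 z2 less.prems by (auto simp: inj_on_def)
      thus False using lt by simp
    qed
    have "le2 (p z1) (p z2) \<or> le2 (p z2) (p z1)"
      by (rule moved_chain[OF inj1 mv1 pos fill z1(1) z2(1) m1 m2])
    thus False using z1 z2 y by auto
  qed
qed

section \<open>The tableaux attached to a diagonal\<close>

text \<open>The canonical picture has \<open>n\<close> rows, so a rectangle with \<open>m\<close> rows is transposed.\<close>

definition canon :: "bool \<Rightarrow> box \<Rightarrow> int \<times> int" where
  "canon tr u = (if tr then (int (snd u), int (fst u)) else (int (fst u), int (snd u)))"

lemma canon_inj: "canon tr u = canon tr w \<longleftrightarrow> u = w"
  by (auto simp: canon_def prod_eq_iff)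

lemma canon_le: "le2 (canon tr u) (canon tr w) \<longleftrightarrow> fst u \<le> fst w \<and> snd u \<le> snd w"
  by (auto simp: canon_def)

lemma canon_neighbour:
  "canon tr u = (fst (canon tr h), snd (canon tr h) + 1) \<or> canon tr u = (fst (canon tr h) + 1, snd (canon tr h)) \<longleftrightarrow>
   u = (fst h, snd h + 1) \<or> u = (fst h + 1, snd h)"
  by (auto simp: canon_def prod_eq_iff)

lemma slide_next_Some:
  assumes "slide_next T h = Some v"
  shows "(v = (fst h, snd h + 1) \<or> v = (fst h + 1, snd h)) \<and> v \<in> dom T \<and>
    (\<forall>u\<in>dom T. u = (fst h, snd h + 1) \<or> u = (fst h + 1, snd h) \<longrightarrow> the (T v) \<le> the (T u))"
  using assms by (auto simp: slide_next_def Let_def split: option.splits if_splits)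

lemma slide_next_None:
  assumes "slide_next T h = None" "u \<in> dom T"
  shows "u \<noteq> (fst h, snd h + 1) \<and> u \<noteq> (fst h + 1, snd h)"
  using assms by (auto simp: slide_next_def Let_def split: option.splits if_splits)

lemma rev_slide_next_Some:
  assumes "rev_slide_next T h = Some v"
  shows "(v = (fst h, snd h - 1) \<or> v = (fst h - 1, snd h)) \<and> v \<in> dom T \<and>
    (\<forall>u\<in>dom T. u = (fst h, snd h - 1) \<or> u = (fst h - 1, snd h) \<longrightarrow> the (T u) \<le> the (T v))"
  using assms by (auto simp: rev_slide_next_def Let_def split: option.splits if_splits)

lemma rev_slide_next_None:
  assumes "rev_slide_next T h = None" "u \<in> dom T"
  shows "u \<noteq> (fst h, snd h - 1) \<and> u \<noteq> (fst h - 1, snd h)"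
  using assms by (auto simp: rev_slide_next_def Let_def split: option.splits if_splits)

lemma frame_forward: "finite X \<Longrightarrow> frame X (canon tr) (\<lambda>k. k) slide_next"
proof
  fix T h v assume "slide_next T h = Some v"
  note s = slide_next_Some[OF this]
  show "v \<in> dom T \<and> (canon tr v = (fst (canon tr h), snd (canon tr h) + 1) \<or> canon tr v = (fst (canon tr h) + 1, snd (canon tr h))) \<and>
     (\<forall>u\<in>dom T. canon tr u = (fst (canon tr h), snd (canon tr h) + 1) \<or> canon tr u = (fst (canon tr h) + 1, snd (canon tr h)) \<longrightarrow> the (T v) \<le> the (T u))"
    unfolding canon_neighbour using s by blast
next
  fix T h u assume "slide_next T h = None" "u \<in> dom T"
  note s = slide_next_None[OF this]
  show "canon tr u \<noteq> (fst (canon tr h), snd (canon tr h) + 1) \<and> canon tr u \<noteq> (fst (canon tr h) + 1, snd (canon tr h))"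
    using canon_neighbour[of tr u h] s by blast
qed (auto simp: inj_on_def canon_inj)

lemma rot_neighbour:
  assumes "1 \<le> fst h" "1 \<le> snd h"
  shows "rotz n m (canon tr u) = (fst (rotz n m (canon tr h)), snd (rotz n m (canon tr h)) + 1) \<or>
     rotz n m (canon tr u) = (fst (rotz n m (canon tr h)) + 1, snd (rotz n m (canon tr h))) \<longleftrightarrow>
   u = (fst h, snd h - 1) \<or> u = (fst h - 1, snd h)"
  using assms by (auto simp: canon_def rotz_def prod_eq_iff)

lemma frame_backward:
  assumes "finite X" and pos: "\<And>u. u \<in> X \<Longrightarrow> 1 \<le> fst u \<and> 1 \<le> snd u"
  shows "frame X (\<lambda>u. rotz n m (canon tr u)) (\<lambda>k. N - k) rev_slide_next"
proof
  fix T h v assume h: "h \<in> X" and "rev_slide_next T h = Some v"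
  note s = rev_slide_next_Some[OF this(2)]
  have p: "1 \<le> fst h" "1 \<le> snd h" using pos[OF h] by auto
  show "v \<in> dom T \<and> (rotz n m (canon tr v) = (fst (rotz n m (canon tr h)), snd (rotz n m (canon tr h)) + 1) \<or> rotz n m (canon tr v) = (fst (rotz n m (canon tr h)) + 1, snd (rotz n m (canon tr h)))) \<and>
     (\<forall>u\<in>dom T. rotz n m (canon tr u) = (fst (rotz n m (canon tr h)), snd (rotz n m (canon tr h)) + 1) \<or> rotz n m (canon tr u) = (fst (rotz n m (canon tr h)) + 1, snd (rotz n m (canon tr h))) \<longrightarrow> N - the (T v) \<le> N - the (T u))"
    unfolding rot_neighbour[OF p] using s by auto
next
  fix T h u assume h: "h \<in> X" and "rev_slide_next T h = None" "u \<in> dom T"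
  note s = rev_slide_next_None[OF this(2,3)]
  have p: "1 \<le> fst h" "1 \<le> snd h" using pos[OF h] by auto
  show "rotz n m (canon tr u) \<noteq> (fst (rotz n m (canon tr h)), snd (rotz n m (canon tr h)) + 1) \<and> rotz n m (canon tr u) \<noteq> (fst (rotz n m (canon tr h)) + 1, snd (rotz n m (canon tr h)))"
    using rot_neighbour[OF p, of n m tr u] s by blast
next
  show "inj_on (\<lambda>u. rotz n m (canon tr u)) X" by (rule inj_onI) (metis canon_inj rotz_rotz)
qed (auto simp: assms inj_def)

lemma increasing_index:
  fixes f :: "nat \<Rightarrow> nat"
  assumes step: "\<And>i. 1 \<le> i \<Longrightarrow> i < n \<Longrightarrow> f i < f (i + 1)" and rng: "\<And>i. 1 \<le> i \<Longrightarrow> i \<le> n \<Longrightarrow> 1 \<le> f i \<and> f i \<le> n"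
    and i: "1 \<le> i" "i \<le> n"
  shows "f i = i"
proof -
  have lo: "i + 1 \<le> n \<Longrightarrow> i + 1 \<le> f (i + 1)" for i
  proof (induction i)
    case 0 thus ?case using rng[of 1] by simp
  next
    case (Suc i) thus ?case using step[of "i + 1"] by simp
  qed
  have hi: "k < n \<Longrightarrow> f (n - k) \<le> n - k" for k
  proof (induction k)
    case 0 thus ?case using rng[of n] by simp
  next
    case (Suc k)
    have e: "n - Suc k + 1 = n - k" using Suc.prems by simp
    have "f (n - Suc k) < f (n - Suc k + 1)" by (rule step) (use Suc.prems in auto)
    moreover have "f (n - k) \<le> n - k" using Suc by simp
    ultimately show ?case using e by simp
  qed
  show ?thesis using lo[of "i - 1"] hi[of "n - i"] i by simp
qed

locale oriented =
  fixes n m r s :: nat and tr :: bool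
  assumes n1: "1 \<le> n" and nm: "n \<le> m" and rs: "(r, s) = (if tr then (m, n) else (n, m))"
begin

lemma canon_rect: "u \<in> rect r s \<longleftrightarrow> canon tr u \<in> rectz n m"
  using rs by (cases u) (auto simp: rect_def rectz_def canon_def split: if_splits)

lemma canon_surj: "y \<in> rectz n m \<Longrightarrow> \<exists>u\<in>rect r s. canon tr u = y"
proof -
  assume y: "y \<in> rectz n m"
  define u where "u = (if tr then (nat (snd y), nat (fst y)) else (nat (fst y), nat (snd y)))"
  have "canon tr u = y" using y by (cases y) (auto simp: u_def canon_def rectz_def)
  thus ?thesis using canon_rect y by metis
qed

lemma canon_bij: "bij_betw (canon tr) (rect r s) (rectz n m)"
proof (rule bij_betw_imageI)
  show "inj_on (canon tr) (rect r s)" by (simp add: inj_on_def canon_inj)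
  show "canon tr ` rect r s = rectz n m" using canon_rect canon_surj by blast
qed

lemma finite_rect: "finite (rect r s)"
  by (simp add: rect_def)

lemma canon_first: "canon tr (1, 1) = (1, 1)" and canon_last: "canon tr (r, s) = (int n, int m)"
  and card_rect: "card (rect r s) = m * n" and rs_mult: "r * s = m * n"
  using rs by (auto simp: canon_def rect_def split: if_splits)

lemma corner_rect: "(1, 1) \<in> rect r s" "(r, s) \<in> rect r s"
  using canon_rect canon_first canon_last n1 nm by (auto simp: rectz_def)

end

locale oriented_diag = oriented +
  fixes Lplus Lminus :: "box set" and b :: "nat \<Rightarrow> box"
  assumes dia: "is_diagonal (rect r s) n Lplus Lminus b"
begin

text \<open>The boxes \<open>b i\<close> run up and to the right: after transposition
  \<open>b i\<close> has row \<open>i\<close>, without it the rows are counted from the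
  bottom.\<close>

definition canon_row :: "nat \<Rightarrow> int" where "canon_row i = (if tr then int i else int n + 1 - int i)"

definition row_end :: "int \<Rightarrow> int" where "row_end a = snd (canon tr (b (nat (if tr then a else int n + 1 - a))))"

lemma young_plus: "young_diagram Lplus" and young_minus: "young_diagram Lminus" and sub: "Lminus \<subseteq> Lplus" "Lplus \<subseteq> rect r s"
  and diff: "Lplus - Lminus = b ` {1..n}"
  and b_step: "1 \<le> i \<Longrightarrow> i < n \<Longrightarrow> fst (b (i + 1)) < fst (b i) \<and> snd (b i) < snd (b (i + 1))"
  using dia by (auto simp: is_diagonal_def)

lemma b_rect: "1 \<le> i \<Longrightarrow> i \<le> n \<Longrightarrow> b i \<in> rect r s"
  using diff sub by auto

text \<open>\<open>n\<close> strictly monotone indices between 1 and \<open>n\<close> leave no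
  choice.\<close>

lemma b_row: "1 \<le> i \<Longrightarrow> i \<le> n \<Longrightarrow> fst (canon tr (b i)) = canon_row i"
proof -
  assume i: "1 \<le> i" "i \<le> n"
  have rng: "1 \<le> fst (b i) \<and> 1 \<le> snd (b i) \<and> fst (b i) \<le> r \<and> snd (b i) \<le> s" if "1 \<le> i" "i \<le> n" for i
    using b_rect[OF that] by (cases "b i") (auto simp: rect_def)
  show ?thesis
  proof (cases tr)
    case True
    have "snd (b i) = i" by (rule increasing_index[OF _ _ i]) (use b_step rng rs True in auto)
    thus ?thesis using True unfolding canon_def canon_row_def by simp
  next
    case False
    have r: "r = n" using rs False by simp
    have "n + 1 - fst (b i) = i"
    proof (rule increasing_index[OF _ _ i])
      fix i assume h: "1 \<le> i" "i < n"
      show "n + 1 - fst (b i) < n + 1 - fst (b (i + 1))" using b_step[OF h] rng[of i] h r by auto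
    next
      fix i assume h: "1 \<le> i" "i \<le> n"
      show "1 \<le> n + 1 - fst (b i) \<and> n + 1 - fst (b i) \<le> n" using rng[OF h] r by auto
    qed
    thus ?thesis using False rng[OF i] r unfolding canon_def canon_row_def by auto
  qed
qed

lemma canon_row_range: "1 \<le> i \<Longrightarrow> i \<le> n \<Longrightarrow> 1 \<le> canon_row i \<and> canon_row i \<le> int n"
  by (auto simp: canon_row_def)

lemma canon_row_inj: "1 \<le> i \<Longrightarrow> i \<le> n \<Longrightarrow> 1 \<le> i' \<Longrightarrow> i' \<le> n \<Longrightarrow> canon_row i = canon_row i' \<Longrightarrow> i = i'"
  by (auto simp: canon_row_def split: if_splits)

lemma canon_row_surj: "1 \<le> a \<Longrightarrow> a \<le> int n \<Longrightarrow> \<exists>i. 1 \<le> i \<and> i \<le> n \<and> canon_row i = a"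
  by (rule exI[of _ "nat (if tr then a else int n + 1 - a)"]) (auto simp: canon_row_def)

lemma b_canon: "1 \<le> i \<Longrightarrow> i \<le> n \<Longrightarrow> canon tr (b i) = (canon_row i, row_end (canon_row i))"
proof -
  assume i: "1 \<le> i" "i \<le> n"
  have "nat (if tr then canon_row i else int n + 1 - canon_row i) = i" unfolding canon_row_def using i by auto
  thus ?thesis using b_row[OF i] by (simp add: row_end_def prod_eq_iff)
qed

lemma b_inj: "inj_on b {1..n}"
  by (rule inj_onI) (metis atLeastAtMost_iff b_row canon_row_inj)

lemma diag_row_end: "diag n row_end"
proof
  fix a assume a: "1 \<le> a" "a < int n"
  show "row_end (a + 1) < row_end a"
  proof (cases tr)
    case True
    have "nat (a + 1) = nat a + 1" using a by simp
    thus ?thesis using b_step[of "nat a"] a True unfolding row_end_def canon_def by simp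
  next
    case False
    define i where "i = nat (int n - a)"
    have "nat (int n + 1 - (a + 1)) = i" "nat (int n + 1 - a) = i + 1" using a by (auto simp: i_def)
    moreover have "1 \<le> i" "i < n" using a by (auto simp: i_def)
    ultimately show ?thesis using b_step[of i] a False unfolding row_end_def canon_def by simp
  qed
next
  obtain i where i: "1 \<le> i" "i \<le> n" "canon_row i = int n" using canon_row_surj[of "int n"] n1 by auto
  have "canon tr (b i) \<in> rectz n m" using canon_rect b_rect[OF i(1,2)] by blast
  thus "1 \<le> row_end (int n)" using b_canon[OF i(1,2)] i by (simp add: rectz_def)
qed

sublocale DG: diag n row_end by (rule diag_row_end)

lemma row_end_le: "1 \<le> a \<Longrightarrow> a \<le> int n \<Longrightarrow> row_end a \<le> int m"
proof -
  assume "1 \<le> a" "a \<le> int n"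
  then obtain i where i: "1 \<le> i" "i \<le> n" "canon_row i = a" using canon_row_surj by blast
  have "canon tr (b i) \<in> rectz n m" using canon_rect b_rect[OF i(1,2)] by blast
  thus ?thesis using b_canon[OF i(1,2)] i by (simp add: rectz_def)
qed

lemma young_down: "young_diagram Y \<Longrightarrow> w \<in> Y \<Longrightarrow> u \<in> rect r s \<Longrightarrow> le2 (canon tr u) (canon tr w) \<Longrightarrow> u \<in> Y"
proof -
  assume y: "young_diagram Y" and w: "w \<in> Y" and u: "u \<in> rect r s" and le: "le2 (canon tr u) (canon tr w)"
  have "1 \<le> fst u" "1 \<le> snd u" "fst u \<le> fst w" "snd u \<le> snd w" using u le by (cases u; auto simp: rect_def canon_le)+
  moreover have "\<And>i j i' j'. (i, j) \<in> Y \<Longrightarrow> 1 \<le> i' \<Longrightarrow> i' \<le> i \<Longrightarrow> 1 \<le> j' \<Longrightarrow> j' \<le> j \<Longrightarrow> (i', j') \<in> Y"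
    using y unfolding young_diagram_def by blast
  moreover have "(fst w, snd w) \<in> Y" using w by simp
  ultimately have "(fst u, snd u) \<in> Y" by blast
  thus ?thesis by simp
qed

text \<open>Each row contains one diagonal box, and closure of both diagrams towards the north-west
  decides the membership of the boxes on either side of it.\<close>

lemma mem_plus: "u \<in> rect r s \<Longrightarrow> u \<in> Lplus \<longleftrightarrow> snd (canon tr u) \<le> row_end (fst (canon tr u))"
  and mem_minus: "u \<in> rect r s \<Longrightarrow> u \<in> Lminus \<longleftrightarrow> snd (canon tr u) < row_end (fst (canon tr u))"
proof -
  assume u: "u \<in> rect r s"
  have "canon tr u \<in> rectz n m" using canon_rect u by blast
  then obtain i where i: "1 \<le> i" "i \<le> n" "canon_row i = fst (canon tr u)" using canon_row_surj[of "fst (canon tr u)"] by (auto simp: rectz_def)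
  have bi: "canon tr (b i) = (fst (canon tr u), row_end (fst (canon tr u)))" using b_canon[OF i(1,2)] i by simp
  have bm: "b i \<in> Lplus" "b i \<notin> Lminus" using diff i by auto
  have only: "u = b i" if h: "u \<in> Lplus" "u \<notin> Lminus"
  proof -
    have "u \<in> b ` {1..n}" using h diff by blast
    then obtain i' where i': "1 \<le> i'" "i' \<le> n" "u = b i'" by auto
    have "canon_row i' = canon_row i" using b_canon[OF i'(1,2)] i i' by simp
    thus ?thesis using canon_row_inj i i' by blast
  qed
  have le_plus: "u \<in> Lplus" if "snd (canon tr u) \<le> row_end (fst (canon tr u))"
    using young_down[OF young_plus bm(1) u] bi that by simp
  have no_minus: "u \<notin> Lminus" if "row_end (fst (canon tr u)) \<le> snd (canon tr u)"
  proof
    assume "u \<in> Lminus"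
    hence "b i \<in> Lminus" using young_down[OF young_minus _ b_rect[OF i(1,2)]] bi that by simp
    thus False using bm by simp
  qed
  show "u \<in> Lplus \<longleftrightarrow> snd (canon tr u) \<le> row_end (fst (canon tr u))"
    using le_plus no_minus only bi by (metis linear snd_conv order_refl)
  show "u \<in> Lminus \<longleftrightarrow> snd (canon tr u) < row_end (fst (canon tr u))"
    using le_plus no_minus only bi sub by (metis less_irrefl less_imp_le not_less snd_conv)
qed

lemma diag_filling_b: "1 \<le> i \<Longrightarrow> i \<le> n \<Longrightarrow> diag_filling n b f (b i) = Some (f i)"
  and diag_filling_dom: "dom (diag_filling n b f) = b ` {1..n}"
proof -
  have ks: "map fst (map (\<lambda>i. (b i, f i)) [1..<n + 1]) = map b [1..<n + 1]" by simp
  have observed: "set [1..<n + 1] = {1..n}" by auto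
  have d: "distinct (map fst (map (\<lambda>i. (b i, f i)) [1..<n + 1]))"
    unfolding ks distinct_map observed using b_inj distinct_upt by blast
  show "diag_filling n b f (b i) = Some (f i)" if i: "1 \<le> i" "i \<le> n"
  proof -
    have "(b i, f i) \<in> set (map (\<lambda>i. (b i, f i)) [1..<n + 1])" unfolding set_map observed using i by auto
    thus ?thesis unfolding diag_filling_def by (rule map_of_is_SomeI[OF d])
  qed
  show "dom (diag_filling n b f) = b ` {1..n}"
    unfolding diag_filling_def dom_map_of_conv_image_fst set_map image_image observed by simp
qed

lemma b_set: "b ` {1..n} = {u\<in>rect r s. snd (canon tr u) = row_end (fst (canon tr u))}"
proof -
  have "b ` {1..n} = {u\<in>rect r s. u \<in> Lplus \<and> u \<notin> Lminus}" using diff sub by blast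
  also have "\<dots> = {u\<in>rect r s. snd (canon tr u) = row_end (fst (canon tr u))}"
  proof (rule Collect_cong, rule conj_cong[OF refl])
    fix u assume "u \<in> rect r s"
    thus "(u \<in> Lplus \<and> u \<notin> Lminus) = (snd (canon tr u) = row_end (fst (canon tr u)))"
      using mem_plus[of u] mem_minus[of u] by linarith
  qed
  finally show ?thesis .
qed

text \<open>Residues are represented in \<open>{1..n}\<close> and not from 0 on, since
  \<open>w\<close> permutes that set.\<close>

definition perm_class :: "(nat \<Rightarrow> nat) \<Rightarrow> int \<Rightarrow> int" where
  "perm_class w k = canon_row (inv w (nat ((k - 1) mod int n + 1)))"

context
  fixes w :: "nat \<Rightarrow> nat"
  assumes w: "w permutes {1..n}"
begin

lemma w_range: "i \<in> {1..n} \<Longrightarrow> w i \<in> {1..n}" "i \<in> {1..n} \<Longrightarrow> inv w i \<in> {1..n}"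
  using w permutes_in_image permutes_inv by metis+

lemma perm_class_w: "1 \<le> i \<Longrightarrow> i \<le> n \<Longrightarrow> perm_class w (int (w i)) = canon_row i"
proof -
  assume i: "1 \<le> i" "i \<le> n"
  have "1 \<le> w i" "w i \<le> n" using w_range(1)[of i] i by auto
  hence "(int (w i) - 1) mod int n = int (w i) - 1" by (intro mod_pos_pos_trivial) auto
  thus ?thesis using permutes_inverses(2)[OF w] by (simp add: perm_class_def)
qed

lemma perm_class_ex: "\<exists>i. 1 \<le> i \<and> i \<le> n \<and> perm_class w k = canon_row i \<and> int (w i) mod int n = k mod int n"
proof -
  define j where "j = nat ((k - 1) mod int n + 1)"
  have "0 \<le> (k - 1) mod int n" "(k - 1) mod int n < int n" using n1 by auto
  hence j: "j \<in> {1..n}" "int j = (k - 1) mod int n + 1" by (auto simp: j_def)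
  have "inv w j \<in> {1..n}" "w (inv w j) = j" using w_range(2)[OF j(1)] permutes_inverses(1)[OF w] by auto
  moreover have "int j mod int n = k mod int n" unfolding j(2) by (simp add: mod_add_left_eq)
  ultimately show ?thesis by (intro exI[of _ "inv w j"]) (auto simp: perm_class_def j_def)
qed

lemma rods_perm_class: "rods n (perm_class w)"
proof
  show "1 \<le> n" by (rule n1)
  fix k
  have "(k + int n - 1) mod int n = (k - 1) mod int n" by (metis add_diff_eq diff_add_eq mod_add_self2)
  thus "perm_class w (k + int n) = perm_class w k" by (simp add: perm_class_def)
next
  have im: "perm_class w ` {1..int n} \<subseteq> {1..int n}"
  proof
    fix z assume "z \<in> perm_class w ` {1..int n}"
    then obtain k where "z = perm_class w k" by blast
    thus "z \<in> {1..int n}" using perm_class_ex[of k] canon_row_range by auto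
  qed
  have inj: "inj_on (perm_class w) {1..int n}"
  proof (rule inj_onI)
    fix x y assume x: "x \<in> {1..int n}" and y: "y \<in> {1..int n}" and e: "perm_class w x = perm_class w y"
    obtain i where i: "1 \<le> i" "i \<le> n" "perm_class w x = canon_row i" "int (w i) mod int n = x mod int n" using perm_class_ex by blast
    obtain i' where i': "1 \<le> i'" "i' \<le> n" "perm_class w y = canon_row i'" "int (w i') mod int n = y mod int n" using perm_class_ex by blast
    have "i = i'" using canon_row_inj i i' e by metis
    hence "x mod int n = y mod int n" using i i' by simp
    hence "int n dvd x - y" by (simp add: mod_eq_dvd_iff)
    thus "x = y" using x y dvd_imp_le_int[of "x - y" "int n"] by (cases "x = y") auto
  qed
  have "perm_class w ` {1..int n} = {1..int n}" by (rule card_subset_eq) (use im card_image[OF inj] in auto)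
  thus "bij_betw (perm_class w) {1..int n} {1..int n}" using inj by (simp add: bij_betw_def)
qed

lemma glued_perm_class: "glued n (perm_class w) m"
  by (intro glued.intro rods_perm_class glued_axioms.intro nm)

interpretation G: glued n "perm_class w" m by (rule glued_perm_class)

lemma lower_frame: "run_frame n (perm_class w) row_end Lplus (canon tr) (\<lambda>k. k) slide_next (int n)"
proof (intro run_frame.intro diag_rods.intro rods_perm_class diag_row_end frame_forward run_frame_axioms.intro)
  show "finite Lplus" using young_plus by (simp add: young_diagram_def)
  show "bij_betw (canon tr) Lplus (diag.L n row_end)"
  proof (rule bij_betw_imageI)
    show "inj_on (canon tr) Lplus" by (simp add: inj_on_def canon_inj)
    show "canon tr ` Lplus = diag.L n row_end"
    proof
      show "canon tr ` Lplus \<subseteq> diag.L n row_end"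
      proof
        fix y assume "y \<in> canon tr ` Lplus"
        then obtain u where u: "u \<in> Lplus" "y = canon tr u" by blast
        have "u \<in> rect r s" using u sub by blast
        thus "y \<in> diag.L n row_end" using mem_plus[of u] canon_rect[of u] u by (auto simp: DG.L_def rectz_def)
      qed
      show "diag.L n row_end \<subseteq> canon tr ` Lplus"
      proof
        fix y assume y: "y \<in> diag.L n row_end"
        have "y \<in> rectz n m" using y row_end_le[of "fst y"] by (cases y) (auto simp: DG.L_def rectz_def)
        then obtain u where u: "u \<in> rect r s" "canon tr u = y" using canon_surj by blast
        thus "y \<in> canon tr ` Lplus" using mem_plus[OF u(1)] y by (auto simp: DG.L_def)
      qed
    qed
  qed
qed simp

lemma lower_tab:
  shows "dom (T_lower n Lplus b w) = Lplus" and "u \<in> Lplus \<Longrightarrow> the (T_lower n Lplus b w u) = G.val 0 (canon tr u)"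
proof -
  interpret F: run_frame n "perm_class w" row_end Lplus "canon tr" "\<lambda>k. k" slide_next "int n" by (rule lower_frame)
  define T0 where "T0 = diag_filling n b (\<lambda>i. int (w i))"
  have bP: "b ` {1..n} = {u\<in>Lplus. snd (canon tr u) = row_end (fst (canon tr u))}"
    unfolding b_set using sub mem_plus by force
  have r0: "F.good T0"
  proof (rule F.good_init)
    show "dom T0 = {u\<in>Lplus. snd (canon tr u) = row_end (fst (canon tr u))}" unfolding T0_def diag_filling_dom by (rule bP)
    fix u assume "u \<in> dom T0"
    then obtain i where i: "1 \<le> i" "i \<le> n" "u = b i" unfolding T0_def diag_filling_dom by auto
    show "1 \<le> the (T0 u) \<and> the (T0 u) \<le> int n \<and> perm_class w (the (T0 u)) = fst (canon tr u)"
      using diag_filling_b[OF i(1,2)] w_range(1)[of i] perm_class_w[OF i(1,2)] b_row[OF i(1,2)] i by (simp add: T0_def)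
  qed
  have observed: "lower_step n Lplus b T T' \<longleftrightarrow> F.run_step T T'" if T: "F.good T" for T T'
  proof -
    have dP: "dom T \<subseteq> Lplus" using T by (simp add: F.good_def)
    \<comment> \<open>Taking \<open>x\<close> out of the unfilled part leaves a Young diagram
      exactly when the filled part together with \<open>x\<close> is closed towards the
      south-east.\<close>
    have yd: "young_diagram (Lplus - dom T - {x}) \<longleftrightarrow> F.up_closed (insert x (dom T))" if x: "x \<in> Lplus - dom T" for x
    proof
      assume y: "young_diagram (Lplus - dom T - {x})"
      show "F.up_closed (insert x (dom T))"
        unfolding F.up_closed_def
      proof (intro ballI impI)
        fix u z assume u: "u \<in> insert x (dom T)" and z: "z \<in> Lplus" and le: "le2 (canon tr u) (canon tr z)"
        have ur: "u \<in> rect r s" using u x dP sub by blast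
        show "z \<in> insert x (dom T)"
        proof (rule ccontr)
          assume "z \<notin> insert x (dom T)"
          hence "z \<in> Lplus - dom T - {x}" using z by blast
          hence "u \<in> Lplus - dom T - {x}" using young_down[OF y _ ur le] by blast
          thus False using u by blast
        qed
      qed
    next
      assume up: "F.up_closed (insert x (dom T))"
      show "young_diagram (Lplus - dom T - {x})"
        unfolding young_diagram_def
      proof (intro conjI)
        show "finite (Lplus - dom T - {x})" using F.X_fin by simp
        show "\<forall>(i, j)\<in>Lplus - dom T - {x}. 1 \<le> i \<and> 1 \<le> j" using young_plus unfolding young_diagram_def by blast
        show "\<forall>i j i' j'. (i, j) \<in> Lplus - dom T - {x} \<and> 1 \<le> i' \<and> i' \<le> i \<and> 1 \<le> j' \<and> j' \<le> j \<longrightarrow> (i', j') \<in> Lplus - dom T - {x}"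
        proof (intro allI impI)
          fix i j i' j' assume h: "(i, j) \<in> Lplus - dom T - {x} \<and> 1 \<le> i' \<and> i' \<le> i \<and> 1 \<le> j' \<and> j' \<le> j"
          hence P: "(i', j') \<in> Lplus" using young_plus unfolding young_diagram_def by blast
          have "le2 (canon tr (i', j')) (canon tr (i, j))" using h by (simp add: canon_le)
          hence "(i', j') \<notin> insert x (dom T)" using up h unfolding F.up_closed_def by blast
          thus "(i', j') \<in> Lplus - dom T - {x}" using P by blast
        qed
      qed
    qed
    have ex: "(\<exists>S. \<exists>i\<in>{1..n}. slide T x = (S, b i) \<and> T' = S(b i \<mapsto> the (T (b i)) + int n)) \<longleftrightarrow>
      (\<exists>S \<beta> s. \<beta> \<in> Lplus \<and> 1 \<le> s \<and> s \<le> int n \<and> canon tr \<beta> = (s, row_end s) \<and> slide_by slide_next T x = (S, \<beta>) \<and> T' = S(\<beta> \<mapsto> the (T \<beta>) + int n))" for x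
    proof
      assume "\<exists>S. \<exists>i\<in>{1..n}. slide T x = (S, b i) \<and> T' = S(b i \<mapsto> the (T (b i)) + int n)"
      then obtain S i where i: "i \<in> {1..n}" "slide T x = (S, b i)" "T' = S(b i \<mapsto> the (T (b i)) + int n)" by blast
      have "b i \<in> Lplus" using diff i by blast
      moreover have "canon tr (b i) = (canon_row i, row_end (canon_row i))" "1 \<le> canon_row i" "canon_row i \<le> int n" using b_canon[of i] canon_row_range[of i] i by auto
      ultimately show "\<exists>S \<beta> s. \<beta> \<in> Lplus \<and> 1 \<le> s \<and> s \<le> int n \<and> canon tr \<beta> = (s, row_end s) \<and> slide_by slide_next T x = (S, \<beta>) \<and> T' = S(\<beta> \<mapsto> the (T \<beta>) + int n)"
        using i unfolding slide_def by blast
    next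
      assume "\<exists>S \<beta> s. \<beta> \<in> Lplus \<and> 1 \<le> s \<and> s \<le> int n \<and> canon tr \<beta> = (s, row_end s) \<and> slide_by slide_next T x = (S, \<beta>) \<and> T' = S(\<beta> \<mapsto> the (T \<beta>) + int n)"
      then obtain S \<beta> s where h: "\<beta> \<in> Lplus" "1 \<le> s" "s \<le> int n" "canon tr \<beta> = (s, row_end s)" "slide_by slide_next T x = (S, \<beta>)" "T' = S(\<beta> \<mapsto> the (T \<beta>) + int n)" by blast
      have "\<beta> \<in> b ` {1..n}" unfolding bP using h by simp
      then obtain i where "i \<in> {1..n}" "\<beta> = b i" by blast
      thus "\<exists>S. \<exists>i\<in>{1..n}. slide T x = (S, b i) \<and> T' = S(b i \<mapsto> the (T (b i)) + int n)" using h unfolding slide_def by blast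
    qed
    show ?thesis unfolding lower_step_def Let_def F.run_step_def ex by (rule bex_cong[OF refl]) (simp add: yd)
  qed
  show "dom (T_lower n Lplus b w) = Lplus" unfolding T_lower_def T0_def[symmetric] by (rule F.run_result(1)[OF r0 observed])
  show "u \<in> Lplus \<Longrightarrow> the (T_lower n Lplus b w u) = G.val 0 (canon tr u)"
    unfolding T_lower_def T0_def[symmetric] by (rule F.run_result(2)[OF r0 observed])
qed

definition rot_row_end :: "int \<Rightarrow> int" where "rot_row_end a = int m + 1 - row_end (int n + 1 - a)"

lemma diag_rot_row_end: "diag n rot_row_end"
proof
  fix i assume i: "1 \<le> i" "i < int n"
  have e: "int n + 1 - (i + 1) = int n - i" "int n - i + 1 = int n + 1 - i" by auto
  have "row_end (int n + 1 - i) < row_end (int n - i)" using DG.C_dec[of "int n - i"] i unfolding e by simp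
  thus "rot_row_end (i + 1) < rot_row_end i" unfolding rot_row_end_def e by simp
qed (use row_end_le[of 1] n1 in \<open>simp add: rot_row_end_def\<close>)

text \<open>Rotating the boxes and replacing \<open>k\<close> by \<open>m * n + 1 - k\<close> turns
  reverse slides into slides. Subtracting \<open>n\<close> from an entry then means adding
  \<open>n\<close> to its image, which explains the increment \<open>- int n\<close>.\<close>

lemma upper_frame: "run_frame n G.rev_class rot_row_end (rect r s - Lminus) (\<lambda>u. rotz n m (canon tr u)) (\<lambda>k. int m * int n + 1 - k) rev_slide_next (- int n)"
proof (intro run_frame.intro diag_rods.intro G.rods_rev_class diag_rot_row_end frame_backward run_frame_axioms.intro)
  interpret DR: diag n rot_row_end by (rule diag_rot_row_end)
  show "finite (rect r s - Lminus)" using finite_rect by simp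
  show "\<And>u. u \<in> rect r s - Lminus \<Longrightarrow> 1 \<le> fst u \<and> 1 \<le> snd u" by (auto simp: rect_def)
  show "bij_betw (\<lambda>u. rotz n m (canon tr u)) (rect r s - Lminus) (diag.L n rot_row_end)"
  proof (rule bij_betw_imageI)
    show "inj_on (\<lambda>u. rotz n m (canon tr u)) (rect r s - Lminus)" by (rule inj_onI) (metis canon_inj rotz_rotz)
    show "(\<lambda>u. rotz n m (canon tr u)) ` (rect r s - Lminus) = diag.L n rot_row_end"
    proof
      show "(\<lambda>u. rotz n m (canon tr u)) ` (rect r s - Lminus) \<subseteq> diag.L n rot_row_end"
      proof
        fix y assume "y \<in> (\<lambda>u. rotz n m (canon tr u)) ` (rect r s - Lminus)"
        then obtain u where u: "u \<in> rect r s" "u \<notin> Lminus" "y = rotz n m (canon tr u)" by blast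
        thus "y \<in> diag.L n rot_row_end" using mem_minus[of u] canon_rect[of u] by (cases "canon tr u") (auto simp: DR.L_def rectz_def rotz_def rot_row_end_def)
      qed
      show "diag.L n rot_row_end \<subseteq> (\<lambda>u. rotz n m (canon tr u)) ` (rect r s - Lminus)"
      proof
        fix y assume y: "y \<in> diag.L n rot_row_end"
        have h: "1 \<le> int n + 1 - fst y" "int n + 1 - fst y \<le> int n" using y by (auto simp: DR.L_def)
        have "rotz n m y \<in> rectz n m" using y DG.C_pos[OF h] by (cases y) (auto simp: DR.L_def rectz_def rotz_def rot_row_end_def)
        then obtain u where u: "u \<in> rect r s" "canon tr u = rotz n m y" using canon_surj by blast
        have "u \<notin> Lminus" using mem_minus[OF u(1)] u(2) y by (auto simp: DR.L_def rotz_def rot_row_end_def)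
        thus "y \<in> (\<lambda>u. rotz n m (canon tr u)) ` (rect r s - Lminus)" using u by (intro image_eqI[of _ _ u]) auto
      qed
    qed
  qed
qed simp

lemma upper_tab:
  shows "dom (T_upper m n (rect r s) Lminus b w) = rect r s - Lminus"
    and "u \<in> rect r s - Lminus \<Longrightarrow> the (T_upper m n (rect r s) Lminus b w u) = int m * int n + 1 - G.R.val 0 (rotz n m (canon tr u))"
proof -
  define \<phi> where "\<phi> = (\<lambda>u. rotz n m (canon tr u))"
  define X where "X = rect r s - Lminus"
  interpret F: run_frame n G.rev_class rot_row_end X \<phi> "\<lambda>k. int m * int n + 1 - k" rev_slide_next "- int n"
    unfolding X_def \<phi>_def by (rule upper_frame)
  define T0 where "T0 = diag_filling n b (\<lambda>i. int (w i) + (int m - 1) * int n)"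
  have ph: "snd (\<phi> u) = rot_row_end (fst (\<phi> u)) \<longleftrightarrow> snd (canon tr u) = row_end (fst (canon tr u))" for u by (auto simp: \<phi>_def rotz_def rot_row_end_def)
  have phle: "le2 (\<phi> u) (\<phi> z) \<longleftrightarrow> le2 (canon tr z) (canon tr u)" for u z by (auto simp: \<phi>_def rotz_def)
  have bP: "b ` {1..n} = {u\<in>X. snd (canon tr u) = row_end (fst (canon tr u))}"
    unfolding b_set X_def using mem_minus by force
  have r0: "F.good T0"
  proof (rule F.good_init)
    show "dom T0 = {u\<in>X. snd (\<phi> u) = rot_row_end (fst (\<phi> u))}" unfolding T0_def diag_filling_dom ph by (rule bP)
    fix u assume "u \<in> dom T0"
    then obtain i where i: "1 \<le> i" "i \<le> n" "u = b i" unfolding T0_def diag_filling_dom by auto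
    \<comment> \<open>The offset \<open>(m - 1) * n\<close> of the starting entries brings their
      complements into \<open>{1..n}\<close>, as \<open>good_init\<close> requires.\<close>
    have t: "int m * int n + 1 - the (T0 u) = int n + 1 - int (w i)"
      using diag_filling_b[OF i(1,2)] i by (simp add: T0_def algebra_simps)
    have "G.rev_class (int n + 1 - int (w i)) = int n + 1 - perm_class w (int (w i) - int n)" by (simp add: G.rev_class_def)
    also have "perm_class w (int (w i) - int n) = canon_row i" using G.per[of "int (w i) - int n"] perm_class_w[OF i(1,2)] by simp
    finally have "G.rev_class (int n + 1 - int (w i)) = fst (\<phi> u)" using b_row[OF i(1,2)] i by (simp add: \<phi>_def rotz_def)
    thus "1 \<le> int m * int n + 1 - the (T0 u) \<and> int m * int n + 1 - the (T0 u) \<le> int n \<and> G.rev_class (int m * int n + 1 - the (T0 u)) = fst (\<phi> u)"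
      unfolding t using w_range(1)[of i] i by auto
  qed
  have observed: "upper_step n (rect r s) Lminus b T T' \<longleftrightarrow> F.run_step T T'" if T: "F.good T" for T T'
  proof -
    have dP: "dom T \<subseteq> X" using T by (simp add: F.good_def)
    have yd: "young_diagram (Lminus \<union> dom T \<union> {x}) \<longleftrightarrow> F.up_closed (insert x (dom T))" if x: "x \<in> X - dom T" for x
    proof
      assume y: "young_diagram (Lminus \<union> dom T \<union> {x})"
      show "F.up_closed (insert x (dom T))"
        unfolding F.up_closed_def phle
      proof (intro ballI impI)
        fix u z assume u: "u \<in> insert x (dom T)" and z: "z \<in> X" and le: "le2 (canon tr z) (canon tr u)"
        have zr: "z \<in> rect r s" using z by (simp add: X_def)
        have "u \<in> Lminus \<union> dom T \<union> {x}" using u by blast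
        hence "z \<in> Lminus \<union> dom T \<union> {x}" by (rule young_down[OF y _ zr le])
        thus "z \<in> insert x (dom T)" using z by (auto simp: X_def)
      qed
    next
      assume up: "F.up_closed (insert x (dom T))"
      show "young_diagram (Lminus \<union> dom T \<union> {x})"
        unfolding young_diagram_def
      proof (intro conjI)
        have sr: "Lminus \<union> dom T \<union> {x} \<subseteq> rect r s" using sub dP x by (auto simp: X_def)
        show "finite (Lminus \<union> dom T \<union> {x})" using sr finite_rect finite_subset by blast
        show "\<forall>(i, j)\<in>Lminus \<union> dom T \<union> {x}. 1 \<le> i \<and> 1 \<le> j" using sr by (auto simp: rect_def)
        show "\<forall>i j i' j'. (i, j) \<in> Lminus \<union> dom T \<union> {x} \<and> 1 \<le> i' \<and> i' \<le> i \<and> 1 \<le> j' \<and> j' \<le> j \<longrightarrow> (i', j') \<in> Lminus \<union> dom T \<union> {x}"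
        proof (intro allI impI)
          fix i j i' j' assume h: "(i, j) \<in> Lminus \<union> dom T \<union> {x} \<and> 1 \<le> i' \<and> i' \<le> i \<and> 1 \<le> j' \<and> j' \<le> j"
          have R: "(i', j') \<in> rect r s" using h sr by (force simp: rect_def)
          have le: "le2 (canon tr (i', j')) (canon tr (i, j))" using h by (simp add: canon_le)
          show "(i', j') \<in> Lminus \<union> dom T \<union> {x}"
          proof (cases "(i, j) \<in> Lminus")
            case True thus ?thesis using young_down[OF young_minus _ R le] by blast
          next
            case False
            hence "(i, j) \<in> insert x (dom T)" using h by blast
            moreover have "(i', j') \<in> X \<or> (i', j') \<in> Lminus" using R by (auto simp: X_def)
            ultimately show ?thesis using up le unfolding F.up_closed_def phle by blast
          qed
        qed
      qed
    qed
    have ex: "(\<exists>S. \<exists>i\<in>{1..n}. rev_slide T x = (S, b i) \<and> T' = S(b i \<mapsto> the (T (b i)) - int n)) \<longleftrightarrow>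
      (\<exists>S \<beta> s. \<beta> \<in> X \<and> 1 \<le> s \<and> s \<le> int n \<and> \<phi> \<beta> = (s, rot_row_end s) \<and> slide_by rev_slide_next T x = (S, \<beta>) \<and> T' = S(\<beta> \<mapsto> the (T \<beta>) + - int n))" for x
    proof
      assume "\<exists>S. \<exists>i\<in>{1..n}. rev_slide T x = (S, b i) \<and> T' = S(b i \<mapsto> the (T (b i)) - int n)"
      then obtain S i where i: "i \<in> {1..n}" "rev_slide T x = (S, b i)" "T' = S(b i \<mapsto> the (T (b i)) - int n)" by blast
      have "b i \<in> X" using bP i by blast
      moreover have "\<phi> (b i) = (int n + 1 - canon_row i, rot_row_end (int n + 1 - canon_row i))" "1 \<le> int n + 1 - canon_row i" "int n + 1 - canon_row i \<le> int n"
        using b_canon[of i] canon_row_range[of i] i by (auto simp: \<phi>_def rotz_def rot_row_end_def)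
      ultimately show "\<exists>S \<beta> s. \<beta> \<in> X \<and> 1 \<le> s \<and> s \<le> int n \<and> \<phi> \<beta> = (s, rot_row_end s) \<and> slide_by rev_slide_next T x = (S, \<beta>) \<and> T' = S(\<beta> \<mapsto> the (T \<beta>) + - int n)"
        using i unfolding rev_slide_def diff_conv_add_uminus by blast
    next
      assume "\<exists>S \<beta> s. \<beta> \<in> X \<and> 1 \<le> s \<and> s \<le> int n \<and> \<phi> \<beta> = (s, rot_row_end s) \<and> slide_by rev_slide_next T x = (S, \<beta>) \<and> T' = S(\<beta> \<mapsto> the (T \<beta>) + - int n)"
      then obtain S \<beta> s where h: "\<beta> \<in> X" "1 \<le> s" "s \<le> int n" "\<phi> \<beta> = (s, rot_row_end s)" "slide_by rev_slide_next T x = (S, \<beta>)" "T' = S(\<beta> \<mapsto> the (T \<beta>) + - int n)" by blast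
      have "\<beta> \<in> b ` {1..n}" unfolding bP using h ph[of \<beta>] by simp
      then obtain i where "i \<in> {1..n}" "\<beta> = b i" by blast
      thus "\<exists>S. \<exists>i\<in>{1..n}. rev_slide T x = (S, b i) \<and> T' = S(b i \<mapsto> the (T (b i)) - int n)"
        using h unfolding rev_slide_def diff_conv_add_uminus by blast
    qed
    have XX: "rect r s - (Lminus \<union> dom T) = X - dom T" by (auto simp: X_def)
    show ?thesis unfolding upper_step_def Let_def F.run_step_def ex XX by (rule bex_cong[OF refl]) (simp add: yd del: Un_insert_right)
  qed
  show "dom (T_upper m n (rect r s) Lminus b w) = rect r s - Lminus"
    unfolding T_upper_def T0_def[symmetric] X_def[symmetric] by (rule F.run_result(1)[OF r0 observed])
  have "u \<in> X \<Longrightarrow> int m * int n + 1 - the (T_upper m n (rect r s) Lminus b w u) = G.R.val 0 (\<phi> u)"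
    unfolding T_upper_def T0_def[symmetric] X_def[symmetric] by (rule F.run_result(2)[OF r0 observed])
  thus "u \<in> rect r s - Lminus \<Longrightarrow> the (T_upper m n (rect r s) Lminus b w u) = int m * int n + 1 - G.R.val 0 (rotz n m (canon tr u))"
    by (simp add: X_def \<phi>_def)
qed

lemma T_tab_eq:
  "T_tab m n (rect r s) Lplus Lminus b w = (\<lambda>x. if x \<in> rect r s then
     Some (if x \<in> Lplus then G.val 0 (canon tr x) else int m * int n + 1 - G.R.val 0 (rotz n m (canon tr x))) else None)"
proof
  fix x
  consider "x \<in> Lplus" | "x \<in> rect r s - Lplus" | "x \<notin> rect r s" by blast
  thus "T_tab m n (rect r s) Lplus Lminus b w x = (if x \<in> rect r s then
     Some (if x \<in> Lplus then G.val 0 (canon tr x) else int m * int n + 1 - G.R.val 0 (rotz n m (canon tr x))) else None)"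
  proof cases
    case 1
    have "x \<in> dom (T_lower n Lplus b w)" using 1 lower_tab(1) by simp
    thus ?thesis using 1 lower_tab(2)[OF 1] sub by (auto simp: T_tab_def)
  next
    case 2
    hence x: "x \<in> rect r s - Lminus" using sub by blast
    have "x \<in> dom (T_upper m n (rect r s) Lminus b w)" using x upper_tab(1) by simp
    thus ?thesis using 2 upper_tab(2)[OF x] by (auto simp: T_tab_def)
  next
    case 3
    have "x \<notin> dom (T_upper m n (rect r s) Lminus b w)" using 3 upper_tab(1) by simp
    thus ?thesis using 3 sub by (auto simp: T_tab_def domIff)
  qed
qed

text \<open>\<open>Lplus\<close> lies within \<open>i + j \<le> m + 1\<close>, where the universal
  formula holds, and the rest of the rectangle within \<open>n + 1 \<le> i + j\<close>, where the
  rotated one does. In this form a diagonal enters only through the classes of its boxes.\<close>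

lemma T_tab_glued:
  "T_tab m n (rect r s) Lplus Lminus b w = (\<lambda>x. if x \<in> rect r s then Some (G.glued_val 0 (canon tr x)) else None)"
proof -
  have "(if x \<in> Lplus then G.val 0 (canon tr x) else int m * int n + 1 - G.R.val 0 (rotz n m (canon tr x))) = G.glued_val 0 (canon tr x)"
    if x: "x \<in> rect r s" for x
  proof -
    have k: "canon tr x \<in> rectz n m" using canon_rect x by blast
    define a where "a = fst (canon tr x)"
    have a: "1 \<le> a" "a \<le> int n" using k by (auto simp: a_def rectz_def)
    show ?thesis
    proof (cases "x \<in> Lplus")
      case True
      have "row_end a + (a - 1) \<le> row_end 1" using DG.C_gap[of 1 a] a by simp
      hence "fst (canon tr x) + snd (canon tr x) \<le> int m + 1" using mem_plus[OF x] True row_end_le[of 1] n1 by (simp add: a_def)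
      thus ?thesis using True by (simp add: G.glued_val_def)
    next
      case False
      have "int n + 1 \<le> a + row_end a" using DG.C_lower[OF a] .
      hence "int n + 1 \<le> fst (canon tr x) + snd (canon tr x)" using mem_plus[OF x] False by (simp add: a_def)
      thus ?thesis using G.glued_val_rot[OF k, of 0] False by simp
    qed
  qed
  thus ?thesis unfolding T_tab_eq by (auto simp: fun_eq_iff)
qed

end

end

section \<open>Promotion\<close>

context oriented begin

text \<open>The entries at time \<open>t\<close> are \<open>t + 1\<close> up to \<open>t + m * n\<close>.\<close>

definition fill :: "(int \<Rightarrow> int \<times> int \<Rightarrow> int) \<Rightarrow> int \<Rightarrow> filling" where
  "fill V t = (\<lambda>x. if x \<in> rect r s then Some (V t (canon tr x) - t) else None)"

lemma sytD:
  assumes "T \<in> syt (rect r s)"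
  shows "dom T = rect r s" "bij_betw (\<lambda>x. the (T x)) (rect r s) {1..int m * int n}"
    "u \<in> rect r s \<Longrightarrow> w \<in> rect r s \<Longrightarrow> le2 (canon tr u) (canon tr w) \<Longrightarrow> the (T u) \<le> the (T w)"
proof -
  have h: "dom T = rect r s" "bij_betw (\<lambda>x. the (T x)) (rect r s) {1..int (card (rect r s))}"
    and row: "\<And>i j j'. (i, j) \<in> rect r s \<Longrightarrow> (i, j') \<in> rect r s \<Longrightarrow> j < j' \<Longrightarrow> the (T (i, j)) < the (T (i, j'))"
    and col: "\<And>i i' j. (i, j) \<in> rect r s \<Longrightarrow> (i', j) \<in> rect r s \<Longrightarrow> i < i' \<Longrightarrow> the (T (i, j)) < the (T (i', j))"
    using assms unfolding syt_def by blast+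
  show "dom T = rect r s" by (rule h)
  show "bij_betw (\<lambda>x. the (T x)) (rect r s) {1..int m * int n}" using h(2) by (simp add: card_rect)
  show "the (T u) \<le> the (T w)" if u: "u \<in> rect r s" "w \<in> rect r s" and le: "le2 (canon tr u) (canon tr w)"
  proof -
    obtain i j where uu: "u = (i, j)" by (cases u)
    obtain i' j' where ww: "w = (i', j')" by (cases w)
    have l: "i \<le> i'" "j \<le> j'" using le uu ww by (auto simp: canon_le)
    have mid: "(i, j') \<in> rect r s" using u uu ww by (auto simp: rect_def)
    have "the (T (i, j)) \<le> the (T (i, j'))" using row[of i j j'] u uu mid l by (cases "j = j'") auto
    also have "\<dots> \<le> the (T (i', j'))" using col[of i j' i'] u ww mid l by (cases "i = i'") auto
    finally show ?thesis using uu ww by simp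
  qed
qed

lemma sytI:
  assumes "dom T = rect r s" "bij_betw (\<lambda>x. the (T x)) (rect r s) {1..int m * int n}"
    "\<And>u w. u \<in> rect r s \<Longrightarrow> w \<in> rect r s \<Longrightarrow> le2 (canon tr u) (canon tr w) \<Longrightarrow> the (T u) \<le> the (T w)"
  shows "T \<in> syt (rect r s)"
proof -
  have observed: "the (T u) < the (T w)" if "u \<in> rect r s" "w \<in> rect r s" "fst u \<le> fst w" "snd u \<le> snd w" "u \<noteq> w" for u w
  proof -
    have "the (T u) \<noteq> the (T w)" using assms(2) that by (auto simp: bij_betw_def inj_on_def)
    thus ?thesis using assms(3)[of u w] that by (simp add: canon_le)
  qed
  show ?thesis
    unfolding syt_def mem_Collect_eq card_rect
  proof (intro conjI allI impI)
    fix i j j' assume "(i, j) \<in> rect r s \<and> (i, j') \<in> rect r s \<and> j < j'"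
    thus "the (T (i, j)) < the (T (i, j'))" using observed[of "(i, j)" "(i, j')"] by simp
  next
    fix i i' j assume "(i, j) \<in> rect r s \<and> (i', j) \<in> rect r s \<and> i < i'"
    thus "the (T (i, j)) < the (T (i', j))" using observed[of "(i, j)" "(i', j)"] by simp
  qed (use assms in auto)
qed

lemma promotion_slide:
  assumes T: "T \<in> syt (rect r s)"
  shows "\<exists>S. promotion r s T = S((r, s) \<mapsto> int m * int n) \<and> dom S = rect r s - {(r, s)} \<and>
    (\<forall>u\<in>dom S. \<forall>w\<in>dom S. le2 (canon tr u) (canon tr w) \<longrightarrow> the (S u) \<le> the (S w)) \<and> inj_on S (dom S) \<and>
    (\<forall>u\<in>rect r s - {(1, 1)}. \<exists>u'\<in>dom S. S u' = Some (the (T u) - 1) \<and> nw_step (canon tr u') (canon tr u)) \<and> the (T (1, 1)) = 1"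
proof -
  note t = sytD[OF T]
  define X where "X = rect r s"
  interpret F: frame X "canon tr" "\<lambda>k. k" slide_next by (rule frame_forward) (simp add: X_def finite_rect)
  have one: "(1, 1) \<in> X" using corner_rect by (simp add: X_def)
  have ge: "le2 (canon tr (1, 1)) (canon tr u)" if "u \<in> X" for u using that by (auto simp: canon_le X_def rect_def)
  have "0 < int m * int n" using n1 nm by simp
  hence "1 \<in> (\<lambda>x. the (T x)) ` rect r s" using t(2) by (auto simp: bij_betw_def)
  then obtain u0 where u0: "u0 \<in> rect r s" "the (T u0) = 1" by auto
  have "the (T (1, 1)) \<le> 1" using t(3)[OF _ u0(1)] ge[of u0] u0 one by (simp add: X_def)
  moreover have "1 \<le> the (T (1, 1))" using t(2) one by (auto simp: bij_betw_def X_def)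
  ultimately have T1: "the (T (1, 1)) = 1" by simp
  define T' where "T' = (\<lambda>x. if x = (1, 1) then None else map_option (\<lambda>a. a - 1) (T x))"
  have T'v: "T' u = Some (the (T u) - 1)" if "u \<in> X - {(1, 1)}" for u
  proof -
    have "u \<in> dom T" using that t(1) by (simp add: X_def)
    thus ?thesis using that by (auto simp: T'_def)
  qed
  have dT': "dom T' = X - {(1, 1)}"
  proof
    have "dom T' \<subseteq> dom T - {(1, 1)}" by (auto simp: T'_def split: if_splits)
    thus "dom T' \<subseteq> X - {(1, 1)}" unfolding t(1) X_def .
    show "X - {(1, 1)} \<subseteq> dom T'" using T'v by blast
  qed
  have i0: "F.inc T'"
    unfolding F.inc_def dT'
  proof (intro conjI ballI impI)
    fix u w assume "u \<in> X - {(1, 1)}" "w \<in> X - {(1, 1)}" "le2 (canon tr u) (canon tr w)"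
    thus "the (T' u) \<le> the (T' w)" using T'v[of u] T'v[of w] t(3)[of u w] by (simp add: X_def)
  next
    show "inj_on T' (X - {(1, 1)})"
    proof (rule inj_onI)
      fix u w assume "u \<in> X - {(1, 1)}" "w \<in> X - {(1, 1)}" "T' u = T' w"
      thus "u = w" using T'v[of u] T'v[of w] t(2) by (auto simp: X_def bij_betw_def inj_on_def)
    qed
  qed
  have ins: "insert (1, 1) (X - {(1, 1)}) = X" using one by blast
  have cv: "F.convex (insert (1, 1) (X - {(1, 1)}))"
    unfolding ins F.convex_def
  proof (intro ballI allI impI)
    fix u w y assume u: "u \<in> X" and w: "w \<in> X" and y: "le2 (canon tr u) y \<and> le2 y (canon tr w)"
    have "canon tr u \<in> rectz n m" "canon tr w \<in> rectz n m" using u w canon_rect by (auto simp: X_def)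
    hence "y \<in> rectz n m" using y by (cases y) (auto simp: rectz_def)
    thus "y \<in> canon tr ` X" using canon_surj[of y] by (auto simp: X_def)
  qed
  obtain S e where S: "slide_by slide_next T' (1, 1) = (S, e)" "e \<in> X" "dom S = X - {e}" "F.inc S"
     "\<forall>u\<in>X - {(1, 1)}. \<exists>u'\<in>dom S. S u' = T' u \<and> nw_step (canon tr u') (canon tr u)"
     "\<forall>u\<in>X. canon tr u \<noteq> (fst (canon tr e), snd (canon tr e) + 1) \<and> canon tr u \<noteq> (fst (canon tr e) + 1, snd (canon tr e))"
    using F.slide_ex[OF _ one _ dT' i0 cv] unfolding ins by blast
  \<comment> \<open>The rectangle has no box to the right of the final hole or below it, so the hole
    has reached the last corner.\<close>
  have "canon tr e = (int n, int m)"
  proof -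
    have k: "canon tr e \<in> rectz n m" using S(2) canon_rect by (simp add: X_def)
    have "(fst (canon tr e), snd (canon tr e) + 1) \<notin> rectz n m" using S(6) canon_surj unfolding X_def by blast
    moreover have "(fst (canon tr e) + 1, snd (canon tr e)) \<notin> rectz n m" using S(6) canon_surj unfolding X_def by blast
    ultimately show ?thesis using k by (cases "canon tr e") (auto simp: rectz_def)
  qed
  hence e: "e = (r, s)" using canon_last canon_inj by metis
  have "promotion r s T = S((r, s) \<mapsto> int m * int n)"
    unfolding promotion_def Let_def slide_def T'_def[symmetric] S(1) rs_mult by simp
  moreover have "S u' = Some (the (T u) - 1)" if "u \<in> X - {(1, 1)}" "S u' = T' u" for u u' using T'v[OF that(1)] that(2) by simp
  ultimately show ?thesis using S(3,4,5) T1 unfolding e F.inc_def X_def by (intro exI[of _ S]) metis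
qed

lemma promotion_syt:
  assumes T: "T \<in> syt (rect r s)"
  shows "promotion r s T \<in> syt (rect r s)"
    "u \<in> rect r s - {(1, 1)} \<Longrightarrow> \<exists>u'\<in>rect r s. promotion r s T u' = Some (the (T u) - 1) \<and> nw_step (canon tr u') (canon tr u)"
proof -
  note t = sytD[OF T]
  obtain S where S: "promotion r s T = S((r, s) \<mapsto> int m * int n)" "dom S = rect r s - {(r, s)}"
    "\<forall>u\<in>dom S. \<forall>w\<in>dom S. le2 (canon tr u) (canon tr w) \<longrightarrow> the (S u) \<le> the (S w)" "inj_on S (dom S)"
    "\<forall>u\<in>rect r s - {(1, 1)}. \<exists>u'\<in>dom S. S u' = Some (the (T u) - 1) \<and> nw_step (canon tr u') (canon tr u)" "the (T (1, 1)) = 1"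
    using promotion_slide[OF T] by blast
  define T2 where "T2 = promotion r s T"
  have T2o: "T2 u = S u" if "u \<noteq> (r, s)" for u using S(1) that by (simp add: T2_def)
  have T2e: "T2 (r, s) = Some (int m * int n)" using S(1) by (simp add: T2_def)
  have d2: "dom T2 = rect r s" using S(1,2) corner_rect(2) by (auto simp: T2_def)
  show mv: "\<exists>u'\<in>rect r s. promotion r s T u' = Some (the (T u) - 1) \<and> nw_step (canon tr u') (canon tr u)" if u: "u \<in> rect r s - {(1, 1)}" for u
  proof -
    obtain u' where u': "u' \<in> dom S" "S u' = Some (the (T u) - 1)" "nw_step (canon tr u') (canon tr u)" using S(5) u by blast
    have "u' \<in> rect r s - {(r, s)}" using u'(1) unfolding S(2) .
    hence "u' \<noteq> (r, s)" "u' \<in> rect r s" by blast+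
    thus ?thesis using T2o[of u'] u' by (auto simp: T2_def)
  qed
  have im: "(\<lambda>x. the (T2 x)) ` rect r s = {1..int m * int n}"
  proof -
    have fin: "finite ((\<lambda>x. the (T2 x)) ` rect r s)" using finite_rect by simp
    have sub: "{1..int m * int n} \<subseteq> (\<lambda>x. the (T2 x)) ` rect r s"
    proof
      fix k assume k: "k \<in> {1..int m * int n}"
      show "k \<in> (\<lambda>x. the (T2 x)) ` rect r s"
      proof (cases "k = int m * int n")
        case True thus ?thesis using T2e corner_rect(2) by (intro image_eqI[of _ _ "(r, s)"]) auto
      next
        case False
        have "k + 1 \<in> (\<lambda>x. the (T x)) ` rect r s" using t(2) k False by (auto simp: bij_betw_def)
        then obtain u where u: "u \<in> rect r s" "the (T u) = k + 1" by auto
        have "u \<noteq> (1, 1)" using u S(6) k by auto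
        then obtain u' where "u' \<in> rect r s" "T2 u' = Some (the (T u) - 1)" using mv[of u] u by (auto simp: T2_def)
        thus ?thesis using u by (intro image_eqI[of _ _ u']) auto
      qed
    qed
    have "card ((\<lambda>x. the (T2 x)) ` rect r s) \<le> card (rect r s)" by (rule card_image_le[OF finite_rect])
    also have "\<dots> = card {1..int m * int n}" by (simp add: card_rect flip: of_nat_mult)
    finally show ?thesis using card_seteq[OF fin sub] by simp
  qed
  have inj: "inj_on (\<lambda>x. the (T2 x)) (rect r s)"
    by (rule eq_card_imp_inj_on[OF finite_rect]) (simp add: im card_rect flip: of_nat_mult)
  show "promotion r s T \<in> syt (rect r s)"
    unfolding T2_def[symmetric]
  proof (rule sytI[OF d2])
    show "bij_betw (\<lambda>x. the (T2 x)) (rect r s) {1..int m * int n}" using inj im by (simp add: bij_betw_def)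
    fix u w assume u: "u \<in> rect r s" and w: "w \<in> rect r s" and le: "le2 (canon tr u) (canon tr w)"
    show "the (T2 u) \<le> the (T2 w)"
    proof (cases "w = (r, s)")
      case True
      have "the (T2 u) \<in> {1..int m * int n}" using im u by blast
      thus ?thesis using T2e True by simp
    next
      case False
      have "u \<noteq> (r, s)"
      proof
        assume "u = (r, s)"
        hence "w = (r, s)" using le w by (cases w) (auto simp: canon_le rect_def)
        thus False using False by simp
      qed
      thus ?thesis using S(2,3) u w le False T2o[of u] T2o[of w] by auto
    qed
  qed
qed

lemma fill_syt:
  assumes "rflow n m P V"
  shows "fill V t \<in> syt (rect r s)"
proof -
  interpret W: rflow n m P V by (rule assms)
  show ?thesis
  proof (rule sytI)
    show "dom (fill V t) = rect r s" by (auto simp: fill_def split: if_splits)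
    show "bij_betw (\<lambda>x. the (fill V t x)) (rect r s) {1..int m * int n}"
    proof (rule bij_betwI[where g = "\<lambda>k. inv_into (rect r s) (canon tr) (P t (k + t))"])
      show "(\<lambda>x. the (fill V t x)) \<in> rect r s \<rightarrow> {1..int m * int n}"
      proof
        fix x assume x: "x \<in> rect r s"
        have "canon tr x \<in> rectz n m" using canon_rect x by blast
        thus "the (fill V t x) \<in> {1..int m * int n}" using W.V_gt[of "canon tr x" t] W.V_le[of "canon tr x" t] x by (simp add: fill_def)
      qed
      have iv: "inv_into (rect r s) (canon tr) y \<in> rect r s \<and> canon tr (inv_into (rect r s) (canon tr) y) = y" if "y \<in> rectz n m" for y
        using canon_bij that by (metis bij_betw_imp_surj_on f_inv_into_f inv_into_into)
      show "(\<lambda>k. inv_into (rect r s) (canon tr) (P t (k + t))) \<in> {1..int m * int n} \<rightarrow> rect r s"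
      proof
        fix k assume "k \<in> {1..int m * int n}"
        hence "P t (k + t) \<in> rectz n m" by (intro W.P_D) auto
        thus "inv_into (rect r s) (canon tr) (P t (k + t)) \<in> rect r s" using iv by blast
      qed
      fix x assume x: "x \<in> rect r s"
      have "canon tr x \<in> rectz n m" using canon_rect x by blast
      thus "inv_into (rect r s) (canon tr) (P t (the (fill V t x) + t)) = x"
        using x W.P_V[of "canon tr x" t] canon_bij by (simp add: fill_def bij_betw_def)
    next
      fix k assume k: "k \<in> {1..int m * int n}"
      hence l: "t < k + t \<and> k + t \<le> t + int m * int n" by auto
      have y: "P t (k + t) \<in> rectz n m" by (rule W.P_D[OF l])
      define x where "x = inv_into (rect r s) (canon tr) (P t (k + t))"
      have x: "x \<in> rect r s" "canon tr x = P t (k + t)"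
        using canon_bij y unfolding x_def by (metis bij_betw_imp_surj_on inv_into_into, metis bij_betw_imp_surj_on f_inv_into_f)
      show "the (fill V t x) = k" using x W.V_P[OF l] by (simp add: fill_def)
    qed
    fix u w assume u: "u \<in> rect r s" "w \<in> rect r s" "le2 (canon tr u) (canon tr w)"
    have "V t (canon tr u) \<le> V t (canon tr w)" using W.V_mono canon_rect u by blast
    thus "the (fill V t u) \<le> the (fill V t w)" using u by (simp add: fill_def)
  qed
qed

text \<open>Promotion and the passage from \<open>t\<close> to \<open>t + 1\<close> both carry the
  surviving entries by single steps from the same boxes onto the same set of boxes, with increasing
  outcome; by \<open>unique_moves\<close> they agree.\<close>

lemma promotion_fill:
  assumes "rflow n m P V"
  shows "promotion r s (fill V t) = fill V (t + 1)"
proof -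
  interpret W: rflow n m P V by (rule assms)
  define T where "T = fill V t"
  have T: "T \<in> syt (rect r s)" unfolding T_def by (rule fill_syt[OF assms])
  obtain S where S: "promotion r s T = S((r, s) \<mapsto> int m * int n)" "dom S = rect r s - {(r, s)}"
    "\<forall>u\<in>dom S. \<forall>w\<in>dom S. le2 (canon tr u) (canon tr w) \<longrightarrow> the (S u) \<le> the (S w)" "inj_on S (dom S)"
    "\<forall>u\<in>rect r s - {(1, 1)}. \<exists>u'\<in>dom S. S u' = Some (the (T u) - 1) \<and> nw_step (canon tr u') (canon tr u)"
    using promotion_slide[OF T] by blast
  \<comment> \<open>The entry \<open>a\<close> after promotion was \<open>a + 1\<close> before it,
    which stands for the value \<open>a + t + 1\<close> of the family. The new entry
    \<open>m * n\<close> is left out.\<close>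
  define A where "A = {1..<int m * int n}"
  define p where "p = (\<lambda>a. P t (a + t + 1))"
  define p2 where "p2 = (\<lambda>a. P (t + 1) (a + t + 1))"
  have lv: "t < a + t + 1 \<and> a + t + 1 \<le> t + int m * int n" "t + 1 < a + t + 1" "t + 1 < a + t + 1 \<and> a + t + 1 \<le> t + 1 + int m * int n"
    if "a \<in> A" for a using that by (auto simp: A_def)
  have ex: "\<exists>u'. u' \<in> dom S \<and> S u' = Some a \<and> nw_step (canon tr u') (p a)" if a: "a \<in> A" for a
  proof -
    have y: "p a \<in> rectz n m" unfolding p_def by (rule W.P_D[OF lv(1)[OF a]])
    obtain u where u: "u \<in> rect r s" "canon tr u = p a" using canon_surj[OF y] by blast
    have v: "V t (p a) = a + t + 1" unfolding p_def by (rule W.V_P[OF lv(1)[OF a]])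
    have "u \<noteq> (1, 1)"
    proof
      assume "u = (1, 1)"
      hence "V t (1, 1) = a + t + 1" using u v canon_first by simp
      thus False using W.V_first[of t] a by (simp add: A_def)
    qed
    moreover have "the (T u) - 1 = a" using u v by (simp add: T_def fill_def)
    ultimately show ?thesis using S(5) u by force
  qed
  define q where "q = (\<lambda>a. SOME u'. u' \<in> dom S \<and> S u' = Some a \<and> nw_step (canon tr u') (p a))"
  have q: "q a \<in> dom S \<and> S (q a) = Some a \<and> nw_step (canon tr (q a)) (p a)" if "a \<in> A" for a
    unfolding q_def by (rule someI_ex[OF ex[OF that]])
  define p1 where "p1 = (\<lambda>a. canon tr (q a))"
  have q_inj: "inj_on q A" by (rule inj_onI) (metis option.inject q)
  have "card (rect r s - {(r, s)}) = m * n - 1" using card_Diff_singleton[OF corner_rect(2)] card_rect by simp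
  moreover have "card A = m * n - 1" by (simp add: A_def nat_diff_distrib flip: of_nat_mult)
  ultimately have "card (q ` A) = card (dom S)" using card_image[OF q_inj] S(2) by simp
  moreover have "finite (dom S)" using S(2) finite_rect by simp
  moreover have "q ` A \<subseteq> dom S" using q by blast
  ultimately have q_im: "q ` A = dom S" by (simp add: card_subset_eq)
  have last: "(int n, int m) \<in> rectz n m" using n1 nm by (auto simp: rectz_def)
  have im1: "p1 ` A = rectz n m - {(int n, int m)}"
  proof -
    have "p1 ` A = canon tr ` (rect r s - {(r, s)})" unfolding p1_def using q_im S(2) by (metis image_image)
    also have "\<dots> = canon tr ` rect r s - canon tr ` {(r, s)}" by (rule image_set_diff) (simp add: inj_def canon_inj)
    finally show ?thesis using canon_bij canon_last by (simp add: bij_betw_def)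
  qed
  have im2: "p2 ` A = rectz n m - {(int n, int m)}"
  proof
    show "p2 ` A \<subseteq> rectz n m - {(int n, int m)}"
    proof
      fix y assume "y \<in> p2 ` A"
      then obtain a where a: "a \<in> A" "y = p2 a" by blast
      have "V (t + 1) y = a + t + 1" using W.V_P[OF lv(3)[OF a(1)]] a by (simp add: p2_def)
      moreover have "y \<in> rectz n m" using W.P_D[OF lv(3)[OF a(1)]] a by (simp add: p2_def)
      ultimately show "y \<in> rectz n m - {(int n, int m)}" using W.V_last[of "t + 1"] a by (auto simp: A_def)
    qed
    show "rectz n m - {(int n, int m)} \<subseteq> p2 ` A"
    proof
      fix y assume y: "y \<in> rectz n m - {(int n, int m)}"
      define a where "a = V (t + 1) y - t - 1"
      have "V (t + 1) y < V (t + 1) (int n, int m)"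
        by (rule W.V_strict) (use y last in \<open>auto simp: rectz_def\<close>)
      hence "a \<in> A" using W.V_gt[of y "t + 1"] W.V_last[of "t + 1"] y by (auto simp: A_def a_def)
      moreover have "y = p2 a" using W.P_V[of y "t + 1"] y by (simp add: p2_def a_def)
      ultimately show "y \<in> p2 ` A" by blast
    qed
  qed
  have same: "p1 a = p2 a" if a: "a \<in> A" for a
  proof (rule unique_moves[where A = A and p = p])
    show "inj_on p1 A" by (rule inj_onI) (metis canon_inj option.inject p1_def q)
    show "inj_on p2 A"
    proof (rule inj_onI)
      fix x y assume "x \<in> A" "y \<in> A" "p2 x = p2 y"
      thus "x = y" using W.P_inj[OF lv(3) lv(3), of x y] by (simp add: p2_def)
    qed
    show "p1 ` A = p2 ` A" using im1 im2 by simp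
    show "a \<in> A" by (rule a)
    fix a assume a: "a \<in> A"
    show "nw_step (p1 a) (p a)" using q[OF a] by (simp add: p1_def)
    show "nw_step (p2 a) (p a)" using W.move[OF lv(1,2)[OF a]] by (simp add: p_def p2_def)
    have y1: "p1 a \<in> rectz n m" using im1 a by blast
    show "1 \<le> fst (p1 a) \<and> 1 \<le> snd (p1 a)" by (rule W.D_pos[OF y1])
    show "0 < a" using a by (simp add: A_def)
    show "p1 a = (1, 1) \<or> (\<exists>b\<in>A. p b = p1 a)"
    proof (cases "p1 a = (1, 1)")
      case False
      define b where "b = V t (p1 a) - t - 1"
      have "V t (p1 a) \<noteq> t + 1" using W.V_inj[OF y1 W.D_first, of t] W.V_first[of t] False by auto
      hence "b \<in> A" using W.V_gt[OF y1, of t] W.V_le[OF y1, of t] by (auto simp: A_def b_def)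
      moreover have "p b = p1 a" using W.P_V[OF y1, of t] by (simp add: p_def b_def)
      ultimately show ?thesis by blast
    qed simp
    fix b assume b: "b \<in> A"
    show "le2 (p1 a) (p1 b) \<Longrightarrow> a \<le> b" using S(3) q[OF a] q[OF b] by (force simp: p1_def)
    show "le2 (p2 a) (p2 b) \<Longrightarrow> a \<le> b" using W.P_mono[OF lv(3)[OF a] lv(3)[OF b]] by (simp add: p2_def)
    show "le2 (p a) (p b) \<Longrightarrow> a \<le> b" using W.P_mono[OF lv(1)[OF a] lv(1)[OF b]] by (simp add: p_def)
  qed
  show ?thesis
    unfolding T_def[symmetric] S(1)
  proof
    fix x
    consider "x = (r, s)" | "x \<in> rect r s - {(r, s)}" | "x \<notin> rect r s" "x \<noteq> (r, s)" by blast
    thus "(S((r, s) \<mapsto> int m * int n)) x = fill V (t + 1) x"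
    proof cases
      case 1 thus ?thesis using corner_rect(2) canon_last W.V_last[of "t + 1"] by (simp add: fill_def)
    next
      case 2
      hence "x \<in> q ` A" unfolding q_im S(2) .
      then obtain a where a: "a \<in> A" "x = q a" by blast
      have "canon tr x = P (t + 1) (a + t + 1)" using same[OF a(1)] unfolding p1_def p2_def a(2) .
      hence v: "V (t + 1) (canon tr x) = a + t + 1" using W.V_P[OF lv(3)[OF a(1)]] by simp
      have "S x = Some a" using q[OF a(1)] unfolding a(2) by blast
      moreover have "fill V (t + 1) x = Some a" using 2 v by (simp add: fill_def)
      ultimately show ?thesis using 2 by simp
    next
      case 3
      hence "x \<notin> dom S" using S(2) by blast
      thus ?thesis using 3 by (auto simp: fill_def domIff)
    qed
  qed
qed

text \<open>Periodicity of the orbit extends promotion to negative times. Adding \<open>t\<close> to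
  the entries at time \<open>t\<close> undoes the relabelling, so that an entry keeps its value as
  long as it is present.\<close>

lemma orbit_flow:
  assumes T: "T \<in> promotion_fixed r s n"
  shows "\<exists>P V. rflow n m P V \<and> fill V 0 = T"
proof -
  define E where "E = (\<lambda>t. (promotion r s ^^ nat (t mod int n)) T)"
  have Ts: "T \<in> syt (rect r s)" and fixT: "(promotion r s ^^ n) T = T" using T by (auto simp: promotion_fixed_def)
  have its: "(promotion r s ^^ i) T \<in> syt (rect r s)" for i
    by (induction i) (use Ts promotion_syt(1) in auto)
  have Es: "E t \<in> syt (rect r s)" for t by (simp add: E_def its)
  have Enext: "promotion r s (E t) = E (t + 1)" for t
  proof -
    define i where "i = nat (t mod int n)"
    have i: "int i = t mod int n" "i < n" using n1 by (auto simp: i_def nat_less_iff)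
    have m1: "(t + 1) mod int n = (int i + 1) mod int n" using i by (simp add: mod_add_left_eq)
    have "E t = (promotion r s ^^ i) T" by (simp add: E_def i_def)
    hence p: "promotion r s (E t) = (promotion r s ^^ Suc i) T" by simp
    show ?thesis
    proof (cases "Suc i = n")
      case True
      hence "(t + 1) mod int n = 0" using m1 by (metis mod_self of_nat_Suc add.commute)
      thus ?thesis using p True fixT by (simp add: E_def)
    next
      case False
      hence "(t + 1) mod int n = int (Suc i)" using m1 i by simp
      hence "E (t + 1) = (promotion r s ^^ Suc i) T" by (simp only: E_def nat_int)
      thus ?thesis using p by simp
    qed
  qed
  define kb where "kb = inv_into (rect r s) (canon tr)"
  have kb: "kb y \<in> rect r s" "canon tr (kb y) = y" if "y \<in> rectz n m" for y
    using canon_bij that unfolding kb_def by (metis bij_betw_imp_surj_on inv_into_into, metis bij_betw_imp_surj_on f_inv_into_f)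
  have bk: "kb (canon tr u) = u" if "u \<in> rect r s" for u using canon_bij that by (simp add: kb_def bij_betw_def)
  define V where "V = (\<lambda>t y. the (E t (kb y)) + t)"
  define U where "U = (\<lambda>t k. inv_into (rect r s) (\<lambda>x. the (E t x)) (k - t))"
  define P where "P = (\<lambda>t k. canon tr (U t k))"
  have U: "U t k \<in> rect r s" "the (E t (U t k)) = k - t" if "t < k" "k \<le> t + int m * int n" for t k
  proof -
    have "k - t \<in> (\<lambda>x. the (E t x)) ` rect r s" using sytD(2)[OF Es[of t]] that by (simp add: bij_betw_def)
    thus "U t k \<in> rect r s" "the (E t (U t k)) = k - t"
      unfolding U_def by (rule inv_into_into, rule f_inv_into_f[of "k - t" "\<lambda>x. the (E t x)"])
  qed
  have Einj: "u = w" if "u \<in> rect r s" "w \<in> rect r s" "the (E t u) = the (E t w)" for t u w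
    using sytD(2)[OF Es[of t]] that by (auto simp: bij_betw_def inj_on_def)
  have Erng: "1 \<le> the (E t u) \<and> the (E t u) \<le> int m * int n" if "u \<in> rect r s" for t u
    using sytD(2)[OF Es[of t]] that by (auto simp: bij_betw_def)
  have "rflow n m P V"
  proof
    show "1 \<le> n" by (rule n1)
    show "n \<le> m" by (rule nm)
    show "(1, 1) \<in> rectz n m" using n1 nm by (auto simp: rectz_def)
    fix t k assume l: "t < k \<and> k \<le> t + int m * int n"
    note u = U[of t k]
    show "P t k \<in> rectz n m" using u l canon_rect by (simp add: P_def)
    show "V t (P t k) = k" using u l bk by (simp add: V_def P_def)
    assume k: "t + 1 < k"
    have "U t k \<noteq> (1, 1)"
    proof
      assume "U t k = (1, 1)"
      hence "k - t = 1" using u l promotion_slide[OF Es[of t]] by metis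
      thus False using k by simp
    qed
    then obtain u' where u': "u' \<in> rect r s" "promotion r s (E t) u' = Some (the (E t (U t k)) - 1)" "nw_step (canon tr u') (canon tr (U t k))"
      using promotion_syt(2)[OF Es[of t], of "U t k"] u l by blast
    have "the (E (t + 1) u') = k - (t + 1)" using u'(2) u l unfolding Enext by simp
    hence "u' = U (t + 1) k" using Einj[OF u'(1) U(1)[of "t + 1" k], of "t + 1"] U(2)[of "t + 1" k] l k by simp
    thus "nw_step (P (t + 1) k) (P t k)" using u'(3) by (simp add: P_def)
  next
    fix x t assume x: "x \<in> rectz n m"
    show "t < V t x \<and> V t x \<le> t + int m * int n" using Erng[OF kb(1)[OF x], of t] by (auto simp: V_def)
    have "U t (V t x) = kb x"
      by (rule Einj[of _ _ t]) (use U[of t "V t x"] kb(1)[OF x] Erng[OF kb(1)[OF x], of t] in \<open>auto simp: V_def\<close>)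
    thus "P t (V t x) = x" using kb(2)[OF x] by (simp add: P_def)
    show "1 \<le> fst x \<and> 1 \<le> snd x" using x by (auto simp: rectz_def)
    show "V (t + int n) x = V t x + int n" by (simp add: V_def E_def)
  next
    fix x y t assume x: "x \<in> rectz n m" "y \<in> rectz n m" "le2 x y"
    thus "V t x \<le> V t y" using sytD(3)[OF Es[of t] kb(1)[OF x(1)] kb(1)[OF x(2)]] kb(2) by (simp add: V_def)
  qed auto
  moreover have "fill V 0 = T"
  proof
    fix x show "fill V 0 x = T x"
    proof (cases "x \<in> rect r s")
      case True
      have "x \<in> dom T" using sytD(1)[OF Ts] True by simp
      thus ?thesis using True bk[OF True] by (auto simp: fill_def V_def E_def)
    next
      case False
      hence "x \<notin> dom T" using sytD(1)[OF Ts] by simp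
      thus ?thesis using False by (auto simp: fill_def domIff)
    qed
  qed
  ultimately show ?thesis by blast
qed

end

section \<open>The cycle and the bijection\<close>

text \<open>The cycle sends each element of the list \<open>1, n, ..., 2\<close> to its successor,
  cyclically; for \<open>n = 1\<close> the list has a single element.\<close>

lemma cyc_value:
  assumes "1 \<le> n" "1 \<le> i" "i \<le> n"
  shows "cyc n i = (if i = 1 then n else i - 1)"
proof -
  define cs where "cs = 1 # rev [2..<n + 1]"
  have len: "length cs = n" unfolding cs_def length_Cons length_rev length_upt using assms by arith
  have d: "distinct cs" by (auto simp: cs_def)
  have nth: "cs ! k = (if k = 0 then 1 else n + 1 - k)" if "k < n" for k
    using that by (cases k) (auto simp: cs_def rev_nth simp del: upt_Suc)
  have "map (cycle_of_list cs) cs = rotate1 cs" using cyclic_rotation[OF d, of 1] by simp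
  hence rot: "cyc n (cs ! k) = cs ! (Suc k mod n)" if "k < n" for k
    using that len by (metis cs_def cyc_def nth_map nth_rotate1)
  show ?thesis
  proof (cases "i = 1")
    case True
    have "cyc n 1 = cs ! (Suc 0 mod n)" using rot[of 0] nth[of 0] assms by simp
    thus ?thesis using True nth[of "Suc 0 mod n"] assms by (cases "n = 1") auto
  next
    case False
    define k where "k = n + 1 - i"
    have k: "k < n" "cs ! k = i" "k \<noteq> 0" using False assms nth[of k] by (auto simp: k_def)
    have c: "cyc n i = cs ! (Suc k mod n)" using rot[OF k(1)] k(2) by simp
    show ?thesis
    proof (cases "Suc k = n")
      case True thus ?thesis using c nth[of 0] False assms by (auto simp: k_def)
    next
      case F2: False
      hence "Suc k mod n = Suc k" "Suc k < n" using k by auto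
      moreover from this have "cs ! Suc k = n - k" using nth[of "Suc k"] by simp
      moreover have "n - k = i - 1" using False assms by (simp add: k_def)
      ultimately show ?thesis using c False by simp
    qed
  qed
qed

lemma cyc_permutes: "1 \<le> n \<Longrightarrow> cyc n permutes {1..n}"
proof -
  assume n: "1 \<le> n"
  have "set (1 # rev [2..<n + 1]) = {1..n}" using n by auto
  thus ?thesis using cycle_permutes[of "1 # rev [2..<n + 1]"] by (simp add: cyc_def)
qed

context oriented_diag begin

abbreviation Tw :: "(nat \<Rightarrow> nat) \<Rightarrow> filling" where "Tw \<equiv> T_tab m n (rect r s) Lplus Lminus b"

lemma Tw_fill: "w permutes {1..n} \<Longrightarrow> Tw w = fill (glued.glued_val n (perm_class w) m) 0"
  unfolding fill_def diff_zero by (rule T_tab_glued)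

lemma Tw_flow: "w permutes {1..n} \<Longrightarrow> rflow n m (glued.glued_pos n (perm_class w) m) (glued.glued_val n (perm_class w) m)"
  by (rule glued.glued_rflow[OF glued_perm_class])

text \<open>Lowering all residues by one is a shift of the class function, that is, a change of the
  origin of time.\<close>

lemma perm_class_cyc:
  assumes w: "w permutes {1..n}"
  shows "perm_class (cyc n \<circ> w) = (\<lambda>k. perm_class w (k + 1))"
proof
  fix k
  have w': "cyc n \<circ> w permutes {1..n}" by (rule permutes_compose[OF w cyc_permutes[OF n1]])
  obtain i where i: "1 \<le> i" "i \<le> n" "perm_class (cyc n \<circ> w) k = canon_row i" "int ((cyc n \<circ> w) i) mod int n = k mod int n"
    using perm_class_ex[OF w'] by blast
  have wi: "1 \<le> w i" "w i \<le> n" using w_range(1)[OF w, of i] i by auto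
  have "int (w i) mod int n = (int (cyc n (w i)) + 1) mod int n"
    using cyc_value[OF n1 wi] wi by auto
  also have "\<dots> = (k + 1) mod int n" using i(4) by (metis comp_apply mod_add_left_eq)
  finally have "int n dvd int (w i) - (k + 1)" by (simp add: mod_eq_dvd_iff)
  hence "perm_class w (int (w i)) = perm_class w (k + 1)" using rods.c_eq_iff[OF rods_perm_class[OF w]] by blast
  thus "perm_class (cyc n \<circ> w) k = perm_class w (k + 1)" using perm_class_w[OF w i(1,2)] i(3) by simp
qed

text \<open>Promotion advances the time by one unit, and time 1 of the family of \<open>w\<close> is
  time 0 of the family of \<open>cyc n \<circ> w\<close>.\<close>

lemma promotion_Tw:
  assumes w: "w permutes {1..n}"
  shows "promotion r s (Tw w) = Tw (cyc n \<circ> w)"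
proof -
  have w': "cyc n \<circ> w permutes {1..n}" by (rule permutes_compose[OF w cyc_permutes[OF n1]])
  interpret G: glued n "perm_class w" m by (rule glued_perm_class[OF w])
  interpret H: glued n "\<lambda>k. perm_class w (k + 1)" m using glued_perm_class[OF w'] unfolding perm_class_cyc[OF w] .
  have glued_val: "H.glued_val 0 y = G.glued_val 1 y - 1" if y: "y \<in> rectz n m" for y
  proof -
    have "H.val 0 y = G.val 1 y - 1" using G.val_shifted[OF G.RR_strip[OF y], of 1 0] by simp
    moreover have "rods.val H.rev_class 0 (rotz n m y) = G.R.val (- 1) (rotz n m y) + 1"
      using G.R.val_shifted[OF G.RR_rev_strip[OF rotz_rectz[OF y]], of "- 1" 0] unfolding G.rev_class_shifted[of 1] by simp
    ultimately show ?thesis by (simp add: H.glued_val_def G.glued_val_def)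
  qed
  have "promotion r s (Tw w) = fill G.glued_val 1"
    using promotion_fill[OF Tw_flow[OF w], of 0] Tw_fill[OF w] by simp
  also have "\<dots> = fill H.glued_val 0"
    using glued_val canon_rect by (auto simp: fill_def fun_eq_iff)
  also have "\<dots> = Tw (cyc n \<circ> w)" using Tw_fill[OF w'] unfolding perm_class_cyc[OF w] by simp
  finally show ?thesis .
qed

text \<open>After \<open>n\<close> units of time every entry has grown by \<open>n\<close>, which
  \<open>fill\<close> subtracts again.\<close>

lemma Tw_fixed:
  assumes w: "w permutes {1..n}"
  shows "Tw w \<in> promotion_fixed r s n"
proof -
  interpret G: glued n "perm_class w" m by (rule glued_perm_class[OF w])
  have "(promotion r s ^^ i) (Tw w) = fill G.glued_val (int i)" for i
  proof (induction i)
    case 0 show ?case using Tw_fill[OF w] by simp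
  next
    case (Suc i)
    have e: "int (Suc i) = int i + 1" by simp
    show ?case unfolding e using Suc promotion_fill[OF Tw_flow[OF w], of "int i"] by simp
  qed
  hence "(promotion r s ^^ n) (Tw w) = fill G.glued_val (int n)" .
  also have "\<dots> = fill G.glued_val 0"
    using G.glued_val_shift[of _ 0] canon_rect by (auto simp: fill_def fun_eq_iff)
  finally have "(promotion r s ^^ n) (Tw w) = Tw w" using Tw_fill[OF w] by simp
  moreover have "Tw w \<in> syt (rect r s)" using fill_syt[OF Tw_flow[OF w]] Tw_fill[OF w] by simp
  ultimately show ?thesis by (simp add: promotion_fixed_def)
qed

text \<open>Diagonal boxes lie on or beyond the antidiagonal, where the class of an entry is its
  row.\<close>

lemma Tw_corner:
  assumes w: "w permutes {1..n}" and i: "1 \<le> i" "i \<le> n"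
  shows "the (Tw w (b i)) mod int n = int (w i) mod int n"
proof -
  interpret G: glued n "perm_class w" m by (rule glued_perm_class[OF w])
  have bL: "b i \<in> Lplus" using diff i by auto
  have x: "canon tr (b i) = (canon_row i, row_end (canon_row i))" by (rule b_canon[OF i])
  have D: "canon tr (b i) \<in> G.strip" using G.RR_strip canon_rect b_rect[OF i] by blast
  have "the (Tw w (b i)) = G.val 0 (canon tr (b i))" using T_tab_eq[OF w] b_rect[OF i] bL by simp
  moreover have "perm_class w (G.val 0 (canon tr (b i))) = canon_row i"
    using G.class_row[OF D, of 0] DG.C_lower[of "canon_row i"] canon_row_range[OF i] x by simp
  ultimately have "perm_class w (the (Tw w (b i))) = perm_class w (int (w i))" using perm_class_w[OF w i] by simp
  hence "int n dvd the (Tw w (b i)) - int (w i)" using G.c_eq_iff by blast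
  thus ?thesis by (simp add: mod_eq_dvd_iff)
qed

lemma mod_window:
  assumes "1 \<le> a" "a \<le> n" "1 \<le> a'" "a' \<le> n" "int a mod int n = int a' mod int n"
  shows "a = a'"
proof -
  have "int n dvd int a - int a'" using assms(5) by (simp add: mod_eq_dvd_iff)
  thus ?thesis using assms dvd_imp_le_int[of "int a - int a'" "int n"] by (cases "a = a'") auto
qed

lemma Tw_separates:
  assumes w: "w permutes {1..n}" and w': "w' permutes {1..n}" and i: "i \<in> {1..n}" and e: "the (Tw w (b i)) = the (Tw w' (b i))"
  shows "w i = w' i"
proof -
  have i': "1 \<le> i" "i \<le> n" using i by auto
  have "int (w i) mod int n = int (w' i) mod int n" using Tw_corner[OF w i'] Tw_corner[OF w' i'] e by simp
  thus ?thesis using mod_window[of "w i" "w' i"] w_range(1)[OF w i] w_range(1)[OF w' i] by simp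
qed

text \<open>The orbit of \<open>T\<close> is a periodic family whose classes at the diagonal are
  given by \<open>w\<close>. So \<open>lower_val\<close> and \<open>upper_val\<close> describe the
  two parts of \<open>T\<close> by the same formulas as those of \<open>Tw w\<close>.\<close>

lemma Tw_recover:
  assumes T: "T \<in> promotion_fixed r s n" and w: "\<And>i. i \<in> {1..n} \<Longrightarrow> w i \<in> {1..n} \<and> int (w i) mod int n = the (T (b i)) mod int n"
    and out: "\<And>i. i \<notin> {1..n} \<Longrightarrow> w i = i"
  shows "w permutes {1..n} \<and> Tw w = T"
proof -
  obtain P V where f: "rflow n m P V" and TV: "fill V 0 = T" using orbit_flow[OF T] by blast
  interpret W: dflow n m P V row_end
    by (intro dflow.intro f diag_row_end dflow_axioms.intro) (use row_end_le[of 1] n1 in simp)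
  have Tb: "the (T (b i)) = V 0 (canon_row i, row_end (canon_row i))" if i: "1 \<le> i" "i \<le> n" for i
    using b_rect[OF i] b_canon[OF i] unfolding TV[symmetric] by (simp add: fill_def)
  have inj: "inj_on w {1..n}"
  proof (rule inj_onI)
    fix i i' assume i: "i \<in> {1..n}" and i': "i' \<in> {1..n}" and e: "w i = w i'"
    have "V 0 (canon_row i, row_end (canon_row i)) mod int n = V 0 (canon_row i', row_end (canon_row i')) mod int n"
      using w[OF i] w[OF i'] e Tb[of i] Tb[of i'] i i' by simp
    hence "canon_row i = canon_row i'" using W.corner_residues_inj[of 0] canon_row_range[of i] canon_row_range[of i'] i i' by (auto simp: inj_on_def)
    thus "i = i'" using canon_row_inj i i' by simp
  qed
  have "w ` {1..n} = {1..n}" by (rule card_subset_eq) (use w card_image[OF inj] in auto)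
  hence "bij_betw w {1..n} {1..n}" using inj by (simp add: bij_betw_def)
  hence wp: "w permutes {1..n}" by (rule bij_imp_permutes) (use out in blast)
  have box_class: "W.box_class = perm_class w"
  proof
    fix k
    obtain i where i: "1 \<le> i" "i \<le> n" "perm_class w k = canon_row i" "int (w i) mod int n = k mod int n" using perm_class_ex[OF wp] by blast
    have "k mod int n = V 0 (canon_row i, row_end (canon_row i)) mod int n" using i w[of i] Tb[of i] by simp
    thus "W.box_class k = perm_class w k" using W.box_class_eqI[of "canon_row i" k 0] canon_row_range[OF i(1,2)] i(3) by simp
  qed
  have lo: "V 0 y = rods.val (perm_class w) 0 y" if "y \<in> DG.L" for y using W.lower_val[OF that] unfolding box_class .
  have hi: "V 0 y = int m * int n + 1 - rods.val (rods.rev_class n (perm_class w)) 0 (rotz n m y)" if "y \<in> rectz n m" "row_end (fst y) \<le> snd y" for y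
    using W.upper_val[OF that] unfolding box_class .
  have "Tw w = fill V 0"
    unfolding T_tab_eq[OF wp] fill_def
  proof
    fix x
    show "(if x \<in> rect r s then Some (if x \<in> Lplus then rods.val (perm_class w) 0 (canon tr x)
         else int m * int n + 1 - rods.val (rods.rev_class n (perm_class w)) 0 (rotz n m (canon tr x))) else None) =
      (if x \<in> rect r s then Some (V 0 (canon tr x) - 0) else None)"
    proof (cases "x \<in> rect r s")
      case True
      have k: "canon tr x \<in> rectz n m" using canon_rect True by blast
      show ?thesis
      proof (cases "x \<in> Lplus")
        case xL: True
        have "canon tr x \<in> DG.L" using mem_plus[OF True] xL k by (auto simp: DG.L_def rectz_def)
        thus ?thesis using lo True xL by simp
      next
        case False
        hence "row_end (fst (canon tr x)) \<le> snd (canon tr x)" using mem_plus[OF True] by simp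
        thus ?thesis using hi[OF k] True False by simp
      qed
    qed simp
  qed
  thus ?thesis using wp TV by simp
qed

lemma diagonal_bijection:
  "(bij_betw Tw {w. w permutes {1..n}} (promotion_fixed r s n)) \<and>
    (\<forall>w. w permutes {1..n} \<longrightarrow>
           promotion r s (Tw w) = Tw (cyc n \<circ> w) \<and> Tw w \<in> promotion_fixed r s n) \<and>
    (\<forall>w w'. w permutes {1..n} \<and> w' permutes {1..n} \<longrightarrow>
           (\<forall>i \<in> {1..n}. w i \<noteq> w' i \<longrightarrow> the (Tw w (b i)) \<noteq> the (Tw w' (b i)))) \<and>
    (inj_on Tw {w. w permutes {1..n}}) \<and>
    (\<forall>T \<in> promotion_fixed r s n. \<forall>w :: nat \<Rightarrow> nat.
           (\<forall>i \<in> {1..n}. w i \<in> {1..n} \<and> [int (w i) = the (T (b i))] (mod int n)) \<and>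
           (\<forall>i. i \<notin> {1..n} \<longrightarrow> w i = i) \<longrightarrow>
           w permutes {1..n} \<and> Tw w = T) \<and>
    (Tw ` {w. w permutes {1..n}} = promotion_fixed r s n)"
proof -
  have inj: "inj_on Tw {w. w permutes {1..n}}"
  proof (rule inj_onI)
    fix w w' assume w: "w \<in> {w. w permutes {1..n}}" "w' \<in> {w. w permutes {1..n}}" and e: "Tw w = Tw w'"
    show "w = w'"
    proof
      fix i show "w i = w' i"
        using Tw_separates[of w w' i] w e by (cases "i \<in> {1..n}") (auto simp: permutes_def)
    qed
  qed
  have im: "Tw ` {w. w permutes {1..n}} = promotion_fixed r s n"
  proof
    show "Tw ` {w. w permutes {1..n}} \<subseteq> promotion_fixed r s n" using Tw_fixed by blast
    show "promotion_fixed r s n \<subseteq> Tw ` {w. w permutes {1..n}}"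
    proof
      fix T assume T: "T \<in> promotion_fixed r s n"
      \<comment> \<open>The residue of the entry of \<open>b i\<close>, represented in
        \<open>{1..n}\<close>.\<close>
      define w where "w = (\<lambda>i. if i \<in> {1..n} then nat ((the (T (b i)) - 1) mod int n + 1) else i)"
      have "w permutes {1..n} \<and> Tw w = T"
      proof (rule Tw_recover[OF T])
        fix i assume i: "i \<in> {1..n}"
        define z where "z = (the (T (b i)) - 1) mod int n"
        have z: "0 \<le> z" "z < int n" using n1 by (auto simp: z_def)
        have wi: "int (w i) = z + 1" using i z by (simp add: w_def z_def)
        have "(z + 1) mod int n = the (T (b i)) mod int n" by (simp add: z_def mod_add_left_eq)
        thus "w i \<in> {1..n} \<and> int (w i) mod int n = the (T (b i)) mod int n" using wi z by auto
      next
        fix i assume "i \<notin> {1..n}" thus "w i = i" unfolding w_def by (rule if_not_P)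
      qed
      thus "T \<in> Tw ` {w. w permutes {1..n}}" by blast
    qed
  qed
  show ?thesis
  proof (intro conjI)
    show "bij_betw Tw {w. w permutes {1..n}} (promotion_fixed r s n)" using inj im by (simp add: bij_betw_def)
    show "\<forall>w. w permutes {1..n} \<longrightarrow> promotion r s (Tw w) = Tw (cyc n \<circ> w) \<and> Tw w \<in> promotion_fixed r s n"
      using promotion_Tw Tw_fixed by blast
    show "\<forall>w w'. w permutes {1..n} \<and> w' permutes {1..n} \<longrightarrow>
           (\<forall>i \<in> {1..n}. w i \<noteq> w' i \<longrightarrow> the (Tw w (b i)) \<noteq> the (Tw w' (b i)))" using Tw_separates by blast
    show "\<forall>T \<in> promotion_fixed r s n. \<forall>w :: nat \<Rightarrow> nat.
           (\<forall>i \<in> {1..n}. w i \<in> {1..n} \<and> [int (w i) = the (T (b i))] (mod int n)) \<and>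
           (\<forall>i. i \<notin> {1..n} \<longrightarrow> w i = i) \<longrightarrow>
           w permutes {1..n} \<and> Tw w = T"
    proof (intro ballI allI impI)
      fix T w assume T: "T \<in> promotion_fixed r s n"
        and h: "(\<forall>i \<in> {1..n}. w i \<in> {1..n} \<and> [int (w i) = the (T (b i))] (mod int n)) \<and> (\<forall>i. i \<notin> {1..n} \<longrightarrow> w i = i)"
      show "w permutes {1..n} \<and> Tw w = T" by (rule Tw_recover[OF T]) (use h in \<open>auto simp: cong_def\<close>)
    qed
  qed (use inj im in blast)+
qed

end

theorem theorem1p3:
  fixes m n r s :: nat
    and R Lplus Lminus :: "box set"
    and b :: "nat \<Rightarrow> box"
    and Tw :: "(nat \<Rightarrow> nat) \<Rightarrow> filling"
  assumes "1 \<le> n" and "n \<le> m"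
    and "(r, s) = (n, m) \<or> (r, s) = (m, n)"
    and R_def: "R = rect r s"
    and "is_diagonal R n Lplus Lminus b"
    and Tw_def: "Tw = T_tab m n R Lplus Lminus b"
  shows "(bij_betw Tw {w. w permutes {1..n}} (promotion_fixed r s n)) \<and>
    (\<forall>w. w permutes {1..n} \<longrightarrow>
           promotion r s (Tw w) = Tw (cyc n \<circ> w) \<and> Tw w \<in> promotion_fixed r s n) \<and>
    (\<forall>w w'. w permutes {1..n} \<and> w' permutes {1..n} \<longrightarrow>
           (\<forall>i \<in> {1..n}. w i \<noteq> w' i \<longrightarrow> the (Tw w (b i)) \<noteq> the (Tw w' (b i)))) \<and>
    (inj_on Tw {w. w permutes {1..n}}) \<and>
    (\<forall>T \<in> promotion_fixed r s n. \<forall>w :: nat \<Rightarrow> nat.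
           (\<forall>i \<in> {1..n}. w i \<in> {1..n} \<and> [int (w i) = the (T (b i))] (mod int n)) \<and>
           (\<forall>i. i \<notin> {1..n} \<longrightarrow> w i = i) \<longrightarrow>
           w permutes {1..n} \<and> Tw w = T) \<and>
    (Tw ` {w. w permutes {1..n}} = promotion_fixed r s n)"
proof -
  \<comment> \<open>For \<open>n = m\<close> both orientations fit; the flag then selects the
    picture without transposition.\<close>
  have "(r, s) = (if (r, s) = (n, m) then (n, m) else (m, n))" using assms(3) by auto
  hence rs: "(r, s) = (if (r, s) \<noteq> (n, m) then (m, n) else (n, m))" by (simp split: if_splits)
  interpret oriented_diag n m r s "(r, s) \<noteq> (n, m)" Lplus Lminus b
    by (intro oriented_diag.intro oriented.intro oriented_diag_axioms.intro assms(1,2) rs assms(5)[unfolded R_def])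
  show ?thesis unfolding Tw_def R_def by (rule diagonal_bijection)
qed

end
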